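(* There exist a quasi-convex, connected, open set $\Omega\subset\mathbb{R}^3$ and a number $p_0\in(1,\infty)$ such that the approximative trace in $W^{1,p}(\Omega)$ is unique for all $p\in(p_0,\infty]$ and is not unique for all $p\in[1,p_0)$.
   Context: For a nonempty open set $\Omega\subset\mathbb{R}^3$ let $\Gamma:=\partial\Omega$ be its topological boundary; all functions are real-valued, and $\mathcal{H}^{2}$ is the two-dimensional Hausdorff measure. Set $\Gamma_{\mathrm{loc}}:=\{z\in\Gamma : \exists r>0,\ \mathcal{H}^{2}(\Gamma\cap B(z,r))<\infty\}$ and $\Gamma_{\mathrm{inf}}:=\Gamma\setminus\Gamma_{\mathrm{loc}}$. $L^1_{\mathrm{loc}}(\Gamma)$ denotes the space of locally integrable functions on $\Gamma$ with respect to $\mathcal{H}^{2}$ (modulo $\mathcal{H}^{2}$-null sets); it is identified with $L^1_{\mathrm{loc}}(\Gamma_{\mathrm{loc}})$, i.e. its elements vanish $\mathcal{H}^{2}$-a.e. on $\Gamma_{\mathrm{inf}}$ and are integrable over every compact $K\subset\Gamma_{\mathrm{loc}}$. It carries the topology given by the seminorms $\varphi\mapsto\int_K|\varphi|\,d\mathcal{H}^{2}$, $K\subset\Gamma_{\mathrm{loc}}$ compact. $W^{1,p}(\Omega)\cap C(\overline\Omega)$ is the set of continuous functions on $\overline\Omega$ whose restriction to $\Omega$ is in $W^{1,p}(\Omega)$. A function $\varphi\in L^1_{\mathrm{loc}}(\Gamma)$ is an approximative trace of $u\in W^{1,p}(\Omega)$ if there is a sequence $(u_n)$ in $W^{1,p}(\Omega)\cap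 C(\overline\Omega)$ with $u_n|_\Gamma\in L^1_{\mathrm{loc}}(\Gamma)$ for all $n$, $u_n\to u$ in $W^{1,p}(\Omega)$ and $u_n|_\Gamma\to\varphi$ in $L^1_{\mathrm{loc}}(\Gamma)$. The approximative trace in $W^{1,p}(\Omega)$ is called unique if the only approximative trace of the zero function in $W^{1,p}(\Omega)$ is $\varphi=0$, and not unique otherwise. $\Omega$ is quasi-convex if its intrinsic geodesic distance (infimum of lengths of rectifiable curves in $\Omega$ joining two points) is comparable with the Euclidean distance, i.e. bounded by a constant times the Euclidean distance. *)

theory Defs
  imports "HOL-Analysis.Analysis" "HOL-Probability.Essential_Supremum"
begin

section \<open>Hausdorff measure\<close>

text \<open>
  The factor \<open>unit_ball_vol m / 2 ^ m\<close> is the usual normalisation (\<open>\<pi> / 4\<close> for \<open>m = 2\<close>).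
  Boundedness is required explicitly because \<^const>\<open>diameter\<close> is a junk value on unbounded sets.
  The definitions are meant for \<open>m > 0\<close>: for \<open>m = 0\<close> empty covering sets would have weight 1.
\<close>

definition hausdorff_pre :: "nat \<Rightarrow> real \<Rightarrow> 'a::metric_space set \<Rightarrow> ennreal" where
  "hausdorff_pre m \<delta> A =
     (INF E \<in> {E :: nat \<Rightarrow> 'a set. A \<subseteq> (\<Union>i. E i) \<and> (\<forall>i. bounded (E i) \<and> diameter (E i) \<le> \<delta>)}.
        \<Sum>i. ennreal (unit_ball_vol (real m) * (diameter (E i) / 2) ^ m))"

definition hausdorff_outer :: "nat \<Rightarrow> 'a::metric_space set \<Rightarrow> ennreal" where
  "hausdorff_outer m A = (SUP \<delta> \<in> {0<..}. hausdorff_pre m \<delta> A)"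

text \<open>The measure lives on all Caratheodory-measurable sets.\<close>

definition hausdorff_measure :: "nat \<Rightarrow> 'a::metric_space measure" where
  "hausdorff_measure m =
     measure_of UNIV (lambda_system UNIV UNIV (hausdorff_outer m)) (hausdorff_outer m)"

lemma hausdorff_pre_mono: "A \<subseteq> B \<Longrightarrow> hausdorff_pre m \<delta> A \<le> hausdorff_pre m \<delta> B"
  unfolding hausdorff_pre_def by (rule INF_superset_mono) auto

lemma hausdorff_pre_empty:
  assumes "m > 0" "\<delta> > 0" shows "hausdorff_pre m \<delta> {} = 0"
proof -
  have "hausdorff_pre m \<delta> ({} :: 'a set)
      \<le> (\<Sum>i::nat. ennreal (unit_ball_vol (real m) * (diameter ({} :: 'a set) / 2) ^ m))"
    unfolding hausdorff_pre_def by (rule INF_lower) (use assms in auto)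
  then show ?thesis using assms by (simp add: power_0_left)
qed

lemma hausdorff_pre_countably_subadditive:
  fixes A :: "nat \<Rightarrow> 'a::metric_space set"
  shows "hausdorff_pre m \<delta> (\<Union>i. A i) \<le> (\<Sum>i. hausdorff_pre m \<delta> (A i))"
proof (rule ennreal_le_epsilon)
  fix e :: real assume e: "e > 0" and fin: "(\<Sum>i. hausdorff_pre m \<delta> (A i)) < top"
  define w where "w = (\<lambda>E :: 'a set. ennreal (unit_ball_vol (real m) * (diameter E / 2) ^ m))"
  have "\<exists>E. A i \<subseteq> (\<Union>j. E j) \<and> (\<forall>j. bounded (E j) \<and> diameter (E j) \<le> \<delta>) \<and>
          (\<Sum>j. w (E j)) \<le> hausdorff_pre m \<delta> (A i) + ennreal (e * (1/2) ^ Suc i)" for i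
  proof -
    have lt: "hausdorff_pre m \<delta> (A i) < top"
      using fin ennreal_suminf_lessD by blast
    then have "hausdorff_pre m \<delta> (A i)
        < hausdorff_pre m \<delta> (A i) + ennreal (e * (1/2) ^ Suc i)"
      using e by (auto simp: ennreal_add_left_cancel_less intro: ennreal_less_zero_iff[THEN iffD2])
    then show ?thesis
      unfolding w_def by (subst (asm) (1) hausdorff_pre_def) (auto simp: INF_less_iff intro: less_imp_le)
  qed
  then obtain E where E: "\<And>i. A i \<subseteq> (\<Union>j. E i j)" "\<And>i j. bounded (E i j)"
      "\<And>i j. diameter (E i j) \<le> \<delta>"
      "\<And>i. (\<Sum>j. w (E i j)) \<le> hausdorff_pre m \<delta> (A i) + ennreal (e * (1/2) ^ Suc i)"
    by metis
  define F where "F = (\<lambda>k. case prod_decode k of (i, j) \<Rightarrow> E i j)"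
  have "(\<Union>i. A i) \<subseteq> (\<Union>k. F k)"
  proof
    fix x assume "x \<in> (\<Union>i. A i)"
    then obtain i j where "x \<in> E i j" using E(1) by blast
    then have "x \<in> F (prod_encode (i, j))" by (simp add: F_def)
    then show "x \<in> (\<Union>k. F k)" by blast
  qed
  then have "hausdorff_pre m \<delta> (\<Union>i. A i) \<le> (\<Sum>k. w (F k))"
    unfolding hausdorff_pre_def w_def
    by (intro INF_lower) (auto simp: F_def E split: prod.split)
  also have "\<dots> = (\<Sum>i. \<Sum>j. w (E i j))"
    using suminf_ennreal_2dimen[where f="\<lambda>(i, j). w (E i j)" and g="\<lambda>i. \<Sum>j. w (E i j)"]
    by (simp add: F_def comp_def case_prod_beta)
  also have "\<dots> \<le> (\<Sum>i. hausdorff_pre m \<delta> (A i) + ennreal (e * (1/2) ^ Suc i))"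
    by (intro suminf_le E) auto
  also have "\<dots> = (\<Sum>i. hausdorff_pre m \<delta> (A i)) + (\<Sum>i. ennreal (e * (1/2) ^ Suc i))"
    by (subst suminf_add) auto
  also have "(\<Sum>i. ennreal (e * (1/2) ^ Suc i)) = ennreal e"
    using e sums_mult[OF power_half_series, of e] by (intro suminf_ennreal_eq) auto
  finally show "hausdorff_pre m \<delta> (\<Union>i. A i) \<le> (\<Sum>i. hausdorff_pre m \<delta> (A i)) + ennreal e" .
qed

lemma outer_measure_space_hausdorff:
  assumes "m > 0"
  shows "outer_measure_space UNIV (hausdorff_outer m :: 'a::metric_space set \<Rightarrow> ennreal)"
  unfolding outer_measure_space_def
proof (intro conjI)
  show "positive UNIV (hausdorff_outer m :: 'a set \<Rightarrow> ennreal)"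
    using assms by (auto simp: positive_def hausdorff_outer_def hausdorff_pre_empty)
  show "increasing UNIV (hausdorff_outer m :: 'a set \<Rightarrow> ennreal)"
    unfolding increasing_def hausdorff_outer_def
    by (auto intro!: SUP_mono' hausdorff_pre_mono)
  show "countably_subadditive UNIV (hausdorff_outer m :: 'a set \<Rightarrow> ennreal)"
    unfolding countably_subadditive_def
  proof (intro allI impI)
    fix A :: "nat \<Rightarrow> 'a set"
    show "hausdorff_outer m (\<Union>i. A i) \<le> (\<Sum>i. hausdorff_outer m (A i))"
      unfolding hausdorff_outer_def[of m "\<Union>i. A i"]
    proof (rule SUP_least)
      fix \<delta> :: real assume "\<delta> \<in> {0<..}"
      then have "hausdorff_pre m \<delta> (A i) \<le> hausdorff_outer m (A i)" for i
        unfolding hausdorff_outer_def by (rule SUP_upper)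
      then have "(\<Sum>i. hausdorff_pre m \<delta> (A i)) \<le> (\<Sum>i. hausdorff_outer m (A i))"
        by (intro suminf_le) auto
      with hausdorff_pre_countably_subadditive[of m \<delta> A]
      show "hausdorff_pre m \<delta> (\<Union>i. A i) \<le> (\<Sum>i. hausdorff_outer m (A i))"
        by (rule order_trans)
    qed
  qed
qed

lemma
  assumes "m > 0"
  shows sets_hausdorff_measure:
      "sets (hausdorff_measure m :: 'a::metric_space measure) = lambda_system UNIV UNIV (hausdorff_outer m)"
    and emeasure_hausdorff_measure:
      "(A :: 'a set) \<in> sets (hausdorff_measure m) \<Longrightarrow> emeasure (hausdorff_measure m) A = hausdorff_outer m A"
proof -
  interpret sigma_algebra UNIV "UNIV :: 'a set set"
    using sigma_algebra_Pow[of UNIV] by simp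
  have ms: "measure_space UNIV (lambda_system UNIV UNIV (hausdorff_outer m)) (hausdorff_outer m :: 'a set \<Rightarrow> ennreal)"
    by (rule caratheodory_lemma[OF outer_measure_space_hausdorff[OF assms]])
  then interpret L: sigma_algebra UNIV "lambda_system UNIV UNIV (hausdorff_outer m :: 'a set \<Rightarrow> ennreal)"
    by (simp add: measure_space_def)
  show s: "sets (hausdorff_measure m :: 'a measure) = lambda_system UNIV UNIV (hausdorff_outer m)"
    unfolding hausdorff_measure_def by (simp add: L.sets_measure_of_eq)
  show "A \<in> sets (hausdorff_measure m) \<Longrightarrow> emeasure (hausdorff_measure m) A = hausdorff_outer m A"
    unfolding s using ms unfolding hausdorff_measure_def measure_space_def
    by (auto intro!: emeasure_measure_of_sigma)
qed

lemma space_hausdorff_measure [simp]: "space (hausdorff_measure m) = UNIV"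
  by (simp add: hausdorff_measure_def space_measure_of_conv)


section \<open>Lebesgue and Sobolev spaces\<close>

definition Lp_space :: "'a measure \<Rightarrow> ennreal \<Rightarrow> ('a \<Rightarrow> 'b::euclidean_space) set" where
  "Lp_space M p = {f. f \<in> borel_measurable M \<and>
     (if p = \<infinity> then esssup M (\<lambda>x. ennreal (norm (f x))) < \<infinity>
      else integrable M (\<lambda>x. norm (f x) powr enn2real p))}"

definition Lp_norm :: "'a measure \<Rightarrow> ennreal \<Rightarrow> ('a \<Rightarrow> 'b::euclidean_space) \<Rightarrow> real" where
  "Lp_norm M p f =
     (if p = \<infinity> then enn2real (esssup M (\<lambda>x. ennreal (norm (f x))))
      else (LINT x|M. norm (f x) powr enn2real p) powr (1 / enn2real p))"

definition partial_deriv :: "'n::finite \<Rightarrow> (real^'n \<Rightarrow> real) \<Rightarrow> real^'n \<Rightarrow> real" where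
  "partial_deriv i f x = frechet_derivative f (at x) (axis i 1)"

primrec C_k :: "nat \<Rightarrow> (real^'n::finite \<Rightarrow> real) \<Rightarrow> bool" where
  "C_k 0 f \<longleftrightarrow> continuous_on UNIV f"
| "C_k (Suc k) f \<longleftrightarrow> (\<forall>x. f differentiable (at x)) \<and> (\<forall>i. C_k k (partial_deriv i f))"

definition test_functions :: "(real^'n::finite) set \<Rightarrow> (real^'n \<Rightarrow> real) set" where
  "test_functions \<Omega> =
     {\<phi>. (\<forall>k. C_k k \<phi>) \<and> compact (closure {x. \<phi> x \<noteq> 0}) \<and> closure {x. \<phi> x \<noteq> 0} \<subseteq> \<Omega>}"

text \<open>
  Functions on \<open>\<Omega>\<close> are total functions whose values off \<open>\<Omega>\<close> are irrelevant. Local integrability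
  is part of the definition so that the Bochner integrals below are never junk values.
\<close>

definition weak_gradient ::
    "(real^'n::finite) set \<Rightarrow> (real^'n \<Rightarrow> real) \<Rightarrow> (real^'n \<Rightarrow> real^'n) \<Rightarrow> bool" where
  "weak_gradient \<Omega> u g \<longleftrightarrow>
     (\<forall>K. compact K \<and> K \<subseteq> \<Omega> \<longrightarrow> set_integrable lebesgue K u \<and> set_integrable lebesgue K g) \<and>
     (\<forall>\<phi> \<in> test_functions \<Omega>. \<forall>i.
        (LINT x|lebesgue_on \<Omega>. u x * partial_deriv i \<phi> x) =
        - (LINT x|lebesgue_on \<Omega>. g x $ i * \<phi> x))"

definition W1p :: "ennreal \<Rightarrow> (real^'n::finite) set \<Rightarrow> (real^'n \<Rightarrow> real) set" where
  "W1p p \<Omega> = {u \<in> Lp_space (lebesgue_on \<Omega>) p.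
     \<exists>g \<in> Lp_space (lebesgue_on \<Omega>) p. weak_gradient \<Omega> u g}"

text \<open>The weak gradient is unique almost everywhere, so the choice below does not matter.\<close>

definition W1p_norm :: "ennreal \<Rightarrow> (real^'n::finite) set \<Rightarrow> (real^'n \<Rightarrow> real) \<Rightarrow> real" where
  "W1p_norm p \<Omega> u = Lp_norm (lebesgue_on \<Omega>) p u +
     Lp_norm (lebesgue_on \<Omega>) p (SOME g. weak_gradient \<Omega> u g)"


section \<open>Approximative traces\<close>

abbreviation H2 :: "(real^3) measure" where
  "H2 \<equiv> hausdorff_measure 2"

definition Gamma_loc :: "(real^3) set \<Rightarrow> (real^3) set" where
  "Gamma_loc \<Omega> = {z \<in> frontier \<Omega>. \<exists>r>0. emeasure H2 (frontier \<Omega> \<inter> ball z r) < \<infinity>}"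

definition Gamma_inf :: "(real^3) set \<Rightarrow> (real^3) set" where
  "Gamma_inf \<Omega> = frontier \<Omega> - Gamma_loc \<Omega>"

text \<open>
  \<open>L1_loc \<Omega>\<close> is \<open>L\<^sup>1\<^sub>l\<^sub>o\<^sub>c(\<Gamma>)\<close> for \<open>\<Gamma> = frontier \<Omega>\<close>, on the level of representatives;
  equality in it is equality \<open>H2\<close>-almost everywhere on \<open>\<Gamma>\<close>.
\<close>

definition L1_loc :: "(real^3) set \<Rightarrow> (real^3 \<Rightarrow> real) set" where
  "L1_loc \<Omega> = {\<phi>. set_borel_measurable H2 (frontier \<Omega>) \<phi> \<and>
     (AE x in H2. x \<in> Gamma_inf \<Omega> \<longrightarrow> \<phi> x = 0) \<and>
     (\<forall>K. compact K \<and> K \<subseteq> Gamma_loc \<Omega> \<longrightarrow> set_integrable H2 K \<phi>)}"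

definition approx_trace ::
    "ennreal \<Rightarrow> (real^3) set \<Rightarrow> (real^3 \<Rightarrow> real) \<Rightarrow> (real^3 \<Rightarrow> real) \<Rightarrow> bool" where
  "approx_trace p \<Omega> u \<phi> \<longleftrightarrow> u \<in> W1p p \<Omega> \<and> \<phi> \<in> L1_loc \<Omega> \<and>
     (\<exists>U :: nat \<Rightarrow> real^3 \<Rightarrow> real.
        (\<forall>n. U n \<in> W1p p \<Omega> \<and> continuous_on (closure \<Omega>) (U n) \<and> U n \<in> L1_loc \<Omega>) \<and>
        (\<lambda>n. W1p_norm p \<Omega> (\<lambda>x. U n x - u x)) \<longlonglongrightarrow> 0 \<and>
        (\<forall>K. compact K \<and> K \<subseteq> Gamma_loc \<Omega> \<longrightarrow>
           (\<lambda>n. LINT x:K|H2. \<bar>U n x - \<phi> x\<bar>) \<longlonglongrightarrow> 0))"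

definition approx_trace_unique :: "ennreal \<Rightarrow> (real^3) set \<Rightarrow> bool" where
  "approx_trace_unique p \<Omega> \<longleftrightarrow>
     (\<forall>\<phi>. approx_trace p \<Omega> (\<lambda>_. 0) \<phi> \<longrightarrow> (AE x in H2. x \<in> frontier \<Omega> \<longrightarrow> \<phi> x = 0))"


section \<open>Quasi-convexity\<close>

definition path_length :: "(real \<Rightarrow> 'a::metric_space) \<Rightarrow> ennreal" where
  "path_length \<gamma> =
     (SUP (n, t) \<in> {(n :: nat, t :: nat \<Rightarrow> real). mono_on {..n} t \<and> t ` {..n} \<subseteq> {0..1}}.
        \<Sum>i<n. ennreal (dist (\<gamma> (t i)) (\<gamma> (t (Suc i)))))"

definition geodesic_dist :: "'a::metric_space set \<Rightarrow> 'a \<Rightarrow> 'a \<Rightarrow> ennreal" where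
  "geodesic_dist \<Omega> x y =
     (INF \<gamma> \<in> {\<gamma>. path \<gamma> \<and> path_image \<gamma> \<subseteq> \<Omega> \<and> pathstart \<gamma> = x \<and> pathfinish \<gamma> = y \<and>
                path_length \<gamma> < \<infinity>}. path_length \<gamma>)"

definition quasi_convex :: "'a::metric_space set \<Rightarrow> bool" where
  "quasi_convex \<Omega> \<longleftrightarrow>
     (\<exists>C::real. \<forall>x\<in>\<Omega>. \<forall>y\<in>\<Omega>. geodesic_dist \<Omega> x y \<le> ennreal (C * dist x y))"

end

(* The domain lies above the plane x3 = 0. At level k it consists of thin vertical slits over the strips
   of width "width k" along the lines x1 = m * spacing k and x2 = m * spacing k, up to the height
   "height k", which is (spacing (k - 1))^2. A point of the plane not below any slit is thus reached from the
   domain only through arbitrarily fine slits, of which those beyond level k have volume of order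
   (spacing k)^2 per unit area, up to powers of 2^k, although the whole plane belongs to the boundary. The widths are summable
   relative to the spacings, so the slits miss a set of positive area in the plane.

   For p < 2, a function that cuts off the slits up to level k has gradient of order 1 / spacing k, up to
   powers of 2^k, and its support lies in the finer slits, so its energy is of order (spacing k)^(2 - p) and
   tends to 0. Its trace stays 1 on the part of the plane missed by all enlarged slits.

   For p > 2, averages of a function over slit pieces of level k + 1 are compared with those over the slits
   of level k which they cross. By Hoelder's inequality this costs (spacing k)^(1 - 2 / p) times the
   norm of the gradient, up to powers of 2^k; the sum over k is finite, so the integral of the boundary
   values over a square in the plane is bounded by the Sobolev norm. Off the plane the boundary is locally
   a finite union of rectangles, where the estimate is elementary. *)

theory Submission
  imports Defs "HOL-Computational_Algebra.Polynomial" "HOL-Real_Asymp.Real_Asymp"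
begin

text \<open>Quasi-convexity shapes the construction. Two parallel slits of different levels
  separated by a very thin wall would contain points that are close in space but far apart in the
  domain. The divisor 3 in \<open>width\<close> excludes this: measured in units of the finer
  spacing, the right edge of a coarser slit has a denominator 3 that never cancels. Disjoint slits
  are therefore at least a third of the finer spacing apart, and the finer level itself offers a
  crossing slit within comparable distance. The exponent k^2 in \<open>spacing\<close> outruns every
  geometric sequence. This makes losses of the form c^k harmless, and it keeps the total area of the
  slit walls locally finite although the number of slits explodes. Hence \<open>Gamma_loc\<close> is
  the whole boundary and traces have to be controlled everywhere. The functions are only weakly
  differentiable inside the domain but continuous up to the boundary. Point values are therefore
  used only at the boundary, through uniform continuity; inside, averages over boxes are compared by
  testing the weak gradient with explicit products of one-variable functions.\<close>

section \<open>Smooth functions of one variable and a smooth step\<close>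

primrec Ck1 :: "nat \<Rightarrow> (real \<Rightarrow> real) \<Rightarrow> bool" where
  "Ck1 0 f \<longleftrightarrow> continuous_on UNIV f"
| "Ck1 (Suc k) f \<longleftrightarrow> (\<exists>f'. (\<forall>x. (f has_real_derivative f' x) (at x)) \<and> Ck1 k f')"

lemma Ck1_SucI: "(\<And>x. (f has_real_derivative f' x) (at x)) \<Longrightarrow> Ck1 k f' \<Longrightarrow> Ck1 (Suc k) f"
  by auto

lemma Ck1_lower: "Ck1 (Suc k) f \<Longrightarrow> Ck1 k f"
proof (induction k arbitrary: f)
  case 0
  then obtain f' where "\<And>x. (f has_real_derivative f' x) (at x)" by auto
  then show ?case by (auto simp: continuous_on_eq_continuous_within intro!: DERIV_isCont)
next
  case (Suc k)
  then show ?case by (metis Ck1.simps(2))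
qed

lemma Ck1_const: "Ck1 k (\<lambda>_. c)"
proof (induction k arbitrary: c)
  case (Suc k)
  show ?case by (rule Ck1_SucI[where f'="\<lambda>_. 0"]) (auto intro: Suc)
qed auto

lemma Ck1_add: "Ck1 k f \<Longrightarrow> Ck1 k g \<Longrightarrow> Ck1 k (\<lambda>x. f x + g x)"
proof (induction k arbitrary: f g)
  case 0 then show ?case by (auto intro: continuous_intros)
next
  case (Suc k)
  then obtain f' g' where
    "\<And>x. (f has_real_derivative f' x) (at x)" "\<And>x. (g has_real_derivative g' x) (at x)" "Ck1 k f'" "Ck1 k g'"
    by auto
  then show ?case by (intro Ck1_SucI[where f'="\<lambda>x. f' x + g' x"] Suc.IH) (auto intro!: derivative_eq_intros)
qed

lemma Ck1_mult: "Ck1 k f \<Longrightarrow> Ck1 k g \<Longrightarrow> Ck1 k (\<lambda>x. f x * g x)"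
proof (induction k arbitrary: f g)
  case 0 then show ?case by (auto intro: continuous_intros)
next
  case (Suc k)
  then obtain f' g' where
    "\<And>x. (f has_real_derivative f' x) (at x)" "\<And>x. (g has_real_derivative g' x) (at x)" "Ck1 k f'" "Ck1 k g'"
    by auto
  moreover have "Ck1 k f" "Ck1 k g" using Suc.prems Ck1_lower by auto
  ultimately show ?case
    by (intro Ck1_SucI[where f'="\<lambda>x. f' x * g x + f x * g' x"] Suc.IH Ck1_add)
       (auto intro!: derivative_eq_intros)
qed

lemma Ck1_inverse: "Ck1 k f \<Longrightarrow> (\<And>x. f x \<noteq> 0) \<Longrightarrow> Ck1 k (\<lambda>x. inverse (f x))"
proof (induction k arbitrary: f)
  case 0 then show ?case by (auto intro: continuous_intros)
next
  case (Suc k)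
  then obtain f' where f': "\<And>x. (f has_real_derivative f' x) (at x)" "Ck1 k f'"
    by auto
  moreover have "Ck1 k f" using Suc.prems Ck1_lower by auto
  ultimately have "Ck1 k (\<lambda>x. (-1) * f' x * (inverse (f x) * inverse (f x)))"
    using Suc by (intro Ck1_mult Ck1_const) auto
  then show ?case
    by (rule Ck1_SucI[rotated])
       (use Suc.prems in \<open>auto intro!: derivative_eq_intros f' simp: power2_eq_square\<close>)
qed

lemma Ck1_affine: "Ck1 k f \<Longrightarrow> Ck1 k (\<lambda>x. f (a * x + b))"
proof (induction k arbitrary: f)
  case 0
  then show ?case by (auto intro!: continuous_on_compose2[of UNIV f] continuous_intros)
next
  case (Suc k)
  then obtain f' where f': "\<And>x. (f has_real_derivative f' x) (at x)" "Ck1 k f'"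
    by auto
  have "((\<lambda>x. f (a * x + b)) has_real_derivative f' (a * x + b) * a) (at x)" for x
    by (rule DERIV_chain2[OF f'(1)]) (auto intro!: derivative_eq_intros)
  with f'(2) show ?case
    by (intro Ck1_SucI[where f'="\<lambda>x. f' (a * x + b) * a"] Ck1_mult Ck1_const Suc.IH)
qed

lemma poly_times_exp_minus_tendsto_0: "((\<lambda>y. poly p y * exp (- y)) \<longlongrightarrow> (0::real)) at_top"
proof -
  have "((\<lambda>y. \<Sum>i\<le>degree p. coeff p i * (y ^ i / exp y)) \<longlongrightarrow> (\<Sum>i\<le>degree p. coeff p i * 0)) at_top"
    by (intro tendsto_sum tendsto_mult tendsto_const tendsto_power_div_exp_0)
  then show ?thesis
    by (simp add: poly_altdef sum_divide_distrib sum_distrib_right exp_minus field_simps)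
qed

text \<open>The functions P(1/t) exp(-1/t), extended by 0, form a class closed under
  differentiation; with the polynomial as a parameter, smoothness becomes a plain induction.\<close>

definition exp_inv_poly :: "real poly \<Rightarrow> real \<Rightarrow> real" where
  "exp_inv_poly p t = (if t \<le> 0 then 0 else poly p (1 / t) * exp (- (1 / t)))"

text \<open>For t > 0 the derivative of P(1/t) exp(-1/t) is t^(-2) (P - P')(1/t) exp(-1/t), and
  t^(-2) is the value of \<open>[:0, 0, 1:]\<close> at 1/t.\<close>

lemma has_real_derivative_exp_inv_poly:
  "(exp_inv_poly p has_real_derivative exp_inv_poly ([:0, 0, 1:] * (p - pderiv p)) t) (at t)"
proof -
  consider "t < 0" | "t > 0" | "t = 0" by linarith
  then show ?thesis
  proof cases
    case 1
    have "((\<lambda>_. 0) has_real_derivative 0) (at t)" by auto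
    then have "(exp_inv_poly p has_real_derivative 0) (at t)"
      by (rule has_field_derivative_transform_within_open[where S="{..<0}"])
         (use 1 in \<open>auto simp: exp_inv_poly_def\<close>)
    then show ?thesis using 1 by (simp add: exp_inv_poly_def)
  next
    case 2
    have i: "((\<lambda>t. 1 / t) has_real_derivative - (1 / t\<^sup>2)) (at t)"
      using 2 by (auto intro!: derivative_eq_intros simp: power2_eq_square)
    have "((\<lambda>t. poly p (1 / t)) has_real_derivative poly (pderiv p) (1 / t) * - (1 / t\<^sup>2)) (at t)"
      by (rule DERIV_chain2[OF poly_DERIV i])
    moreover have "((\<lambda>t. exp (- (1 / t))) has_real_derivative exp (- (1 / t)) * (1 / t\<^sup>2)) (at t)"
      using DERIV_chain2[OF DERIV_exp DERIV_minus[OF i]] by simp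
    ultimately have "((\<lambda>t. poly p (1 / t) * exp (- (1 / t))) has_real_derivative
        exp_inv_poly ([:0, 0, 1:] * (p - pderiv p)) t) (at t)"
      by (rule DERIV_cong[OF DERIV_mult])
         (use 2 in \<open>simp add: exp_inv_poly_def power2_eq_square algebra_simps diff_divide_distrib\<close>)
    then show ?thesis
      by (rule has_field_derivative_transform_within_open[where S="{0<..}"])
         (use 2 in \<open>auto simp: exp_inv_poly_def\<close>)
  next
    case 3
    \<comment> \<open>With y = 1/t the right difference quotient at 0 is y P(y) exp(-y), whence the
      extra factor \<open>[:0,1:]\<close>.\<close>
    have "((\<lambda>y. poly ([:0,1:] * p) y * exp (- y)) \<longlongrightarrow> (0::real)) at_top"
      by (rule poly_times_exp_minus_tendsto_0)
    then have "((\<lambda>t. poly ([:0,1:] * p) (inverse t) * exp (- (inverse t))) \<longlongrightarrow> (0::real)) (at_right 0)"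
      by (rule filterlim_compose[OF _ filterlim_inverse_at_top_right])
    then have r: "((\<lambda>t. exp_inv_poly p t / t) \<longlongrightarrow> 0) (at_right 0)"
      by (rule Lim_transform_eventually)
         (auto intro!: eventually_at_rightI[of 0 1] simp: exp_inv_poly_def field_simps)
    have l: "((\<lambda>t. exp_inv_poly p t / t) \<longlongrightarrow> 0) (at_left 0)"
      by (rule Lim_transform_eventually[of "\<lambda>_. 0"])
         (auto intro!: eventually_at_leftI[of "-1" 0] simp: exp_inv_poly_def)
    have "((\<lambda>t. exp_inv_poly p t / t) \<longlongrightarrow> 0) (at 0)"
      using l r by (simp add: filterlim_split_at)
    then show ?thesis using 3
      by (simp add: DERIV_def exp_inv_poly_def)
  qed
qed

lemma Ck1_exp_inv_poly: "Ck1 k (exp_inv_poly p)"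
proof (induction k arbitrary: p)
  case 0
  have "isCont (exp_inv_poly p) x" for x
    by (rule DERIV_isCont[OF has_real_derivative_exp_inv_poly])
  then show ?case by (simp add: continuous_on_eq_continuous_within)
next
  case (Suc k)
  show ?case by (rule Ck1_SucI[OF has_real_derivative_exp_inv_poly Suc])
qed

text \<open>The usual transition e(t) / (e(t) + e(1 - t)) with e(t) = exp(-1/t) for positive t; the
  denominator never vanishes because t and 1 - t are not both nonpositive.\<close>

definition smooth_step :: "real \<Rightarrow> real" where
  "smooth_step t = exp_inv_poly 1 t * inverse (exp_inv_poly 1 t + exp_inv_poly 1 (1 - t))"

lemma exp_inv_poly_1: "exp_inv_poly 1 t \<ge> 0" "t > 0 \<Longrightarrow> exp_inv_poly 1 t > 0"
    "t \<le> 0 \<Longrightarrow> exp_inv_poly 1 t = 0"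
  by (auto simp: exp_inv_poly_def)

lemma smooth_step_denominator: "exp_inv_poly 1 t + exp_inv_poly 1 (1 - t) > 0"
  using exp_inv_poly_1(1,2)[of t] exp_inv_poly_1(1,2)[of "1 - t"] by (cases "t > 0") auto

lemma Ck1_smooth_step: "Ck1 k smooth_step"
proof -
  have "Ck1 k (\<lambda>t. exp_inv_poly 1 t * inverse (exp_inv_poly 1 t + exp_inv_poly 1 ((-1) * t + 1)))"
    by (intro Ck1_mult Ck1_inverse Ck1_add Ck1_affine Ck1_exp_inv_poly)
       (use smooth_step_denominator in \<open>simp add: less_imp_neq[symmetric]\<close>)
  then show ?thesis by (simp add: smooth_step_def[abs_def])
qed

lemma smooth_step_0: "t \<le> 0 \<Longrightarrow> smooth_step t = 0"
  and smooth_step_1: "t \<ge> 1 \<Longrightarrow> smooth_step t = 1"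
  using exp_inv_poly_1[of t] by (auto simp: smooth_step_def exp_inv_poly_1(3))

lemma smooth_step_bounds: "0 \<le> smooth_step t" "smooth_step t \<le> 1"
  using exp_inv_poly_1(1)[of t] exp_inv_poly_1(1)[of "1 - t"] smooth_step_denominator[of t]
  by (auto simp: smooth_step_def field_simps)

subsection \<open>Smooth functions of several variables\<close>

lemma partial_deriv_eq:
  "(f has_derivative f') (at x) \<Longrightarrow> partial_deriv i f x = f' (axis i 1)"
  by (simp add: partial_deriv_def frechet_derivative_at[symmetric])

lemma partial_deriv_const: "partial_deriv i (\<lambda>_. c) x = 0"
  by (subst partial_deriv_eq[OF has_derivative_const]) auto

lemma C_k_const: "C_k k (\<lambda>_. c)"
proof (induction k arbitrary: c)
  case (Suc k)
  have "partial_deriv i (\<lambda>_. c) = (\<lambda>_::real^'a. 0)" for i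
    by (simp add: fun_eq_iff partial_deriv_const)
  then show ?case using Suc by auto
qed auto

lemma C_k_lower: "C_k (Suc k) f \<Longrightarrow> C_k k f"
proof (induction k arbitrary: f)
  case 0 then show ?case
    by (auto simp: continuous_on_eq_continuous_at intro!: differentiable_imp_continuous_within)
qed auto

lemma partial_deriv_add:
  "f differentiable at x \<Longrightarrow> g differentiable at x \<Longrightarrow>
    partial_deriv i (\<lambda>x. f x + g x) x = partial_deriv i f x + partial_deriv i g x"
  unfolding frechet_derivative_works
  by (subst partial_deriv_eq[OF has_derivative_add]) (auto simp: partial_deriv_def)

lemma partial_deriv_mult:
  "f differentiable at x \<Longrightarrow> g differentiable at x \<Longrightarrow>
    partial_deriv i (\<lambda>x. f x * g x) x = f x * partial_deriv i g x + partial_deriv i f x * g x"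
  unfolding frechet_derivative_works
  by (subst partial_deriv_eq[OF has_derivative_mult]) (auto simp: partial_deriv_def)

lemma partial_deriv_coord:
  assumes "(f has_real_derivative f') (at (x $ j))"
  shows "((\<lambda>x. f (x $ j)) has_derivative (\<lambda>v. f' * v $ j)) (at x)"
    and "partial_deriv i (\<lambda>x. f (x $ j)) x = (if i = j then f' else 0)"
proof -
  show d: "((\<lambda>x. f (x $ j)) has_derivative (\<lambda>v. f' * v $ j)) (at x)"
    using has_derivative_compose[OF bounded_linear_imp_has_derivative[OF bounded_linear_vec_nth]
        assms[unfolded has_field_derivative_def]]
    by simp
  show "partial_deriv i (\<lambda>x. f (x $ j)) x = (if i = j then f' else 0)"
    using partial_deriv_eq[OF d] by (simp add: axis_def)
qed

lemma C_k_add: "C_k k f \<Longrightarrow> C_k k g \<Longrightarrow> C_k k (\<lambda>x. f x + g x)"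
proof (induction k arbitrary: f g)
  case 0 then show ?case by (auto intro: continuous_intros)
next
  case (Suc k)
  then have "partial_deriv i (\<lambda>x. f x + g x) = (\<lambda>x. partial_deriv i f x + partial_deriv i g x)" for i
    by (auto simp: partial_deriv_add)
  then show ?case using Suc by auto
qed

lemma C_k_mult: "C_k k f \<Longrightarrow> C_k k g \<Longrightarrow> C_k k (\<lambda>x. f x * g x)"
proof (induction k arbitrary: f g)
  case 0 then show ?case by (auto intro: continuous_intros)
next
  case (Suc k)
  then have "partial_deriv i (\<lambda>x. f x * g x) = (\<lambda>x. f x * partial_deriv i g x + partial_deriv i f x * g x)" for i
    by (auto simp: partial_deriv_mult)
  moreover have "C_k k f" "C_k k g" using Suc.prems C_k_lower by blast+
  ultimately show ?case using Suc by (auto intro!: C_k_add)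
qed

lemma C_k_coord: "Ck1 k f \<Longrightarrow> C_k k (\<lambda>x. f (x $ j))"
proof (induction k arbitrary: f)
  case 0 then show ?case
    by (auto intro!: continuous_on_compose2[of UNIV f] continuous_intros)
next
  case (Suc k)
  then obtain f' where f': "\<And>x. (f has_real_derivative f' x) (at x)" "Ck1 k f'"
    by auto
  have "partial_deriv i (\<lambda>x. f (x $ j)) = (if i = j then (\<lambda>x. f' (x $ j)) else (\<lambda>_. 0))" for i
    by (intro ext) (simp add: partial_deriv_coord(2)[OF f'(1)])
  moreover have "(\<lambda>x. f (x $ j)) differentiable at x" for x
    using partial_deriv_coord(1)[OF f'(1)] by (rule differentiableI)
  ultimately show ?case using Suc.IH[OF f'(2)] C_k_const by auto
qed

subsection \<open>Smooth approximations of indicator functions\<close>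

text \<open>Subtracting 1 leaves a margin 1/(n+1) at both ends on which the function vanishes, so
  its support is a compact part of the open interval.\<close>

definition bump :: "nat \<Rightarrow> real \<Rightarrow> real \<Rightarrow> real \<Rightarrow> real" where
  "bump n a b t = smooth_step (real (Suc n) * (t - a) - 1) * smooth_step (real (Suc n) * (b - t) - 1)"

lemma Ck1_bump: "Ck1 k (bump n a b)"
proof -
  have "Ck1 k (\<lambda>t. smooth_step (real (Suc n) * t + (- real (Suc n) * a - 1))
      * smooth_step ((- real (Suc n)) * t + (real (Suc n) * b - 1)))"
    by (intro Ck1_mult; rule Ck1_affine[OF Ck1_smooth_step])
  then show ?thesis unfolding bump_def[abs_def] by (simp add: algebra_simps)
qed

lemma bump_bounds: "0 \<le> bump n a b t" "bump n a b t \<le> 1"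
  by (auto simp: bump_def smooth_step_bounds intro!: mult_le_one)

lemma bump_0: "t \<le> a + 1 / real (Suc n) \<Longrightarrow> bump n a b t = 0"
              "t \<ge> b - 1 / real (Suc n) \<Longrightarrow> bump n a b t = 0"
proof -
  have *: "real (Suc n) * (1 / real (Suc n)) = 1" by simp
  show "bump n a b t = 0" if "t \<le> a + 1 / real (Suc n)"
    using mult_left_mono[of "t - a" "1 / real (Suc n)" "real (Suc n)"] that
    by (simp only: bump_def smooth_step_0 *) (simp add: smooth_step_0)
  show "bump n a b t = 0" if "t \<ge> b - 1 / real (Suc n)"
    using mult_left_mono[of "b - t" "1 / real (Suc n)" "real (Suc n)"] that
    by (simp only: bump_def smooth_step_0 *) (simp add: smooth_step_0)
qed

lemma bump_outside: "t \<notin> {a<..<b} \<Longrightarrow> bump n a b t = 0"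
proof -
  assume t: "t \<notin> {a<..<b}"
  have "1 / real (Suc n) > 0" by simp
  then have "t \<le> a + 1 / real (Suc n) \<or> t \<ge> b - 1 / real (Suc n)" using t
    unfolding greaterThanLessThan_iff by linarith
  then show ?thesis using bump_0 by blast
qed

lemma bump_tendsto: "(\<lambda>n. bump n a b t) \<longlonglongrightarrow> indicator {a<..<b} t"
proof (cases "a < t \<and> t < b")
  case True
  have "eventually (\<lambda>n. real (Suc n) * (t - a) - 1 \<ge> 1) sequentially"
       "eventually (\<lambda>n. real (Suc n) * (b - t) - 1 \<ge> 1) sequentially"
    using True by real_asymp+
  then have "eventually (\<lambda>n. bump n a b t = 1) sequentially"
    by eventually_elim (simp add: bump_def smooth_step_1)
  then show ?thesis using True by (simp add: tendsto_eventually)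
qed (auto simp: bump_outside)

text \<open>A primitive, not the bump itself, enters the test functions in the direction of
  differentiation. It is constant on both margins, with the total mass on the right, so two such
  primitives can be combined to make the constants cancel.\<close>

lemma bump_primitive:
  assumes "a \<le> b"
  obtains P where "\<And>t. (P has_real_derivative bump n a b t) (at t)"
    "\<And>t. t \<le> a + 1 / real (Suc n) \<Longrightarrow> P t = 0"
    "\<And>t. t \<ge> b - 1 / real (Suc n) \<Longrightarrow> P t = (LINT t|lborel. bump n a b t)"
    "\<And>t. 0 \<le> P t" "\<And>t. P t \<le> (LINT t|lborel. bump n a b t)"
proof -
  have cont: "isCont (bump n a b) t" for t
    using Ck1_bump[of 0 n a b] by (simp add: continuous_on_eq_continuous_at)
  obtain F where F: "\<And>x. (F has_vector_derivative bump n a b x) (at x)"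
    using einterval_antiderivative[of "-\<infinity>" "\<infinity>" "bump n a b"] cont by auto
  define P where "P t = F t - F a" for t
  have P: "(P has_real_derivative bump n a b t) (at t)" for t
    using F[of t] unfolding P_def has_real_derivative_iff_has_vector_derivative
    by (auto intro!: derivative_eq_intros)
  have mono: "P x \<le> P y" if "x \<le> y" for x y
    by (rule DERIV_nonneg_imp_nondecreasing[OF that]) (use P bump_bounds in blast)
  have const: "P x = P y" if "x \<le> y" "\<And>t. x \<le> t \<Longrightarrow> t \<le> y \<Longrightarrow> bump n a b t = 0" for x y
  proof (cases "x = y")
    case False
    show ?thesis
      by (rule DERIV_isconst_end[of x y P, symmetric])
         (use that False P in \<open>auto intro!: continuous_at_imp_continuous_on DERIV_isCont[of P], metis less_imp_le\<close>)
  qed auto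
  define A where "A = a + 1 / real (Suc n)"
  define B where "B = b - 1 / real (Suc n)"
  have aA: "a \<le> A" "B \<le> b" by (auto simp: A_def B_def)
  have Pa: "P a = 0" by (simp add: P_def)
  have 0: "P t = 0" if "t \<le> A" for t
  proof (cases "t \<le> a")
    case True
    then have "P t = P a" using aA by (intro const bump_0(1)[of _ a n b, folded A_def]) auto
    then show ?thesis using Pa by simp
  next
    case False then show ?thesis using const[of a t] bump_0(1)[of _ a n b] that Pa by (auto simp: A_def)
  qed
  have 1: "P t = P b" if "t \<ge> B" for t
  proof (cases "t \<le> b")
    case True then show ?thesis using const[of t b] bump_0(2)[of b n _ a] that by (auto simp: B_def)
  next
    case False
    then have "P b = P t" using aA by (intro const bump_0(2)[of b n _ a, folded B_def]) auto
    then show ?thesis by simp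
  qed
  have "(bump n a b has_integral (P b - P a)) {a..b}"
    using assms P by (intro fundamental_theorem_of_calculus)
      (auto simp: has_real_derivative_iff_has_vector_derivative[symmetric] intro: has_field_derivative_at_within)
  moreover have "set_integrable lborel {a..b} (bump n a b)"
    by (rule borel_integrable_atLeastAtMost') (use cont in \<open>auto intro: continuous_at_imp_continuous_on\<close>)
  ultimately have "(LINT t:{a..b}|lborel. bump n a b t) = P b"
    using Pa by (metis diff_zero has_integral_unique set_borel_integral_eq_integral(2) integrable_integral set_borel_integral_eq_integral(1))
  moreover have "indicator {a..b} t *\<^sub>R bump n a b t = bump n a b t" for t
    by (cases "t \<in> {a<..<b}") (auto simp: bump_outside)
  then have "(\<lambda>t. indicator {a..b} t *\<^sub>R bump n a b t) = bump n a b" ..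
  ultimately have Pb: "P b = (LINT t|lborel. bump n a b t)"
    by (simp add: set_lebesgue_integral_def)
  show ?thesis
  proof (rule that[of P])
    show "P t = 0" if "t \<le> a + 1 / real (Suc n)" for t using 0 that by (simp only: A_def)
    show "P t = (LINT t|lborel. bump n a b t)" if "t \<ge> b - 1 / real (Suc n)" for t
      using 1 that Pb by (simp only: B_def)
    show "0 \<le> P t" for t
      using mono[of a t] 0[of t] Pa aA by (cases "a \<le> t") auto
    show "P t \<le> (LINT t|lborel. bump n a b t)" for t
      using mono[of t b] 1[of t] Pb aA by (cases "t \<le> b") auto
  qed (rule P)
qed

lemma integral_bump_tendsto:
  assumes "a \<le> b"
  shows "(\<lambda>n. LINT t|lborel. bump n a b t) \<longlonglongrightarrow> b - a"
proof -
  have m: "bump n a b \<in> borel_measurable borel" for n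
    using Ck1_bump[of 0 n a b] by (auto intro: borel_measurable_continuous_onI)
  have "(\<lambda>n. LINT t|lborel. bump n a b t) \<longlonglongrightarrow> (LINT t|lborel. indicator {a<..<b} t)"
  proof (rule integral_dominated_convergence[where w="indicator {a..b}"])
    show "integrable lborel (indicator {a..b} :: real \<Rightarrow> real)"
      by (auto simp: integrable_indicator_iff emeasure_lborel_Icc_eq)
    show "AE x in lborel. norm (bump n a b x) \<le> indicator {a..b} x" for n
      using bump_bounds[of n a b] bump_outside[of _ a b n] by (auto simp: indicator_def)
  qed (auto simp: m bump_tendsto)
  then show ?thesis using assms by simp
qed

lemma integral_bump_bounds:
  assumes "a \<le> b"
  shows "0 \<le> (LINT t|lborel. bump n a b t)" "(LINT t|lborel. bump n a b t) \<le> b - a"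
proof -
  show "0 \<le> (LINT t|lborel. bump n a b t)" by (intro integral_nonneg_AE) (auto simp: bump_bounds)
  have "(LINT t|lborel. bump n a b t) \<le> (LINT t|lborel. indicator {a..b} t)"
  proof (rule integral_mono')
    show "integrable lborel (indicator {a..b} :: real \<Rightarrow> real)"
      by (auto simp: integrable_indicator_iff emeasure_lborel_Icc_eq)
    show "bump n a b x \<le> indicator {a..b} x" for x
      using bump_bounds[of n a b] bump_outside[of _ a b n] by (auto simp: indicator_def)
  qed auto
  then show "(LINT t|lborel. bump n a b t) \<le> b - a" using assms by simp
qed

subsection \<open>Product test functions\<close>

lemma C_k_prod: "finite J \<Longrightarrow> (\<And>j. j \<in> J \<Longrightarrow> C_k k (f j)) \<Longrightarrow> C_k k (\<lambda>x. \<Prod>j\<in>J. f j x)"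
  by (induction J rule: finite_induct) (auto simp: C_k_const C_k_mult)

lemma C_k_1_differentiable: "C_k (Suc k) f \<Longrightarrow> f differentiable at x"
  by auto

lemma partial_deriv_prod_coord:
  fixes f :: "'n::finite \<Rightarrow> real \<Rightarrow> real"
  assumes f: "\<And>j k. Ck1 k (f j)" and f': "\<And>t. (f i has_real_derivative f' t) (at t)"
  shows "partial_deriv i (\<lambda>x. \<Prod>j\<in>UNIV. f j (x $ j)) x = f' (x $ i) * (\<Prod>j\<in>-{i}. f j (x $ j))"
proof -
  have c: "C_k (Suc 0) (\<lambda>x. \<Prod>j\<in>J. f j (x $ j))" for J :: "'n set"
    by (intro C_k_prod) (simp, rule C_k_coord[OF f])
  have d: "(\<lambda>x. \<Prod>j\<in>J. f j (x $ j)) differentiable at x" for J :: "'n set" and x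
    by (rule C_k_1_differentiable[OF c])
  have d1: "(\<lambda>x. f j (x $ j)) differentiable at x" for j x
    by (rule C_k_1_differentiable[OF C_k_coord[OF f[of "Suc 0"]]])
  have z: "partial_deriv i (\<lambda>x. \<Prod>j\<in>J. f j (x $ j)) x = 0" if "i \<notin> J" for J :: "'n set"
    using finite[of J] that
  proof (induction J rule: finite_induct)
    case empty
    show ?case by (simp add: partial_deriv_const)
  next
    case (insert j J)
    obtain fj' where "\<And>t. (f j has_real_derivative fj' t) (at t)"
      using f[of "Suc 0" j] by auto
    then have "partial_deriv i (\<lambda>x. f j (x $ j)) x = 0"
      using insert.prems by (simp add: partial_deriv_coord(2)[of _ "fj' (x $ j)"])
    then show ?case using insert by (simp add: partial_deriv_mult[OF d1 d])
  qed
  have "(\<lambda>x. \<Prod>j\<in>UNIV. f j (x $ j)) = (\<lambda>x. f i (x $ i) * (\<Prod>j\<in>-{i}. f j (x $ j)))"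
    by (simp add: prod.remove[of UNIV i] Compl_eq_Diff_UNIV)
  then show ?thesis
    using z[of "-{i}"] by (simp add: partial_deriv_mult[OF d1 d] partial_deriv_coord(2)[OF f'])
qed

text \<open>The margin e confines the support to a closed box inside the open one.\<close>

lemma prod_coord_test_function:
  fixes a b :: "real^'n::finite"
  assumes f: "\<And>j k. Ck1 k (f j)" and "e > 0"
    and supp: "\<And>j t. t \<le> a $ j + e \<or> t \<ge> b $ j - e \<Longrightarrow> f j t = 0"
    and sub: "box a b \<subseteq> \<Omega>"
  shows "(\<lambda>x. \<Prod>j\<in>UNIV. f j (x $ j)) \<in> test_functions \<Omega>"
proof -
  define K where "K = cbox (a + (\<chi> j. e)) (b - (\<chi> j. e))"
  have "{x. (\<Prod>j\<in>UNIV. f j (x $ j)) \<noteq> 0} \<subseteq> K"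
  proof
    fix x assume "x \<in> {x. (\<Prod>j\<in>UNIV. f j (x $ j)) \<noteq> 0}"
    then have "f j (x $ j) \<noteq> 0" for j by auto
    then have "\<not> (x $ j \<le> a $ j + e \<or> x $ j \<ge> b $ j - e)" for j using supp by blast
    then show "x \<in> K" by (simp add: K_def mem_box_cart not_le less_imp_le)
  qed
  then have c: "closure {x. (\<Prod>j\<in>UNIV. f j (x $ j)) \<noteq> 0} \<subseteq> K"
    by (intro closure_minimal) (auto simp: K_def)
  moreover have "K \<subseteq> box a b" using \<open>e > 0\<close> by (auto simp: K_def mem_box_cart; smt (verit))
  moreover have "compact (closure {x. (\<Prod>j\<in>UNIV. f j (x $ j)) \<noteq> 0})"
    using compact_cbox c unfolding K_def
    by (meson bounded_cbox bounded_subset closed_closure compact_eq_bounded_closed)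
  moreover have "C_k k (\<lambda>x. \<Prod>j\<in>UNIV. f j (x $ j))" for k
    by (intro C_k_prod) (simp, rule C_k_coord[OF f])
  ultimately show ?thesis using sub by (auto simp: test_functions_def)
qed

lemma integral_lebesgue_on_box:
  fixes F :: "'a::euclidean_space \<Rightarrow> real"
  assumes "open \<Omega>" "B \<subseteq> \<Omega>" "\<And>x. x \<notin> B \<Longrightarrow> F x = 0"
  shows "(LINT x|lebesgue_on \<Omega>. F x) = (LINT x|lebesgue. indicator B x * F x)"
proof -
  have "(\<lambda>x. indicat_real \<Omega> x *\<^sub>R F x) = (\<lambda>x. indicator B x * F x)"
    using assms(2,3) by (auto simp: indicator_def fun_eq_iff)
  then show ?thesis using assms(1) by (subst integral_restrict_space) auto
qed

subsection \<open>Consequences of the weak gradient identity on boxes\<close>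

text \<open>The defining identity of the weak gradient for products of one-variable functions. The
  factor in direction i is left arbitrary, so that it can be chosen as a primitive with prescribed
  derivative.\<close>

lemma weak_gradient_box_identity:
  fixes f :: "'n::finite \<Rightarrow> real \<Rightarrow> real" and a b :: "real^'n"
  assumes wg: "weak_gradient \<Omega> u g" and "open \<Omega>" and sub: "box a b \<subseteq> \<Omega>"
    and f: "\<And>j k. Ck1 k (f j)" and "e > 0"
    and supp: "\<And>j t. t \<le> a $ j + e \<or> t \<ge> b $ j - e \<Longrightarrow> f j t = 0"
    and f': "\<And>t. (f i has_real_derivative f' t) (at t)"
  shows "(LINT x|lebesgue. indicator (box a b) x * (u x * (f' (x $ i) * (\<Prod>j\<in>-{i}. f j (x $ j))))) =
       - (LINT x|lebesgue. indicator (box a b) x * (g x $ i * (\<Prod>j\<in>UNIV. f j (x $ j))))"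
proof -
  let ?\<phi> = "\<lambda>x. \<Prod>j\<in>UNIV. f j (x $ j)"
  have t: "?\<phi> \<in> test_functions \<Omega>"
    by (rule prod_coord_test_function[OF f \<open>e > 0\<close> supp sub])
  have out: "\<exists>j. f j (x $ j) = 0" if "x \<notin> box a b" for x
    using that supp \<open>e > 0\<close> by (auto simp: mem_box_cart not_less) (smt (verit))+
  \<comment> \<open>The factor \<open>f i\<close> vanishes on a whole neighbourhood of such a t, so
    its derivative vanishes too; this confines both integrands to the box.\<close>
  have f'0: "f' t = 0" if "t \<le> a $ i \<or> t \<ge> b $ i" for t
  proof -
    have "((\<lambda>_. 0) has_real_derivative 0) (at t)" by simp
    moreover have ev: "\<forall>\<^sub>F s in nhds t. f i s = 0"
    proof -
      have "\<forall>\<^sub>F s in nhds t. s < a $ i + e \<or> s > b $ i - e"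
      proof (cases "t \<le> a $ i")
        case True
        then have "\<forall>\<^sub>F s in nhds t. s \<in> {..<a $ i + e}" using \<open>e > 0\<close>
          by (intro eventually_nhds_in_open) auto
        then show ?thesis by eventually_elim auto
      next
        case False
        then have "\<forall>\<^sub>F s in nhds t. s \<in> {b $ i - e<..}" using \<open>e > 0\<close> that
          by (intro eventually_nhds_in_open) auto
        then show ?thesis by eventually_elim auto
      qed
      then show ?thesis by eventually_elim (use supp in auto)
    qed
    ultimately have "(f i has_real_derivative 0) (at t)"
      using DERIV_cong_ev[OF refl ev refl] by blast
    then show ?thesis using f'[of t] DERIV_unique by blast
  qed
  have "(LINT x|lebesgue_on \<Omega>. u x * partial_deriv i ?\<phi> x) = - (LINT x|lebesgue_on \<Omega>. g x $ i * ?\<phi> x)"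
    using wg t unfolding weak_gradient_def by blast
  moreover have "(LINT x|lebesgue_on \<Omega>. u x * partial_deriv i ?\<phi> x) =
     (LINT x|lebesgue. indicator (box a b) x * (u x * partial_deriv i ?\<phi> x))"
  proof (rule integral_lebesgue_on_box[OF \<open>open \<Omega>\<close> sub])
    fix x assume "x \<notin> box a b"
    then obtain j where j: "x $ j \<le> a $ j \<or> x $ j \<ge> b $ j" by (auto simp: mem_box_cart not_less)
    show "u x * partial_deriv i ?\<phi> x = 0"
    proof (cases "j = i")
      case True then show ?thesis using f'0 j by (simp add: partial_deriv_prod_coord[where f=f and f'=f' and i=i, OF f f'])
    next
      case False
      then have "(\<Prod>j\<in>-{i}. f j (x $ j)) = 0"
        using supp[of "x $ j" j] j \<open>e > 0\<close> by (intro prod_zero) (auto intro!: bexI[of _ j])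
      then show ?thesis by (simp add: partial_deriv_prod_coord[where f=f and f'=f' and i=i, OF f f'])
    qed
  qed
  moreover have "(LINT x|lebesgue_on \<Omega>. g x $ i * ?\<phi> x) =
     (LINT x|lebesgue. indicator (box a b) x * (g x $ i * ?\<phi> x))"
    by (rule integral_lebesgue_on_box[OF \<open>open \<Omega>\<close> sub]) (use out in \<open>auto simp: prod_zero_iff\<close>)
  ultimately show ?thesis by (simp add: partial_deriv_prod_coord[where f=f and f'=f' and i=i, OF f f'])
qed

lemma Ck1_borel: "Ck1 0 f \<Longrightarrow> f \<in> borel_measurable borel"
  by (auto intro: borel_measurable_continuous_onI)

lemma measurable_coord_lebesgue:
  assumes "f \<in> borel_measurable borel"
  shows "(\<lambda>x::real^'n::finite. f (x $ i) :: real) \<in> borel_measurable lebesgue"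
proof -
  have "(\<lambda>x::real^'n. x $ i) \<in> borel_measurable borel"
    by (intro borel_measurable_continuous_onI continuous_intros)
  then have "(\<lambda>x::real^'n. f (x $ i)) \<in> borel_measurable borel"
    using assms by (rule measurable_compose)
  then show ?thesis by (simp add: measurable_completion)
qed

text \<open>A substitute for the fundamental theorem of calculus that avoids point values of u. In
  direction i the test function is a primitive of the bump on (c, d) minus the bump on (c', d'),
  weighted so that the total mass is zero; the primitive then has compact support and is bounded by
  \<open>C n * C' n\<close>. In the other directions bumps tending to 1 are used. In the limit one
  side becomes the difference of the averages, the other is bounded by the gradient.\<close>

lemma box_average:
  fixes a b :: "real^'n::finite"
  assumes wg: "weak_gradient \<Omega> u g" and "open \<Omega>" and sub: "box a b \<subseteq> \<Omega>"
    and c: "a $ i \<le> c" "c < d" "d \<le> b $ i" and c': "a $ i \<le> c'" "c' < d'" "d' \<le> b $ i"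
    and iu: "set_integrable lebesgue (box a b) u" and ig: "set_integrable lebesgue (box a b) g"
  shows "\<bar>(LINT x:{x \<in> box a b. c < x $ i \<and> x $ i < d}|lebesgue. u x) / (d - c) -
          (LINT x:{x \<in> box a b. c' < x $ i \<and> x $ i < d'}|lebesgue. u x) / (d' - c')\<bar>
        \<le> (LINT x:box a b|lebesgue. norm (g x))"
proof -
  define B where "B = box a b"
  define C where "C n = (LINT t|lborel. bump n c d t)" for n
  define C' where "C' n = (LINT t|lborel. bump n c' d' t)" for n
  have C: "0 \<le> C n" "C n \<le> d - c" "0 \<le> C' n" "C' n \<le> d' - c'" for n
    using integral_bump_bounds[of c d n] integral_bump_bounds[of c' d' n] c c' by (auto simp: C_def C'_def)
  have Clim: "C \<longlonglongrightarrow> d - c" "C' \<longlonglongrightarrow> d' - c'"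
    using integral_bump_tendsto[of c d] integral_bump_tendsto[of c' d'] c c' unfolding C_def C'_def by auto
  define D where "D n t = C' n * bump n c d t - C n * bump n c' d' t" for n t
  define R where "R n x = (\<Prod>j\<in>-{i}. bump n (a $ j) (b $ j) (x $ j))" for n and x :: "real^'n"
  have R01: "0 \<le> R n x" "R n x \<le> 1" for n x
    unfolding R_def by (auto intro!: prod_nonneg prod_le_1 simp: bump_bounds)
  define L where "L n = (LINT x|lebesgue. indicator B x * (u x * (D n (x $ i) * R n x)))" for n
  define G where "G = (LINT x:B|lebesgue. norm (g x))"
  have bound: "\<bar>L n\<bar> \<le> C n * C' n * G" for n
  proof -
    obtain P where P: "\<And>t. (P has_real_derivative bump n c d t) (at t)"
      "\<And>t. t \<le> c + 1 / real (Suc n) \<Longrightarrow> P t = 0" "\<And>t. t \<ge> d - 1 / real (Suc n) \<Longrightarrow> P t = C n"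
      "\<And>t. 0 \<le> P t" "\<And>t. P t \<le> C n"
      using bump_primitive[of c d n] c unfolding C_def by (metis less_imp_le)
    obtain Q where Q: "\<And>t. (Q has_real_derivative bump n c' d' t) (at t)"
      "\<And>t. t \<le> c' + 1 / real (Suc n) \<Longrightarrow> Q t = 0" "\<And>t. t \<ge> d' - 1 / real (Suc n) \<Longrightarrow> Q t = C' n"
      "\<And>t. 0 \<le> Q t" "\<And>t. Q t \<le> C' n"
      using bump_primitive[of c' d' n] c' unfolding C'_def by (metis less_imp_le)
    define \<beta> where "\<beta> t = C' n * P t - C n * Q t" for t
    define f where "f j = (if j = i then \<beta> else bump n (a $ j) (b $ j))" for j
    have dP: "(\<beta> has_real_derivative D n t) (at t)" for t
      unfolding \<beta>_def D_def by (auto intro!: derivative_eq_intros P(1) Q(1))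
    have "Ck1 k (\<lambda>t. C' n * bump n c d t + (- C n) * bump n c' d' t)" for k
      by (intro Ck1_add Ck1_mult Ck1_const Ck1_bump)
    then have "Ck1 k (D n)" for k by (simp add: D_def[abs_def])
    then have "Ck1 (Suc k) \<beta>" for k using dP by (rule Ck1_SucI[rotated])
    then have "Ck1 k \<beta>" for k by (rule Ck1_lower)
    then have fs: "Ck1 k (f j)" for j k by (auto simp: f_def Ck1_bump)
    have supp: "f j t = 0" if "t \<le> a $ j + 1 / real (Suc n) \<or> t \<ge> b $ j - 1 / real (Suc n)" for j t
    proof (cases "j = i")
      case True
      \<comment> \<open>Near the left face both primitives are 0, near the right face both have
        reached their full mass, and then the weights cancel.\<close>
      have "P t = 0 \<and> Q t = 0 \<or> P t = C n \<and> Q t = C' n"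
        using that True c c' P(2,3)[of t] Q(2,3)[of t] by (smt (verit))
      then show ?thesis using True by (auto simp: f_def \<beta>_def)
    next
      case False then show ?thesis using that bump_0 by (auto simp: f_def)
    qed
    have fi: "(f i has_real_derivative D n t) (at t)" for t using dP by (simp add: f_def)
    have fR: "(\<Prod>j\<in>-{i}. f j (x $ j)) = R n x" for x
      unfolding R_def by (intro prod.cong) (auto simp: f_def)
    have fU: "(\<Prod>j\<in>UNIV. f j (x $ j)) = \<beta> (x $ i) * R n x" for x
      using prod.remove[of UNIV i "\<lambda>j. f j (x $ j)"] fR[of x] by (simp add: Compl_eq_Diff_UNIV f_def)
    have \<beta>b: "\<bar>\<beta> t\<bar> \<le> C n * C' n" for t
    proof -
      have "C' n * P t \<le> C n * C' n" "C n * Q t \<le> C n * C' n" "0 \<le> C' n * P t" "0 \<le> C n * Q t"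
        using mult_left_mono[OF P(5)[of t] C(3)[of n]] mult_left_mono[OF Q(5)[of t] C(1)[of n]]
          C[of n] P(4)[of t] Q(4)[of t] by (auto simp: mult.commute)
      then show ?thesis by (auto simp: \<beta>_def)
    qed
    have "L n = - (LINT x|lebesgue. indicator B x * (g x $ i * (\<beta> (x $ i) * R n x)))"
      using weak_gradient_box_identity[where f=f and f'="D n" and i=i and e="1 / real (Suc n)",
          OF wg \<open>open \<Omega>\<close> sub fs _ supp fi]
      by (simp add: fR fU L_def B_def)
    also have "\<bar>\<dots>\<bar> \<le> (LINT x|lebesgue. C n * C' n * (indicator B x * norm (g x)))"
    proof -
      have "\<bar>LINT x|lebesgue. indicator B x * (g x $ i * (\<beta> (x $ i) * R n x))\<bar> \<le>
          (LINT x|lebesgue. \<bar>indicator B x * (g x $ i * (\<beta> (x $ i) * R n x))\<bar>)"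
        by (rule integral_abs_bound)
      also have "\<dots> \<le> (LINT x|lebesgue. C n * C' n * (indicator B x * norm (g x)))"
      proof (rule integral_mono')
        show "integrable lebesgue (\<lambda>x. C n * C' n * (indicator B x * norm (g x)))"
          using set_integrable_norm[OF ig] by (simp add: set_integrable_def B_def)
        fix x :: "real^'n"
        have "\<bar>g x $ i\<bar> * (\<bar>\<beta> (x $ i)\<bar> * R n x) \<le> norm (g x) * (C n * C' n * 1)"
          using C[of n] R01[of n x] \<beta>b component_le_norm_cart[of "g x" i]
          by (intro mult_mono mult_nonneg_nonneg) auto
        then show "\<bar>indicator B x * (g x $ i * (\<beta> (x $ i) * R n x))\<bar> \<le> C n * C' n * (indicator B x * norm (g x))"
          using R01[of n x] by (auto simp: indicator_def abs_mult mult_ac)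
        show "0 \<le> C n * C' n * (indicator B x * norm (g x))"
          using C[of n] by auto
      qed
      finally show ?thesis by simp
    qed
    finally show ?thesis by (simp add: G_def set_lebesgue_integral_def)
  qed
  \<comment> \<open>The pointwise limit of the integrands of \<open>L n\<close>; its integral is the
    difference of the averages times the product of the two lengths.\<close>
  define E where "E x = indicator B x * (u x * ((d' - c') * indicator {c<..<d} (x $ i) - (d - c) * indicator {c'<..<d'} (x $ i)))" for x
  have iu': "integrable lebesgue (\<lambda>x. indicator B x * u x)"
    using iu by (simp add: set_integrable_def B_def)
  have mu: "(\<lambda>x. indicator B x * u x) \<in> borel_measurable lebesgue"
    using iu' by auto
  have Rlim: "(\<lambda>n. R n x) \<longlonglongrightarrow> 1" if "x \<in> B" for x
  proof -
    have "(\<lambda>n. R n x) \<longlonglongrightarrow> (\<Prod>j\<in>-{i}. indicator {a $ j<..<b $ j} (x $ j))"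
      unfolding R_def by (intro tendsto_prod bump_tendsto)
    also have "(\<Prod>j\<in>-{i}. indicat_real {a $ j<..<b $ j} (x $ j)) = 1"
      using that by (intro prod.neutral) (auto simp: B_def mem_box_cart)
    finally show ?thesis .
  qed
  have "L \<longlonglongrightarrow> (LINT x|lebesgue. E x)"
    unfolding L_def
  proof (rule integral_dominated_convergence[where w="\<lambda>x. ((d' - c') + (d - c)) * \<bar>indicator B x * u x\<bar>"])
    have "(\<lambda>x. (indicator B x * u x) * ((d' - c') * indicator {c<..<d} (x $ i) - (d - c) * indicator {c'<..<d'} (x $ i))) \<in> borel_measurable lebesgue"
      by (intro borel_measurable_times borel_measurable_diff mu borel_measurable_const measurable_coord_lebesgue) auto
    then show "E \<in> borel_measurable lebesgue" by (simp add: E_def[abs_def] mult.assoc)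
    have "(\<lambda>x. (indicator B x * u x) * ((C' n * bump n c d (x $ i) - C n * bump n c' d' (x $ i)) *
             (\<Prod>j\<in>-{i}. bump n (a $ j) (b $ j) (x $ j)))) \<in> borel_measurable lebesgue" for n
      by (intro borel_measurable_times borel_measurable_diff mu borel_measurable_const measurable_coord_lebesgue Ck1_borel Ck1_bump borel_measurable_prod)
    then show "(\<lambda>x. indicator B x * (u x * (D n (x $ i) * R n x))) \<in> borel_measurable lebesgue" for n
      by (simp add: R_def D_def mult.assoc)
    show "integrable lebesgue (\<lambda>x. ((d' - c') + (d - c)) * \<bar>indicator B x * u x\<bar>)"
      using iu' by (intro integrable_mult_right integrable_abs)
    show "AE x in lebesgue. (\<lambda>n. indicator B x * (u x * (D n (x $ i) * R n x))) \<longlonglongrightarrow> E x"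
    proof (rule AE_I2)
      fix x :: "real^'n"
      show "(\<lambda>n. indicator B x * (u x * (D n (x $ i) * R n x))) \<longlonglongrightarrow> E x"
      proof (cases "x \<in> B")
        case True
        have "(\<lambda>n. indicator B x * (u x * (D n (x $ i) * R n x))) \<longlonglongrightarrow>
           indicator B x * (u x * (((d' - c') * indicator {c<..<d} (x $ i) - (d - c) * indicator {c'<..<d'} (x $ i)) * 1))"
          unfolding D_def by (intro tendsto_intros Rlim[OF True] bump_tendsto Clim)
        then show ?thesis by (simp add: E_def)
      qed (simp add: E_def)
    qed
    show "AE x in lebesgue. norm (indicator B x * (u x * (D n (x $ i) * R n x))) \<le> ((d' - c') + (d - c)) * \<bar>indicator B x * u x\<bar>" for n
    proof (rule AE_I2)
      fix x :: "real^'n"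
      have "C' n * bump n c d (x $ i) \<le> (d' - c') * 1" "C n * bump n c' d' (x $ i) \<le> (d - c) * 1"
        "0 \<le> C' n * bump n c d (x $ i)" "0 \<le> C n * bump n c' d' (x $ i)"
        using C[of n] by (auto intro!: mult_mono simp: bump_bounds simp del: mult_1_right)
      then have "\<bar>D n (x $ i)\<bar> \<le> (d' - c') + (d - c)" by (auto simp: D_def)
      then have "\<bar>D n (x $ i)\<bar> * R n x \<le> ((d' - c') + (d - c)) * 1"
        using R01[of n x] by (intro mult_mono) auto
      then have "\<bar>indicator B x * u x\<bar> * (\<bar>D n (x $ i)\<bar> * R n x) \<le> \<bar>indicator B x * u x\<bar> * (((d' - c') + (d - c)))"
        by (intro mult_left_mono) auto
      then show "norm (indicator B x * (u x * (D n (x $ i) * R n x))) \<le> ((d' - c') + (d - c)) * \<bar>indicator B x * u x\<bar>"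
        using R01[of n x] by (simp add: abs_mult mult_ac)
    qed
  qed
  then have "\<bar>LINT x|lebesgue. E x\<bar> \<le> (d - c) * (d' - c') * G"
    by (intro tendsto_le[OF _ tendsto_mult_right[OF tendsto_mult[OF Clim]] tendsto_rabs])
       (use bound in auto)
  moreover have "(LINT x|lebesgue. E x) = (d' - c') * (LINT x:{x \<in> box a b. c < x $ i \<and> x $ i < d}|lebesgue. u x)
       - (d - c) * (LINT x:{x \<in> box a b. c' < x $ i \<and> x $ i < d'}|lebesgue. u x)"
  proof -
    have int: "integrable lebesgue (\<lambda>x. (indicator B x * u x) * indicator {c<..<d} (x $ i))" for c d
    proof (rule Bochner_Integration.integrable_bound[OF iu'])
      show "(\<lambda>x. (indicator B x * u x) * indicator {c<..<d} (x $ i)) \<in> borel_measurable lebesgue"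
        by (intro borel_measurable_times mu measurable_coord_lebesgue) auto
    qed (auto simp: indicator_def)
    have eq: "(LINT x:{x \<in> box a b. c < x $ i \<and> x $ i < d}|lebesgue. u x) =
        (LINT x|lebesgue. (indicator B x * u x) * indicator {c<..<d} (x $ i))" for c d
      unfolding set_lebesgue_integral_def by (intro Bochner_Integration.integral_cong) (auto simp: B_def indicator_def)
    have "(LINT x|lebesgue. E x) = (LINT x|lebesgue. (d' - c') * ((indicator B x * u x) * indicator {c<..<d} (x $ i))
         - (d - c) * ((indicator B x * u x) * indicator {c'<..<d'} (x $ i)))"
      unfolding E_def by (intro Bochner_Integration.integral_cong) (auto simp: algebra_simps)
    then show ?thesis unfolding eq using int by simp
  qed
  moreover have "\<bar>X / p - Y / q\<bar> \<le> Z" if "\<bar>q * X - p * Y\<bar> \<le> p * q * Z" "p > 0" "q > 0" for p q X Y Z :: real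
  proof -
    have "X / p - Y / q = (q * X - p * Y) / (p * q)" using that by (simp add: field_simps)
    also have "\<bar>\<dots>\<bar> \<le> Z" using that by (simp add: abs_divide abs_mult divide_le_eq mult.commute)
    finally show ?thesis .
  qed
  ultimately show ?thesis
    using c c' unfolding G_def B_def by simp
qed

section \<open>Uniqueness of weak gradients\<close>

text \<open>Boxes form an intersection-stable generator of the Borel sets, so the integrals over all
  Borel sets vanish. Cutting off at the open box makes the function integrable on the whole space;
  the boundary of the box is a null set.\<close>

lemma integral_box_zero_imp_AE_zero:
  fixes f :: "real^'n::finite \<Rightarrow> real"
  assumes int: "set_integrable lebesgue (cbox a b) f"
    and zero: "\<And>c d. box c d \<subseteq> box a b \<Longrightarrow> (LINT x:box c d|lebesgue. f x) = 0"
  shows "AE x in lebesgue. x \<in> cbox a b \<longrightarrow> f x = 0"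
proof -
  define F where "F x = indicator (box a b) x *\<^sub>R f x" for x
  have Fi: "integrable lebesgue F"
    using set_integrable_subset[OF int _ box_subset_cbox] by (simp add: F_def[abs_def] set_integrable_def)
  \<comment> \<open>The generator argument reaches Borel sets only, while f is Lebesgue measurable;
    hence a Borel representative.\<close>
  obtain F' where F': "F' \<in> borel_measurable lborel" "AE x in lborel. F x = F' x"
    using completion_ex_borel_measurable_real[OF borel_measurable_integrable[OF Fi]] by blast
  have ae: "AE x in lebesgue. F x = F' x" using F'(2) by (rule AE_completion)
  have Fi': "integrable lebesgue F'"
    using Fi F' ae by (subst integrable_cong_AE[of _ _ F]) (auto simp: measurable_completion)
  then have i': "integrable lborel F'" using F'(1) by (simp add: integrable_completion)
  have boxes: "(LINT x:box c d|lborel. F' x) = 0" for c d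
  proof -
    obtain c' d' where cd: "box c d \<inter> box a b = box c' d'"
      using box_Int_box[of c d a b] by blast
    have "(LINT x:box c d|lborel. F' x) = (LINT x|lebesgue. indicator (box c d) x *\<^sub>R F' x)"
      unfolding set_lebesgue_integral_def using F'(1) by (intro integral_completion[symmetric]) auto
    also have "\<dots> = (LINT x|lebesgue. indicator (box c d) x *\<^sub>R F x)"
      using ae by (intro integral_cong_AE borel_measurable_scaleR borel_measurable_indicator
          borel_measurable_integrable[OF Fi] borel_measurable_integrable[OF Fi']) auto
    also have "\<dots> = (LINT x:box c' d'|lebesgue. f x)"
      unfolding set_lebesgue_integral_def cd[symmetric] F_def
      by (intro Bochner_Integration.integral_cong) (auto simp: indicator_def)
    also have "\<dots> = 0" using cd by (intro zero) auto
    finally show ?thesis .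
  qed
  have borel_sets: "(LINT x:A|lborel. F' x) = 0" if "A \<in> sets borel" for A
  proof -
    have A: "A \<in> sigma_sets UNIV (range (\<lambda>(a, b). box a b :: (real^'n) set))"
      using that by (simp add: borel_eq_box)
    have "Int_stable (range (\<lambda>(a, b). box a b :: (real^'n) set))"
    proof (rule Int_stableI)
      fix X Y :: "(real^'n) set"
      assume "X \<in> range (\<lambda>(a, b). box a b)" "Y \<in> range (\<lambda>(a, b). box a b)"
      then obtain z z' where z: "X = (\<lambda>(a, b). box a b) z" "Y = (\<lambda>(a, b). box a b) z'"
        by (elim rangeE)
      obtain lo hi where "box (fst z) (snd z) \<inter> box (fst z') (snd z') = box lo hi"
        unfolding box_Int_box by blast
      then have "X \<inter> Y = (\<lambda>(a, b). box a b) (lo, hi)"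
        unfolding z case_prod_beta by simp
      then show "X \<inter> Y \<in> range (\<lambda>(a, b). box a b)" by (rule range_eqI)
    qed
    moreover have "range (\<lambda>(a, b). box a b :: (real^'n) set) \<subseteq> Pow UNIV" by simp
    ultimately show ?thesis using A
    proof (induction rule: sigma_sets_induct_disjoint)
      case (basic A) then show ?case using boxes by auto
    next
      case empty show ?case by (simp add: set_lebesgue_integral_def)
    next
      case (compl A)
      then have A: "A \<in> sets borel" by (simp add: borel_eq_box)
      \<comment> \<open>Complements rest on the total integral being zero, which is the hypothesis
        for the whole box.\<close>
      have "(LINT x|lborel. F' x) = (LINT x|lebesgue. F' x)"
        using F'(1) by (rule integral_completion[symmetric])
      also have "\<dots> = (LINT x|lebesgue. F x)"
        using F'(1) Fi ae by (intro integral_cong_AE) (auto simp: measurable_completion)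
      also have "\<dots> = 0" using zero[OF order_refl] by (simp add: F_def set_lebesgue_integral_def)
      finally have 0: "(LINT x|lborel. F' x) = 0" .
      have "(LINT x:UNIV - A|lborel. F' x) = (LINT x|lborel. F' x - indicator A x *\<^sub>R F' x)"
        unfolding set_lebesgue_integral_def
        by (intro Bochner_Integration.integral_cong) (auto simp: indicator_def)
      also have "\<dots> = (LINT x|lborel. F' x) - (LINT x|lborel. indicator A x *\<^sub>R F' x)"
        using A i' by (intro Bochner_Integration.integral_diff integrable_mult_indicator) auto
      also have "\<dots> = 0" using 0 compl by (simp add: set_lebesgue_integral_def)
      finally show ?case .
    next
      case (union A)
      then have A: "A i \<in> sets borel" for i by (auto simp: borel_eq_box)
      have "(LINT x:(\<Union>i. A i)|lborel. F' x) = (\<Sum>i. LINT x:A i|lborel. F' x)"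
      proof (rule lebesgue_integral_countable_add)
        show "set_integrable lborel (\<Union>i. A i) F'"
          unfolding set_integrable_def using A by (intro integrable_mult_indicator i') auto
      qed (use A union(1) in \<open>auto simp: disjoint_family_on_def\<close>)
      then show ?case using union by simp
    qed
  qed
  have "AE x in lborel. F' x = 0"
    by (rule sigma_finite_measure.density_zero[OF sigma_finite_lborel i']) (use borel_sets in auto)
  then have "AE x in lebesgue. F' x = 0" by (rule AE_completion)
  moreover have "AE x in lebesgue. x \<notin> cbox a b - box a b"
    by (rule AE_not_in) (metis negligible_frontier_interval negligible_iff_null_sets)
  ultimately show ?thesis using ae
    by eventually_elim (auto simp: F_def indicator_def split: if_splits)
qed


lemma set_integrable_vec_nth:
  fixes g :: "'a \<Rightarrow> real^'n"
  assumes "set_integrable M A g"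
  shows "set_integrable M A (\<lambda>x. g x $ i)"
  using integrable_bounded_linear[OF bounded_linear_vec_nth assms[unfolded set_integrable_def]]
  by (simp add: set_integrable_def)

text \<open>Testing with products of bumps that tend to the indicator of a box shows that both
  gradients have the same integrals over boxes. Countably many closed boxes exhaust the open set,
  which turns local equality into equality almost everywhere.\<close>

lemma weak_gradient_unique:
  fixes g g' :: "real^'n::finite \<Rightarrow> real^'n"
  assumes "open \<Omega>" and wg: "weak_gradient \<Omega> u g" "weak_gradient \<Omega> u g'"
  shows "AE x in lebesgue. x \<in> \<Omega> \<longrightarrow> g x = g' x"
proof -
  have cell: "AE x in lebesgue. x \<in> cbox a b \<longrightarrow> g x = g' x" if sub: "cbox a b \<subseteq> \<Omega>" for a b
  proof -
    have "AE x in lebesgue. x \<in> cbox a b \<longrightarrow> g x $ i - g' x $ i = 0" for i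
    proof (rule integral_box_zero_imp_AE_zero)
      have gi: "set_integrable lebesgue (cbox a b) g" "set_integrable lebesgue (cbox a b) g'"
        using wg sub by (auto simp: weak_gradient_def)
      then show int: "set_integrable lebesgue (cbox a b) (\<lambda>x. g x $ i - g' x $ i)"
        by (intro set_integral_diff set_integrable_vec_nth)
      fix c d assume cd: "box c d \<subseteq> box a b"
      then have "box c d \<subseteq> cbox a b" using box_subset_cbox by blast
      with gi int have ints: "set_integrable lebesgue (box c d) g" "set_integrable lebesgue (box c d) g'"
         "set_integrable lebesgue (box c d) (\<lambda>x. g x $ i - g' x $ i)"
        by (auto intro: set_integrable_subset)
      define R where "R n x = (\<Prod>j\<in>UNIV. bump n (c $ j) (d $ j) (x $ j))" for n and x :: "real^'n"
      have R01: "0 \<le> R n x" "R n x \<le> 1" for n x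
        unfolding R_def by (auto intro!: prod_nonneg prod_le_1 simp: bump_bounds)
      have Rm: "R n \<in> borel_measurable lebesgue" for n
        unfolding R_def by (intro borel_measurable_prod measurable_coord_lebesgue Ck1_borel Ck1_bump)
      have Ri: "integrable lebesgue (\<lambda>x. (indicator (box c d) x *\<^sub>R h x) * R n x)"
        if "set_integrable lebesgue (box c d) h" for h :: "real^'n \<Rightarrow> real" and n
      proof (rule Bochner_Integration.integrable_bound[OF that[unfolded set_integrable_def]])
        show "(\<lambda>x. (indicator (box c d) x *\<^sub>R h x) * R n x) \<in> borel_measurable lebesgue"
          using that by (intro borel_measurable_times Rm) (auto simp: set_integrable_def)
        show "AE x in lebesgue. norm ((indicator (box c d) x *\<^sub>R h x) * R n x) \<le> norm (indicator (box c d) x *\<^sub>R h x)"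
          using R01[of n] by (auto simp: abs_mult intro!: mult_left_le mult_left_le_one_le)
      qed
      have z: "(LINT x|lebesgue. (indicator (box c d) x *\<^sub>R (g x $ i - g' x $ i)) * R n x) = 0" for n
      proof -
        obtain f' where f': "\<And>t. (bump n (c $ i) (d $ i) has_real_derivative f' t) (at t)"
          using Ck1_bump[of "Suc 0" n "c $ i" "d $ i"] by auto
        have "box c d \<subseteq> \<Omega>" using cd sub box_subset_cbox by blast
        have id: "(LINT x|lebesgue. indicator (box c d) x * (h x $ i * R n x)) =
            - (LINT x|lebesgue. indicator (box c d) x * (u x * (f' (x $ i) * (\<Prod>j\<in>-{i}. bump n (c $ j) (d $ j) (x $ j)))))"
          if "weak_gradient \<Omega> u h" for h
          unfolding R_def
          by (subst weak_gradient_box_identity[OF that \<open>open \<Omega>\<close> \<open>box c d \<subseteq> \<Omega>\<close>,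
                where f="\<lambda>j. bump n (c $ j) (d $ j)" and e="1 / real (Suc n)"])
             (use Ck1_bump f' bump_0 in \<open>auto simp del: of_nat_Suc\<close>)
        have "(LINT x|lebesgue. indicator (box c d) x * (g x $ i * R n x)) = (LINT x|lebesgue. indicator (box c d) x * (g' x $ i * R n x))"
          using id[OF wg(1)] id[OF wg(2)] by simp
        moreover have "(LINT x|lebesgue. (indicator (box c d) x *\<^sub>R (g x $ i - g' x $ i)) * R n x)
           = (LINT x|lebesgue. (indicator (box c d) x *\<^sub>R g x $ i) * R n x - (indicator (box c d) x *\<^sub>R g' x $ i) * R n x)"
          by (intro Bochner_Integration.integral_cong) (auto simp: algebra_simps)
        moreover have "\<dots> = (LINT x|lebesgue. (indicator (box c d) x *\<^sub>R g x $ i) * R n x) - (LINT x|lebesgue. (indicator (box c d) x *\<^sub>R g' x $ i) * R n x)"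
          by (intro Bochner_Integration.integral_diff Ri set_integrable_vec_nth ints)
        ultimately show ?thesis by (simp add: mult.assoc)
      qed
      have "(\<lambda>n. LINT x|lebesgue. (indicator (box c d) x *\<^sub>R (g x $ i - g' x $ i)) * R n x) \<longlonglongrightarrow>
          (LINT x|lebesgue. indicator (box c d) x *\<^sub>R (g x $ i - g' x $ i))"
      proof (rule integral_dominated_convergence[where w="\<lambda>x. norm (indicator (box c d) x *\<^sub>R (g x $ i - g' x $ i))"])
        show "AE x in lebesgue. (\<lambda>n. (indicator (box c d) x *\<^sub>R (g x $ i - g' x $ i)) * R n x)
            \<longlonglongrightarrow> indicator (box c d) x *\<^sub>R (g x $ i - g' x $ i)"
        proof (rule AE_I2)
          fix x :: "real^'n"
          have "(\<lambda>n. R n x) \<longlonglongrightarrow> (\<Prod>j\<in>UNIV. indicator {c $ j<..<d $ j} (x $ j))"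
            unfolding R_def by (intro tendsto_prod bump_tendsto)
          also have "(\<Prod>j\<in>UNIV. indicat_real {c $ j<..<d $ j} (x $ j)) = indicator (box c d) x"
            by (cases "x \<in> box c d") (auto simp: mem_box_cart indicator_def prod_zero_iff)
          finally have "(\<lambda>n. (indicator (box c d) x *\<^sub>R (g x $ i - g' x $ i)) * R n x)
            \<longlonglongrightarrow> indicator (box c d) x *\<^sub>R (g x $ i - g' x $ i) * indicator (box c d) x"
            by (intro tendsto_intros)
          then show "(\<lambda>n. (indicator (box c d) x *\<^sub>R (g x $ i - g' x $ i)) * R n x)
            \<longlonglongrightarrow> indicator (box c d) x *\<^sub>R (g x $ i - g' x $ i)"
            by (cases "x \<in> box c d") simp_all
        qed
        show "AE x in lebesgue. norm ((indicator (box c d) x *\<^sub>R (g x $ i - g' x $ i)) * R n x) \<le> norm (indicator (box c d) x *\<^sub>R (g x $ i - g' x $ i))" for n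
          using R01[of n] by (auto simp: abs_mult intro!: mult_left_le mult_left_le_one_le)
        show "integrable lebesgue (\<lambda>x. norm (indicator (box c d) x *\<^sub>R (g x $ i - g' x $ i)))"
          using ints(3) by (intro integrable_norm) (simp add: set_integrable_def)
        show "(\<lambda>x. indicator (box c d) x *\<^sub>R (g x $ i - g' x $ i) * R n x) \<in> borel_measurable lebesgue" for n
          by (rule borel_measurable_integrable[OF Ri[OF ints(3)]])
        show "(\<lambda>x. indicator (box c d) x *\<^sub>R (g x $ i - g' x $ i)) \<in> borel_measurable lebesgue"
          by (rule borel_measurable_integrable[OF ints(3)[unfolded set_integrable_def]])
      qed
      then show "(LINT x:box c d|lebesgue. g x $ i - g' x $ i) = 0"
        unfolding z set_lebesgue_integral_def by (simp add: LIMSEQ_const_iff)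
    qed
    then have "AE x in lebesgue. \<forall>i\<in>UNIV. x \<in> cbox a b \<longrightarrow> g x $ i - g' x $ i = 0"
      by (intro AE_finite_allI) auto
    then show ?thesis by eventually_elim (auto simp: vec_eq_iff)
  qed
  obtain \<D> where D: "countable \<D>" "\<D> \<subseteq> Pow \<Omega>" "\<And>X. X \<in> \<D> \<Longrightarrow> \<exists>a b. X = cbox a b" "\<Union>\<D> = \<Omega>"
    using open_countable_Union_open_cbox[OF \<open>open \<Omega>\<close>] by metis
  have "AE x in lebesgue. \<forall>X\<in>\<D>. x \<in> X \<longrightarrow> g x = g' x"
    using D cell by (subst AE_ball_countable) (auto, metis PowD subsetD)
  then show ?thesis by eventually_elim (use D(4) in auto)
qed

subsection \<open>Integration by parts for continuously differentiable functions\<close>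

text \<open>Translation invariance makes the integral of every difference quotient zero. The
  quotients are dominated: the mean value theorem bounds them by the maximum of the partial
  derivative, and steps of size at most 1 keep them supported in one ball.\<close>

lemma integral_partial_deriv_eq_0:
  fixes w :: "real^'n::finite \<Rightarrow> real"
  assumes d: "\<And>x. w differentiable at x" and c: "continuous_on UNIV (partial_deriv i w)"
    and supp: "\<And>x. norm x > r \<Longrightarrow> w x = 0"
  shows "(LINT x|lborel. partial_deriv i w x) = 0"
proof -
  define e where "e = (axis i 1 :: real^'n)"
  have ne: "norm e = 1" by (simp add: e_def norm_axis_1)
  define t where "t n = 1 / real (Suc n)" for n
  have t: "0 < t n" "t n \<le> 1" for n by (auto simp: t_def)
  have t0: "t \<longlonglongrightarrow> 0" unfolding t_def by real_asymp
  define q where "q n x = (w (x + t n *\<^sub>R e) - w x) / t n" for n x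
  have line: "((\<lambda>s. w (x + s *\<^sub>R e)) has_real_derivative partial_deriv i w (x + s *\<^sub>R e)) (at s)" for x s
  proof -
    have D: "(w has_derivative frechet_derivative w (at (x + s *\<^sub>R e))) (at (x + s *\<^sub>R e))"
      using d frechet_derivative_works by blast
    have "((\<lambda>s. w (x + s *\<^sub>R e)) has_derivative (\<lambda>h. frechet_derivative w (at (x + s *\<^sub>R e)) (h *\<^sub>R e))) (at s)"
      by (rule has_derivative_compose[where f="\<lambda>s. x + s *\<^sub>R e" and f'="\<lambda>h. h *\<^sub>R e" and g=w, OF _ D]) (auto intro!: derivative_eq_intros)
    moreover have "frechet_derivative w (at (x + s *\<^sub>R e)) (h *\<^sub>R e) = partial_deriv i w (x + s *\<^sub>R e) * h" for h
      using linear_cmul[OF has_derivative_linear[OF D]] by (simp add: partial_deriv_def e_def)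
    ultimately show ?thesis by (simp add: has_field_derivative_def)
  qed
  have wc: "continuous_on UNIV w"
    using d by (auto simp: continuous_on_eq_continuous_at intro: differentiable_imp_continuous_within)
  have d0: "partial_deriv i w x = 0" if "norm x > r" for x
  proof -
    have "w x = 0 * 0" using supp that by simp
    have "(w has_derivative (\<lambda>_. 0)) (at x)"
    proof (rule has_derivative_transform_within_open[of "\<lambda>_. 0" _ x UNIV "- cball 0 r"])
      show "((\<lambda>_. 0) has_derivative (\<lambda>_. 0)) (at x)" by (rule has_derivative_const)
    qed (use that supp in auto)
    then show ?thesis by (simp add: partial_deriv_eq)
  qed
  have "compact (partial_deriv i w ` cball 0 (r + 1))"
    by (intro compact_continuous_image compact_cball continuous_on_subset[OF c]) auto
  then obtain M where M: "\<And>x. x \<in> cball 0 (r + 1) \<Longrightarrow> \<bar>partial_deriv i w x\<bar> \<le> M"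
    by (metis bounded_iff compact_imp_bounded imageI real_norm_def)
  have Mall: "\<bar>partial_deriv i w x\<bar> \<le> max M 0" for x
    using M[of x] d0[of x] by (cases "norm x > r") auto
  have qb: "\<bar>q n x\<bar> \<le> max M 0 * indicator (cball 0 (r + 1)) x" for n x
  proof (cases "norm x \<le> r + 1")
    case True
    obtain z where "w (x + t n *\<^sub>R e) - w (x + 0 *\<^sub>R e) = (t n - 0) * partial_deriv i w (x + z *\<^sub>R e)"
      using MVT2[OF t(1)[of n], of "\<lambda>s. w (x + s *\<^sub>R e)" "\<lambda>s. partial_deriv i w (x + s *\<^sub>R e)"] line by blast
    then have "q n x = partial_deriv i w (x + z *\<^sub>R e)" using t(1)[of n] by (simp add: q_def)
    then show ?thesis using Mall True by simp
  next
    case False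
    have "norm (x + t n *\<^sub>R e) \<ge> norm x - norm (t n *\<^sub>R e)" by (rule norm_diff_ineq)
    then have "norm (x + t n *\<^sub>R e) > r" using False t[of n] ne by simp
    then show ?thesis using False supp by (simp add: q_def)
  qed
  have wm: "w \<in> borel_measurable borel" using wc by (rule borel_measurable_continuous_onI)
  have wi: "integrable lborel w"
  proof -
    have "set_integrable lborel (cball 0 r) w"
      unfolding set_integrable_def
      by (intro borel_integrable_compact continuous_on_subset[OF wc]) auto
    moreover have "(\<lambda>x. indicator (cball 0 r) x *\<^sub>R w x) = w"
      using supp by (auto simp: fun_eq_iff indicator_def not_le)
    ultimately show ?thesis by (simp add: set_integrable_def)
  qed
  have tr: "integrable lborel (\<lambda>x. w (x + v))" "(LINT x|lborel. w (x + v)) = (LINT x|lborel. w x)" for v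
  proof -
    have "integrable (distr lborel borel ((+) v)) w = integrable lborel (\<lambda>x. w (v + x))"
      by (intro integrable_distr_eq) (use wm in auto)
    then show "integrable lborel (\<lambda>x. w (x + v))"
      using wi by (simp add: lborel_distr_plus add.commute)
    have "(LINT x|distr lborel borel ((+) v). w x) = (LINT x|lborel. w (v + x))"
      by (intro integral_distr) (use wm in auto)
    then show "(LINT x|lborel. w (x + v)) = (LINT x|lborel. w x)"
      by (simp add: lborel_distr_plus add.commute)
  qed
  have "(LINT x|lborel. q n x) = 0" for n
    using tr wi by (simp add: q_def)
  moreover have "(\<lambda>n. LINT x|lborel. q n x) \<longlonglongrightarrow> (LINT x|lborel. partial_deriv i w x)"
  proof (rule integral_dominated_convergence[where w="\<lambda>x. max M 0 * indicator (cball 0 (r + 1)) x"])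
    show "partial_deriv i w \<in> borel_measurable lborel"
      using c by (simp add: borel_measurable_continuous_onI)
    show "q n \<in> borel_measurable lborel" for n
      unfolding q_def using tr(1) wi by (intro borel_measurable_integrable) auto
    show "integrable lborel (\<lambda>x. max M 0 * indicator (cball 0 (r + 1)) x :: real)"
      by (intro integrable_mult_right) (simp add: integrable_indicator_iff emeasure_lborel_cball_finite[unfolded infinity_ennreal_def])
    show "AE x in lborel. (\<lambda>n. q n x) \<longlonglongrightarrow> partial_deriv i w x"
    proof (rule AE_I2)
      fix x
      have "((\<lambda>h. (w (x + h *\<^sub>R e) - w x) / h) \<longlongrightarrow> partial_deriv i w x) (at 0)"
        using line[of x 0] by (simp add: DERIV_def)
      moreover have "filterlim t (at 0) sequentially"
        using t0 t by (auto simp: filterlim_at intro!: always_eventually) (metis less_irrefl)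
      ultimately show "(\<lambda>n. q n x) \<longlonglongrightarrow> partial_deriv i w x"
        unfolding q_def by (rule filterlim_compose)
    qed
    show "AE x in lborel. norm (q n x) \<le> max M 0 * indicator (cball 0 (r + 1)) x" for n
      using qb by auto
  qed
  ultimately show ?thesis by (simp add: LIMSEQ_const_iff)
qed

definition gradient :: "(real^'n::finite \<Rightarrow> real) \<Rightarrow> real^'n \<Rightarrow> real^'n" where
  "gradient f x = (\<chi> i. partial_deriv i f x)"

lemma set_integrable_compact_lebesgue:
  fixes f :: "'a::euclidean_space \<Rightarrow> 'b::euclidean_space"
  assumes "continuous_on UNIV f" "compact K"
  shows "set_integrable lebesgue K f"
proof -
  have "set_integrable lborel K f"
    unfolding set_integrable_def
    using assms by (intro borel_integrable_compact) (auto intro: continuous_on_subset)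
  then show ?thesis by (auto simp: set_integrable_def integrable_completion)
qed

text \<open>The product rule reduces the identity to the vanishing integral of a partial derivative
  of \<open>u x * \<phi> x\<close>, a function with compact support in the open set.\<close>

lemma weak_gradient_C1:
  fixes u :: "real^'n::finite \<Rightarrow> real"
  assumes u: "C_k 1 u" and "open \<Omega>"
  shows "weak_gradient \<Omega> u (gradient u)"
  unfolding weak_gradient_def
proof (intro conjI allI impI ballI)
  have d: "\<And>x. u differentiable at x" and c: "\<And>i. continuous_on UNIV (partial_deriv i u)"
    using u by auto
  have uc: "continuous_on UNIV u"
    using d by (auto simp: continuous_on_eq_continuous_at intro: differentiable_imp_continuous_within)
  have gc: "continuous_on UNIV (gradient u)"
    unfolding gradient_def[abs_def] using c by (intro continuous_on_vec_lambda)
  fix K :: "(real^'n) set" assume "compact K \<and> K \<subseteq> \<Omega>"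
  then show "set_integrable lebesgue K u" "set_integrable lebesgue K (gradient u)"
    using uc gc by (auto intro: set_integrable_compact_lebesgue)
next
  fix \<phi> i assume "\<phi> \<in> test_functions \<Omega>"
  then have \<phi>: "\<And>k. C_k k \<phi>" "compact (closure {x. \<phi> x \<noteq> 0})" "closure {x. \<phi> x \<noteq> 0} \<subseteq> \<Omega>"
    by (auto simp: test_functions_def)
  define K where "K = closure {x. \<phi> x \<noteq> 0}"
  have \<phi>0: "\<phi> x = 0" if "x \<notin> K" for x using that closure_subset[of "{x. \<phi> x \<noteq> 0}"] by (auto simp: K_def)
  have oK: "open (- K)" unfolding K_def by (intro open_Compl closed_closure)
  have d\<phi>0: "partial_deriv i \<phi> x = 0" if "x \<notin> K" for x
  proof -
    have "(\<phi> has_derivative (\<lambda>_. 0)) (at x)"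
      by (rule has_derivative_transform_within_open[of "\<lambda>_. 0" _ x UNIV "- K"])
         (use that \<phi>0 oK in auto)
    then show ?thesis by (simp add: partial_deriv_eq)
  qed
  have c: "C_k 1 (\<lambda>x. u x * \<phi> x)" using u \<phi>(1) by (intro C_k_mult)
  have d: "\<And>x. u differentiable at x" "\<And>x. \<phi> differentiable at x" and ci: "continuous_on UNIV (partial_deriv i u)"
      "continuous_on UNIV (partial_deriv i \<phi>)"
    using u \<phi>(1)[of 1] by auto
  have uc: "continuous_on UNIV u" "continuous_on UNIV \<phi>"
    using d by (auto simp: continuous_on_eq_continuous_at intro: differentiable_imp_continuous_within)
  have "bounded K" using \<phi>(2) by (simp add: K_def compact_imp_bounded)
  then obtain r where r: "\<And>x. x \<in> K \<Longrightarrow> norm x \<le> r" by (auto simp: bounded_iff)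
  have "(LINT x|lborel. partial_deriv i (\<lambda>x. u x * \<phi> x) x) = 0"
  proof (rule integral_partial_deriv_eq_0[where r=r])
    show "(\<lambda>x. u x * \<phi> x) differentiable at x" for x using d by (rule differentiable_mult)
    show "continuous_on UNIV (partial_deriv i (\<lambda>x. u x * \<phi> x))" using c by simp
    show "u x * \<phi> x = 0" if "norm x > r" for x using r[of x] \<phi>0[of x] that by force
  qed
  then have z: "(LINT x|lborel. u x * partial_deriv i \<phi> x + partial_deriv i u x * \<phi> x) = 0"
    by (simp add: partial_deriv_mult[OF d])
  have conv: "(LINT x|lebesgue_on \<Omega>. F x) = (LINT x|lborel. F x)" "integrable lborel F"
    if F: "continuous_on UNIV F" "\<And>x. x \<notin> K \<Longrightarrow> F x = 0" for F :: "real^'n \<Rightarrow> real"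
  proof -
    have F': "F \<in> borel_measurable borel" by (rule borel_measurable_continuous_onI[OF F(1)])
    have "(LINT x|lebesgue_on \<Omega>. F x) = (LINT x|lebesgue. indicator K x * F x)"
      by (rule integral_lebesgue_on_box[OF \<open>open \<Omega>\<close> \<phi>(3)[folded K_def] F(2)])
    also have e: "(\<lambda>x. indicator K x * F x) = F" using F(2) by (auto simp: fun_eq_iff indicator_def)
    also have "(LINT x|lebesgue. F x) = (LINT x|lborel. F x)"
      by (rule integral_completion) (use F' in simp)
    finally show "(LINT x|lebesgue_on \<Omega>. F x) = (LINT x|lborel. F x)" .
    have "set_integrable lborel K F"
      using F(1) \<phi>(2) unfolding K_def set_integrable_def by (intro borel_integrable_compact) (auto intro: continuous_on_subset)
    then show "integrable lborel F" by (simp add: set_integrable_def e)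
  qed
  have "(LINT x|lborel. u x * partial_deriv i \<phi> x) + (LINT x|lborel. partial_deriv i u x * \<phi> x) = 0"
    using z by (subst Bochner_Integration.integral_add[symmetric])
      (auto intro!: conv(2) continuous_intros uc ci simp: \<phi>0 d\<phi>0)
  moreover have "(LINT x|lebesgue_on \<Omega>. u x * partial_deriv i \<phi> x) = (LINT x|lborel. u x * partial_deriv i \<phi> x)"
    by (rule conv) (auto intro!: continuous_intros uc ci simp: \<phi>0 d\<phi>0)
  moreover have "(LINT x|lebesgue_on \<Omega>. gradient u x $ i * \<phi> x) = (LINT x|lborel. partial_deriv i u x * \<phi> x)"
    unfolding gradient_def vec_lambda_beta
    by (rule conv) (auto intro!: continuous_intros uc ci simp: \<phi>0 d\<phi>0)
  ultimately show "(LINT x|lebesgue_on \<Omega>. u x * partial_deriv i \<phi> x) = - (LINT x|lebesgue_on \<Omega>. gradient u x $ i * \<phi> x)"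
    by simp
qed

section \<open>Hausdorff measure\<close>

lemma hausdorff_outer_empty: "m > 0 \<Longrightarrow> hausdorff_outer m {} = 0"
  by (simp add: hausdorff_outer_def hausdorff_pre_empty)

lemma hausdorff_outer_mono: "A \<subseteq> B \<Longrightarrow> hausdorff_outer m A \<le> hausdorff_outer m B"
  unfolding hausdorff_outer_def by (auto intro!: SUP_mono' hausdorff_pre_mono)

lemma hausdorff_outer_UN: "hausdorff_outer m (\<Union>i. A i) \<le> (\<Sum>i. hausdorff_outer m (A i))"
  unfolding hausdorff_outer_def[of m "\<Union>i. A i"]
proof (rule SUP_least)
  fix \<delta> :: real assume "\<delta> \<in> {0<..}"
  then have "hausdorff_pre m \<delta> (A i) \<le> hausdorff_outer m (A i)" for i
    unfolding hausdorff_outer_def by (rule SUP_upper)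
  then have "(\<Sum>i. hausdorff_pre m \<delta> (A i)) \<le> (\<Sum>i. hausdorff_outer m (A i))"
    by (intro suminf_le) auto
  then show "hausdorff_pre m \<delta> (\<Union>i. A i) \<le> (\<Sum>i. hausdorff_outer m (A i))"
    by (rule order_trans[OF hausdorff_pre_countably_subadditive])
qed

lemma hausdorff_outer_Un:
  assumes "m > 0"
  shows "hausdorff_outer m (A \<union> B) \<le> hausdorff_outer m A + hausdorff_outer m B"
proof -
  have "A \<union> B = (\<Union>i. binaryset A B i)" by (simp add: UN_binaryset_eq)
  then have "hausdorff_outer m (A \<union> B) \<le> (\<Sum>i. hausdorff_outer m (binaryset A B i))"
    using hausdorff_outer_UN by metis
  also have "\<dots> = hausdorff_outer m A + hausdorff_outer m B"
    by (rule suminf_binaryset_eq) (simp add: hausdorff_outer_empty assms)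
  finally show ?thesis .
qed

lemma hausdorff_outer_finite_UN:
  assumes "m > 0" "finite I"
  shows "hausdorff_outer m (\<Union>i\<in>I. A i) \<le> (\<Sum>i\<in>I. hausdorff_outer m (A i))"
  using assms(2)
  by (induction I rule: finite_induct)
     (auto simp: hausdorff_outer_empty assms(1) intro: order_trans[OF hausdorff_outer_Un[OF assms(1)]] add_left_mono)

lemma hausdorff_pre_antimono:
  assumes "\<delta> \<le> \<epsilon>" shows "hausdorff_pre m \<epsilon> A \<le> hausdorff_pre m \<delta> A"
  unfolding hausdorff_pre_def by (rule INF_superset_mono) (use assms in \<open>auto intro: order_trans\<close>)

text \<open>A covering set of diameter at most \<open>\<delta>\<close> cannot meet both A and B, so
  a cover of the union splits in two. Discarded members become empty and have weight 0 because m is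
  positive.\<close>

lemma hausdorff_pre_separated:
  assumes "m > 0" and sep: "\<And>x y. x \<in> A \<Longrightarrow> y \<in> B \<Longrightarrow> dist x y > \<delta>"
  shows "hausdorff_pre m \<delta> A + hausdorff_pre m \<delta> B \<le> hausdorff_pre m \<delta> (A \<union> B)"
  unfolding hausdorff_pre_def[of m \<delta> "A \<union> B"]
proof (rule INF_greatest)
  fix E :: "nat \<Rightarrow> 'a set"
  assume "E \<in> {E. A \<union> B \<subseteq> (\<Union>i. E i) \<and> (\<forall>i. bounded (E i) \<and> diameter (E i) \<le> \<delta>)}"
  then have E: "A \<union> B \<subseteq> (\<Union>i. E i)" "\<And>i. bounded (E i)" "\<And>i. diameter (E i) \<le> \<delta>" by auto
  define w where "w X = ennreal (unit_ball_vol (real m) * (diameter X / 2) ^ m)" for X :: "'a set"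
  have w0: "w {} = 0" using assms(1) by (simp add: w_def power_0_left)
  have \<delta>: "\<delta> \<ge> 0" using E(3)[of 0] diameter_ge_0[OF E(2)[of 0]] by linarith
  define F where "F i = (if E i \<inter> A \<noteq> {} then E i else {})" for i
  define G where "G i = (if E i \<inter> B \<noteq> {} then E i else {})" for i
  have "hausdorff_pre m \<delta> A \<le> (\<Sum>i. w (F i))"
    unfolding hausdorff_pre_def w_def
    by (rule INF_lower) (use E \<delta> in \<open>fastforce simp: F_def\<close>)
  moreover have "hausdorff_pre m \<delta> B \<le> (\<Sum>i. w (G i))"
    unfolding hausdorff_pre_def w_def
    by (rule INF_lower) (use E \<delta> in \<open>fastforce simp: G_def\<close>)
  moreover have "w (F i) + w (G i) \<le> w (E i)" for i
  proof (cases "E i \<inter> A \<noteq> {} \<and> E i \<inter> B \<noteq> {}")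
    case True
    then obtain x y where "x \<in> E i" "x \<in> A" "y \<in> E i" "y \<in> B" by auto
    then have "dist x y \<le> \<delta>" "dist x y > \<delta>"
      using diameter_bounded_bound[OF E(2)[of i], of x y] E(3)[of i] sep by auto
    then show ?thesis by simp
  qed (auto simp: F_def G_def w0)
  ultimately have "hausdorff_pre m \<delta> A + hausdorff_pre m \<delta> B \<le> (\<Sum>i. w (F i)) + (\<Sum>i. w (G i))"
    by (intro add_mono)
  also have "\<dots> = (\<Sum>i. w (F i) + w (G i))" by (subst suminf_add) auto
  also have "\<dots> \<le> (\<Sum>i. w (E i))"
    by (intro suminf_le) (auto simp: \<open>\<And>i. w (F i) + w (G i) \<le> w (E i)\<close>)
  finally show "hausdorff_pre m \<delta> A + hausdorff_pre m \<delta> B \<le>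
     (\<Sum>i. ennreal (unit_ball_vol (real m) * (diameter (E i) / 2) ^ m))"
    by (simp add: w_def)
qed

text \<open>Below the separation e the premeasures are superadditive, and they increase as
  \<open>\<delta>\<close> decreases, so the suprema add.\<close>

lemma hausdorff_outer_separated:
  assumes "m > 0" "e > 0" and sep: "\<And>x y. x \<in> A \<Longrightarrow> y \<in> B \<Longrightarrow> dist x y \<ge> e"
  shows "hausdorff_outer m (A \<union> B) = hausdorff_outer m A + hausdorff_outer m B"
proof (rule antisym[OF hausdorff_outer_Un[OF assms(1)]])
  have "hausdorff_outer m A + hausdorff_outer m B =
      (SUP \<delta>\<in>{0<..}. hausdorff_pre m \<delta> A + hausdorff_pre m \<delta> B)"
    unfolding hausdorff_outer_def
  proof (rule SUP_add_directed_ennreal[symmetric])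
    fix i j :: real assume "i \<in> {0<..}" "j \<in> {0<..}"
    then show "\<exists>k\<in>{0<..}. hausdorff_pre m i A + hausdorff_pre m j B \<le> hausdorff_pre m k A + hausdorff_pre m k B"
      by (intro bexI[of _ "min i j"] add_mono hausdorff_pre_antimono) auto
  qed
  also have "\<dots> \<le> hausdorff_outer m (A \<union> B)"
  proof (rule SUP_least)
    fix \<delta> :: real assume \<delta>: "\<delta> \<in> {0<..}"
    define d where "d = min \<delta> (e / 2)"
    have d: "d > 0" "d \<le> \<delta>" "d < e" using \<delta> assms(2) by (auto simp: d_def)
    have "hausdorff_pre m \<delta> A + hausdorff_pre m \<delta> B \<le> hausdorff_pre m d A + hausdorff_pre m d B"
      using d by (intro add_mono hausdorff_pre_antimono)
    also have "\<dots> \<le> hausdorff_pre m d (A \<union> B)"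
      using d sep by (intro hausdorff_pre_separated assms(1)) fastforce
    also have "\<dots> \<le> hausdorff_outer m (A \<union> B)"
      unfolding hausdorff_outer_def using d by (intro SUP_upper) auto
    finally show "hausdorff_pre m \<delta> A + hausdorff_pre m \<delta> B \<le> hausdorff_outer m (A \<union> B)" .
  qed
  finally show "hausdorff_outer m A + hausdorff_outer m B \<le> hausdorff_outer m (A \<union> B)" .
qed

text \<open>Shells whose indices have the same parity have another shell between them; as f is
  1-Lipschitz they are at positive distance, and their outer measures add. The offset p selects the
  parity.\<close>

lemma hausdorff_outer_shells:
  fixes f :: "'a::metric_space \<Rightarrow> real" and m :: nat
  assumes "m > 0" and lip: "\<And>x y. \<bar>f x - f y\<bar> \<le> dist x y"
    and D: "\<And>k x. x \<in> D k \<Longrightarrow> 1 / real (Suc (Suc (Suc k))) \<le> f x \<and> f x < 1 / real (Suc (Suc k))"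
  shows "(\<Sum>k<n. hausdorff_outer m (D (2 * k + p))) \<le> hausdorff_outer m (\<Union>k. D k)"
proof -
  have "(\<Sum>k<n. hausdorff_outer m (D (2 * k + p))) \<le> hausdorff_outer m (\<Union>k<n. D (2 * k + p))"
  proof (induction n)
    case (Suc n)
    have "(\<Union>k<Suc n. D (2 * k + p)) = (\<Union>k<n. D (2 * k + p)) \<union> D (2 * n + p)"
      by (auto simp: lessThan_Suc)
    moreover have "hausdorff_outer m ((\<Union>k<n. D (2 * k + p)) \<union> D (2 * n + p)) =
       hausdorff_outer m (\<Union>k<n. D (2 * k + p)) + hausdorff_outer m (D (2 * n + p))"
    proof (rule hausdorff_outer_separated[OF assms(1)])
      let ?N = "real (2 * n + p)"
      \<comment> \<open>An earlier shell of the same parity has index at most \<open>?N - 2\<close>,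
        so f is at least 1/(\<open>?N\<close> + 1) there, whereas f is below 1/(\<open>?N\<close> +
        2) on the shell \<open>?N\<close>.\<close>
      show "1 / (?N + 1) - 1 / (?N + 2) > 0" by (simp add: frac_less2)
      fix x y assume "x \<in> (\<Union>k<n. D (2 * k + p))" and y: "y \<in> D (2 * n + p)"
      then obtain k where k: "k < n" "x \<in> D (2 * k + p)" by auto
      have "1 / (?N + 1) \<le> 1 / (real (2 * k + p) + 3)"
        using k by (intro divide_left_mono) auto
      also have "\<dots> \<le> f x" using D[OF k(2)] by (simp add: add.commute)
      finally have "1 / (?N + 1) \<le> f x" .
      moreover have "f y \<le> 1 / (?N + 2)" using D[OF y] by (simp add: add.commute)
      ultimately show "1 / (?N + 1) - 1 / (?N + 2) \<le> dist x y"
        using lip[of x y] by linarith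
    qed
    ultimately show ?case using Suc by (simp add: add_right_mono)
  qed (simp add: hausdorff_outer_empty assms)
  also have "\<dots> \<le> hausdorff_outer m (\<Union>k. D k)" by (rule hausdorff_outer_mono) auto
  finally show ?thesis .
qed

text \<open>Caratheodory's criterion for metric outer measures. The part \<open>A n\<close> of T at
  distance at least 1/(n + 2) from C is separated from C; what it leaves of T outside C is covered
  by the shells from index n on, whose measures are summable, so the error tends to 0.\<close>

lemma closed_in_lambda_system_hausdorff:
  fixes C :: "'a::metric_space set"
  assumes "m > 0" "closed C"
  shows "C \<in> lambda_system UNIV UNIV (hausdorff_outer m)"
proof (cases "C = {}")
  case True
  then show ?thesis using assms by (simp add: lambda_system_def hausdorff_outer_empty)
next
  case False
  define \<mu> where "\<mu> = (hausdorff_outer m :: 'a set \<Rightarrow> ennreal)"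
  define f where "f x = infdist x C" for x
  have lip: "\<bar>f x - f y\<bar> \<le> dist x y" for x y
    using infdist_triangle_abs[of x C y] by (simp add: f_def)
  have "\<mu> (C \<inter> T) + \<mu> ((UNIV - C) \<inter> T) = \<mu> T" for T
  proof (cases "\<mu> T = \<infinity>")
    case True
    have "\<mu> T \<le> \<mu> (C \<inter> T) + \<mu> ((UNIV - C) \<inter> T)"
      using hausdorff_outer_Un[OF assms(1), of "C \<inter> T" "(UNIV - C) \<inter> T"]
      by (auto simp: \<mu>_def Un_Diff_Int Int_Un_distrib2[symmetric])
    then show ?thesis using True by (simp add: top_unique)
  next
    case fin: False
    define A where "A n = {x \<in> T. f x \<ge> 1 / real (Suc (Suc n))}" for n
    define D where "D k = {x \<in> T. 1 / real (Suc (Suc (Suc k))) \<le> f x \<and> f x < 1 / real (Suc (Suc k))}" for k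
    have Dle: "\<mu> (D k) \<le> \<mu> T" for k unfolding \<mu>_def by (rule hausdorff_outer_mono) (auto simp: D_def)
    define d where "d k = enn2real (\<mu> (D k))" for k
    have dk: "ennreal (d k) = \<mu> (D k)" for k
      using Dle[of k] fin by (simp add: d_def less_top le_less_trans)
    define t where "t = enn2real (\<mu> T)"
    have t: "ennreal t = \<mu> T" using fin by (simp add: t_def less_top)
    \<comment> \<open>Even and odd shells are each additive, so all partial sums stay below twice
      the measure of T.\<close>
    have half: "(\<Sum>k<n. d (2 * k + p)) \<le> t" for n p
    proof -
      have "(\<Sum>k<n. \<mu> (D (2 * k + p))) \<le> \<mu> (\<Union>k. D k)"
        unfolding \<mu>_def by (rule hausdorff_outer_shells[OF assms(1) lip]) (auto simp: D_def)
      also have "\<dots> \<le> \<mu> T" unfolding \<mu>_def by (rule hausdorff_outer_mono) (auto simp: D_def)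
      finally have "(\<Sum>k<n. ennreal (d (2 * k + p))) \<le> ennreal t" by (simp add: dk t)
      then show ?thesis by (simp add: d_def t_def sum_ennreal)
    qed
    have "(\<Sum>k<2 * n. d k) = (\<Sum>k<n. d (2 * k)) + (\<Sum>k<n. d (2 * k + 1))" for n
      by (induction n) auto
    then have two: "(\<Sum>k<2 * n. d k) \<le> 2 * t" for n
      using half[where p=0, of n] half[where p=1, of n] by simp
    have "(\<Sum>k<n. d k) \<le> 2 * t" for n
      by (rule order_trans[OF sum_mono2 two[of n]]) (auto simp: d_def)
    then have sum: "summable d"
      by (intro summableI_nonneg_bounded[where x="2 * t"]) (auto simp: d_def)
    have key: "\<mu> (C \<inter> T) + \<mu> ((UNIV - C) \<inter> T) \<le> \<mu> T + ennreal (\<Sum>k. d (k + n))" for n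
    proof -
      have "(UNIV - C) \<inter> T \<subseteq> A n \<union> (\<Union>k. D (k + n))"
      proof
        fix x assume x: "x \<in> (UNIV - C) \<inter> T"
        then have fx: "f x > 0"
          unfolding f_def using in_closed_iff_infdist_zero[OF assms(2) False] infdist_nonneg[of x C] by (simp add: less_le)
        then obtain M where M: "1 / real (Suc M) < f x" by (metis nat_approx_posE)
        show "x \<in> A n \<union> (\<Union>k. D (k + n))"
        proof (cases "x \<in> A n")
          case xA: False
          \<comment> \<open>The index of the shell containing x; minimality yields the upper bound
            on \<open>f x\<close>.\<close>
          define k where "k = (LEAST k. 1 / real (Suc (Suc (Suc k))) \<le> f x)"
          have ex: "1 / real (Suc (Suc (Suc M))) \<le> f x"
            by (rule order_trans[OF _ less_imp_le[OF M]]) (auto intro!: divide_left_mono)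
          have k: "1 / real (Suc (Suc (Suc k))) \<le> f x"
            unfolding k_def by (rule LeastI) (rule ex)
          have "n \<le> k"
          proof (rule ccontr)
            assume "\<not> n \<le> k"
            then have "1 / real (Suc (Suc n)) \<le> 1 / real (Suc (Suc (Suc k)))" by (intro divide_left_mono) auto
            then show False using xA x k by (auto simp: A_def)
          qed
          have "f x < 1 / real (Suc (Suc k))"
          proof (cases k)
            case 0 then show ?thesis using \<open>n \<le> k\<close> xA x by (auto simp: A_def)
          next
            case (Suc k')
            then have "\<not> 1 / real (Suc (Suc (Suc k'))) \<le> f x"
              using not_less_Least[of k' "\<lambda>k. 1 / real (Suc (Suc (Suc k))) \<le> f x"] unfolding k_def by simp
            then show ?thesis unfolding Suc by simp
          qed
          then have "x \<in> D ((k - n) + n)" using k x \<open>n \<le> k\<close> by (auto simp: D_def)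
          then show ?thesis by blast
        qed auto
      qed
      then have "\<mu> ((UNIV - C) \<inter> T) \<le> \<mu> (A n \<union> (\<Union>k. D (k + n)))"
        unfolding \<mu>_def by (rule hausdorff_outer_mono)
      also have "\<dots> \<le> \<mu> (A n) + \<mu> (\<Union>k. D (k + n))"
        unfolding \<mu>_def by (rule hausdorff_outer_Un[OF assms(1)])
      also have "\<mu> (\<Union>k. D (k + n)) \<le> (\<Sum>k. \<mu> (D (k + n)))"
        unfolding \<mu>_def by (rule hausdorff_outer_UN)
      also have "(\<Sum>k. \<mu> (D (k + n))) = ennreal (\<Sum>k. d (k + n))"
        using summable_ignore_initial_segment[OF sum, of n]
        by (subst dk[symmetric], intro suminf_ennreal2) (auto simp: d_def)
      finally have 1: "\<mu> ((UNIV - C) \<inter> T) \<le> \<mu> (A n) + ennreal (\<Sum>k. d (k + n))"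
        by (simp add: add_left_mono)
      have "\<mu> (C \<inter> T) + \<mu> (A n) = \<mu> ((C \<inter> T) \<union> A n)"
        unfolding \<mu>_def
      proof (rule hausdorff_outer_separated[OF assms(1), symmetric])
        fix x y assume "x \<in> C \<inter> T" "y \<in> A n"
        then have "f x = 0" "f y \<ge> 1 / real (Suc (Suc n))" by (auto simp: f_def A_def)
        then show "1 / real (Suc (Suc n)) \<le> dist x y" using lip[of x y] by linarith
      qed auto
      also have "\<dots> \<le> \<mu> T" unfolding \<mu>_def by (rule hausdorff_outer_mono) (auto simp: A_def)
      finally have 2: "\<mu> (C \<inter> T) + \<mu> (A n) \<le> \<mu> T" .
      have "\<mu> (C \<inter> T) + \<mu> ((UNIV - C) \<inter> T) \<le> (\<mu> (C \<inter> T) + \<mu> (A n)) + ennreal (\<Sum>k. d (k + n))"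
        using add_left_mono[OF 1, of "\<mu> (C \<inter> T)"] by (simp add: add.assoc)
      also have "\<dots> \<le> \<mu> T + ennreal (\<Sum>k. d (k + n))" by (rule add_right_mono[OF 2])
      finally show ?thesis .
    qed
    have "\<mu> (C \<inter> T) + \<mu> ((UNIV - C) \<inter> T) \<le> \<mu> T"
    proof (rule ennreal_le_epsilon)
      fix e :: real assume "e > 0"
      then obtain n where "\<And>n'. n' \<ge> n \<Longrightarrow> norm (\<Sum>k. d (k + n')) < e"
        using suminf_exist_split[OF \<open>e > 0\<close> sum] by blast
      from this[of n] have "(\<Sum>k. d (k + n)) \<le> e" by simp
      then show "\<mu> (C \<inter> T) + \<mu> ((UNIV - C) \<inter> T) \<le> \<mu> T + ennreal e"
        using key[of n] by (meson add_left_mono ennreal_leI order_trans)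
    qed
    moreover have "\<mu> T \<le> \<mu> (C \<inter> T) + \<mu> ((UNIV - C) \<inter> T)"
      using hausdorff_outer_Un[OF assms(1), of "C \<inter> T" "(UNIV - C) \<inter> T"]
      by (auto simp: \<mu>_def Un_Diff_Int Int_Un_distrib2[symmetric])
    ultimately show ?thesis by (rule antisym)
  qed
  then show ?thesis by (simp add: lambda_system_def \<mu>_def)
qed

lemma borel_sets_hausdorff:
  assumes "m > 0" "A \<in> sets borel"
  shows "A \<in> sets (hausdorff_measure m)"
proof -
  have "closed C \<Longrightarrow> C \<in> sets (hausdorff_measure m)" for C :: "'a set"
    using closed_in_lambda_system_hausdorff[OF assms(1)] by (simp add: sets_hausdorff_measure assms(1))
  then have "sigma_sets UNIV {C. closed C} \<subseteq> sets (hausdorff_measure m :: 'a measure)"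
    using sets.sigma_sets_subset[of "{C. closed C}" "hausdorff_measure m :: 'a measure"] by auto
  then show ?thesis using assms(2) by (auto simp: borel_eq_closed)
qed

lemma emeasure_hausdorff_borel:
  "m > 0 \<Longrightarrow> A \<in> sets borel \<Longrightarrow> emeasure (hausdorff_measure m) A = hausdorff_outer m A"
  by (intro emeasure_hausdorff_measure borel_sets_hausdorff)

lemma borel_measurable_hausdorff:
  "m > 0 \<Longrightarrow> f \<in> borel_measurable borel \<Longrightarrow> f \<in> borel_measurable (hausdorff_measure m)"
  by (auto simp: measurable_def borel_sets_hausdorff)


subsection \<open>Plane rectangles\<close>

lemma hausdorff_pre_finite_cover:
  fixes E :: "'b \<Rightarrow> 'a::metric_space set"
  assumes "m > 0" "\<delta> \<ge> 0" "finite I" "A \<subseteq> (\<Union>i\<in>I. E i)" "\<And>i. i \<in> I \<Longrightarrow> bounded (E i)"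
    "\<And>i. i \<in> I \<Longrightarrow> diameter (E i) \<le> \<delta>"
  shows "hausdorff_pre m \<delta> A \<le> (\<Sum>i\<in>I. ennreal (unit_ball_vol (real m) * (diameter (E i) / 2) ^ m))"
proof -
  obtain h where h: "bij_betw h {0..<card I} I" using ex_bij_betw_nat_finite[OF assms(3)] by blast
  define w where "w X = ennreal (unit_ball_vol (real m) * (diameter X / 2) ^ m)" for X :: "'a set"
  have w0: "w {} = 0" using assms(1) by (simp add: w_def power_0_left)
  define F where "F n = (if n < card I then E (h n) else {})" for n
  have hI: "h n \<in> I" if "n < card I" for n using bij_betwE[OF h] that by simp
  have "A \<subseteq> (\<Union>n. F n)"
  proof
    fix x assume "x \<in> A"
    then obtain i where i: "i \<in> I" "x \<in> E i" using assms(4) by blast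
    then obtain n where "n < card I" "i = h n" using bij_betw_imp_surj_on[OF h] by fastforce
    then show "x \<in> (\<Union>n. F n)" using i by (auto simp: F_def)
  qed
  then have "hausdorff_pre m \<delta> A \<le> (\<Sum>n. w (F n))"
    unfolding hausdorff_pre_def w_def
    by (intro INF_lower) (use assms hI in \<open>auto simp: F_def\<close>)
  also have "\<dots> = (\<Sum>n\<in>{0..<card I}. w (F n))"
    by (rule suminf_finite) (auto simp: F_def w0)
  also have "\<dots> = (\<Sum>n\<in>{0..<card I}. w (E (h n)))" by (intro sum.cong) (auto simp: F_def)
  also have "\<dots> = (\<Sum>i\<in>I. w (E i))" by (rule sum.reindex_bij_betw[OF h])
  finally show ?thesis by (simp add: w_def)
qed

text \<open>Squares of side s have weight \<pi>/4 times 2 s^2, so a grid of them gives about \<pi>/2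
  times the area. The constant 2 is larger than \<pi>/2, and the slack absorbs the overhang of the
  grid at the edges.\<close>

lemma hausdorff_outer_rectangle:
  fixes i j k :: 3 and w h :: real
  assumes ijk: "UNIV = {i, j, k}" and w: "w > 0" and h: "h > 0"
    and S: "\<And>p::real^3. p \<in> S \<Longrightarrow> p $ i = c \<and> b \<le> p $ j \<and> p $ j \<le> b + w \<and> b' \<le> p $ k \<and> p $ k \<le> b' + h"
  shows "hausdorff_outer 2 S \<le> ennreal (2 * w * h)"
  unfolding hausdorff_outer_def
proof (rule SUP_least)
  fix \<delta> :: real assume "\<delta> \<in> {0<..}"
  then have \<delta>: "\<delta> > 0" by simp
  have "((\<lambda>s. pi / 2 * ((w + s) * (h + s))) \<longlongrightarrow> pi / 2 * ((w + 0) * (h + 0))) (at_right 0)"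
    by (intro tendsto_intros)
  moreover have "pi / 2 * ((w + 0) * (h + 0)) < 2 * w * h"
    using w h pi_less_4 by simp
  ultimately have "\<forall>\<^sub>F s in at_right 0. pi / 2 * ((w + s) * (h + s)) < 2 * w * h"
    by (rule order_tendstoD)
  moreover have "\<forall>\<^sub>F s in at_right 0. s * sqrt 2 \<le> \<delta> \<and> s > (0::real)"
    using \<delta> by (intro eventually_at_rightI[of 0 "\<delta> / sqrt 2"]) (auto simp: field_simps)
  ultimately have "\<forall>\<^sub>F s in at_right 0. pi / 2 * ((w + s) * (h + s)) < 2 * w * h \<and> s * sqrt 2 \<le> \<delta> \<and> s > 0"
    by eventually_elim auto
  then obtain s where s: "pi / 2 * ((w + s) * (h + s)) < 2 * w * h" "s * sqrt 2 \<le> \<delta>" "s > 0"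
    by (metis (no_types, lifting) eventually_happens trivial_limit_at_right_real)
  define M where "M = nat \<lceil>w / s\<rceil>"
  define N where "N = nat \<lceil>h / s\<rceil>"
  have M: "w \<le> real M * s" "real M * s \<le> w + s"
  proof -
    have "w / s \<le> real M" "real M \<le> w / s + 1" using w s by (auto simp: M_def)
    then show "w \<le> real M * s" "real M * s \<le> w + s" using s by (auto simp: field_simps)
  qed
  have N: "h \<le> real N * s" "real N * s \<le> h + s"
  proof -
    have "h / s \<le> real N" "real N \<le> h / s + 1" using h s by (auto simp: N_def)
    then show "h \<le> real N * s" "real N * s \<le> h + s" using s by (auto simp: field_simps)
  qed
  define E where "E = (\<lambda>(m, n). {p::real^3. p $ i = c \<and> b + real m * s \<le> p $ j \<and> p $ j \<le> b + (real m + 1) * s \<and>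
       b' + real n * s \<le> p $ k \<and> p $ k \<le> b' + (real n + 1) * s})"
  define I where "I = {..<M} \<times> {..<N}"
  \<comment> \<open>The right end of the grid lies in the last closed cell, which the floor would
    miss; it is the second case.\<close>
  have cell: "\<exists>m<K. z + real m * s \<le> y \<and> y \<le> z + (real m + 1) * s" if "z \<le> y" "y \<le> z + v" "v \<le> real K * s" "v > 0" for z y v K
  proof (cases "y < z + real K * s")
    case True
    define m where "m = nat \<lfloor>(y - z) / s\<rfloor>"
    have m: "real m \<le> (y - z) / s" "(y - z) / s < real m + 1"
      using that s by (auto simp: m_def)
    then have "real m * s \<le> y - z" "y - z < (real m + 1) * s" using s by (auto simp: field_simps)
    moreover have "real m * s < real K * s" using calculation True by linarith
    then have "m < K" using s by simp
    ultimately show ?thesis by (intro exI[of _ m]) auto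
  next
    case False
    then have "y = z + real K * s" "K > 0" using that by (auto intro: Nat.gr0I)
    then show ?thesis using s by (intro exI[of _ "K - 1"]) (auto simp: field_simps of_nat_diff)
  qed
  have cov: "S \<subseteq> (\<Union>x\<in>I. E x)"
  proof
    fix p assume "p \<in> S"
    note p = S[OF this]
    obtain m where "m < M" "b + real m * s \<le> p $ j \<and> p $ j \<le> b + (real m + 1) * s"
      using cell[of b "p $ j" w M] p M w by blast
    moreover obtain n where "n < N" "b' + real n * s \<le> p $ k \<and> p $ k \<le> b' + (real n + 1) * s"
      using cell[of b' "p $ k" h N] p N h by blast
    ultimately show "p \<in> (\<Union>x\<in>I. E x)" using p by (auto simp: I_def E_def)
  qed
  have dist: "norm (p - q) \<le> s * sqrt 2" if "p \<in> E x" "q \<in> E x" for p q x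
  proof -
    have 1: "\<bar>p $ i - q $ i\<bar> = 0" "\<bar>p $ j - q $ j\<bar> \<le> s" "\<bar>p $ k - q $ k\<bar> \<le> s"
      using that by (auto simp: E_def abs_le_iff algebra_simps split: prod.splits)
    have "(norm (p - q))\<^sup>2 = (\<Sum>l\<in>UNIV. (p $ l - q $ l)\<^sup>2)"
      by (simp add: norm_vec_def L2_set_def sum_nonneg)
    also have "\<dots> \<le> (p $ i - q $ i)\<^sup>2 + (p $ j - q $ j)\<^sup>2 + (p $ k - q $ k)\<^sup>2"
      unfolding ijk by (auto simp: sum.insert_if)
    also have "\<dots> \<le> 0 + s\<^sup>2 + s\<^sup>2"
      using 1 power_mono[OF 1(2), of 2] power_mono[OF 1(3), of 2] by (intro add_mono) auto
    also have "\<dots> = (s * sqrt 2)\<^sup>2" by (simp add: power_mult_distrib)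
    finally show ?thesis using s by (intro power2_le_imp_le[of "norm (p - q)"]) auto
  qed
  have bd: "bounded (E x)" for x
  proof (cases "E x = {}")
    case False
    then obtain q where "q \<in> E x" by blast
    have "E x \<subseteq> cball q (s * sqrt 2)"
      using dist[OF \<open>q \<in> E x\<close>] by (auto simp: dist_norm)
    then show ?thesis by (rule bounded_subset[OF bounded_cball])
  qed simp
  have dE: "diameter (E x) \<le> s * sqrt 2" for x
    by (rule diameter_le) (use s dist in auto)
  have "hausdorff_pre 2 \<delta> S \<le> (\<Sum>x\<in>I. ennreal (unit_ball_vol (real 2) * (diameter (E x) / 2) ^ 2))"
    using \<delta> cov bd order_trans[OF dE s(2)] by (intro hausdorff_pre_finite_cover) (auto simp: I_def)
  also have "\<dots> \<le> (\<Sum>x\<in>I. ennreal (pi / 2 * s\<^sup>2))"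
  proof (intro sum_mono ennreal_leI)
    fix x
    have "(diameter (E x) / 2)\<^sup>2 \<le> (s * sqrt 2 / 2)\<^sup>2"
      using dE[of x] diameter_ge_0[OF bd[of x]] by (intro power_mono) auto
    also have "\<dots> = s\<^sup>2 / 2" by (simp add: power_mult_distrib power_divide)
    finally show "unit_ball_vol (real 2) * (diameter (E x) / 2) ^ 2 \<le> pi / 2 * s\<^sup>2"
      by (simp add: unit_ball_vol_2 field_simps)
  qed
  also have "\<dots> = ennreal (real (M * N) * (pi / 2 * s\<^sup>2))"
    by (subst sum_ennreal) (auto simp: I_def)
  also have "\<dots> \<le> ennreal (2 * w * h)"
  proof (rule ennreal_leI)
    have "real (M * N) * (pi / 2 * s\<^sup>2) = pi / 2 * ((real M * s) * (real N * s))"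
      by (simp add: power2_eq_square)
    also have "\<dots> \<le> pi / 2 * ((w + s) * (h + s))"
      using M N w h s by (intro mult_left_mono mult_mono) auto
    finally show "real (M * N) * (pi / 2 * s\<^sup>2) \<le> 2 * w * h" using s(1) by linarith
  qed
  finally show "hausdorff_pre 2 \<delta> S \<le> ennreal (2 * w * h)" .
qed


section \<open>Coordinate cells in three-dimensional space\<close>

lemma UNIV_3_distinct:
  assumes "(UNIV :: 3 set) = {i, j, k}"
  shows "i \<noteq> j" "i \<noteq> k" "j \<noteq> k"
proof -
  have "card (UNIV :: 3 set) = 3" by simp
  then have "card {i, j, k} = 3" unfolding assms .
  then show "i \<noteq> j" "i \<noteq> k" "j \<noteq> k" by (auto simp: card_insert_if split: if_splits)
qed

text \<open>The coordinates i, j, k may come in any order, so the same set can be presented with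
  whichever direction is wanted first; averages are later compared along the first one.\<close>

definition cell :: "3 \<Rightarrow> 3 \<Rightarrow> 3 \<Rightarrow> real \<Rightarrow> real \<Rightarrow> real \<Rightarrow> real \<Rightarrow> real \<Rightarrow> real \<Rightarrow> (real^3) set" where
  "cell i j k x x' y y' z z' = {p. x < p $ i \<and> p $ i < x' \<and> y < p $ j \<and> p $ j < y' \<and> z < p $ k \<and> p $ k < z'}"

definition vec3 :: "3 \<Rightarrow> 3 \<Rightarrow> real \<Rightarrow> real \<Rightarrow> real \<Rightarrow> real^3" where
  "vec3 i j x y z = (\<chi> l. if l = i then x else if l = j then y else z)"

lemma vec3_nth:
  assumes "(UNIV :: 3 set) = {i, j, k}"
  shows "vec3 i j x y z $ i = x" "vec3 i j x y z $ j = y" "vec3 i j x y z $ k = z"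
  using UNIV_3_distinct[OF assms] by (auto simp: vec3_def)

lemma all_3:
  assumes "(UNIV :: 3 set) = {i, j, k}"
  shows "(\<forall>l. P l) \<longleftrightarrow> P i \<and> P j \<and> P k"
  using assms by (metis UNIV_I empty_iff insert_iff)

lemma sum_3':
  assumes "(UNIV :: 3 set) = {i, j, k}"
  shows "(\<Sum>l\<in>UNIV. f l) = f i + f j + (f k :: 'a::comm_monoid_add)"
  using UNIV_3_distinct[OF assms] unfolding assms by (simp add: add.assoc)

lemma prod_3':
  assumes "(UNIV :: 3 set) = {i, j, k}"
  shows "(\<Prod>l\<in>UNIV. f l) = f i * f j * (f k :: 'a::comm_monoid_mult)"
  using UNIV_3_distinct[OF assms] unfolding assms by (simp add: mult.assoc)

lemma cell_eq_box:
  assumes "(UNIV :: 3 set) = {i, j, k}"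
  shows "cell i j k x x' y y' z z' = box (vec3 i j x y z) (vec3 i j x' y' z')"
  by (auto simp: cell_def mem_box_cart all_3[OF assms] vec3_nth[OF assms])

lemma mem_cbox_vec3:
  assumes "(UNIV :: 3 set) = {i, j, k}"
  shows "p \<in> cbox (vec3 i j x y z) (vec3 i j x' y' z') \<longleftrightarrow>
    x \<le> p $ i \<and> p $ i \<le> x' \<and> y \<le> p $ j \<and> p $ j \<le> y' \<and> z \<le> p $ k \<and> p $ k \<le> z'"
  by (auto simp: mem_box_cart all_3[OF assms] vec3_nth[OF assms])

lemma measure_cbox_vec3:
  assumes "(UNIV :: 3 set) = {i, j, k}" "x \<le> x'" "y \<le> y'" "z \<le> z'"
  shows "measure lborel (cbox (vec3 i j x y z) (vec3 i j x' y' z')) = (x' - x) * (y' - y) * (z' - z)"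
proof -
  have "cbox (vec3 i j x y z) (vec3 i j x' y' z') \<noteq> {}"
    using assms(2-) by (auto simp: interval_ne_empty_cart all_3[OF assms(1)] vec3_nth[OF assms(1)])
  then show ?thesis
    by (subst content_cbox_cart) (auto simp: prod_3'[OF assms(1)] vec3_nth[OF assms(1)])
qed

lemma measure_cell:
  assumes "(UNIV :: 3 set) = {i, j, k}" "x \<le> x'" "y \<le> y'" "z \<le> z'"
  shows "measure lebesgue (cell i j k x x' y y' z z') = (x' - x) * (y' - y) * (z' - z)"
  unfolding cell_eq_box[OF assms(1)]
  using measure_cbox_vec3[OF assms] by (simp add: measure_completion measure_lborel_box_eq measure_lborel_cbox_eq)

lemma cell_lmeasurable:
  assumes "(UNIV :: 3 set) = {i, j, k}"
  shows "cell i j k x x' y y' z z' \<in> lmeasurable"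
  unfolding cell_eq_box[OF assms] by (rule lmeasurable_box)

text \<open>Thickening by a unit interval in the third coordinate replaces planar by spatial Lebesgue measure.\<close>

lemma emeasure_le_hausdorff_outer:
  fixes T S :: "(real^3) set"
  assumes T: "\<And>p. p \<in> T \<Longrightarrow> 0 \<le> p $ 3 \<and> p $ 3 \<le> 1 \<and> (\<exists>q\<in>S. q $ 1 = p $ 1 \<and> q $ 2 = p $ 2)"
  shows "ennreal (1 / 8) * emeasure lborel T \<le> hausdorff_outer 2 S"
proof -
  have U: "(UNIV :: 3 set) = {1, 2, 3}" by (simp add: UNIV_3)
  have "ennreal (1 / 8) * emeasure lborel T \<le> hausdorff_pre 2 1 S"
    unfolding hausdorff_pre_def
  proof (rule INF_greatest)
    fix E :: "nat \<Rightarrow> (real^3) set"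
    assume "E \<in> {E. S \<subseteq> (\<Union>i. E i) \<and> (\<forall>i. bounded (E i) \<and> diameter (E i) \<le> 1)}"
    then have E: "S \<subseteq> (\<Union>i. E i)" "\<And>i. bounded (E i)" by auto
    define d where "d i = diameter (E i)" for i
    have d: "d i \<ge> 0" for i using diameter_ge_0[OF E(2)] by (simp add: d_def)
    define q where "q i = (SOME x. x \<in> E i)" for i
    \<comment> \<open>In the first two coordinates a set of diameter d lies in the square of half
      side d about any of its points; with unit height this has volume 4 d^2.\<close>
    define B where "B i = cbox (vec3 1 2 (q i $ 1 - d i) (q i $ 2 - d i) 0) (vec3 1 2 (q i $ 1 + d i) (q i $ 2 + d i) 1)" for i
    have "T \<subseteq> (\<Union>i. B i)"
    proof
      fix p assume "p \<in> T"
      then obtain s where s: "s \<in> S" "s $ 1 = p $ 1" "s $ 2 = p $ 2" and p3: "0 \<le> p $ 3" "p $ 3 \<le> 1" using T by blast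
      then obtain i where i: "s \<in> E i" using E by blast
      then have "q i \<in> E i" unfolding q_def by (rule someI)
      then have "dist s (q i) \<le> d i" using diameter_bounded_bound[OF E(2)] i by (simp add: d_def)
      then have "\<bar>(s - q i) $ l\<bar> \<le> d i" for l
        using component_le_norm_cart[of "s - q i" l] by (simp add: dist_norm)
      from this[of 1] this[of 2] have "p \<in> B i"
        using s p3 by (auto simp: B_def mem_cbox_vec3[OF U] abs_le_iff)
      then show "p \<in> (\<Union>i. B i)" by blast
    qed
    then have "emeasure lborel T \<le> emeasure lborel (\<Union>i. B i)"
      by (intro emeasure_mono) (auto simp: B_def)
    also have "\<dots> \<le> (\<Sum>i. emeasure lborel (B i))"
      by (intro emeasure_subadditive_countably) (auto simp: B_def)
    finally have "ennreal (1 / 8) * emeasure lborel T \<le> ennreal (1 / 8) * (\<Sum>i. emeasure lborel (B i))"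
      by (intro mult_left_mono) auto
    also have "\<dots> = (\<Sum>i. ennreal (1 / 8) * emeasure lborel (B i))" by simp
    also have "\<dots> \<le> (\<Sum>i. ennreal (unit_ball_vol (real 2) * (diameter (E i) / 2) ^ 2))"
    proof (intro suminf_le summableI)
      fix i
      have "measure lborel (B i) = 2 * d i * (2 * d i) * 1"
        unfolding B_def by (subst measure_cbox_vec3[OF U]) (use d in auto)
      moreover have "emeasure lborel (B i) = ennreal (measure lborel (B i))"
        using emeasure_lborel_cbox_finite by (intro emeasure_eq_ennreal_measure) (auto simp: B_def less_top[symmetric])
      ultimately have "emeasure lborel (B i) = ennreal (4 * (d i)\<^sup>2)"
        by (simp add: power2_eq_square)
      then have "ennreal (1 / 8) * emeasure lborel (B i) = ennreal (1 / 8 * (4 * (d i)\<^sup>2))"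
        by (simp only: ennreal_mult'[symmetric])
      also have "\<dots> \<le> ennreal (unit_ball_vol (real 2) * (diameter (E i) / 2) ^ 2)"
      proof (rule ennreal_leI)
        \<comment> \<open>The factor 1/8 turns 4 d^2 into d^2/2, which is at most the weight \<pi>
          d^2/4 of the covering set.\<close>
        have "2 * (d i)\<^sup>2 \<le> pi * (d i)\<^sup>2" using pi_ge_two by (intro mult_right_mono) auto
        then show "1 / 8 * (4 * (d i)\<^sup>2) \<le> unit_ball_vol (real 2) * (diameter (E i) / 2) ^ 2"
          by (simp add: d_def[symmetric] unit_ball_vol_2 power_divide)
      qed
      finally show "ennreal (1 / 8) * emeasure lborel (B i) \<le> ennreal (unit_ball_vol (real 2) * (diameter (E i) / 2) ^ 2)" .
    qed
    finally show "ennreal (1 / 8) * emeasure lborel T \<le> (\<Sum>i. ennreal (unit_ball_vol (real 2) * (diameter (E i) / 2) ^ 2))" .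
  qed
  also have "\<dots> \<le> hausdorff_outer 2 S" unfolding hausdorff_outer_def by (rule SUP_upper) simp
  finally show ?thesis .
qed

section \<open>Trace estimates\<close>

text \<open>The pieces may overlap, as closed rectangles sharing edges do: the sum of their
  indicators still dominates the indicator of F.\<close>

lemma nn_integral_hausdorff_cover:
  fixes u :: "real^3 \<Rightarrow> real"
  assumes "finite I" "F \<subseteq> (\<Union>m\<in>I. C m)" "\<And>m. m \<in> I \<Longrightarrow> C m \<in> sets borel"
    and c: "\<And>m. m \<in> I \<Longrightarrow> hausdorff_outer 2 (C m) \<le> ennreal (c m)" "\<And>m. m \<in> I \<Longrightarrow> 0 \<le> c m"
    and a: "\<And>m x. m \<in> I \<Longrightarrow> x \<in> C m \<Longrightarrow> x \<in> F \<Longrightarrow> \<bar>u x\<bar> \<le> a m" "\<And>m. m \<in> I \<Longrightarrow> 0 \<le> a m"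
  shows "(\<integral>\<^sup>+x\<in>F. ennreal \<bar>u x\<bar> \<partial>H2) \<le> ennreal (\<Sum>m\<in>I. c m * a m)"
proof -
  have "(\<integral>\<^sup>+x\<in>F. ennreal \<bar>u x\<bar> \<partial>H2) \<le> (\<integral>\<^sup>+x. (\<Sum>m\<in>I. ennreal (a m) * indicator (C m) x) \<partial>H2)"
  proof (rule nn_integral_mono)
    fix x
    show "ennreal \<bar>u x\<bar> * indicator F x \<le> (\<Sum>m\<in>I. ennreal (a m) * indicator (C m) x)"
    proof (cases "x \<in> F")
      case True
      then obtain m where m: "m \<in> I" "x \<in> C m" using assms(2) by blast
      have "ennreal \<bar>u x\<bar> * indicator F x \<le> ennreal (a m) * indicator (C m) x"
        using a(1)[OF m True] m True by (auto intro: ennreal_leI)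
      also have "\<dots> \<le> (\<Sum>m\<in>I. ennreal (a m) * indicator (C m) x)"
        using assms(1) m by (intro member_le_sum) auto
      finally show ?thesis .
    qed auto
  qed
  also have "\<dots> = (\<Sum>m\<in>I. \<integral>\<^sup>+x. ennreal (a m) * indicator (C m) x \<partial>H2)"
    by (rule nn_integral_sum)
       (intro borel_measurable_times_ennreal borel_measurable_const borel_measurable_indicator borel_sets_hausdorff assms(3), auto)
  also have "\<dots> = (\<Sum>m\<in>I. ennreal (a m) * hausdorff_outer 2 (C m))"
    using assms(3) by (intro sum.cong refl)
      (simp add: nn_integral_cmult_indicator borel_sets_hausdorff emeasure_hausdorff_borel)
  also have "\<dots> \<le> (\<Sum>m\<in>I. ennreal (c m * a m))"
  proof (rule sum_mono)
    fix m assume m: "m \<in> I"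
    have "ennreal (a m) * hausdorff_outer 2 (C m) \<le> ennreal (a m) * ennreal (c m)"
      by (rule mult_left_mono[OF c(1)[OF m]]) simp
    then show "ennreal (a m) * hausdorff_outer 2 (C m) \<le> ennreal (c m * a m)"
      using a(2)[OF m] c(2)[OF m] by (simp add: ennreal_mult' mult.commute)
  qed
  also have "\<dots> = ennreal (\<Sum>m\<in>I. c m * a m)"
    using a(2) c(2) by (intro sum_ennreal) auto
  finally show ?thesis .
qed

lemma abs_le_average:
  fixes u :: "'a::euclidean_space \<Rightarrow> real"
  assumes P: "P \<in> lmeasurable" and u: "set_integrable lebesgue P u"
    and v: "measure lebesgue P = v" "v > 0" and close: "\<And>y. y \<in> P \<Longrightarrow> \<bar>u x - u y\<bar> \<le> \<epsilon>"
  shows "\<bar>u x\<bar> \<le> \<bar>(LINT y:P|lebesgue. u y) / v\<bar> + \<epsilon>"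
proof -
  have c: "set_integrable lebesgue P (\<lambda>_. t)" "(LINT y:P|lebesgue. t) = v * t" for t :: real
    using P v by (auto simp: set_integrable_def set_lebesgue_integral_def fmeasurable_def less_top)
  have "\<bar>LINT y:P|lebesgue. u x - u y\<bar> \<le> (LINT y:P|lebesgue. \<bar>u x - u y\<bar>)"
    using integral_abs_bound[of lebesgue "\<lambda>y. indicator P y *\<^sub>R (u x - u y)"]
    by (simp add: set_lebesgue_integral_def abs_mult)
  also have "\<dots> \<le> (LINT y:P|lebesgue. \<epsilon>)"
    using close by (intro set_integral_mono c set_integrable_abs set_integral_diff u)
  finally have "\<bar>v * u x - (LINT y:P|lebesgue. u y)\<bar> \<le> v * \<epsilon>"
    using c u by (simp add: set_integral_diff)
  then have "\<bar>u x - (LINT y:P|lebesgue. u y) / v\<bar> \<le> \<epsilon>"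
    using v(2) by (simp add: abs_le_iff field_simps)
  then show ?thesis by linarith
qed

lemma sum_integral_disjoint_le:
  fixes f :: "'a::euclidean_space \<Rightarrow> real"
  assumes "finite I" "disjoint_family_on P I" "\<And>m. m \<in> I \<Longrightarrow> P m \<subseteq> B" "\<And>m. m \<in> I \<Longrightarrow> P m \<in> sets lebesgue"
    "set_integrable lebesgue B f" "\<And>x. x \<in> B \<Longrightarrow> 0 \<le> f x"
  shows "(\<Sum>m\<in>I. LINT x:P m|lebesgue. f x) \<le> (LINT x:B|lebesgue. f x)"
proof -
  have i: "set_integrable lebesgue (P m) f" if "m \<in> I" for m
    by (rule set_integrable_subset[OF assms(5) assms(4)[OF that] assms(3)[OF that]])
  have "(\<Sum>m\<in>I. LINT x:P m|lebesgue. f x) = (LINT x|lebesgue. (\<Sum>m\<in>I. indicator (P m) x *\<^sub>R f x))"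
    unfolding set_lebesgue_integral_def
    by (rule Bochner_Integration.integral_sum[symmetric]) (use i in \<open>simp add: set_integrable_def\<close>)
  also have "\<dots> \<le> (LINT x:B|lebesgue. f x)"
    unfolding set_lebesgue_integral_def
  proof (rule integral_mono)
    show "integrable lebesgue (\<lambda>x. \<Sum>m\<in>I. indicator (P m) x *\<^sub>R f x)"
      by (rule Bochner_Integration.integrable_sum) (use i in \<open>simp add: set_integrable_def\<close>)
    show "integrable lebesgue (\<lambda>x. indicator B x *\<^sub>R f x)" using assms(5) by (simp add: set_integrable_def)
    fix x
    have "indicator (\<Union>m\<in>I. P m) x = (\<Sum>m\<in>I. indicator (P m) x :: real)"
      by (rule indicator_UN_disjoint[OF assms(1,2)])
    then have "(\<Sum>m\<in>I. indicator (P m) x *\<^sub>R f x) = indicator (\<Union>m\<in>I. P m) x *\<^sub>R f x"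
      by (simp add: sum_distrib_right)
    also have "\<dots> \<le> indicator B x *\<^sub>R f x"
      using assms(3,6) by (auto simp: indicator_def)
    finally show "(\<Sum>m\<in>I. indicator (P m) x *\<^sub>R f x) \<le> indicator B x *\<^sub>R f x" .
  qed
  finally show ?thesis .
qed

text \<open>\<open>box_average\<close> along the first coordinate of a cell; the other two ranges
  stay fixed.\<close>

lemma cell_average:
  assumes ijk: "(UNIV :: 3 set) = {i, j, k}" and wg: "weak_gradient \<Omega> u g" and "open \<Omega>"
    and sub: "cell i j k x x' y y' z z' \<subseteq> \<Omega>"
    and c: "x \<le> c" "c < d" "d \<le> x'" and c': "x \<le> c'" "c' < d'" "d' \<le> x'"
    and iu: "set_integrable lebesgue (cell i j k x x' y y' z z') u"
    and ig: "set_integrable lebesgue (cell i j k x x' y y' z z') g"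
  shows "\<bar>(LINT p:cell i j k c d y y' z z'|lebesgue. u p) / (d - c) -
          (LINT p:cell i j k c' d' y y' z z'|lebesgue. u p) / (d' - c')\<bar>
        \<le> (LINT p:cell i j k x x' y y' z z'|lebesgue. norm (g p))"
proof -
  note v = vec3_nth[OF ijk] and b = cell_eq_box[OF ijk]
  have s: "{p \<in> cell i j k x x' y y' z z'. c < p $ i \<and> p $ i < d} = cell i j k c d y y' z z'"
    if "x \<le> c" "d \<le> x'" for c d
    using that by (auto simp: cell_def)
  show ?thesis
    using box_average[OF wg \<open>open \<Omega>\<close>, where a="vec3 i j x y z" and b="vec3 i j x' y' z'" and i=i and c=c and d=d and c'=c' and d'=d']
      c c' sub iu ig
    unfolding b[symmetric] s[OF c(1,3)] s[OF c'(1,3)] by (simp add: v)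
qed

lemma grid_interval:
  fixes z v :: real
  assumes "z \<le> y" "y \<le> z + v" "v > 0" "n > 0"
  obtains m where "m < n" "z + real m * (v / real n) \<le> y" "y \<le> z + real (Suc m) * (v / real n)"
proof (cases "y < z + v")
  case True
  define m where "m = nat \<lfloor>(y - z) * real n / v\<rfloor>"
  have "real m \<le> (y - z) * real n / v" "(y - z) * real n / v < real m + 1"
    using assms by (auto simp: m_def)
  then have m: "real m * v \<le> (y - z) * real n" "(y - z) * real n < (real m + 1) * v"
    using assms by (auto simp: field_simps)
  have "(y - z) * real n < v * real n" using True assms by (intro mult_strict_right_mono) auto
  then have "real m * v < real n * v" using m by (simp add: mult.commute)
  then have "m < n" using assms by simp
  then show ?thesis using m assms by (intro that[of m]) (auto simp: field_simps)
next
  case False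
  then show ?thesis using assms by (intro that[of "n - 1"]) (auto simp: field_simps of_nat_diff Suc_diff_1)
qed

lemma disjoint_grid_intervals:
  fixes z v :: real
  assumes "z + real m * s < y" "y < z + real (Suc m) * s" "z + real m' * s < y" "y < z + real (Suc m') * s" "s > 0"
  shows "m = m'"
proof (rule ccontr)
  assume "m \<noteq> m'"
  then consider "Suc m \<le> m'" | "Suc m' \<le> m" by linarith
  then show False
  proof cases
    case 1
    then have "real (Suc m) * s \<le> real m' * s" using assms by (intro mult_right_mono) auto
    then show False using assms by linarith
  next
    case 2
    then have "real (Suc m') * s \<le> real m * s" using assms by (intro mult_right_mono) auto
    then show False using assms by linarith
  qed
qed

text \<open>The face is cut into small rectangles. By uniform continuity u on a rectangle is close
  to its average over a thin piece P next to it, and \<open>cell_average\<close> replaces P by the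
  whole column Q over the rectangle at the cost of the gradient in Q. The columns are disjoint, so
  these costs add up to integrals over the cell. The factor 2 is that of
  \<open>hausdorff_outer_rectangle\<close>.\<close>

lemma face_estimate:
  fixes u :: "real^3 \<Rightarrow> real"
  assumes ijk: "(UNIV :: 3 set) = {i, j, k}" and wg: "weak_gradient \<Omega> u g" and "open \<Omega>"
    and sub: "cell i j k x x' y y' z z' \<subseteq> \<Omega>" and lt: "x < x'" "y < y'" "z < z'" and e: "e = x \<or> e = x'"
    and cont: "continuous_on (closure \<Omega>) u"
    and iu: "set_integrable lebesgue (cell i j k x x' y y' z z') u"
    and ig: "set_integrable lebesgue (cell i j k x x' y y' z z') g"
  shows "(\<integral>\<^sup>+p\<in>{p. p $ i = e \<and> y \<le> p $ j \<and> p $ j \<le> y' \<and> z \<le> p $ k \<and> p $ k \<le> z'}. ennreal \<bar>u p\<bar> \<partial>H2)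
    \<le> ennreal (2 * ((LINT p:cell i j k x x' y y' z z'|lebesgue. \<bar>u p\<bar>) / (x' - x) + (LINT p:cell i j k x x' y y' z z'|lebesgue. norm (g p))))"
    (is "?L \<le> ennreal ?R")
proof (rule ennreal_le_epsilon)
  fix \<epsilon> :: real assume "\<epsilon> > 0"
  define A where "A = (y' - y) * (z' - z)"
  have A: "A > 0" using lt by (simp add: A_def)
  \<comment> \<open>The rectangles have total Hausdorff bound 2 A, so the oscillation of u
    contributes exactly \<epsilon>.\<close>
  define \<eta> where "\<eta> = \<epsilon> / (2 * A)"
  have \<eta>: "\<eta> > 0" using \<open>\<epsilon> > 0\<close> A by (simp add: \<eta>_def)
  define Z where "Z = cbox (vec3 i j x y z) (vec3 i j x' y' z')"
  have "box (vec3 i j x y z) (vec3 i j x' y' z') \<noteq> {}"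
    using lt by (auto simp: interval_ne_empty_cart all_3[OF ijk] vec3_nth[OF ijk])
  then have "Z = closure (cell i j k x x' y y' z z')"
    unfolding Z_def cell_eq_box[OF ijk] by (simp add: closure_box)
  then have "Z \<subseteq> closure \<Omega>" using sub by (simp add: closure_mono)
  then have "continuous_on Z u" using cont continuous_on_subset by blast
  then have "uniformly_continuous_on Z u" by (simp add: Z_def compact_uniformly_continuous)
  then obtain \<delta> where \<delta>: "\<delta> > 0" "\<And>p q. p \<in> Z \<Longrightarrow> q \<in> Z \<Longrightarrow> dist q p < \<delta> \<Longrightarrow> dist (u q) (u p) < \<eta>"
    using \<eta> unfolding uniformly_continuous_on_def by metis
  \<comment> \<open>Rectangles and thin layer have all three sides at most \<delta>/4, so the sum of
    the coordinate differences stays below \<delta>.\<close>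
  obtain n where n: "n > 0" "(y' - y) / real n \<le> \<delta> / 4" "(z' - z) / real n \<le> \<delta> / 4"
  proof -
    have "eventually (\<lambda>n. (y' - y) / real n < \<delta> / 4) sequentially" "eventually (\<lambda>n. (z' - z) / real n < \<delta> / 4) sequentially"
      using \<delta>(1) by (auto intro!: order_tendstoD[OF lim_const_over_n])
    then have "eventually (\<lambda>n. n > 0 \<and> (y' - y) / real n < \<delta> / 4 \<and> (z' - z) / real n < \<delta> / 4) sequentially"
      using eventually_gt_at_top[of 0] by eventually_elim auto
    then show ?thesis using that by (metis (no_types, lifting) eventually_happens' sequentially_bot less_imp_le)
  qed
  define t where "t = min (x' - x) (\<delta> / 4)"
  have t: "0 < t" "t \<le> x' - x" unfolding t_def using lt \<delta>(1) by auto
  have t4: "t \<le> \<delta> / 4" unfolding t_def by (rule min.cobounded2)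
  \<comment> \<open>The layer of thickness t is placed at that end of the cell where the face
    lies.\<close>
  define x0 where "x0 = (if e = x then x else x' - t)"
  have x0: "x \<le> x0" "x0 + t \<le> x'" "e = x0 \<or> e = x0 + t" using e t by (auto simp: x0_def)
  define sy where "sy = (y' - y) / real n"
  define sz where "sz = (z' - z) / real n"
  have s: "sy > 0" "sz > 0" "sy \<le> \<delta> / 4" "sz \<le> \<delta> / 4" using lt n by (auto simp: sy_def sz_def)
  define Y where "Y m = y + real m * sy" for m
  define Zc where "Zc m = z + real m * sz" for m
  have top: "y \<le> Y m \<and> Y (Suc m) \<le> y' \<and> z \<le> Zc m \<and> Zc (Suc m) \<le> z'" if "m < n" for m
  proof -
    have "real (Suc m) * sy \<le> real n * sy" "real (Suc m) * sz \<le> real n * sz"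
      using that s by (auto intro!: mult_right_mono)
    moreover have "real n * sy = y' - y" "real n * sz = z' - z" using n by (auto simp: sy_def sz_def)
    moreover have "0 \<le> real m * sy" "0 \<le> real m * sz" using s by auto
    ultimately show ?thesis unfolding Y_def Zc_def by linarith
  qed
  have step: "Y (Suc m) = Y m + sy" "Zc (Suc m) = Zc m + sz" for m
    by (auto simp: Y_def Zc_def algebra_simps)
  define I where "I = {..<n} \<times> {..<n}"
  define P where "P a b = cell i j k x0 (x0 + t) (Y a) (Y (Suc a)) (Zc b) (Zc (Suc b))" for a b
  define Q where "Q = (\<lambda>(a, b). cell i j k x x' (Y a) (Y (Suc a)) (Zc b) (Zc (Suc b)))"
  define C where "C = (\<lambda>(a, b). {p. p $ i = e \<and> Y a \<le> p $ j \<and> p $ j \<le> Y (Suc a) \<and> Zc b \<le> p $ k \<and> p $ k \<le> Zc (Suc b)})"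
  define T where "T m = (LINT p:Q m|lebesgue. \<bar>u p\<bar>) / (x' - x) + (LINT p:Q m|lebesgue. norm (g p))" for m
  let ?B = "cell i j k x x' y y' z z'"
  have QB: "Q m \<subseteq> ?B" if "m \<in> I" for m
    using that top unfolding I_def Q_def by (fastforce simp: cell_def)
  have Qm: "Q m \<in> sets lebesgue" for m
    using fmeasurableD[OF cell_lmeasurable[OF ijk]] by (auto simp: Q_def split: prod.splits)
  have T0: "0 \<le> T m" for m
    unfolding T_def set_lebesgue_integral_def using lt by (intro add_nonneg_nonneg divide_nonneg_nonneg integral_nonneg_AE) auto
  have main: "\<bar>u p\<bar> \<le> T m / (sy * sz) + \<eta>" if m: "m \<in> I" and p: "p \<in> C m" for m p
  proof -
    obtain a b where ab: "m = (a, b)" "a < n" "b < n" using m by (auto simp: I_def)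
    have Qab: "Q m = cell i j k x x' (Y a) (Y (Suc a)) (Zc b) (Zc (Suc b))" by (simp add: Q_def ab)
    note QB' = QB[OF m, unfolded Qab] and Qm' = Qm[of m, unfolded Qab]
    have iuQ: "set_integrable lebesgue (Q m) u" "set_integrable lebesgue (Q m) g"
      using set_integrable_subset[OF iu Qm QB[OF m]] set_integrable_subset[OF ig Qm QB[OF m]] by auto
    have PQ: "P a b \<subseteq> Q m" unfolding P_def Qab using x0 t by (auto simp: cell_def)
    have Pm: "P a b \<in> lmeasurable" by (simp add: P_def cell_lmeasurable[OF ijk])
    have vP: "measure lebesgue (P a b) = t * sy * sz" unfolding P_def
      by (subst measure_cell[OF ijk]) (use t s step in auto)
    have "\<bar>u p\<bar> \<le> \<bar>(LINT q:P a b|lebesgue. u q) / (t * sy * sz)\<bar> + \<eta>"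
    proof (rule abs_le_average[OF Pm _ vP])
      show "set_integrable lebesgue (P a b) u"
        using set_integrable_subset[OF iuQ(1) _ PQ] Pm by auto
      show "t * sy * sz > 0" using t s by simp
      fix q assume q: "q \<in> P a b"
      have tp: "y \<le> Y a" "Y (Suc a) \<le> y'" "z \<le> Zc b" "Zc (Suc b) \<le> z'" using top[OF ab(2)] top[OF ab(3)] by auto
      have pZ: "p \<in> Z" "q \<in> Z"
        using p q tp x0 t unfolding ab C_def Z_def P_def by (auto simp: mem_cbox_vec3[OF ijk] cell_def)
      have "\<bar>p $ i - q $ i\<bar> \<le> t" "\<bar>p $ j - q $ j\<bar> \<le> sy" "\<bar>p $ k - q $ k\<bar> \<le> sz"
        using p q x0 step unfolding ab C_def P_def by (auto simp: cell_def)
      then have "(\<Sum>l\<in>UNIV. \<bar>(p - q) $ l\<bar>) \<le> t + sy + sz" by (simp add: sum_3'[OF ijk])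
      then have "norm (p - q) \<le> t + sy + sz" using norm_le_l1_cart[of "p - q"] by linarith
      then have "dist p q < \<delta>" using t t4 s \<delta>(1) by (simp add: dist_norm)
      then show "\<bar>u p - u q\<bar> \<le> \<eta>" using \<delta>(2)[OF pZ(2,1)] by (simp add: dist_real_def)
    qed
    also have "(LINT q:P a b|lebesgue. u q) / (t * sy * sz) = ((LINT q:P a b|lebesgue. u q) / t) / (sy * sz)"
      by simp
    also have "\<bar>\<dots>\<bar> = \<bar>(LINT q:P a b|lebesgue. u q) / t\<bar> / (sy * sz)" using s by (simp add: abs_divide abs_mult)
    also have "\<bar>(LINT q:P a b|lebesgue. u q) / t\<bar> \<le> T m"
    proof -
      have "\<bar>(LINT q:P a b|lebesgue. u q) / (x0 + t - x0) - (LINT q:Q m|lebesgue. u q) / (x' - x)\<bar> \<le> (LINT q:Q m|lebesgue. norm (g q))"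
        unfolding P_def Qab
        by (rule cell_average[OF ijk wg \<open>open \<Omega>\<close>]) (use QB' sub x0 t lt iuQ in \<open>auto simp: Qab\<close>)
      moreover have "\<bar>LINT q:Q m|lebesgue. u q\<bar> \<le> (LINT q:Q m|lebesgue. \<bar>u q\<bar>)"
        using integral_abs_bound[of lebesgue "\<lambda>y. indicator (Q m) y *\<^sub>R (u y)"]
        by (simp add: set_lebesgue_integral_def abs_mult)
      then have "\<bar>(LINT q:Q m|lebesgue. u q) / (x' - x)\<bar> \<le> (LINT q:Q m|lebesgue. \<bar>u q\<bar>) / (x' - x)"
        using lt by (simp add: abs_divide divide_right_mono)
      ultimately show ?thesis unfolding T_def add_diff_cancel_left' by linarith
    qed
    finally show ?thesis using s by (simp add: divide_right_mono)
  qed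
  have "?L \<le> ennreal (\<Sum>m\<in>I. (2 * sy * sz) * (T m / (sy * sz) + \<eta>))"
  proof (rule nn_integral_hausdorff_cover[where C=C])
    show "finite I" by (simp add: I_def)
    show "{p. p $ i = e \<and> y \<le> p $ j \<and> p $ j \<le> y' \<and> z \<le> p $ k \<and> p $ k \<le> z'} \<subseteq> (\<Union>m\<in>I. C m)"
    proof
      fix p assume "p \<in> {p. p $ i = e \<and> y \<le> p $ j \<and> p $ j \<le> y' \<and> z \<le> p $ k \<and> p $ k \<le> z'}"
      then have p: "p $ i = e" "y \<le> p $ j" "p $ j \<le> y + (y' - y)" "z \<le> p $ k" "p $ k \<le> z + (z' - z)" by auto
      obtain a where "a < n" "Y a \<le> p $ j" "p $ j \<le> Y (Suc a)"
        using grid_interval[OF p(2,3) _ n(1)] lt unfolding Y_def sy_def by (metis diff_gt_0_iff_gt)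
      moreover obtain b where "b < n" "Zc b \<le> p $ k" "p $ k \<le> Zc (Suc b)"
        using grid_interval[OF p(4,5) _ n(1)] lt unfolding Zc_def sz_def by (metis diff_gt_0_iff_gt)
      ultimately show "p \<in> (\<Union>m\<in>I. C m)" using p(1) by (auto simp: I_def C_def)
    qed
    fix m assume m: "m \<in> I"
    obtain a b where ab: "m = (a, b)" by force
    have "closed {p::real^3. p $ i = e \<and> Y a \<le> p $ j \<and> p $ j \<le> Y (Suc a) \<and> Zc b \<le> p $ k \<and> p $ k \<le> Zc (Suc b)}"
      by (intro closed_Collect_conj closed_Collect_eq closed_Collect_le continuous_intros)
    then show "C m \<in> sets borel" by (simp add: C_def ab)
    show "hausdorff_outer 2 (C m) \<le> ennreal (2 * sy * sz)"
      by (rule hausdorff_outer_rectangle[OF ijk s(1,2), of _ e "Y a" "Zc b"]) (auto simp: C_def ab step)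
    show "0 \<le> 2 * sy * sz" "0 \<le> T m / (sy * sz) + \<eta>" using s T0[of m] \<eta> by auto
  qed (use main in auto)
  also have "(\<Sum>m\<in>I. (2 * sy * sz) * (T m / (sy * sz) + \<eta>)) = 2 * (\<Sum>m\<in>I. T m) + real n * real n * (2 * sy * sz * \<eta>)"
    using s by (simp add: distrib_left sum.distrib sum_distrib_left I_def)
  also have "real n * real n * (2 * sy * sz * \<eta>) = \<epsilon>"
  proof -
    have "real n * sy = y' - y" "real n * sz = z' - z" using n by (auto simp: sy_def sz_def)
    then have "(real n * sy) * (real n * sz) = A" by (simp add: A_def)
    then have "real n * real n * (2 * sy * sz * \<eta>) = 2 * A * \<eta>" by (simp add: mult_ac)
    then show ?thesis using A by (simp add: \<eta>_def)
  qed
  also have "(\<Sum>m\<in>I. T m) = (\<Sum>m\<in>I. LINT p:Q m|lebesgue. \<bar>u p\<bar>) / (x' - x) + (\<Sum>m\<in>I. LINT p:Q m|lebesgue. norm (g p))"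
    by (simp add: T_def sum.distrib sum_divide_distrib)
  finally have "?L \<le> ennreal (2 * ((\<Sum>m\<in>I. LINT p:Q m|lebesgue. \<bar>u p\<bar>) / (x' - x) + (\<Sum>m\<in>I. LINT p:Q m|lebesgue. norm (g p))) + \<epsilon>)" .
  also have "\<dots> \<le> ennreal (?R + \<epsilon>)"
  proof (intro ennreal_leI add_right_mono mult_left_mono add_mono divide_right_mono)
    have dis: "disjoint_family_on Q I"
      unfolding disjoint_family_on_def
    proof (intro ballI impI)
      fix m m' :: "nat \<times> nat" assume "m \<noteq> m'"
      then show "Q m \<inter> Q m' = {}"
        using disjoint_grid_intervals[of y _ sy] disjoint_grid_intervals[of z _ sz] s
        unfolding Q_def Y_def Zc_def by (auto simp: cell_def simp del: of_nat_Suc)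
    qed
    show "(\<Sum>m\<in>I. LINT p:Q m|lebesgue. \<bar>u p\<bar>) \<le> (LINT p:?B|lebesgue. \<bar>u p\<bar>)"
      by (rule sum_integral_disjoint_le[OF _ dis QB Qm]) (auto simp: I_def intro: set_integrable_abs iu)
    show "(\<Sum>m\<in>I. LINT p:Q m|lebesgue. norm (g p)) \<le> (LINT p:?B|lebesgue. norm (g p))"
      by (rule sum_integral_disjoint_le[OF _ dis QB Qm]) (auto simp: I_def intro: set_integrable_norm ig)
  qed (use lt in auto)
  also have "\<dots> = ennreal ?R + ennreal \<epsilon>"
  proof (rule ennreal_plus)
    show "0 \<le> ?R" unfolding set_lebesgue_integral_def
      using lt by (intro mult_nonneg_nonneg add_nonneg_nonneg divide_nonneg_nonneg integral_nonneg_AE) auto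
  qed (use \<open>\<epsilon> > 0\<close> in simp)
  finally show "?L \<le> ennreal ?R + ennreal \<epsilon>" .
qed

subsection \<open>Bounds in terms of Sobolev norms\<close>

text \<open>The value 0 at infinity lets the Hoelder exponent 1 - 1/p cover finite and infinite p
  alike.\<close>

definition recip :: "ennreal \<Rightarrow> real" where
  "recip p = (if p = \<infinity> then 0 else 1 / enn2real p)"

text \<open>Up to the threshold t the first term suffices; above it a is at most t^(1-q) a^q.
  Integrated and optimised over t, this yields Hoelder's inequality up to a factor 2.\<close>

lemma le_add_powr:
  fixes a t q :: real
  assumes "a \<ge> 0" "t > 0" "q \<ge> 1"
  shows "a \<le> t + t powr (1 - q) * a powr q"
proof (cases "a \<le> t")
  case True then show ?thesis by (simp add: add_increasing2)
next
  case False
  then have "a = a powr (1 - q) * a powr q" using assms by (simp add: powr_add[symmetric])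
  also have "\<dots> \<le> t powr (1 - q) * a powr q"
    using False assms by (intro mult_right_mono powr_mono2') auto
  finally show ?thesis using assms by linarith
qed

text \<open>Hoelder's inequality against the indicator of B, up to a factor 2. The power 1 - 1/p of
  the volume is what later decides between convergence and divergence.\<close>

lemma Lp_space_bound_on_finite_measure:
  fixes f :: "real^'n::finite \<Rightarrow> 'b::euclidean_space"
  assumes p: "1 \<le> p" and "open \<Omega>" and B: "B \<in> lmeasurable" "B \<subseteq> \<Omega>"
    and f: "f \<in> Lp_space (lebesgue_on \<Omega>) p"
  shows "set_integrable lebesgue B f"
    and "(LINT x:B|lebesgue. norm (f x)) \<le> 2 * measure lebesgue B powr (1 - recip p) * Lp_norm (lebesgue_on \<Omega>) p f"
proof -
  have \<Omega>: "\<Omega> \<in> sets lebesgue" "\<Omega> \<inter> space lebesgue \<in> sets lebesgue" using \<open>open \<Omega>\<close> by auto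
  define F where "F x = indicator \<Omega> x *\<^sub>R f x" for x
  have Fm: "F \<in> borel_measurable lebesgue"
    using f \<Omega> by (auto simp: Lp_space_def F_def[abs_def] borel_measurable_restrict_space_iff)
  have BF: "indicator B x *\<^sub>R f x = indicator B x *\<^sub>R F x" for x
    using B(2) by (auto simp: F_def indicator_def)
  have eq: "indicator B x *\<^sub>R norm (f x) = norm (indicator B x *\<^sub>R F x)" for x
    using B(2) by (cases "x \<in> B") (auto simp: F_def)
  have Bs: "B \<in> sets lebesgue" "emeasure lebesgue B < \<infinity>"
    using B(1) by (auto simp: fmeasurable_def)
  define m where "m = measure lebesgue B"
  have m: "m \<ge> 0" "(LINT x|lebesgue. indicator B x * t) = m * t" "integrable lebesgue (\<lambda>x. indicator B x * t)" for t :: real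
    using Bs by (auto simp: m_def less_top)
  have BFm: "(\<lambda>x. indicator B x *\<^sub>R F x) \<in> borel_measurable lebesgue"
    using Bs Fm by (intro borel_measurable_scaleR borel_measurable_indicator)
  have "set_integrable lebesgue B f \<and> (LINT x:B|lebesgue. norm (f x)) \<le> 2 * m powr (1 - recip p) * Lp_norm (lebesgue_on \<Omega>) p f"
  proof (cases "p = \<infinity>")
    case True
    define N where "N = enn2real (esssup (lebesgue_on \<Omega>) (\<lambda>x. ennreal (norm (f x))))"
    have fin: "esssup (lebesgue_on \<Omega>) (\<lambda>x. ennreal (norm (f x))) = ennreal N"
      using f True by (simp add: N_def Lp_space_def)
    have N0: "N \<ge> 0" by (simp add: N_def)
    have "AE x in lebesgue_on \<Omega>. ennreal (norm (f x)) \<le> esssup (lebesgue_on \<Omega>) (\<lambda>x. ennreal (norm (f x)))"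
      by (rule esssup_AE)
    then have ae: "AE x in lebesgue. x \<in> \<Omega> \<longrightarrow> norm (f x) \<le> N"
      unfolding fin AE_restrict_space_iff[OF \<Omega>(2)] using N0 by simp
    have int: "integrable lebesgue (\<lambda>x. indicator B x *\<^sub>R F x)"
    proof (rule Bochner_Integration.integrable_bound[OF m(3)[of N] BFm])
      show "AE x in lebesgue. norm (indicator B x *\<^sub>R F x) \<le> norm (indicator B x * N)"
        using ae by eventually_elim (use N0 in \<open>auto simp: F_def indicator_def\<close>)
    qed
    have "(LINT x:B|lebesgue. norm (f x)) \<le> (LINT x|lebesgue. indicator B x * N)"
      unfolding set_lebesgue_integral_def
    proof (rule integral_mono_AE[OF _ m(3)])
      have "(\<lambda>x. indicator B x *\<^sub>R norm (f x)) = (\<lambda>x. norm (indicator B x *\<^sub>R F x))"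
        by (simp only: eq)
      then show "integrable lebesgue (\<lambda>x. indicator B x *\<^sub>R norm (f x))" using integrable_norm[OF int] by simp
      show "AE x in lebesgue. indicator B x *\<^sub>R norm (f x) \<le> indicator B x * N"
        using ae by eventually_elim (use B(2) in \<open>auto simp: indicator_def\<close>)
    qed
    then have "(LINT x:B|lebesgue. norm (f x)) \<le> m * N" by (simp only: m(2))
    also have "\<dots> \<le> 2 * (m * N)" using m(1) N0 by simp
    finally show ?thesis
      using int m(1) True by (simp add: set_integrable_def BF Lp_norm_def N_def recip_def)
  next
    case False
    define q where "q = enn2real p"
    have q: "q \<ge> 1" using p False unfolding q_def
      by (metis enn2real_1 enn2real_mono infinity_ennreal_def less_top)
    define I where "I = (LINT x|lebesgue_on \<Omega>. norm (f x) powr q)"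
    have "integrable (lebesgue_on \<Omega>) (\<lambda>x. norm (f x) powr q)"
      using f False by (simp add: Lp_space_def q_def)
    then have Ii: "integrable lebesgue (\<lambda>x. indicator \<Omega> x *\<^sub>R norm (f x) powr q)"
      using \<Omega> by (simp add: integrable_restrict_space)
    have I: "I = (LINT x|lebesgue. indicator \<Omega> x *\<^sub>R norm (f x) powr q)"
      unfolding I_def using \<Omega> by (simp add: integral_restrict_space)
    have I0: "I \<ge> 0" unfolding I by (rule integral_nonneg_AE) auto
    have dom: "norm (indicator B x *\<^sub>R F x) \<le> indicator B x * t + t powr (1 - q) * (indicator \<Omega> x *\<^sub>R norm (f x) powr q)"
      if "t > 0" for t x
      using le_add_powr[of "norm (f x)" t q] that q B(2) by (auto simp: F_def indicator_def)
    have Di: "integrable lebesgue (\<lambda>x. indicator B x * t + t powr (1 - q) * (indicator \<Omega> x *\<^sub>R norm (f x) powr q))" for t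
      by (intro Bochner_Integration.integrable_add m(3) integrable_mult_right Ii)
    have int: "integrable lebesgue (\<lambda>x. indicator B x *\<^sub>R F x)"
    proof (rule Bochner_Integration.integrable_bound[OF Di[of 1] BFm])
      show "AE x in lebesgue. norm (indicator B x *\<^sub>R F x) \<le> norm (indicator B x * 1 + 1 powr (1 - q) * (indicator \<Omega> x *\<^sub>R norm (f x) powr q))"
        using dom[of 1] by (intro AE_I2) (smt (verit) real_norm_def norm_ge_zero)
    qed
    define X where "X = (LINT x:B|lebesgue. norm (f x))"
    have X: "X \<le> m * t + t powr (1 - q) * I" if "t > 0" for t
    proof -
      have "X \<le> (LINT x|lebesgue. indicator B x * t + t powr (1 - q) * (indicator \<Omega> x *\<^sub>R norm (f x) powr q))"
        unfolding X_def set_lebesgue_integral_def eq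
        by (rule integral_mono[OF integrable_norm[OF int] Di dom[OF that]])
      also have "\<dots> = (LINT x|lebesgue. indicator B x * t) + (LINT x|lebesgue. t powr (1 - q) * (indicator \<Omega> x *\<^sub>R norm (f x) powr q))"
        by (intro Bochner_Integration.integral_add m(3) integrable_mult_right Ii)
      also have "\<dots> = m * t + t powr (1 - q) * I"
        by (simp only: m(2) integral_mult_right_zero I[symmetric])
      finally show ?thesis .
    qed
    have "X \<le> 2 * m powr (1 - 1 / q) * I powr (1 / q)"
    proof (cases "m = 0")
      case True
      have "B \<in> null_sets lebesgue"
        using Bs True emeasure_eq_ennreal_measure[of lebesgue B] by (auto simp: m_def null_sets_def)
      then have "AE x in lebesgue. indicator B x *\<^sub>R norm (f x) = 0"
        by (intro eventually_mono[OF AE_not_in]) (auto simp: indicator_def)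
      then have "X = 0" unfolding X_def set_lebesgue_integral_def by (rule integral_eq_zero_AE)
      then show ?thesis by simp
    next
      case False
      then have m0: "m > 0" using m(1) by simp
      show ?thesis
      proof (cases "I = 0")
        case True
        \<comment> \<open>With I = 0 the optimal threshold degenerates to 0, so arbitrarily small
          positive thresholds are used.\<close>
        have "X \<le> 0 + e" if "e > 0" for e
          using X[of "e / m"] True that m0 by simp
        then have "X \<le> 0" by (rule field_le_epsilon)
        then show ?thesis using True q by simp
      next
        case False
        then have I0: "I > 0" using I0 by simp
        \<comment> \<open>This threshold makes the two terms in the bound on X equal, whence the
          factor 2.\<close>
        define t where "t = (I / m) powr (1 / q)"
        have t: "t > 0" using I0 m0 by (simp add: t_def)
        have "m * t = m powr (1 - 1 / q) * I powr (1 / q)"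
          using m0 I0 by (simp add: t_def powr_divide powr_diff)
        moreover have "t powr (1 - q) * I = m * t"
        proof -
          have "t powr (1 - q) = t * t powr (- q)" using t by (simp add: powr_diff powr_minus divide_simps)
          also have "t powr (- q) = m / I"
            using m0 I0 q by (simp add: t_def powr_powr powr_minus)
          finally show ?thesis using I0 by simp
        qed
        ultimately have "X \<le> 2 * (m powr (1 - 1 / q) * I powr (1 / q))" using X[OF t] by linarith
        then show ?thesis by (simp only: mult.assoc)
      qed
    qed
    then show ?thesis using int False
      by (simp add: set_integrable_def BF Lp_norm_def q_def[symmetric] I_def X_def recip_def)
  qed
  then show "set_integrable lebesgue B f"
    and "(LINT x:B|lebesgue. norm (f x)) \<le> 2 * measure lebesgue B powr (1 - recip p) * Lp_norm (lebesgue_on \<Omega>) p f"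
    by (auto simp: m_def)
qed

text \<open>This is completeness of Lebesgue measure.\<close>

lemma borel_measurable_lebesgue_on_AE:
  fixes f g :: "real^'n::finite \<Rightarrow> 'b::euclidean_space"
  assumes "open \<Omega>" "f \<in> borel_measurable (lebesgue_on \<Omega>)" "AE x in lebesgue. x \<in> \<Omega> \<longrightarrow> f x = g x"
  shows "g \<in> borel_measurable (lebesgue_on \<Omega>)"
proof -
  have \<Omega>: "\<Omega> \<inter> space lebesgue \<in> sets lebesgue" using assms(1) by auto
  define F where "F x = indicator \<Omega> x *\<^sub>R f x" for x
  define G where "G x = indicator \<Omega> x *\<^sub>R g x" for x
  have Fm: "F \<in> borel_measurable lebesgue"
    using assms(2) \<Omega> by (auto simp: F_def[abs_def] borel_measurable_restrict_space_iff)
  have "G \<in> borel_measurable lebesgue"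
  proof (rule measurableI)
    fix S :: "'b set" assume S: "S \<in> sets borel"
    have A: "F -` S \<inter> space lebesgue \<in> sets lebesgue" using Fm S by (rule measurable_sets)
    have "AE x in lebesgue. x \<in> F -` S \<inter> space lebesgue \<longleftrightarrow> x \<in> G -` S \<inter> space lebesgue"
      using assms(3) by eventually_elim (auto simp: F_def G_def indicator_def)
    from completion.in_sets_AE[OF this A]
    show "G -` S \<inter> space lebesgue \<in> sets lebesgue" by simp
  qed simp
  then show ?thesis
    using \<Omega> by (auto simp: G_def[abs_def] borel_measurable_restrict_space_iff)
qed

lemma Lp_norm_AE_cong:
  fixes f g :: "real^'n::finite \<Rightarrow> 'b::euclidean_space"
  assumes "open \<Omega>" "f \<in> borel_measurable (lebesgue_on \<Omega>)" "g \<in> borel_measurable (lebesgue_on \<Omega>)"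
    "AE x in lebesgue. x \<in> \<Omega> \<longrightarrow> f x = g x"
  shows "Lp_norm (lebesgue_on \<Omega>) p f = Lp_norm (lebesgue_on \<Omega>) p g"
proof -
  have ae: "AE x in lebesgue_on \<Omega>. f x = g x"
    using assms(1,4) by (subst AE_restrict_space_iff) auto
  have "esssup (lebesgue_on \<Omega>) (\<lambda>x. ennreal (norm (f x))) = esssup (lebesgue_on \<Omega>) (\<lambda>x. ennreal (norm (g x)))"
  proof (rule esssup_AE_cong)
    show "AE x in lebesgue_on \<Omega>. ennreal (norm (f x)) = ennreal (norm (g x))"
      using ae by eventually_elim auto
  qed (use assms(2,3) in measurable)
  moreover have "(LINT x|lebesgue_on \<Omega>. norm (f x) powr q) = (LINT x|lebesgue_on \<Omega>. norm (g x) powr q)" for q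
  proof (rule integral_cong_AE)
    show "AE x in lebesgue_on \<Omega>. norm (f x) powr q = norm (g x) powr q"
      using ae by eventually_elim auto
  qed (use assms(2,3) in measurable)
  ultimately show ?thesis by (simp add: Lp_norm_def)
qed


text \<open>The gradient selected in \<open>W1p_norm\<close> agrees almost everywhere with g by
  \<open>weak_gradient_unique\<close>, and \<open>Lp_norm\<close> does not see null sets.\<close>

lemma W1p_norm_eq:
  fixes u :: "real^'n::finite \<Rightarrow> real"
  assumes "open \<Omega>" "weak_gradient \<Omega> u g" "g \<in> Lp_space (lebesgue_on \<Omega>) p"
  shows "W1p_norm p \<Omega> u = Lp_norm (lebesgue_on \<Omega>) p u + Lp_norm (lebesgue_on \<Omega>) p g"
proof -
  define g' where "g' = (SOME g. weak_gradient \<Omega> u g)"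
  have "weak_gradient \<Omega> u g'" unfolding g'_def by (rule someI[where P="weak_gradient \<Omega> u", OF assms(2)])
  then have ae: "AE x in lebesgue. x \<in> \<Omega> \<longrightarrow> g x = g' x"
    by (rule weak_gradient_unique[OF assms(1,2)])
  have gm: "g \<in> borel_measurable (lebesgue_on \<Omega>)" using assms(3) by (simp add: Lp_space_def)
  have "Lp_norm (lebesgue_on \<Omega>) p g = Lp_norm (lebesgue_on \<Omega>) p g'"
    by (rule Lp_norm_AE_cong[OF assms(1) gm borel_measurable_lebesgue_on_AE[OF assms(1) gm ae] ae])
  then show ?thesis by (simp add: W1p_norm_def g'_def)
qed

lemma Lp_norm_nonneg: "0 \<le> Lp_norm M p f"
  by (simp add: Lp_norm_def)

text \<open>An a priori bound of boundary integrals over F by the Sobolev norm forces uniqueness on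
  F: the approximants of a trace of 0 have norms tending to 0, so their integrals over F tend to 0,
  while they converge to \<open>\<phi>\<close> there. All uniqueness statements are reduced to such
  a bound.\<close>

lemma approx_trace_zero_on:
  assumes "open \<Omega>" and tr: "approx_trace p \<Omega> (\<lambda>_. 0) \<phi>" and loc: "frontier \<Omega> \<subseteq> Gamma_loc \<Omega>"
    and F: "compact F"
    and est: "\<And>u g. u \<in> Lp_space (lebesgue_on \<Omega>) p \<Longrightarrow> g \<in> Lp_space (lebesgue_on \<Omega>) p \<Longrightarrow>
        weak_gradient \<Omega> u g \<Longrightarrow> continuous_on (closure \<Omega>) u \<Longrightarrow>
        (\<integral>\<^sup>+x\<in>F. ennreal \<bar>u x\<bar> \<partial>H2) \<le> ennreal (C * (Lp_norm (lebesgue_on \<Omega>) p u + Lp_norm (lebesgue_on \<Omega>) p g))"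
  shows "AE x in H2. x \<in> F \<inter> frontier \<Omega> \<longrightarrow> \<phi> x = 0"
proof -
  define K where "K = F \<inter> frontier \<Omega>"
  have K: "compact K" "K \<subseteq> Gamma_loc \<Omega>" using F loc by (auto simp: K_def intro: compact_Int_closed)
  obtain U where U: "\<And>n. U n \<in> W1p p \<Omega>" "\<And>n. continuous_on (closure \<Omega>) (U n)" "\<And>n. U n \<in> L1_loc \<Omega>"
    "(\<lambda>n. W1p_norm p \<Omega> (U n)) \<longlonglongrightarrow> 0" "(\<lambda>n. LINT x:K|H2. \<bar>U n x - \<phi> x\<bar>) \<longlonglongrightarrow> 0"
    using tr K unfolding approx_trace_def by auto
  have \<phi>i: "set_integrable H2 K \<phi>" using tr K by (auto simp: approx_trace_def L1_loc_def)
  have Ui: "set_integrable H2 K (U n)" for n using U(3) K by (auto simp: L1_loc_def)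
  have bound: "(LINT x:K|H2. \<bar>U n x\<bar>) \<le> max C 0 * W1p_norm p \<Omega> (U n)" for n
  proof -
    obtain g where g: "g \<in> Lp_space (lebesgue_on \<Omega>) p" "weak_gradient \<Omega> (U n) g"
      and u: "U n \<in> Lp_space (lebesgue_on \<Omega>) p"
      using U(1)[of n] by (auto simp: W1p_def)
    have "(\<integral>\<^sup>+x. ennreal \<bar>U n x\<bar> * indicator K x \<partial>H2) \<le> (\<integral>\<^sup>+x\<in>F. ennreal \<bar>U n x\<bar> \<partial>H2)"
      by (rule nn_integral_mono) (auto simp: K_def indicator_def)
    also have "\<dots> \<le> ennreal (C * W1p_norm p \<Omega> (U n))"
      using est[OF u g U(2)] W1p_norm_eq[OF \<open>open \<Omega>\<close> g(2,1)] by simp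
    also have "\<dots> \<le> ennreal (max C 0 * W1p_norm p \<Omega> (U n))"
      by (intro ennreal_leI mult_right_mono) (auto simp: W1p_norm_def Lp_norm_nonneg)
    finally have 1: "(\<integral>\<^sup>+x. ennreal \<bar>U n x\<bar> * indicator K x \<partial>H2) \<le> ennreal (max C 0 * W1p_norm p \<Omega> (U n))" .
    have "(LINT x:K|H2. \<bar>U n x\<bar>) = enn2real (\<integral>\<^sup>+x. ennreal (indicator K x *\<^sub>R \<bar>U n x\<bar>) \<partial>H2)"
      unfolding set_lebesgue_integral_def
      using set_integrable_abs[OF Ui[of n]]
      by (intro integral_eq_nn_integral) (auto simp: set_integrable_def)
    also have "(\<integral>\<^sup>+x. ennreal (indicator K x *\<^sub>R \<bar>U n x\<bar>) \<partial>H2) = (\<integral>\<^sup>+x. ennreal \<bar>U n x\<bar> * indicator K x \<partial>H2)"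
      by (intro nn_integral_cong) (auto simp: indicator_def)
    also have "enn2real \<dots> \<le> max C 0 * W1p_norm p \<Omega> (U n)"
      using 1 by (intro enn2real_leI) (auto simp: W1p_norm_def Lp_norm_nonneg)
    finally show ?thesis .
  qed
  have "(LINT x:K|H2. \<bar>\<phi> x\<bar>) \<le> (LINT x:K|H2. \<bar>U n x - \<phi> x\<bar>) + max C 0 * W1p_norm p \<Omega> (U n)" for n
  proof -
    have "(LINT x:K|H2. \<bar>\<phi> x\<bar>) \<le> (LINT x:K|H2. \<bar>U n x - \<phi> x\<bar> + \<bar>U n x\<bar>)"
      by (intro set_integral_mono set_integral_add set_integrable_abs set_integral_diff \<phi>i Ui) auto
    also have "\<dots> = (LINT x:K|H2. \<bar>U n x - \<phi> x\<bar>) + (LINT x:K|H2. \<bar>U n x\<bar>)"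
      by (intro set_integral_add set_integrable_abs set_integral_diff \<phi>i Ui)
    finally show ?thesis using bound[of n] by linarith
  qed
  moreover have "(\<lambda>n. (LINT x:K|H2. \<bar>U n x - \<phi> x\<bar>) + max C 0 * W1p_norm p \<Omega> (U n)) \<longlonglongrightarrow> 0 + max C 0 * 0"
    by (intro tendsto_add tendsto_mult_left U)
  ultimately have "(LINT x:K|H2. \<bar>\<phi> x\<bar>) \<le> 0"
    by (intro LIMSEQ_le_const[where X="\<lambda>n. (LINT x:K|H2. \<bar>U n x - \<phi> x\<bar>) + max C 0 * W1p_norm p \<Omega> (U n)"]) auto
  moreover have "0 \<le> (LINT x:K|H2. \<bar>\<phi> x\<bar>)"
    unfolding set_lebesgue_integral_def by (rule integral_nonneg_AE) auto
  ultimately have "(LINT x:K|H2. \<bar>\<phi> x\<bar>) = 0" by (rule antisym)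
  then have "(LINT x|H2. indicator K x *\<^sub>R \<bar>\<phi> x\<bar>) = 0" by (simp add: set_lebesgue_integral_def)
  then have "AE x in H2. indicator K x *\<^sub>R \<bar>\<phi> x\<bar> = 0"
    using set_integrable_abs[OF \<phi>i] by (subst (asm) integral_nonneg_eq_0_iff_AE) (auto simp: set_integrable_def)
  then show ?thesis by eventually_elim (auto simp: K_def indicator_def split: if_splits)
qed

section \<open>Quasi-convexity via Lipschitz paths\<close>

lemma path_length_le_lipschitz:
  assumes "L-lipschitz_on {0..1} \<gamma>"
  shows "path_length \<gamma> \<le> ennreal L"
  unfolding path_length_def
proof (rule SUP_least, clarify)
  fix n :: nat and t :: "nat \<Rightarrow> real"
  assume t: "mono_on {..n} t" "t ` {..n} \<subseteq> {0..1}"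
  have L: "L \<ge> 0" using assms by (rule lipschitz_on_nonneg)
  have t01: "t i \<in> {0..1}" if "i \<le> n" for i using t(2) that by auto
  have "(\<Sum>i<n. dist (\<gamma> (t i)) (\<gamma> (t (Suc i)))) \<le> (\<Sum>i<n. L * (t (Suc i) - t i))"
  proof (rule sum_mono)
    fix i assume "i \<in> {..<n}"
    then have i: "i \<le> n" "Suc i \<le> n" by auto
    have "t i \<le> t (Suc i)" by (rule mono_onD[OF t(1)]) (use i in auto)
    then show "dist (\<gamma> (t i)) (\<gamma> (t (Suc i))) \<le> L * (t (Suc i) - t i)"
      using lipschitz_onD[OF assms t01[OF i(1)] t01[OF i(2)]] by (simp add: dist_real_def)
  qed
  also have "\<dots> = L * (t n - t 0)"
    by (simp add: sum_distrib_left[symmetric] sum_lessThan_telescope)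
  also have "\<dots> \<le> L * 1" using t01[of n] t01[of 0] L by (intro mult_left_mono) auto
  finally have "(\<Sum>i<n. dist (\<gamma> (t i)) (\<gamma> (t (Suc i)))) \<le> L" by simp
  then have "ennreal (\<Sum>i<n. dist (\<gamma> (t i)) (\<gamma> (t (Suc i)))) \<le> ennreal L" by (rule ennreal_leI)
  then show "(\<Sum>i<n. ennreal (dist (\<gamma> (t i)) (\<gamma> (t (Suc i))))) \<le> ennreal L" by (simp add: sum_ennreal)
qed

text \<open>A Lipschitz constant on the unit interval stands in for the length: it bounds the length
  from above and is easily tracked under concatenation.\<close>

definition lipschitz_joinable :: "'a::real_normed_vector set \<Rightarrow> real \<Rightarrow> 'a \<Rightarrow> 'a \<Rightarrow> bool" where
  "lipschitz_joinable S L p q \<longleftrightarrow> (\<exists>\<gamma>. path \<gamma> \<and> path_image \<gamma> \<subseteq> S \<and> pathstart \<gamma> = p \<and> pathfinish \<gamma> = q \<and> L-lipschitz_on {0..1} \<gamma>)"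

lemma lipschitz_joinable_geodesic_dist:
  assumes "lipschitz_joinable S L p q"
  shows "geodesic_dist S p q \<le> ennreal L"
proof -
  obtain \<gamma> where \<gamma>: "path \<gamma>" "path_image \<gamma> \<subseteq> S" "pathstart \<gamma> = p" "pathfinish \<gamma> = q" "L-lipschitz_on {0..1} \<gamma>"
    using assms by (auto simp: lipschitz_joinable_def)
  note l = path_length_le_lipschitz[OF \<gamma>(5)]
  then have "path_length \<gamma> < \<infinity>" by (simp add: le_less_trans)
  then have "geodesic_dist S p q \<le> path_length \<gamma>"
    unfolding geodesic_dist_def using \<gamma> by (intro INF_lower) auto
  then show ?thesis using l by (rule order_trans)
qed

lemma lipschitz_joinable_mono: "lipschitz_joinable S L p q \<Longrightarrow> L \<le> L' \<Longrightarrow> lipschitz_joinable S L' p q"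
  unfolding lipschitz_joinable_def using lipschitz_on_le by blast

lemma lipschitz_joinable_segment:
  assumes "convex C" "C \<subseteq> S" "p \<in> C" "q \<in> C"
  shows "lipschitz_joinable S (dist p q) p q"
  unfolding lipschitz_joinable_def
proof (intro exI conjI)
  show "path (linepath p q)" by simp
  show "path_image (linepath p q) \<subseteq> S"
    using assms closed_segment_subset[of p C q] by auto
  show "(dist p q)-lipschitz_on {0..1} (linepath p q)"
  proof (rule lipschitz_onI)
    fix x y :: real
    have "linepath p q x - linepath p q y = (x - y) *\<^sub>R (q - p)"
      by (simp add: linepath_def algebra_simps)
    then show "dist (linepath p q x) (linepath p q y) \<le> dist p q * dist x y"
      by (simp add: dist_norm norm_minus_commute mult.commute)
  qed simp
qed simp_all

text \<open>Each half is run at double speed, which is why a common L doubles.\<close>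

lemma lipschitz_joinable_trans:
  assumes "lipschitz_joinable S L p q" "lipschitz_joinable S L q r"
  shows "lipschitz_joinable S (2 * L) p r"
proof -
  obtain f where f: "path f" "path_image f \<subseteq> S" "pathstart f = p" "pathfinish f = q" "L-lipschitz_on {0..1} f"
    using assms(1) by (auto simp: lipschitz_joinable_def)
  obtain g where g: "path g" "path_image g \<subseteq> S" "pathstart g = q" "pathfinish g = r" "L-lipschitz_on {0..1} g"
    using assms(2) by (auto simp: lipschitz_joinable_def)
  have L: "L \<ge> 0" using f(5) by (rule lipschitz_on_nonneg)
  have "(2 * L)-lipschitz_on {0..1/2} (\<lambda>x. f (2 * x))"
  proof (rule lipschitz_onI)
    fix x y :: real assume "x \<in> {0..1/2}" "y \<in> {0..1/2}"
    then show "dist (f (2 * x)) (f (2 * y)) \<le> 2 * L * dist x y"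
      using lipschitz_onD[OF f(5), of "2 * x" "2 * y"] by (simp add: dist_real_def abs_if algebra_simps split: if_splits)
  qed (use L in simp)
  moreover have "(2 * L)-lipschitz_on {1/2..1} (\<lambda>x. g (2 * x - 1))"
  proof (rule lipschitz_onI)
    fix x y :: real assume "x \<in> {1/2..1}" "y \<in> {1/2..1}"
    then show "dist (g (2 * x - 1)) (g (2 * y - 1)) \<le> 2 * L * dist x y"
      using lipschitz_onD[OF g(5), of "2 * x - 1" "2 * y - 1"] by (simp add: dist_real_def abs_if algebra_simps split: if_splits)
  qed (use L in simp)
  ultimately have "(2 * L)-lipschitz_on {0..1} (f +++ g)"
    unfolding joinpaths_def
    by (rule lipschitz_on_concat) (use f g in \<open>simp add: pathstart_def pathfinish_def\<close>)
  then show ?thesis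
    unfolding lipschitz_joinable_def using f g
    by (intro exI[of _ "f +++ g"]) (auto simp: path_image_join)
qed

lemma lipschitz_joinable_imp_quasi_convex:
  assumes "C \<ge> 0" "\<And>p q. p \<in> S \<Longrightarrow> q \<in> S \<Longrightarrow> lipschitz_joinable S (C * dist p q) p q"
  shows "quasi_convex S" "connected S"
proof -
  show "quasi_convex S"
    unfolding quasi_convex_def
    by (intro exI[of _ C] ballI lipschitz_joinable_geodesic_dist assms)
  have "path_connected S"
    unfolding path_connected_def using assms(2) unfolding lipschitz_joinable_def by blast
  then show "connected S" by (rule path_connected_imp_connected)
qed

section \<open>The domain\<close>

text \<open>With the exponent k^2 every spacing is an integral multiple of all later ones, so the
  lines of a coarse level are lines of each finer level.\<close>

definition spacing :: "nat \<Rightarrow> real" where "spacing k = (1 / 2) ^ (k\<^sup>2)"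
text \<open>Relative to the spacing this is 2^-(k+6)/3. The power of two makes the relative widths
  summable with a small sum; the divisor 3 keeps the right edge of a slit off every finer
  grid.\<close>

definition width :: "nat \<Rightarrow> real" where "width k = (1 / 2) ^ (k\<^sup>2 + k + 6) / 3"

text \<open>The truncated subtraction makes \<open>height 0 = 1\<close>; for \<open>k > 0\<close> it is \<open>(spacing (k - 1))\<^sup>2\<close>.\<close>

definition height :: "nat \<Rightarrow> real" where "height k = (1 / 4) ^ ((k - 1)\<^sup>2)"

definition slits :: "nat \<Rightarrow> real set" where
  "slits k = (\<Union>m::int. {of_int m * spacing k <..< of_int m * spacing k + width k})"

text \<open>Slits of both directions occur at every level, so each slab crosses slabs of all coarser
  levels, and these are at least as high because \<open>height\<close> decreases.\<close>

definition domain :: "(real^3) set" where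
  "domain = {p. \<exists>k. 0 < p $ 3 \<and> p $ 3 < height k \<and> (p $ 1 \<in> slits k \<or> p $ 2 \<in> slits k)}"

definition slab :: "3 \<Rightarrow> nat \<Rightarrow> int \<Rightarrow> (real^3) set" where
  "slab i k m = {p. of_int m * spacing k < p $ i \<and> p $ i < of_int m * spacing k + width k \<and> 0 < p $ 3 \<and> p $ 3 < height k}"

lemma spacing_pos: "spacing k > 0" by (simp add: spacing_def)
lemma width_pos: "width k > 0" by (simp add: width_def)
lemma height_pos: "height k > 0" by (simp add: height_def)

lemma width_eq: "width k = spacing k * (1 / 2) ^ (k + 6) / 3"
  by (simp add: width_def spacing_def power_add add.assoc)

lemma width_le: "width k \<le> spacing k / 3"
  using spacing_pos[of k] by (simp add: width_eq power_le_one)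

lemma height_Suc: "height (Suc k) = (spacing k)\<^sup>2"
  by (simp add: height_def spacing_def power_divide power_mult[symmetric] mult.commute) (simp add: power_mult)

lemma height_antimono: "k \<le> l \<Longrightarrow> height l \<le> height k"
  unfolding height_def by (intro power_decreasing power_mono diff_le_mono) auto

lemma spacing_antimono: "k \<le> l \<Longrightarrow> spacing l \<le> spacing k"
  unfolding spacing_def by (intro power_decreasing power_mono) auto

lemma spacing_multiple: "k \<le> l \<Longrightarrow> spacing k = of_int (2 ^ (l\<^sup>2 - k\<^sup>2)) * spacing l"
proof -
  assume "k \<le> l"
  then have "k\<^sup>2 \<le> l\<^sup>2" by (intro power_mono) auto
  then have "(2::real) ^ (l\<^sup>2) = 2 ^ (l\<^sup>2 - k\<^sup>2) * 2 ^ (k\<^sup>2)" by (simp add: power_add[symmetric])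
  then show ?thesis by (simp add: spacing_def power_divide field_simps)
qed

lemma spacing_tendsto: "spacing \<longlonglongrightarrow> 0"
  unfolding spacing_def by real_asymp

lemma height_tendsto: "height \<longlonglongrightarrow> 0"
proof -
  have "(\<lambda>k. height (Suc k)) \<longlonglongrightarrow> 0\<^sup>2"
    unfolding height_Suc by (intro tendsto_power spacing_tendsto)
  then show ?thesis by (simp add: filterlim_sequentially_Suc)
qed

lemma slab_subset_domain: "i \<noteq> 3 \<Longrightarrow> slab i k m \<subseteq> domain"
proof -
  assume "i \<noteq> 3"
  then have "i = 1 \<or> i = 2" using exhaust_3[of i] by auto
  then show ?thesis by (auto simp: slab_def domain_def slits_def intro!: exI[of _ k])
qed

lemma domain_eq: "domain = (\<Union>i\<in>{1,2}. \<Union>k m. slab i k m)"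
  by (auto simp: slab_def domain_def slits_def)

lemma mem_domainE:
  assumes "p \<in> domain" obtains i k m where "i \<noteq> 3" "p \<in> slab i k m"
proof -
  from assms obtain i k m where "i \<in> {1, 2::3}" "p \<in> slab i k m" unfolding domain_eq by blast
  then show ?thesis by (intro that[of i k m]) auto
qed

lemma open_slab: "open (slab i k m)"
  unfolding slab_def by (intro open_Collect_conj open_Collect_less continuous_intros)

lemma open_domain: "open domain"
  unfolding domain_eq by (intro open_UN ballI open_slab)

lemma convex_slab: "convex (slab i k m)"
proof -
  have "slab i k m = {p. axis i 1 \<bullet> p > of_int m * spacing k} \<inter> {p. axis i 1 \<bullet> p < of_int m * spacing k + width k} \<inter>
     {p. axis 3 1 \<bullet> p > 0} \<inter> {p. axis 3 1 \<bullet> p < height k}"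
    by (auto simp: slab_def inner_axis')
  then show ?thesis by (simp add: convex_Int convex_halfspace_gt convex_halfspace_lt)
qed

lemma domain_nonempty: "domain \<noteq> {}"
proof -
  have "(\<chi> l. if l = 3 then height 0 / 2 else width 0 / 2) \<in> slab 1 0 0"
    using height_pos[of 0] width_pos[of 0] by (simp add: slab_def)
  then show ?thesis using slab_subset_domain[of 1 0 0] by auto
qed

section \<open>Quasi-convexity of the domain\<close>

definition upd :: "real^3 \<Rightarrow> 3 \<Rightarrow> real \<Rightarrow> real^3" where
  "upd p i x = (\<chi> l. if l = i then x else p $ l)"

lemma upd_nth [simp]: "upd p i x $ l = (if l = i then x else p $ l)"
  by (simp add: upd_def)

lemma dist_upd: "dist p (upd p i x) = \<bar>x - p $ i\<bar>" "dist (upd p i x) p = \<bar>x - p $ i\<bar>"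
proof -
  have "upd p i x - p = (x - p $ i) *\<^sub>R axis i 1"
    by (auto simp: vec_eq_iff axis_def)
  then have "norm (upd p i x - p) = \<bar>x - p $ i\<bar>" by (simp add: norm_axis_1)
  then show "dist p (upd p i x) = \<bar>x - p $ i\<bar>" "dist (upd p i x) p = \<bar>x - p $ i\<bar>"
    by (auto simp: dist_norm norm_minus_commute)
qed

lemma component_dist: "\<bar>p $ i - q $ i\<bar> \<le> dist p (q :: real^'n::finite)"
  using component_le_norm_cart[of "p - q" i] by (simp add: dist_norm)

text \<open>Both slits start at multiples of \<open>spacing l\<close>. If the finer one lies on the
  left, the gap is at least a full spacing minus \<open>width l\<close>. If it lies on the right,
  the gap is a multiple of \<open>spacing l\<close> minus \<open>width k\<close>. When
  \<open>width k\<close> is small this is at least two thirds of the spacing; otherwise it is an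
  integral number of thirds, which is not 0 because 3 does not divide a power of two.\<close>

lemma separated_slits:
  assumes "k \<le> l" and x: "of_int m * spacing k < x" "x < of_int m * spacing k + width k"
    and y: "of_int m' * spacing l < y" "y < of_int m' * spacing l + width l"
    and disj: "{of_int m * spacing k <..< of_int m * spacing k + width k} \<inter> {of_int m' * spacing l <..< of_int m' * spacing l + width l} = {}"
  shows "spacing l / 3 \<le> \<bar>x - y\<bar>"
proof -
  obtain c :: int where c: "spacing k = of_int c * spacing l" using spacing_multiple[OF assms(1)] by blast
  define a where "a = m * c"
  have a: "of_int m * spacing k = of_int a * spacing l" by (simp add: a_def c)
  have "of_int m' * spacing l \<ge> of_int a * spacing l + width k \<or> of_int a * spacing l \<ge> of_int m' * spacing l + width l"
  proof (rule ccontr)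
    assume "\<not> ?thesis"
    then have "max (of_int a * spacing l) (of_int m' * spacing l) < min (of_int a * spacing l + width k) (of_int m' * spacing l + width l)"
      using width_pos[of k] width_pos[of l] by auto
    then obtain z where "max (of_int a * spacing l) (of_int m' * spacing l) < z" "z < min (of_int a * spacing l + width k) (of_int m' * spacing l + width l)"
      using dense by blast
    then have "z \<in> {of_int m * spacing k <..< of_int m * spacing k + width k} \<inter> {of_int m' * spacing l <..< of_int m' * spacing l + width l}"
      by (simp add: a)
    then show False using disj by blast
  qed
  then show ?thesis
  proof
    assume 1: "of_int a * spacing l \<ge> of_int m' * spacing l + width l"
    then have "of_int m' * spacing l < of_int a * spacing l" using width_pos[of l] by linarith
    then have "m' + 1 \<le> a" using spacing_pos[of l] by simp
    then have "of_int (m' + 1) * spacing l \<le> of_int a * spacing l" using spacing_pos[of l] by (intro mult_right_mono) auto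
    then have "of_int m' * spacing l + spacing l \<le> of_int a * spacing l" by (simp add: algebra_simps)
    then show ?thesis using x y width_le[of l] spacing_pos[of l] unfolding a by linarith
  next
    assume 2: "of_int m' * spacing l \<ge> of_int a * spacing l + width k"
    have "of_int m' * spacing l - (of_int a * spacing l + width k) \<ge> spacing l / 3"
    proof (cases "l\<^sup>2 \<le> k\<^sup>2 + k + 6")
      case True
      have "width k \<le> spacing l / 3" unfolding width_def spacing_def
        by (intro divide_right_mono power_decreasing True) auto
      moreover have "of_int a * spacing l < of_int m' * spacing l" using 2 width_pos[of k] by linarith
      then have "a + 1 \<le> m'" using spacing_pos[of l] by simp
      then have "of_int (a + 1) * spacing l \<le> of_int m' * spacing l" using spacing_pos[of l] by (intro mult_right_mono) auto
      then have "of_int a * spacing l + spacing l \<le> of_int m' * spacing l" by (simp add: algebra_simps)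
      ultimately show ?thesis using spacing_pos[of l] by linarith
    next
      case False
      define e where "e = l\<^sup>2 - (k\<^sup>2 + k + 6)"
      have "l\<^sup>2 = e + (k\<^sup>2 + k + 6)" using False by (simp add: e_def)
      then have w: "width k = of_int (2 ^ e) * spacing l / 3"
        by (simp add: width_def spacing_def power_add power_divide)
      \<comment> \<open>The gap counted in thirds of \<open>spacing l\<close>: nonnegative by the
        order of the slits, and not divisible by 3.\<close>
      define b where "b = 3 * (m' - a) - 2 ^ e"
      have b: "of_int m' * spacing l - (of_int a * spacing l + width k) = of_int b * spacing l / 3"
        by (simp add: w b_def algebra_simps)
      have "of_int b * spacing l / 3 \<ge> 0" using 2 b by linarith
      then have "b \<ge> 0" using spacing_pos[of l] by (simp add: zero_le_mult_iff)
      moreover have "\<not> 3 dvd (2::int) ^ e"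
      proof (induction e)
        case (Suc e)
        have "\<not> 3 dvd x \<Longrightarrow> \<not> 3 dvd 2 * x" for x :: int by presburger
        then show ?case using Suc by simp
      qed simp
      then have "b \<noteq> 0" unfolding b_def by presburger
      ultimately have "b \<ge> 1" by linarith
      then have "1 * spacing l / 3 \<le> of_int b * spacing l / 3" using spacing_pos[of l] by (intro divide_right_mono mult_right_mono) auto
      then show ?thesis using b by linarith
    qed
    then show ?thesis using x y unfolding a by linarith
  qed
qed

text \<open>If the slits are disjoint, the points are at least \<open>spacing l / 3\<close> apart,
  so a detour along the slit to the next crossing slit of level l costs a bounded multiple of their
  distance d. The crossing slab is high enough because both points are at the height of q, which
  lies in level l. If the slits overlap, at most one turn suffices. Every leg has length at most 4
  d, and two concatenations double this to 16 d.\<close>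

lemma lipschitz_joinable_same_height:
  assumes "k \<le> l" "i \<noteq> 3" "j \<noteq> 3" "i \<noteq> j" and p: "p \<in> slab i k m" and q: "q \<in> slab i l m'" and z: "p $ 3 = q $ 3"
  shows "lipschitz_joinable domain (16 * dist p q) p q"
proof -
  define d where "d = dist p q"
  have d: "d \<ge> 0" by (simp add: d_def)
  note sub = slab_subset_domain[OF \<open>i \<noteq> 3\<close>] and subj = slab_subset_domain[OF \<open>j \<noteq> 3\<close>]
  have seg: "lipschitz_joinable domain (4 * d) a b" if "a \<in> slab i' k' m''" "b \<in> slab i' k' m''" "dist a b \<le> 4 * d" "i' \<noteq> 3" for a b i' k' m''
    using lipschitz_joinable_mono[OF lipschitz_joinable_segment[OF convex_slab slab_subset_domain[OF that(4)] that(1,2)] that(3)] .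
  show ?thesis
  proof (cases "{of_int m * spacing k <..< of_int m * spacing k + width k} \<inter> {of_int m' * spacing l <..< of_int m' * spacing l + width l} = {}")
    case True
    have dl: "spacing l / 3 \<le> d"
      using separated_slits[OF assms(1) _ _ _ _ True, of "p $ i" "q $ i"] p q component_dist[of p i q]
      by (auto simp: slab_def d_def)
    define n where "n = \<lfloor>p $ j / spacing l\<rfloor>"
    define y where "y = of_int n * spacing l + width l / 2"
    have n: "of_int n * spacing l \<le> p $ j" "p $ j < of_int n * spacing l + spacing l"
    proof -
      have "of_int n \<le> p $ j / spacing l" "p $ j / spacing l < of_int n + 1" by (auto simp: n_def)
      then show "of_int n * spacing l \<le> p $ j" "p $ j < of_int n * spacing l + spacing l"
        using spacing_pos[of l] by (auto simp: field_simps)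
    qed
    \<comment> \<open>Both numbers lie in the same grid interval of length \<open>spacing l\<close>,
      which is at most 3 d.\<close>
    have yj: "\<bar>y - p $ j\<bar> \<le> 3 * d"
      using n width_pos[of l] width_le[of l] dl unfolding y_def by linarith
    have yn: "of_int n * spacing l < y" "y < of_int n * spacing l + width l"
      using width_pos[of l] by (auto simp: y_def)
    define r where "r = upd p j y"
    define r' where "r' = upd q j y"
    have s: "r \<in> slab i k m" "r' \<in> slab i l m'" "r \<in> slab j l n" "r' \<in> slab j l n"
      using p q z yn assms by (auto simp: slab_def r_def r'_def)
    have "r' $ i = q $ i" "r $ i = p $ i" "r $ j = y" "r' $ j = y" "r $ 3 = r' $ 3"
      using assms by (auto simp: r_def r'_def)
    then have "r' = upd r i (q $ i)"
      using assms exhaust_3 by (auto simp: vec_eq_iff) (metis (full_types) exhaust_3 assms(2-4))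
    then have "dist r r' = \<bar>q $ i - p $ i\<bar>" using assms by (simp add: dist_upd r_def)
    then have rr: "dist r r' \<le> d" using component_dist[of p i q] by (simp add: d_def)
    have pr: "dist p r \<le> 3 * d" using yj by (simp add: r_def dist_upd)
    have "\<bar>y - q $ j\<bar> \<le> 4 * d" using yj component_dist[of p j q] unfolding d_def by linarith
    then have qr: "dist r' q \<le> 4 * d" by (simp add: r'_def dist_upd)
    have "lipschitz_joinable domain (2 * (4 * d)) p r'"
      by (rule lipschitz_joinable_trans[OF seg[OF p s(1)] seg[OF s(3,4)]]) (use pr rr d assms in auto)
    moreover have "lipschitz_joinable domain (2 * (4 * d)) r' q"
      by (rule lipschitz_joinable_mono[OF seg[OF s(2) q qr]]) (use d assms in auto)
    ultimately have "lipschitz_joinable domain (2 * (2 * (4 * d))) p q"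
      by (rule lipschitz_joinable_trans)
    then show ?thesis by (simp add: d_def)
  next
    case False
    then obtain x where "x \<in> {of_int m * spacing k <..< of_int m * spacing k + width k} \<inter>
        {of_int m' * spacing l <..< of_int m' * spacing l + width l}" by blast
    then have x: "of_int m * spacing k < x" "x < of_int m * spacing k + width k"
       "of_int m' * spacing l < x" "x < of_int m' * spacing l + width l" by auto
    \<comment> \<open>The slits overlap at x: either one of the points already lies in the slit of
      the other, or x lies between their coordinates and marks the turning point.\<close>
    consider "p $ i \<in> {of_int m' * spacing l <..< of_int m' * spacing l + width l}" |
      "q $ i \<in> {of_int m * spacing k <..< of_int m * spacing k + width k}" |
      "min (p $ i) (q $ i) \<le> x \<and> x \<le> max (p $ i) (q $ i)"
      using x p q by (simp add: slab_def) linarith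
    then show ?thesis
    proof cases
      case 1
      then have "p \<in> slab i l m'" using p q z by (auto simp: slab_def)
      then have "lipschitz_joinable domain (4 * d) p q" using q d assms by (intro seg) (auto simp: d_def)
      then show ?thesis by (rule lipschitz_joinable_mono) (simp add: d_def)
    next
      case 2
      then have "q \<in> slab i k m" using p q z by (auto simp: slab_def)
      then have "lipschitz_joinable domain (4 * d) p q" using p d assms by (intro seg) (auto simp: d_def)
      then show ?thesis by (rule lipschitz_joinable_mono) (simp add: d_def)
    next
      case 3
      define r where "r = upd p i x"
      have "r \<in> slab i k m" "r \<in> slab i l m'" using p q z x assms by (auto simp: r_def slab_def)
      moreover have pr: "dist p r \<le> d" using 3 component_dist[of p i q] by (simp add: r_def dist_upd d_def) linarith
      moreover have "dist r q \<le> 4 * d"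
        using pr dist_triangle[of r q p] d unfolding dist_commute[of r p] d_def[symmetric] by linarith
      ultimately have "lipschitz_joinable domain (2 * (4 * d)) p q"
        using p q d assms by (intro lipschitz_joinable_trans[of _ _ p r q] seg) auto
      then show ?thesis by (rule lipschitz_joinable_mono) (simp add: d_def)
    qed
  qed
qed

lemma lipschitz_joinable_sym:
  assumes "lipschitz_joinable S L p q" shows "lipschitz_joinable S L q p"
proof -
  obtain f where f: "path f" "path_image f \<subseteq> S" "pathstart f = p" "pathfinish f = q" "L-lipschitz_on {0..1} f"
    using assms by (auto simp: lipschitz_joinable_def)
  have "L-lipschitz_on {0..1} (reversepath f)"
  proof (rule lipschitz_onI)
    fix x y :: real assume "x \<in> {0..1}" "y \<in> {0..1}"
    then show "dist (reversepath f x) (reversepath f y) \<le> L * dist x y"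
      using lipschitz_onD[OF f(5), of "1 - x" "1 - y"] by (simp add: reversepath_def dist_real_def abs_minus_commute)
  qed (use f(5) lipschitz_on_nonneg in blast)
  then show ?thesis using f unfolding lipschitz_joinable_def
    by (intro exI[of _ "reversepath f"]) auto
qed

text \<open>Slabs start at height 0, so moving down stays inside them, and both points can be
  brought to the lower of the two heights. There they are at most 3 d apart. Parallel slabs are
  joined at cost 48 d by the previous construction; crossing slabs share the point that takes one
  horizontal coordinate from each. Two more concatenations give 192 d.\<close>

lemma domain_lipschitz_joinable:
  assumes p: "p \<in> domain" and q: "q \<in> domain"
  shows "lipschitz_joinable domain (192 * dist p q) p q"
proof -
  define d where "d = dist p q"
  obtain i k m where pm: "i \<noteq> 3" "p \<in> slab i k m" using mem_domainE[OF p] .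
  obtain i' l m' where qm: "i' \<noteq> 3" "q \<in> slab i' l m'" using mem_domainE[OF q] .
  define z where "z = min (p $ 3) (q $ 3)"
  define p' where "p' = upd p 3 z"
  define q' where "q' = upd q 3 z"
  have s: "p' \<in> slab i k m" "q' \<in> slab i' l m'" "p' $ 3 = q' $ 3"
    using pm qm by (auto simp: p'_def q'_def z_def slab_def)
  have zd: "\<bar>z - p $ 3\<bar> \<le> d" "\<bar>z - q $ 3\<bar> \<le> d"
    using component_dist[of p 3 q] unfolding z_def d_def by linarith+
  have pp: "dist p p' \<le> d" "dist q' q \<le> d" using zd by (auto simp: p'_def q'_def dist_upd)
  have "dist p' q' \<le> dist p' p + (dist p q + dist q q')"
    using dist_triangle[of p' q' p] dist_triangle[of p q' q] by linarith
  then have d': "dist p' q' \<le> 3 * d" using pp by (simp add: d_def dist_commute)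
  have d0: "d \<ge> 0" by (simp add: d_def)
  have mid: "lipschitz_joinable domain (48 * d) p' q'"
  proof (cases "i = i'")
    case True
    obtain j :: 3 where j: "j \<noteq> 3" "i \<noteq> j"
      by (cases "i = 1") (use that[of 1] that[of 2] in auto)
    have "lipschitz_joinable domain (16 * dist p' q') p' q'"
    proof (cases "k \<le> l")
      case kl: True
      show ?thesis using lipschitz_joinable_same_height[OF kl pm(1) j s(1)] s True by simp
    next
      case kl: False
      have "lipschitz_joinable domain (16 * dist q' p') q' p'"
        using lipschitz_joinable_same_height[of l k i j q' m' p' m] kl pm(1) j s True by simp
      then show ?thesis by (simp add: lipschitz_joinable_sym dist_commute)
    qed
    then show ?thesis by (rule lipschitz_joinable_mono) (use d' in simp)
  next
    case False
    define r where "r = upd p' i' (q' $ i')"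
    have r: "r \<in> slab i k m" "r \<in> slab i' l m'" using s False qm pm by (auto simp: r_def slab_def)
    have pr: "dist p' r \<le> 3 * d" using component_dist[of p' i' q'] d' by (simp add: r_def dist_upd abs_minus_commute)
    have rq: "dist r q' \<le> 6 * d" using dist_triangle[of r q' p'] pr d' by (simp add: dist_commute)
    have "lipschitz_joinable domain (6 * d) p' r"
      by (rule lipschitz_joinable_mono[OF lipschitz_joinable_segment[OF convex_slab slab_subset_domain[OF pm(1)] s(1) r(1)]]) (use pr d0 in simp)
    moreover have "lipschitz_joinable domain (6 * d) r q'"
      by (rule lipschitz_joinable_mono[OF lipschitz_joinable_segment[OF convex_slab slab_subset_domain[OF qm(1)] r(2) s(2)]]) (use rq d0 in simp)
    ultimately have "lipschitz_joinable domain (2 * (6 * d)) p' q'" by (rule lipschitz_joinable_trans)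
    then show ?thesis by (rule lipschitz_joinable_mono) (use d0 in simp)
  qed
  have "lipschitz_joinable domain (48 * d) p p'"
    by (rule lipschitz_joinable_mono[OF lipschitz_joinable_segment[OF convex_slab slab_subset_domain[OF pm(1)] pm(2) s(1)]]) (use pp d0 in simp)
  then have "lipschitz_joinable domain (2 * (48 * d)) p q'" using mid by (rule lipschitz_joinable_trans)
  moreover have "lipschitz_joinable domain (2 * (48 * d)) q' q"
    by (rule lipschitz_joinable_mono[OF lipschitz_joinable_segment[OF convex_slab slab_subset_domain[OF qm(1)] s(2) qm(2)]]) (use pp d0 in simp)
  ultimately have "lipschitz_joinable domain (2 * (2 * (48 * d))) p q" by (rule lipschitz_joinable_trans)
  then show ?thesis by (simp add: d_def)
qed

lemma quasi_convex_domain: "quasi_convex domain" and connected_domain: "connected domain"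
  using lipschitz_joinable_imp_quasi_convex[of 192 domain] domain_lipschitz_joinable by auto

subsection \<open>The boundary of the domain\<close>

lemma floor_spacing:
  "of_int \<lfloor>x / spacing k\<rfloor> * spacing k \<le> x" "x < of_int (\<lfloor>x / spacing k\<rfloor> + 1) * spacing k"
proof -
  have "of_int \<lfloor>x / spacing k\<rfloor> \<le> x / spacing k" by (rule of_int_floor_le)
  then show "of_int \<lfloor>x / spacing k\<rfloor> * spacing k \<le> x"
    by (simp only: pos_le_divide_eq[OF spacing_pos])
  have "x / spacing k < of_int (\<lfloor>x / spacing k\<rfloor> + 1)" by auto
  then show "x < of_int (\<lfloor>x / spacing k\<rfloor> + 1) * spacing k"
    by (simp only: pos_divide_less_eq[OF spacing_pos])
qed

text \<open>The union is infinite, so closedness is read off from the complement, which is the union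
  of the open gaps between consecutive slits.\<close>

lemma closed_closed_slits: "closed (\<Union>m::int. {of_int m * spacing k .. of_int m * spacing k + width k})"
proof -
  let ?A = "\<Union>m::int. {of_int m * spacing k .. of_int m * spacing k + width k}"
  let ?B = "\<Union>m::int. {of_int m * spacing k + width k <..< of_int (m + 1) * spacing k}"
  have "- ?A = ?B"
  proof (intro equalityI subsetI)
    fix x assume x: "x \<in> - ?A"
    let ?m = "\<lfloor>x / spacing k\<rfloor>"
    have "x \<notin> {of_int ?m * spacing k .. of_int ?m * spacing k + width k}" using x by blast
    then have "of_int ?m * spacing k + width k < x"
      using floor_spacing(1)[where x=x and k=k] by auto
    then have "x \<in> {of_int ?m * spacing k + width k <..< of_int (?m + 1) * spacing k}"
      using floor_spacing(2)[where x=x and k=k] unfolding greaterThanLessThan_iff by blast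
    then show "x \<in> ?B" by blast
  next
    fix x assume "x \<in> ?B"
    then obtain m :: int where m: "of_int m * spacing k + width k < x" "x < of_int (m + 1) * spacing k" by auto
    have "\<not> (of_int m' * spacing k \<le> x \<and> x \<le> of_int m' * spacing k + width k)" for m' :: int
    proof (cases "m' \<le> m")
      case True
      then have "of_int m' * spacing k \<le> of_int m * spacing k" using spacing_pos[of k] by (intro mult_right_mono) auto
      then show ?thesis using m by linarith
    next
      case False
      then have "of_int (m + 1) * spacing k \<le> of_int m' * spacing k" using spacing_pos[of k] by (intro mult_right_mono) auto
      then show ?thesis using m by linarith
    qed
    then show "x \<in> - ?A" by auto
  qed
  moreover have "open ?B" by (intro open_UN ballI open_greaterThanLessThan)
  ultimately show ?thesis by (simp add: closed_def)
qed

definition closed_slab :: "3 \<Rightarrow> nat \<Rightarrow> int \<Rightarrow> (real^3) set" where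
  "closed_slab i k m = {p. of_int m * spacing k \<le> p $ i \<and> p $ i \<le> of_int m * spacing k + width k \<and> 0 \<le> p $ 3 \<and> p $ 3 \<le> height k}"

text \<open>Only finitely many levels reach up to half the height of p, and for each of them the
  union of the closed slabs is closed. Accumulation of infinitely many levels can therefore happen
  only in the plane.\<close>

lemma closure_domain_cases:
  assumes "p \<in> closure domain"
  shows "p $ 3 = 0 \<or> p $ 3 > 0 \<and> (\<exists>i k m. i \<noteq> 3 \<and> p \<in> closed_slab i k m)"
proof -
  have "closed {p::real^3. 0 \<le> p $ 3}" by (intro closed_Collect_le continuous_intros)
  then have "closure domain \<subseteq> {p. 0 \<le> p $ 3}"
    by (intro closure_minimal) (auto simp: domain_def)
  then have p0: "0 \<le> p $ 3" using assms by auto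
  show ?thesis
  proof (cases "p $ 3 = 0")
    case False
    then have pos: "p $ 3 > 0" using p0 by simp
    then obtain K where K: "\<And>k. k \<ge> K \<Longrightarrow> height k < p $ 3 / 2"
      using order_tendstoD(2)[OF height_tendsto, of "p $ 3 / 2"] by (auto simp: eventually_sequentially)
    define Z where "Z = (\<Union>i\<in>{1,2::3}. \<Union>k\<in>{..K}. {q::real^3. q $ i \<in> (\<Union>m::int. {of_int m * spacing k .. of_int m * spacing k + width k}) \<and> 0 \<le> q $ 3 \<and> q $ 3 \<le> height k})"
    have "closed {q::real^3. q $ i \<in> (\<Union>m::int. {of_int m * spacing k .. of_int m * spacing k + width k}) \<and> 0 \<le> q $ 3 \<and> q $ 3 \<le> height k}" for i k
    proof (intro closed_Collect_conj closed_Collect_le continuous_intros)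
      have "closed ((\<lambda>q::real^3. q $ i) -` (\<Union>m::int. {of_int m * spacing k .. of_int m * spacing k + width k}))"
        by (intro closed_vimage closed_closed_slits continuous_intros)
      then show "closed {q::real^3. q $ i \<in> (\<Union>m::int. {of_int m * spacing k .. of_int m * spacing k + width k})}"
        by (simp add: vimage_def)
    qed
    then have Zc: "closed Z" unfolding Z_def by (intro closed_UN finite.intros finite_atMost ballI)
    have "closed (Z \<union> {q. q $ 3 \<le> p $ 3 / 2})"
      by (intro closed_Un Zc closed_Collect_le continuous_intros)
    moreover have "domain \<subseteq> Z \<union> {q. q $ 3 \<le> p $ 3 / 2}"
    proof
      fix q assume "q \<in> domain"
      then obtain i k m where q: "i \<in> {1, 2::3}" "q \<in> slab i k m" unfolding domain_eq by blast
      show "q \<in> Z \<union> {q. q $ 3 \<le> p $ 3 / 2}"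
      proof (cases "k \<le> K")
        case True
        then have "q \<in> Z" unfolding Z_def using q
          by (intro UN_I[of i] UN_I[of k] CollectI conjI UN_I[of m]) (auto simp: slab_def)
        then show ?thesis by simp
      next
        case False then show ?thesis using K[of k] q(2) by (auto simp: slab_def)
      qed
    qed
    ultimately have "closure domain \<subseteq> Z \<union> {q. q $ 3 \<le> p $ 3 / 2}" by (rule closure_minimal[rotated])
    then have "p \<in> Z" using assms pos by auto
    then obtain i k m where "i \<in> {1, 2::3}" "p \<in> closed_slab i k m" by (auto simp: Z_def closed_slab_def)
    moreover have "i \<noteq> 3" using calculation(1) by auto
    ultimately show ?thesis using pos by blast
  qed simp
qed

lemma frontier_domain_cases:
  assumes "p \<in> frontier domain"
  shows "p $ 3 = 0 \<or> (\<exists>i k m. i \<noteq> 3 \<and> p \<in> closed_slab i k m \<and>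
      (p $ i = of_int m * spacing k \<or> p $ i = of_int m * spacing k + width k \<or> p $ 3 = height k))"
proof -
  have "p \<in> closure domain" "p \<notin> domain"
    using assms open_domain by (auto simp: frontier_def interior_open)
  then show ?thesis
  proof (cases "p $ 3 = 0")
    case False
    then obtain i k m where i: "p $ 3 > 0" "i \<noteq> 3" "p \<in> closed_slab i k m" using closure_domain_cases[OF \<open>p \<in> closure domain\<close>] by blast
    moreover have "p \<notin> slab i k m" using slab_subset_domain[OF i(2)] \<open>p \<notin> domain\<close> by blast
    ultimately show ?thesis by (auto simp: closed_slab_def slab_def intro!: exI[of _ i] exI[of _ k] exI[of _ m])
  qed simp
qed

text \<open>Slabs of high level are low, and one of them passes within \<open>spacing k\<close> of
  any point, so every point of the plane is approached, whether or not it lies below a slit.\<close>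

lemma plane_subset_frontier: "p $ 3 = 0 \<Longrightarrow> p \<in> frontier domain"
proof -
  assume p: "p $ 3 = 0"
  have "\<exists>q\<in>domain. dist q p < e" if "e > 0" for e
  proof -
    have "eventually (\<lambda>k. spacing k < e / 2) sequentially" "eventually (\<lambda>k. height k < e / 2) sequentially"
      using order_tendstoD(2)[OF spacing_tendsto, of "e / 2"] order_tendstoD(2)[OF height_tendsto, of "e / 2"] that by auto
    then have "eventually (\<lambda>k. spacing k < e / 2 \<and> height k < e / 2) sequentially" by eventually_elim auto
    then obtain k where k: "spacing k < e / 2" "height k < e / 2" by (auto simp: eventually_sequentially)
    define n where "n = \<lfloor>p $ 1 / spacing k\<rfloor>"
    define q where "q = upd (upd p 1 (of_int n * spacing k + width k / 2)) 3 (height k / 2)"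
    have "q \<in> slab 1 k n" using width_pos[of k] height_pos[of k] by (simp add: q_def slab_def)
    then have "q \<in> domain" using slab_subset_domain[of 1 k n] by auto
    have "dist q p \<le> dist q (upd p 1 (of_int n * spacing k + width k / 2)) + dist (upd p 1 (of_int n * spacing k + width k / 2)) p"
      by (rule dist_triangle)
    also have "\<dots> = \<bar>height k / 2 - p $ 3\<bar> + \<bar>of_int n * spacing k + width k / 2 - p $ 1\<bar>"
      by (simp add: q_def dist_upd)
    also have "\<dots> < e"
      using floor_spacing[where x="p $ 1" and k=k] k p width_pos[of k] width_le[of k] height_pos[of k]
      by (simp add: n_def[symmetric] algebra_simps)
    finally show ?thesis using \<open>q \<in> domain\<close> by blast
  qed
  then have "p \<in> closure domain" by (simp add: closure_approachable)
  moreover have "p \<notin> domain" using p by (auto simp: domain_def)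
  ultimately show ?thesis using open_domain by (simp add: frontier_def interior_open)
qed

definition other :: "3 \<Rightarrow> 3" where "other i = (if i = 1 then 2 else 1)"

lemma UNIV_other: "i \<noteq> 3 \<Longrightarrow> (UNIV :: 3 set) = {i, other i, 3}"
  using exhaust_3[of i] by (auto simp: other_def UNIV_3)

lemma other_neq: "other i \<noteq> 3" "other i \<noteq> i" "i \<noteq> 3 \<Longrightarrow> other (other i) = i"
  using exhaust_3[of i] by (auto simp: other_def)

text \<open>A square column, unbounded in the third coordinate; it localises in the horizontal
  directions only.\<close>

definition pillar :: "nat \<Rightarrow> (real^3) set" where
  "pillar N = {p. \<forall>i. i \<noteq> 3 \<longrightarrow> \<bar>p $ i\<bar> \<le> real N}"

lemma hausdorff_outer_slab_faces:
  assumes "i \<noteq> 3" "N > 0"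
  shows "hausdorff_outer 2 ({p \<in> closed_slab i k m. p $ i = of_int m * spacing k \<or> p $ i = of_int m * spacing k + width k \<or> p $ 3 = height k} \<inter> pillar N)
    \<le> ennreal (8 * real N * height k + 4 * real N * width k)"
proof -
  note U = UNIV_other[OF assms(1)]
  have U': "(UNIV :: 3 set) = {3, i, other i}" using U by blast
  let ?A = "\<lambda>e. {p \<in> closed_slab i k m. p $ i = e} \<inter> pillar N"
  let ?C = "{p \<in> closed_slab i k m. p $ 3 = height k} \<inter> pillar N"
  have N: "2 * real N > 0" using assms by simp
  have A: "hausdorff_outer 2 (?A e) \<le> ennreal (2 * (2 * real N) * height k)" for e
    by (rule hausdorff_outer_rectangle[OF U N height_pos, where c=e and b="- real N" and b'=0])
       (use assms other_neq in \<open>auto simp: closed_slab_def pillar_def abs_le_iff minus_le_iff\<close>)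
  have C: "hausdorff_outer 2 ?C \<le> ennreal (2 * width k * (2 * real N))"
    by (rule hausdorff_outer_rectangle[OF U' width_pos N, where c="height k" and b="of_int m * spacing k" and b'="- real N"])
       (use assms other_neq in \<open>auto simp: closed_slab_def pillar_def abs_le_iff minus_le_iff\<close>)
  have "hausdorff_outer 2 ((?A (of_int m * spacing k) \<union> ?A (of_int m * spacing k + width k)) \<union> ?C)
    \<le> (hausdorff_outer 2 (?A (of_int m * spacing k)) + hausdorff_outer 2 (?A (of_int m * spacing k + width k))) + hausdorff_outer 2 ?C"
    by (intro order_trans[OF hausdorff_outer_Un] add_right_mono hausdorff_outer_Un) auto
  also have "\<dots> \<le> (ennreal (2 * (2 * real N) * height k) + ennreal (2 * (2 * real N) * height k)) + ennreal (2 * width k * (2 * real N))"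
    by (intro add_mono A C)
  also have "\<dots> = ennreal (8 * real N * height k + 4 * real N * width k)"
    using height_pos[of k] width_pos[of k] by (simp add: ennreal_plus[symmetric] del: ennreal_plus)
  finally show ?thesis by (rule order_trans[OF hausdorff_outer_mono, rotated]) auto
qed

text \<open>About 2^(k^2) slits of level k meet a bounded region, each with walls of area of order
  \<open>height k\<close>. After a shift of the index the term is 2^(2k+1-k^2).\<close>

lemma summable_power_height: "summable (\<lambda>k. 2 ^ (k\<^sup>2) * height k)"
proof -
  have "summable (\<lambda>k. 2 ^ ((Suc k)\<^sup>2) * ((1 / 2) ^ (k\<^sup>2))\<^sup>2 :: real)"
  \<comment> \<open>From k = 3 on, k^2 is at least 3 k, which leaves 2^(2k+1-3k).\<close>
  proof (rule summable_comparison_test'[where N=3 and g="\<lambda>k. 2 * (1 / 2) ^ k"])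
    show "summable (\<lambda>k. 2 * (1 / 2) ^ k :: real)" by (simp add: summable_geometric)
    fix k :: nat assume k: "k \<ge> 3"
    have "(Suc k)\<^sup>2 = k\<^sup>2 + (2 * k + 1)" by (simp add: power2_eq_square)
    then have "2 ^ ((Suc k)\<^sup>2) = (2 ^ (k\<^sup>2) * 2 ^ (2 * k + 1) :: real)" by (simp only: power_add)
    moreover have "2 ^ (k\<^sup>2) * (1 / 2) ^ (k\<^sup>2) = (1 :: real)" by (simp add: power_mult_distrib[symmetric])
    moreover have "(a * b) * h\<^sup>2 = b * h" if "a * h = 1" for a b h :: real
      using that by (metis mult.assoc mult.commute mult_1 power2_eq_square)
    ultimately have "2 ^ ((Suc k)\<^sup>2) * ((1 / 2) ^ (k\<^sup>2))\<^sup>2 = (2 ^ (2 * k + 1) * (1 / 2) ^ (k\<^sup>2) :: real)"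
      by metis
    also have "\<dots> \<le> 2 ^ (2 * k + 1) * (1 / 2) ^ (3 * k)"
      using k by (intro mult_left_mono power_decreasing) (auto simp: power2_eq_square)
    also have "(2::real) ^ (2 * k + 1) = 2 * (2\<^sup>2) ^ k" by (simp only: power_add power_mult[of "2::real" 2 k] power_one_right)
    also have "(1 / 2 :: real) ^ (3 * k) = ((1 / 2) ^ 3) ^ k" by (rule power_mult)
    also have "2 * (2\<^sup>2) ^ k * ((1 / 2) ^ 3) ^ k = 2 * (2\<^sup>2 * (1 / 2) ^ 3 :: real) ^ k"
      by (simp only: power_mult_distrib mult.assoc)
    also have "\<dots> = 2 * (1 / 2) ^ k" by (simp add: power_divide power3_eq_cube)
    finally show "norm (2 ^ ((Suc k)\<^sup>2) * ((1 / 2) ^ (k\<^sup>2))\<^sup>2 :: real) \<le> 2 * (1 / 2) ^ k" by simp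
  qed
  then have "summable (\<lambda>k. 2 ^ ((Suc k)\<^sup>2) * height (Suc k))"
    by (simp add: height_Suc spacing_def)
  then show ?thesis by (subst (asm) summable_Suc_iff)
qed

lemma summable_power_width: "summable (\<lambda>k. 2 ^ (k\<^sup>2) * width k)"
proof -
  have "(\<lambda>k. 2 ^ (k\<^sup>2) * width k) = (\<lambda>k. (1 / 192) * (1 / 2) ^ k)"
    by (auto simp: width_def power_add power_divide)
  then show ?thesis by (simp add: summable_geometric summable_mult)
qed

lemma spacing_index_bound:
  assumes "\<bar>x\<bar> \<le> real N" "of_int m * spacing k \<le> x" "x \<le> of_int m * spacing k + width k"
  shows "m \<in> {- (int (N + 1) * 2 ^ (k\<^sup>2)) .. int (N + 1) * 2 ^ (k\<^sup>2)}"
proof -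
  have "spacing k \<le> 1" by (simp add: spacing_def power_le_one)
  then have "\<bar>of_int m * spacing k\<bar> \<le> real (N + 1)" using assms width_le[of k] width_pos[of k] by (auto simp: abs_le_iff)
  then have "\<bar>of_int m\<bar> * spacing k \<le> real (N + 1)" using spacing_pos[of k] by (simp add: abs_mult)
  then have "\<bar>of_int m\<bar> \<le> real (N + 1) * 2 ^ (k\<^sup>2)" by (simp add: spacing_def power_divide field_simps)
  then have "of_int \<bar>m\<bar> \<le> real_of_int (int (N + 1) * 2 ^ (k\<^sup>2))" by simp
  then have "\<bar>m\<bar> \<le> int (N + 1) * 2 ^ (k\<^sup>2)" by (simp only: of_int_le_iff)
  then show ?thesis by auto
qed

text \<open>In the column the boundary is covered by a rectangle of the plane and three faces per
  slab. Counting the slabs of each level with \<open>spacing_index_bound\<close> leads to the two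
  summable series with terms \<open>2 ^ (k\<^sup>2) * height k\<close> and
  \<open>2 ^ (k\<^sup>2) * width k\<close>.\<close>

lemma hausdorff_outer_frontier_pillar:
  assumes "N > 0"
  shows "hausdorff_outer 2 (frontier domain \<inter> pillar N) < \<infinity>"
proof -
  define f where "f i k m = {p \<in> closed_slab i k m. p $ i = of_int m * spacing k \<or> p $ i = of_int m * spacing k + width k \<or> p $ 3 = height k} \<inter> pillar N" for i k m
  define M where "M k = int (N + 1) * 2 ^ (k\<^sup>2)" for k
  define J where "J k = {1, 2::3} \<times> {- M k .. M k}" for k
  define P where "P = {p::real^3. p $ 3 = 0} \<inter> pillar N"
  define b where "b k = 8 * real N * height k + 4 * real N * width k" for k
  have b0: "b k \<ge> 0" for k using height_pos[of k] width_pos[of k] by (simp add: b_def)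
  have sub: "frontier domain \<inter> pillar N \<subseteq> P \<union> (\<Union>k. \<Union>(i, m)\<in>J k. f i k m)"
  proof
    fix p assume p: "p \<in> frontier domain \<inter> pillar N"
    show "p \<in> P \<union> (\<Union>k. \<Union>(i, m)\<in>J k. f i k m)"
    proof (cases "p $ 3 = 0")
      case False
      then obtain i k m where i: "i \<noteq> 3" "p \<in> closed_slab i k m"
        "p $ i = of_int m * spacing k \<or> p $ i = of_int m * spacing k + width k \<or> p $ 3 = height k"
        using frontier_domain_cases p by blast
      then have "p \<in> f i k m" using p by (simp add: f_def)
      moreover have "m \<in> {- M k .. M k}" unfolding M_def
        by (rule spacing_index_bound[of "p $ i"]) (use p i in \<open>auto simp: pillar_def closed_slab_def\<close>)
      moreover have "i \<in> {1, 2}" using exhaust_3[of i] i by auto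
      ultimately have "(i, m) \<in> J k" "p \<in> f i k m" by (auto simp: J_def)
      then show ?thesis by blast
    qed (use p in \<open>simp add: P_def\<close>)
  qed
  have "hausdorff_outer 2 P \<le> ennreal (2 * (2 * real N) * (2 * real N))"
  proof (rule hausdorff_outer_rectangle[where i=3 and j=1 and k=2 and c=0 and b="- real N" and b'="- real N"])
    show "UNIV = {3, 1, 2::3}" using UNIV_3 by blast
    fix p :: "real^3" assume p: "p \<in> P"
    have "\<bar>p $ 1\<bar> \<le> real N" "\<bar>p $ 2\<bar> \<le> real N" "p $ 3 = 0" using p by (auto simp: P_def pillar_def)
    then show "p $ 3 = 0 \<and> - real N \<le> p $ 1 \<and> p $ 1 \<le> - real N + 2 * real N \<and> - real N \<le> p $ 2 \<and> p $ 2 \<le> - real N + 2 * real N"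
      by (auto simp: abs_le_iff)
  qed (use assms in auto)
  then have Pfin: "hausdorff_outer 2 P < \<infinity>" by (auto intro: le_less_trans)
  have k: "hausdorff_outer 2 (\<Union>(i, m)\<in>J k. f i k m) \<le> ennreal (2 * (2 * real (N + 1) * 2 ^ (k\<^sup>2) + 1) * b k)" for k
  proof -
    have "hausdorff_outer 2 (\<Union>x\<in>J k. case x of (i, m) \<Rightarrow> f i k m) \<le> (\<Sum>x\<in>J k. hausdorff_outer 2 (case x of (i, m) \<Rightarrow> f i k m))"
      by (rule hausdorff_outer_finite_UN) (auto simp: J_def)
    also have "\<dots> \<le> (\<Sum>x\<in>J k. ennreal (b k))"
      using hausdorff_outer_slab_faces[OF _ assms] by (intro sum_mono) (auto simp: J_def f_def b_def)
    also have "\<dots> = ennreal (real (card (J k)) * b k)"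
      using b0 by (subst sum_ennreal) auto
    also have "real (card (J k)) = 2 * (2 * real (N + 1) * 2 ^ (k\<^sup>2) + 1)"
    proof -
      have "card {- M k .. M k} = nat (2 * M k + 1)" by simp
      moreover have "M k \<ge> 0" by (simp add: M_def)
      moreover have "card {1, 2::3} = 2" by simp
      ultimately have "real (card (J k)) = 2 * real_of_int (2 * M k + 1)"
        unfolding J_def card_cartesian_product by (simp add: of_nat_nat)
      then show ?thesis by (simp add: M_def)
    qed
    finally show ?thesis .
  qed
  have "summable (\<lambda>k. 2 * (2 * real (N + 1) * 2 ^ (k\<^sup>2) + 1) * b k)"
  proof (rule summable_comparison_test')
    have "summable (\<lambda>k. 6 * real (N + 1) * (8 * real N * (2 ^ (k\<^sup>2) * height k) + 4 * real N * (2 ^ (k\<^sup>2) * width k)))"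
      by (intro summable_mult summable_add summable_power_height summable_power_width)
    then show "summable (\<lambda>k. 6 * real (N + 1) * 2 ^ (k\<^sup>2) * b k)" by (simp add: b_def algebra_simps)
    fix k
    have "1 * 1 \<le> real (N + 1) * 2 ^ (k\<^sup>2)" by (intro mult_mono) auto
    moreover have "1 * 1 \<le> X \<Longrightarrow> 2 * (2 * X + 1) \<le> 6 * X" for X :: real by simp
    ultimately have "2 * (2 * real (N + 1) * 2 ^ (k\<^sup>2) + 1) \<le> 6 * real (N + 1) * 2 ^ (k\<^sup>2)"
      unfolding mult.assoc by blast
    then have "2 * (2 * real (N + 1) * 2 ^ (k\<^sup>2) + 1) * b k \<le> 6 * real (N + 1) * 2 ^ (k\<^sup>2) * b k"
      using b0[of k] by (rule mult_right_mono)
    then show "norm (2 * (2 * real (N + 1) * 2 ^ (k\<^sup>2) + 1) * b k) \<le> 6 * real (N + 1) * 2 ^ (k\<^sup>2) * b k"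
      using b0[of k] by simp
  qed
  then have "(\<Sum>k. ennreal (2 * (2 * real (N + 1) * 2 ^ (k\<^sup>2) + 1) * b k)) \<noteq> top"
    using b0 by (intro ennreal_suminf_neq_top) auto
  moreover have "hausdorff_outer 2 (\<Union>k. \<Union>(i, m)\<in>J k. f i k m) \<le> (\<Sum>k. ennreal (2 * (2 * real (N + 1) * 2 ^ (k\<^sup>2) + 1) * b k))"
    by (rule order_trans[OF hausdorff_outer_UN suminf_le[OF k]]) auto
  ultimately have "hausdorff_outer 2 (\<Union>k. \<Union>(i, m)\<in>J k. f i k m) < \<infinity>"
    by (auto simp: less_top intro: le_less_trans)
  then have "hausdorff_outer 2 P + hausdorff_outer 2 (\<Union>k. \<Union>(i, m)\<in>J k. f i k m) < \<infinity>" using Pfin by simp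
  moreover have "hausdorff_outer 2 (frontier domain \<inter> pillar N) \<le> hausdorff_outer 2 P + hausdorff_outer 2 (\<Union>k. \<Union>(i, m)\<in>J k. f i k m)"
    by (rule order_trans[OF hausdorff_outer_mono[OF sub] hausdorff_outer_Un]) simp
  ultimately show ?thesis by (rule le_less_trans[rotated])
qed

lemma closed_pillar: "closed (pillar N)"
proof -
  have "pillar N = {p. \<bar>p $ 1\<bar> \<le> real N} \<inter> {p. \<bar>p $ 2\<bar> \<le> real N}"
    by (auto simp: pillar_def forall_3)
  moreover have "closed ({p::real^3. \<bar>p $ 1\<bar> \<le> real N} \<inter> {p. \<bar>p $ 2\<bar> \<le> real N})"
    by (intro closed_Int closed_Collect_le continuous_intros)
  ultimately show ?thesis by simp
qed

lemma emeasure_frontier_bounded: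
  assumes "bounded B" "B \<in> sets borel" "B \<subseteq> frontier domain"
  shows "emeasure H2 B < \<infinity>"
proof -
  obtain r where r: "\<And>x. x \<in> B \<Longrightarrow> norm x \<le> r" using assms(1) by (auto simp: bounded_iff)
  obtain M where M: "r \<le> real M" using real_arch_simple by blast
  define N where "N = Suc M"
  have N: "real N \<ge> r" "N > 0" using M by (auto simp: N_def)
  have "\<bar>x $ i\<bar> \<le> real N" if "x \<in> B" for x i
    using component_le_norm_cart[of x i] r[OF that] N(1) by linarith
  then have "B \<subseteq> frontier domain \<inter> pillar N"
    using assms(3) by (auto simp: pillar_def)
  then have "hausdorff_outer 2 B \<le> hausdorff_outer 2 (frontier domain \<inter> pillar N)" by (rule hausdorff_outer_mono)
  then show ?thesis
    using hausdorff_outer_frontier_pillar[OF N(2)] assms(2) by (simp add: emeasure_hausdorff_borel)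
qed

text \<open>Bounded parts of the boundary have finite area, so \<open>Gamma_inf\<close> is empty
  here and convergence of traces is tested on all compact parts of the boundary.\<close>

lemma Gamma_loc_domain: "Gamma_loc domain = frontier domain"
proof -
  have "emeasure H2 (frontier domain \<inter> ball z 1) < \<infinity>" for z
    by (rule emeasure_frontier_bounded) (auto intro: bounded_subset[OF bounded_ball])
  then show ?thesis unfolding Gamma_loc_def by (auto intro: exI[of _ 1])
qed

subsection \<open>Uniqueness on the lateral boundary\<close>

text \<open>\<open>face_estimate\<close> combined with the Hoelder bound on the cell is the a priori
  bound that \<open>approx_trace_zero_on\<close> asks for.\<close>

lemma approx_trace_zero_face:
  assumes "open \<Omega>" and p: "1 \<le> p" and tr: "approx_trace p \<Omega> (\<lambda>_. 0) \<phi>" and loc: "frontier \<Omega> \<subseteq> Gamma_loc \<Omega>"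
    and ijk: "(UNIV :: 3 set) = {i, j, k}" and sub: "cell i j k x x' y y' z z' \<subseteq> \<Omega>"
    and lt: "x < x'" "y < y'" "z < z'" and e: "e = x \<or> e = x'"
  shows "AE q in H2. q $ i = e \<and> y \<le> q $ j \<and> q $ j \<le> y' \<and> z \<le> q $ k \<and> q $ k \<le> z' \<and> q \<in> frontier \<Omega> \<longrightarrow> \<phi> q = 0"
proof -
  define F where "F = {q::real^3. q $ i = e \<and> y \<le> q $ j \<and> q $ j \<le> y' \<and> z \<le> q $ k \<and> q $ k \<le> z'}"
  have "F \<subseteq> cbox (vec3 i j x y z) (vec3 i j x' y' z')"
    using e lt by (auto simp: F_def mem_cbox_vec3[OF ijk])
  moreover have "closed F"
    unfolding F_def by (intro closed_Collect_conj closed_Collect_eq closed_Collect_le continuous_intros)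
  ultimately have F: "compact F"
    by (metis bounded_cbox bounded_subset compact_eq_bounded_closed)
  let ?B = "cell i j k x x' y y' z z'"
  define c where "c = 2 * measure lebesgue ?B powr (1 - recip p)"
  have c: "c \<ge> 0" by (simp add: c_def)
  have "AE q in H2. q \<in> F \<inter> frontier \<Omega> \<longrightarrow> \<phi> q = 0"
  proof (rule approx_trace_zero_on[OF \<open>open \<Omega>\<close> tr loc F, where C="2 * (c / (x' - x) + c)"])
    fix u :: "real^3 \<Rightarrow> real" and g :: "real^3 \<Rightarrow> real^3"
    assume u: "u \<in> Lp_space (lebesgue_on \<Omega>) p" and g: "g \<in> Lp_space (lebesgue_on \<Omega>) p"
      and wg: "weak_gradient \<Omega> u g" and cont: "continuous_on (closure \<Omega>) u"
    note ub = Lp_space_bound_on_finite_measure[OF p \<open>open \<Omega>\<close> cell_lmeasurable[OF ijk] sub u]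
    note gb = Lp_space_bound_on_finite_measure[OF p \<open>open \<Omega>\<close> cell_lmeasurable[OF ijk] sub g]
    have "(\<integral>\<^sup>+q\<in>F. ennreal \<bar>u q\<bar> \<partial>H2)
       \<le> ennreal (2 * ((LINT q:?B|lebesgue. \<bar>u q\<bar>) / (x' - x) + (LINT q:?B|lebesgue. norm (g q))))"
      unfolding F_def by (rule face_estimate[OF ijk wg \<open>open \<Omega>\<close> sub lt e cont ub(1) gb(1)])
    also have "\<dots> \<le> ennreal (2 * (c / (x' - x) + c) * (Lp_norm (lebesgue_on \<Omega>) p u + Lp_norm (lebesgue_on \<Omega>) p g))"
    proof (rule ennreal_leI)
      define D where "D = c / (x' - x)"
      have D: "D \<ge> 0" using c lt by (simp add: D_def)
      let ?u = "Lp_norm (lebesgue_on \<Omega>) p u" and ?g = "Lp_norm (lebesgue_on \<Omega>) p g"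
      have "(LINT q:?B|lebesgue. \<bar>u q\<bar>) / (x' - x) \<le> D * ?u"
        using ub(2) lt by (simp add: c_def D_def divide_right_mono)
      also have "\<dots> \<le> D * (?u + ?g)"
        using D Lp_norm_nonneg[of "lebesgue_on \<Omega>" p g] by (intro mult_left_mono) auto
      finally have 1: "(LINT q:?B|lebesgue. \<bar>u q\<bar>) / (x' - x) \<le> D * (?u + ?g)" .
      have "(LINT q:?B|lebesgue. norm (g q)) \<le> c * ?g"
        using gb(2) by (simp add: c_def)
      also have "\<dots> \<le> c * (?u + ?g)"
        using c Lp_norm_nonneg[of "lebesgue_on \<Omega>" p u] by (intro mult_left_mono) auto
      finally have 2: "(LINT q:?B|lebesgue. norm (g q)) \<le> c * (?u + ?g)" .
      have "2 * ((LINT q:?B|lebesgue. \<bar>u q\<bar>) / (x' - x) + (LINT q:?B|lebesgue. norm (g q))) \<le> 2 * (D * (?u + ?g) + c * (?u + ?g))"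
        by (rule mult_left_mono[OF add_mono[OF 1 2]]) simp
      also have "\<dots> = 2 * (D + c) * (?u + ?g)" by (simp add: algebra_simps)
      finally show "2 * ((LINT q:?B|lebesgue. \<bar>u q\<bar>) / (x' - x) + (LINT q:?B|lebesgue. norm (g q)))
        \<le> 2 * (c / (x' - x) + c) * (?u + ?g)" by (simp only: D_def)
    qed
    finally show "(\<integral>\<^sup>+q\<in>F. ennreal \<bar>u q\<bar> \<partial>H2)
       \<le> ennreal (2 * (c / (x' - x) + c) * (Lp_norm (lebesgue_on \<Omega>) p u + Lp_norm (lebesgue_on \<Omega>) p g))" .
  qed
  then show ?thesis by eventually_elim (auto simp: F_def)
qed

text \<open>Off the plane the boundary lies in countably many bounded faces, each a face of a cell
  inside a single slab; countability combines the exceptional null sets.\<close>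

lemma approx_trace_zero_lateral:
  assumes p: "1 \<le> p" and tr: "approx_trace p domain (\<lambda>_. 0) \<phi>"
  shows "AE q in H2. q \<in> frontier domain \<and> q $ 3 \<noteq> 0 \<longrightarrow> \<phi> q = 0"
proof -
  have loc: "frontier domain \<subseteq> Gamma_loc domain" by (simp add: Gamma_loc_domain)
  have *: "AE q in H2. q \<in> closed_slab i k m \<inter> pillar (Suc N) \<inter> frontier domain \<and>
      (q $ i = of_int m * spacing k \<or> q $ i = of_int m * spacing k + width k \<or> q $ 3 = height k) \<longrightarrow> \<phi> q = 0"
    if i: "i \<noteq> 3" for i k m N
  proof -
    note U = UNIV_other[OF i]
    have U': "(UNIV :: 3 set) = {3, i, other i}" using U by blast
    let ?a = "of_int m * spacing k" and ?b = "of_int m * spacing k + width k" and ?N = "real (Suc N)"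
    have s: "cell i (other i) 3 ?a ?b (- ?N) ?N 0 (height k) \<subseteq> domain"
      using slab_subset_domain[OF i, of k m] by (auto simp: cell_def slab_def)
    have s': "cell 3 i (other i) 0 (height k) ?a ?b (- ?N) ?N \<subseteq> domain"
      using slab_subset_domain[OF i, of k m] by (auto simp: cell_def slab_def)
    have lt: "?a < ?b" "- ?N < ?N" "0 < height k" using width_pos[of k] height_pos[of k] by auto
    have c: "\<bar>q $ i\<bar> \<le> ?N \<and> \<bar>q $ other i\<bar> \<le> ?N" if "q \<in> pillar (Suc N)" for q
      using that i other_neq unfolding pillar_def by blast
    have "AE q in H2. q $ i = ?a \<and> - ?N \<le> q $ other i \<and> q $ other i \<le> ?N \<and> 0 \<le> q $ 3 \<and> q $ 3 \<le> height k \<and> q \<in> frontier domain \<longrightarrow> \<phi> q = 0"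
      by (rule approx_trace_zero_face[OF open_domain p tr loc U s lt]) simp
    moreover have "AE q in H2. q $ i = ?b \<and> - ?N \<le> q $ other i \<and> q $ other i \<le> ?N \<and> 0 \<le> q $ 3 \<and> q $ 3 \<le> height k \<and> q \<in> frontier domain \<longrightarrow> \<phi> q = 0"
      by (rule approx_trace_zero_face[OF open_domain p tr loc U s lt]) simp
    moreover have "AE q in H2. q $ 3 = height k \<and> ?a \<le> q $ i \<and> q $ i \<le> ?b \<and> - ?N \<le> q $ other i \<and> q $ other i \<le> ?N \<and> q \<in> frontier domain \<longrightarrow> \<phi> q = 0"
      by (rule approx_trace_zero_face[OF open_domain p tr loc U' s' lt(3,1,2)]) simp
    ultimately show ?thesis
    proof eventually_elim
      case (elim q)
      show ?case
      proof
        assume h: "q \<in> closed_slab i k m \<inter> pillar (Suc N) \<inter> frontier domain \<and> (q $ i = ?a \<or> q $ i = ?b \<or> q $ 3 = height k)"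
        then have "\<bar>q $ other i\<bar> \<le> ?N" using c by blast
        then have "- ?N \<le> q $ other i" "q $ other i \<le> ?N" by linarith+
        moreover have "?a \<le> q $ i" "q $ i \<le> ?b" "0 \<le> q $ 3" "q $ 3 \<le> height k"
          using h by (auto simp: closed_slab_def)
        ultimately show "\<phi> q = 0" using h elim by blast
      qed
    qed
  qed
  have "AE q in H2. \<forall>k m N. q \<in> closed_slab 1 k m \<inter> pillar (Suc N) \<inter> frontier domain \<and>
      (q $ 1 = of_int m * spacing k \<or> q $ 1 = of_int m * spacing k + width k \<or> q $ 3 = height k) \<longrightarrow> \<phi> q = 0"
    unfolding AE_all_countable by (intro allI, rule *) simp
  moreover have "AE q in H2. \<forall>k m N. q \<in> closed_slab 2 k m \<inter> pillar (Suc N) \<inter> frontier domain \<and>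
      (q $ 2 = of_int m * spacing k \<or> q $ 2 = of_int m * spacing k + width k \<or> q $ 3 = height k) \<longrightarrow> \<phi> q = 0"
    unfolding AE_all_countable by (intro allI, rule *) simp
  ultimately show ?thesis
  proof eventually_elim
    case (elim q)
    show ?case
    proof
      assume q: "q \<in> frontier domain \<and> q $ 3 \<noteq> 0"
      then obtain i k m where i: "i \<noteq> 3" "q \<in> closed_slab i k m"
        "q $ i = of_int m * spacing k \<or> q $ i = of_int m * spacing k + width k \<or> q $ 3 = height k"
        using frontier_domain_cases by blast
      obtain N where "norm q \<le> real N" using real_arch_simple by blast
      then have "\<bar>q $ l\<bar> \<le> real (Suc N)" for l
        using component_le_norm_cart[of q l] by simp
      then have "q \<in> pillar (Suc N)" by (simp add: pillar_def)
      then have h: "q \<in> closed_slab i k m \<inter> pillar (Suc N) \<inter> frontier domain" using i q by blast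
      have "i = 1 \<or> i = 2" using i exhaust_3[of i] by auto
      then show "\<phi> q = 0"
      proof
        assume "i = 1" then show ?thesis using elim(1)[rule_format, of k m N] h i(3) by blast
      next
        assume "i = 2" then show ?thesis using elim(2)[rule_format, of k m N] h i(3) by blast
      qed
    qed
  qed
qed

subsection \<open>Uniqueness on the plane\<close>

lemma cell_swap: "cell i j k x x' y y' z z' = cell j i k y y' x x' z z'"
  by (auto simp: cell_def)

lemma cell_rotate: "cell i j k x x' y y' z z' = cell k i j z z' x x' y y'"
  by (auto simp: cell_def)

text \<open>Hoelder is applied once, to the union of the disjoint cells, so the sum is controlled by
  the small total volume V.\<close>

lemma sum_integral_norm_le:
  fixes f :: "real^'n::finite \<Rightarrow> 'b::euclidean_space"
  assumes p: "1 \<le> p" and "open \<Omega>" and f: "f \<in> Lp_space (lebesgue_on \<Omega>) p"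
    and I: "finite I" "disjoint_family_on C I" "\<And>m. m \<in> I \<Longrightarrow> C m \<subseteq> \<Omega>" "\<And>m. m \<in> I \<Longrightarrow> C m \<in> lmeasurable"
    and V: "\<And>m. m \<in> I \<Longrightarrow> measure lebesgue (C m) \<le> v" "real (card I) * v \<le> V"
  shows "(\<Sum>m\<in>I. LINT x:C m|lebesgue. norm (f x)) \<le> 2 * V powr (1 - recip p) * Lp_norm (lebesgue_on \<Omega>) p f"
proof -
  define B where "B = (\<Union>m\<in>I. C m)"
  have B: "B \<in> lmeasurable" "B \<subseteq> \<Omega>" using I by (auto simp: B_def intro!: fmeasurable.finite_UN)
  note b = Lp_space_bound_on_finite_measure[OF p \<open>open \<Omega>\<close> B f]
  have "measure lebesgue B \<le> (\<Sum>m\<in>I. measure lebesgue (C m))"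
    unfolding B_def using I by (intro measure_UNION_le) auto
  also have "\<dots> \<le> real (card I) * v" using V(1) by (rule sum_bounded_above)
  finally have mB: "measure lebesgue B \<le> V" using V(2) by linarith
  have r: "recip p \<le> 1"
  proof (cases "p = \<infinity>")
    case False
    then have "1 \<le> enn2real p" using p by (metis enn2real_1 enn2real_mono infinity_ennreal_def less_top)
    then show ?thesis by (simp add: recip_def)
  qed (simp add: recip_def)
  have "(\<Sum>m\<in>I. LINT x:C m|lebesgue. norm (f x)) \<le> (LINT x:B|lebesgue. norm (f x))"
    by (rule sum_integral_disjoint_le[OF I(1,2)]) (use I b(1) in \<open>auto simp: B_def intro: set_integrable_norm\<close>)
  also have "\<dots> \<le> 2 * measure lebesgue B powr (1 - recip p) * Lp_norm (lebesgue_on \<Omega>) p f" by (rule b(2))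
  also have "\<dots> \<le> 2 * V powr (1 - recip p) * Lp_norm (lebesgue_on \<Omega>) p f"
    using mB r by (intro mult_right_mono mult_left_mono powr_mono2) (auto simp: Lp_norm_nonneg)
  finally show ?thesis .
qed

section \<open>Nested grids on a square of the plane\<close>

text \<open>Counting starts at -N, itself a multiple of \<open>spacing k\<close>, so that indices
  are natural numbers and all grid points carry slits.\<close>

definition grid :: "nat \<Rightarrow> nat \<Rightarrow> nat \<Rightarrow> real" where
  "grid N k a = - real N + real a * spacing k"

definition grid_size :: "nat \<Rightarrow> nat \<Rightarrow> nat" where
  "grid_size N k = 2 * N * 2 ^ (k\<^sup>2)"

text \<open>The quotient of consecutive spacings, since (k+1)^2 - k^2 = 2k + 1.\<close>

definition refinement :: "nat \<Rightarrow> nat" where "refinement k = 2 ^ (2 * k + 1)"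

lemma refinement_pos: "refinement k > 0" by (simp add: refinement_def)

lemma spacing_refinement: "spacing k = real (refinement k) * spacing (Suc k)"
proof -
  have "(Suc k)\<^sup>2 = k\<^sup>2 + (2 * k + 1)" by (simp add: power2_eq_square)
  then show ?thesis by (simp add: spacing_def refinement_def power_add power_divide)
qed

lemma grid_size_Suc: "grid_size N (Suc k) = grid_size N k * refinement k"
proof -
  have "(Suc k)\<^sup>2 = k\<^sup>2 + (2 * k + 1)" by (simp add: power2_eq_square)
  then show ?thesis by (simp add: grid_size_def refinement_def power_add)
qed

lemma grid_size_spacing: "real (grid_size N k) * spacing k = 2 * real N"
  by (simp add: grid_size_def spacing_def power_divide)

lemma grid_Suc: "grid N k (Suc a) = grid N k a + spacing k"
  by (simp add: grid_def algebra_simps)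

lemma grid_bounds: "a < grid_size N k \<Longrightarrow> - real N \<le> grid N k a \<and> grid N k a + spacing k \<le> real N"
proof -
  assume "a < grid_size N k"
  then have "real (Suc a) * spacing k \<le> real (grid_size N k) * spacing k"
    using spacing_pos[of k] by (intro mult_right_mono) auto
  then have "grid N k (Suc a) \<le> real N" by (simp add: grid_size_spacing grid_def)
  then show ?thesis using spacing_pos[of k] grid_Suc[of N k a] by (simp add: grid_def)
qed

text \<open>Integer division yields the parent interval in the coarser grid; the remainder is the
  position inside the parent.\<close>

lemma grid_parent:
  "grid N k (a div refinement k) \<le> grid N (Suc k) a"
  "grid N (Suc k) a + spacing (Suc k) \<le> grid N k (a div refinement k) + spacing k"
proof -
  let ?n = "refinement k"
  have "a = a div ?n * ?n + a mod ?n" by simp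
  then have a: "real a = real (a div ?n) * real ?n + real (a mod ?n)" by (metis of_nat_add of_nat_mult)
  have eq: "grid N (Suc k) a = grid N k (a div ?n) + real (a mod ?n) * spacing (Suc k)"
    unfolding grid_def spacing_refinement[of k] a by (simp add: algebra_simps)
  show "grid N k (a div ?n) \<le> grid N (Suc k) a" unfolding eq using spacing_pos[of "Suc k"] by simp
  have "Suc (a mod ?n) \<le> ?n" using refinement_pos[of k] by (simp add: Suc_leI)
  then have "real (Suc (a mod ?n)) * spacing (Suc k) \<le> real ?n * spacing (Suc k)"
    using spacing_pos[of "Suc k"] by (intro mult_right_mono) auto
  then have "real (a mod ?n) * spacing (Suc k) + spacing (Suc k) \<le> spacing k"
    by (simp add: spacing_refinement[of k] algebra_simps)
  then show "grid N (Suc k) a + spacing (Suc k) \<le> grid N k (a div ?n) + spacing k" unfolding eq by linarith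
qed

lemma grid_cell_subset_domain:
  assumes "i \<noteq> 3" "h \<le> height k"
  shows "cell i j 3 (grid N k a) (grid N k a + width k) y y' 0 h \<subseteq> domain"
proof -
  have "real N = of_int (int N * 2 ^ (k\<^sup>2)) * spacing k" by (simp add: spacing_def power_divide)
  then have "grid N k a = of_int (int a - int N * 2 ^ (k\<^sup>2)) * spacing k"
    by (simp add: grid_def left_diff_distrib)
  then have "cell i j 3 (grid N k a) (grid N k a + width k) y y' 0 h \<subseteq> slab i k (int a - int N * 2 ^ (k\<^sup>2))"
    using assms(2) by (auto simp: cell_def slab_def)
  then show ?thesis using slab_subset_domain[OF assms(1)] by blast
qed

lemma sum_div_nat:
  fixes H :: "nat \<Rightarrow> real"
  assumes "v > 0"
  shows "(\<Sum>a<n * v. H (a div v)) = real v * (\<Sum>a<n. H a)"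
proof -
  have d: "a div v = m" if "a \<in> {m * v..<m * v + v}" for a m :: nat
    by (rule div_nat_eqI) (use that in \<open>simp_all add: mult.commute\<close>)
  have "(\<Sum>a<n * v. H (a div v)) = (\<Sum>m<n. \<Sum>a\<in>{m * v..<m * v + v}. H (a div v))"
    by (rule sum.nat_group[symmetric])
  also have "\<dots> = (\<Sum>m<n. \<Sum>a\<in>{m * v..<m * v + v}. H m)"
    by (intro sum.cong refl) (simp only: d)
  also have "\<dots> = real v * (\<Sum>m<n. H m)" by (simp add: sum_distrib_left)
  finally show ?thesis .
qed

text \<open>Common form of the three cost terms, where \<rho> is a relative width, t a height,
  \<theta> = 1/p, and M comes from the area of the square. Only the power of t matters: replacing
  M^(1-\<theta>) by M and \<rho>^(-\<theta>) by 1/\<rho> loses no more than a geometric factor in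
  the level.\<close>

lemma cost_term_le:
  fixes c \<rho> t M \<theta> :: real
  assumes "c \<ge> 0" "0 < \<rho>" "\<rho> \<le> 1" "t > 0" "M \<ge> 1" "0 \<le> \<theta>" "\<theta> \<le> 1"
  shows "c / (\<rho> * t) * (2 * (M * (\<rho> * t)) powr (1 - \<theta>)) \<le> 2 * M * (c * t powr (- \<theta>)) / \<rho>"
proof -
  have "M powr (1 - \<theta>) \<le> M powr 1" using assms by (intro powr_mono) auto
  then have M: "M powr (1 - \<theta>) \<le> M" using assms by simp
  have "\<rho> powr (- \<theta>) \<le> \<rho> powr (- 1)" using assms by (intro powr_mono') auto
  then have r: "\<rho> powr (- \<theta>) \<le> 1 / \<rho>" using assms by (simp add: powr_minus_divide)
  have "(M * (\<rho> * t)) powr (1 - \<theta>) = M powr (1 - \<theta>) * ((\<rho> * t) powr (1 - \<theta>))"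
    using assms by (simp add: powr_mult)
  also have "(\<rho> * t) powr (1 - \<theta>) = (\<rho> * t) * (\<rho> powr (- \<theta>) * t powr (- \<theta>))"
    using assms by (simp add: powr_mult powr_diff powr_minus_divide)
  finally have "c / (\<rho> * t) * (2 * (M * (\<rho> * t)) powr (1 - \<theta>)) = 2 * c * t powr (- \<theta>) * (M powr (1 - \<theta>) * \<rho> powr (- \<theta>))"
    using assms by (simp add: field_simps)
  also have "\<dots> \<le> 2 * c * t powr (- \<theta>) * (M * (1 / \<rho>))"
    using assms M r by (intro mult_left_mono mult_mono) auto
  finally show ?thesis by (simp add: field_simps)
qed

text \<open>The term is 2^(k - \<epsilon> k^2), at most 2^(-k) as soon as \<epsilon> k is at least
  2.\<close>

lemma summable_spacing_powr:
  assumes "\<epsilon> > 0"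
  shows "summable (\<lambda>k. 2 ^ k * spacing k powr \<epsilon>)"
proof -
  obtain K :: nat where K: "2 / \<epsilon> \<le> real K" using real_arch_simple by blast
  show ?thesis
  proof (rule summable_comparison_test'[where N=K and g="\<lambda>k. (1 / 2) ^ k"])
    show "summable (\<lambda>k. (1 / 2) ^ k :: real)" by (simp add: summable_geometric)
    fix k assume "k \<ge> K"
    then have "2 / \<epsilon> \<le> real k" using K by linarith
    then have "2 \<le> \<epsilon> * real k" using assms by (simp add: field_simps)
    then have "2 * real k \<le> \<epsilon> * real k * real k" by (intro mult_right_mono) auto
    then have e: "2 * real k \<le> real (k\<^sup>2) * \<epsilon>" by (simp add: power2_eq_square mult_ac)
    have "spacing k powr \<epsilon> = (1 / 2) powr (real (k\<^sup>2) * \<epsilon>)"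
      by (simp add: spacing_def powr_realpow[symmetric] powr_powr del: of_nat_power)
    also have "\<dots> \<le> (1 / 2) powr (2 * real k)" using e by (intro powr_mono') auto
    also have "\<dots> = (1 / 2) powr (real (2 * k))" by simp
    also have "\<dots> = (1 / 2) ^ (2 * k)" by (rule powr_realpow) simp
    also have "\<dots> = ((1 / 2)\<^sup>2) ^ k" by (rule power_mult)
    finally have "2 ^ k * spacing k powr \<epsilon> \<le> 2 ^ k * ((1 / 2)\<^sup>2) ^ k" by (intro mult_left_mono) auto
    also have "\<dots> = (2 * (1 / 2)\<^sup>2) ^ k" by (rule power_mult_distrib[symmetric])
    finally show "norm (2 ^ k * spacing k powr \<epsilon>) \<le> (1 / 2) ^ k" by (simp add: power2_eq_square)
  qed
qed

lemma recip_bounds: "1 \<le> p \<Longrightarrow> 0 \<le> recip p \<and> recip p \<le> 1" "2 < p \<Longrightarrow> recip p < 1 / 2"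
proof -
  show "0 \<le> recip p \<and> recip p \<le> 1" if "1 \<le> p"
  proof (cases "p = \<infinity>")
    case False
    then have "1 \<le> enn2real p" using that by (metis enn2real_1 enn2real_mono infinity_ennreal_def less_top)
    then show ?thesis by (simp add: recip_def)
  qed (simp add: recip_def)
  show "recip p < 1 / 2" if "2 < p"
  proof (cases "p = \<infinity>")
    case False
    then obtain r where r: "p = ennreal r" "r \<ge> 0" by (metis ennreal_cases infinity_ennreal_def)
    have "2 < r" using that r by (metis ennreal_less_iff ennreal_numeral zero_le_numeral)
    then show ?thesis using r by (simp add: recip_def field_simps)
  qed (simp add: recip_def)
qed

locale sobolev_pair =
  fixes p :: ennreal and u :: "real^3 \<Rightarrow> real" and g :: "real^3 \<Rightarrow> real^3"
  assumes p: "1 \<le> p"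
    and u: "u \<in> Lp_space (lebesgue_on domain) p" and g: "g \<in> Lp_space (lebesgue_on domain) p"
    and wg: "weak_gradient domain u g" and cont: "continuous_on (closure domain) u"
begin

definition U :: "(real^3) set \<Rightarrow> real" where "U S = (LINT x:S|lebesgue. u x)"
definition G :: "(real^3) set \<Rightarrow> real" where "G S = (LINT x:S|lebesgue. norm (g x))"

lemma average_chain_step:
  assumes ijk: "(UNIV :: 3 set) = {i, j, k}" and sub: "cell i j k x x' y y' z z' \<subseteq> domain"
    and c: "x \<le> c" "c < d" "d \<le> x'" and c': "x \<le> c'" "c' < d'" "d' \<le> x'"
  shows "\<bar>U (cell i j k c d y y' z z')\<bar> / (d - c) \<le> \<bar>U (cell i j k c' d' y y' z z')\<bar> / (d' - c') + G (cell i j k x x' y y' z z')"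
proof -
  have "\<bar>U (cell i j k c d y y' z z') / (d - c) - U (cell i j k c' d' y y' z z') / (d' - c')\<bar> \<le> G (cell i j k x x' y y' z z')"
    unfolding U_def G_def
    by (rule cell_average[OF ijk wg open_domain sub c c'])
       (rule Lp_space_bound_on_finite_measure(1)[OF p open_domain cell_lmeasurable[OF ijk] sub], rule u g)+
  then have "\<bar>U (cell i j k c d y y' z z') / (d - c)\<bar> \<le> \<bar>U (cell i j k c' d' y y' z z') / (d' - c')\<bar> + G (cell i j k x x' y y' z z')"
    by linarith
  then show ?thesis using c c' by (simp add: abs_divide)
qed

text \<open>Three moves lead from a fine piece to the coarse slab crossing it: along the fine slab
  in direction j to the crossing, then in direction i to the full length of the coarse slab over the
  square, still at the small height h', then up to the full height h. Each is one
  \<open>average_chain_step\<close>, divided by the measure of the cross-section of the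
  move.\<close>

lemma average_chain:
  assumes ij3: "(UNIV :: 3 set) = {i, j, 3}"
    and x: "x \<le> xa" "0 < wa" "xa + wa \<le> x + s" and y: "y \<le> yb" "0 < sb" "yb + sb \<le> y + s"
    and w: "0 < w" "w \<le> s" and h: "0 < h'" "h' \<le> h"
    and L: "cell i j 3 xa (xa + wa) y (y + s) 0 h' \<subseteq> domain"
    and S: "cell j i 3 y (y + w) x (x + s) 0 h \<subseteq> domain"
  shows "\<bar>U (cell i j 3 xa (xa + wa) yb (yb + sb) 0 h')\<bar> / (wa * sb * h')
     \<le> \<bar>U (cell j i 3 y (y + w) x (x + s) 0 h)\<bar> / (s * w * h)
       + (G (cell i j 3 xa (xa + wa) y (y + s) 0 h') / (wa * h')
       + G (cell i j 3 x (x + s) y (y + w) 0 h') / (w * h')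
       + G (cell j i 3 y (y + w) x (x + s) 0 h) / (s * w))"
proof -
  have s: "s > 0" using w by linarith
  have ji3: "(UNIV :: 3 set) = {j, i, 3}" and k: "(UNIV :: 3 set) = {3, j, i}" using ij3 by blast+
  let ?P = "U (cell i j 3 xa (xa + wa) yb (yb + sb) 0 h')"
  let ?Q = "U (cell i j 3 xa (xa + wa) y (y + w) 0 h')"
  let ?R = "U (cell i j 3 x (x + s) y (y + w) 0 h')"
  let ?S = "U (cell j i 3 y (y + w) x (x + s) 0 h)"
  let ?gL = "G (cell i j 3 xa (xa + wa) y (y + s) 0 h')"
  let ?gR = "G (cell i j 3 x (x + s) y (y + w) 0 h')"
  let ?gS = "G (cell j i 3 y (y + w) x (x + s) 0 h)"
  have R: "cell i j 3 x (x + s) y (y + w) 0 h' \<subseteq> domain"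
    using S h by (auto simp: cell_def subset_iff)
  have 1: "\<bar>?P\<bar> / sb \<le> \<bar>?Q\<bar> / w + ?gL"
    using average_chain_step[OF ji3 L[unfolded cell_swap[of i]], of yb "yb + sb" y "y + w"] y w
    by (simp add: cell_swap[of j])
  have 2: "\<bar>?Q\<bar> / wa \<le> \<bar>?R\<bar> / s + ?gR"
    using average_chain_step[OF ij3 R, of xa "xa + wa" x "x + s"] x s by simp
  have 3: "\<bar>?R\<bar> / h' \<le> \<bar>?S\<bar> / h + ?gS"
    using average_chain_step[OF k S[unfolded cell_rotate[of j i 3]], of 0 h' 0 h] h
    by (simp add: cell_rotate[of j i 3] cell_swap[of i j 3])
  have "\<bar>?P\<bar> / (wa * sb * h') = (\<bar>?P\<bar> / sb) / (wa * h')" by (simp add: field_simps)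
  also have "\<dots> \<le> (\<bar>?Q\<bar> / w + ?gL) / (wa * h')" using 1 x h by (intro divide_right_mono) auto
  also have "\<dots> = (\<bar>?Q\<bar> / wa) / (w * h') + ?gL / (wa * h')" by (simp add: add_divide_distrib mult_ac)
  also have "\<dots> \<le> (\<bar>?R\<bar> / s + ?gR) / (w * h') + ?gL / (wa * h')" using 2 w h by (intro add_right_mono divide_right_mono) auto
  also have "\<dots> = (\<bar>?R\<bar> / h') / (s * w) + ?gR / (w * h') + ?gL / (wa * h')" by (simp add: add_divide_distrib mult_ac)
  also have "\<dots> \<le> (\<bar>?S\<bar> / h + ?gS) / (s * w) + ?gR / (w * h') + ?gL / (wa * h')" using 3 w s by (intro add_right_mono divide_right_mono) auto
  also have "\<dots> = \<bar>?S\<bar> / (s * w * h) + (?gL / (wa * h') + ?gR / (w * h') + ?gS / (s * w))" by (simp add: add_divide_distrib mult_ac)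
  finally show ?thesis .
qed

text \<open>The part of a slab normal to i over one grid square; a counts in direction i, b in the
  other horizontal direction.\<close>

definition piece :: "3 \<Rightarrow> nat \<Rightarrow> nat \<Rightarrow> nat \<Rightarrow> nat \<Rightarrow> (real^3) set" where
  "piece i N k a b = cell i (other i) 3 (grid N k a) (grid N k a + width k) (grid N k b) (grid N k b + spacing k) 0 (height k)"

text \<open>A Riemann sum: the area of each grid square times the absolute average of u over the
  slit piece above it. For large k it controls the integral of the boundary values.\<close>

definition mean_sum :: "3 \<Rightarrow> nat \<Rightarrow> nat \<Rightarrow> real" where
  "mean_sum i N k = (\<Sum>a<grid_size N k. \<Sum>b<grid_size N k. (spacing k)\<^sup>2 * (\<bar>U (piece i N k a b)\<bar> / (width k * spacing k * height k)))"

lemma disjoint_grid_cells: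
  assumes "wd \<le> spacing k" "vd \<le> spacing l"
  shows "disjoint_family_on (\<lambda>(a, b). cell i j 3 (grid N k a) (grid N k a + wd) (grid N l b) (grid N l b + vd) 0 h) I"
  unfolding disjoint_family_on_def
proof (intro ballI impI)
  fix m m' :: "nat \<times> nat" assume "m \<noteq> m'"
  obtain a b a' b' where m: "m = (a, b)" "m' = (a', b')" by force
  with \<open>m \<noteq> m'\<close> have ne: "\<not> (a = a' \<and> b = b')" by simp
  have "q \<notin> cell i j 3 (grid N k a') (grid N k a' + wd) (grid N l b') (grid N l b' + vd) 0 h"
    if q: "q \<in> cell i j 3 (grid N k a) (grid N k a + wd) (grid N l b) (grid N l b + vd) 0 h" for q
  proof
    assume q': "q \<in> cell i j 3 (grid N k a') (grid N k a' + wd) (grid N l b') (grid N l b' + vd) 0 h"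
    have "a = a'"
      by (rule disjoint_grid_intervals[of "- real N" _ "spacing k" "q $ i"])
         (use q q' assms spacing_pos[of k] grid_Suc[of N k] in \<open>auto simp: cell_def grid_def\<close>)
    moreover have "b = b'"
      by (rule disjoint_grid_intervals[of "- real N" _ "spacing l" "q $ j"])
         (use q q' assms spacing_pos[of l] grid_Suc[of N l] in \<open>auto simp: cell_def grid_def\<close>)
    ultimately show False using ne by simp
  qed
  then show "(case m of (a, b) \<Rightarrow> cell i j 3 (grid N k a) (grid N k a + wd) (grid N l b) (grid N l b + vd) 0 h) \<inter>
    (case m' of (a, b) \<Rightarrow> cell i j 3 (grid N k a) (grid N k a + wd) (grid N l b) (grid N l b + vd) 0 h) = {}"
    unfolding m by auto
qed

text \<open>The cells fill 2 N / \<open>spacing k\<close> strips of length 2 N and cross-section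
  \<open>wd * h\<close>, which gives the volume in the bound. The two directions may use different
  grids, as the first move of \<open>average_chain\<close> requires.\<close>

lemma sum_grid_cells:
  fixes f :: "real^3 \<Rightarrow> 'b::euclidean_space"
  assumes f: "f \<in> Lp_space (lebesgue_on domain) p" and i: "i \<noteq> 3"
    and wd: "0 \<le> wd" "wd \<le> spacing k" and h: "0 \<le> h"
    and sub: "\<And>a b. cell i (other i) 3 (grid N k a) (grid N k a + wd) (grid N l b) (grid N l b + spacing l) 0 h \<subseteq> domain"
  shows "(\<Sum>a<grid_size N k. \<Sum>b<grid_size N l. LINT x:cell i (other i) 3 (grid N k a) (grid N k a + wd) (grid N l b) (grid N l b + spacing l) 0 h|lebesgue. norm (f x))
    \<le> 2 * (4 * (real N)\<^sup>2 * (wd * h / spacing k)) powr (1 - recip p) * Lp_norm (lebesgue_on domain) p f"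
proof -
  define I where "I = {..<grid_size N k} \<times> {..<grid_size N l}"
  define C where "C = (\<lambda>(a, b). cell i (other i) 3 (grid N k a) (grid N k a + wd) (grid N l b) (grid N l b + spacing l) 0 h)"
  note U = UNIV_other[OF i]
  have "(\<Sum>m\<in>I. LINT x:C m|lebesgue. norm (f x)) \<le> 2 * (4 * (real N)\<^sup>2 * (wd * h / spacing k)) powr (1 - recip p) * Lp_norm (lebesgue_on domain) p f"
  proof (rule sum_integral_norm_le[OF p open_domain f])
    show "finite I" by (simp add: I_def)
    show "disjoint_family_on C I" unfolding C_def by (rule disjoint_grid_cells) (use wd in auto)
    fix m assume "m \<in> I"
    show "C m \<subseteq> domain" "C m \<in> lmeasurable" using sub cell_lmeasurable[OF U] by (auto simp: C_def split: prod.splits)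
    show "measure lebesgue (C m) \<le> wd * spacing l * h"
      using wd h spacing_pos[of l] by (auto simp: C_def measure_cell[OF U] split: prod.splits)
  next
    have "real (card I) * (wd * spacing l * h) = real (grid_size N k) * (real (grid_size N l) * spacing l) * (wd * h)"
      by (simp add: I_def)
    also have "real (grid_size N k) = 2 * real N / spacing k"
      using grid_size_spacing[of N k] spacing_pos[of k] by (simp add: field_simps)
    finally show "real (card I) * (wd * spacing l * h) \<le> 4 * (real N)\<^sup>2 * (wd * h / spacing k)"
      by (simp add: grid_size_spacing power2_eq_square)
  qed
  moreover have "(\<Sum>m\<in>I. LINT x:C m|lebesgue. norm (f x)) = (\<Sum>a<grid_size N k. \<Sum>b<grid_size N l. LINT x:C (a, b)|lebesgue. norm (f x))"
    unfolding I_def by (subst sum.cartesian_product) (simp add: case_prod_beta)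
  ultimately show ?thesis by (simp add: C_def)
qed

text \<open>One summand for each move of \<open>average_chain\<close>, in that order: the weight of
  its gradient term after summation over the fine grid, times the Hoelder factor of the total volume
  involved.\<close>

definition step_cost :: "nat \<Rightarrow> nat \<Rightarrow> real" where
  "step_cost N k =
     spacing k * spacing (Suc k) / (width (Suc k) * height (Suc k)) * (2 * (4 * (real N)\<^sup>2 * (width (Suc k) * height (Suc k) / spacing (Suc k))) powr (1 - recip p))
   + (spacing k)\<^sup>2 / (width k * height (Suc k)) * (2 * (4 * (real N)\<^sup>2 * (width k * height (Suc k) / spacing k)) powr (1 - recip p))
   + spacing k / width k * (2 * (4 * (real N)\<^sup>2 * (width k * height k / spacing k)) powr (1 - recip p))"

text \<open>Every fine square is compared with its parent, using the slab of the other direction, so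
  the direction alternates with the level. A parent has \<open>v * v\<close> children and
  \<open>s = v * s'\<close>, hence the averages keep their exact weight and only gradient terms are
  added.\<close>

lemma mean_sum_Suc:
  assumes i: "i \<noteq> 3"
  shows "mean_sum i N (Suc k) \<le> mean_sum (other i) N k + step_cost N k * Lp_norm (lebesgue_on domain) p g"
proof -
  define j where "j = other i"
  have j: "j \<noteq> 3" "other j = i" using other_neq i by (auto simp: j_def)
  note U = UNIV_other[OF i, folded j_def]
  define n where "n = grid_size N k"
  define v where "v = refinement k"
  have v: "v > 0" by (simp add: v_def refinement_pos)
  have n': "grid_size N (Suc k) = n * v" by (simp add: n_def v_def grid_size_Suc)
  define s where "s = spacing k" define s' where "s' = spacing (Suc k)"
  define w where "w = width k" define w' where "w' = width (Suc k)"
  define h where "h = height k" define h' where "h' = height (Suc k)"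
  have pos: "s > 0" "s' > 0" "w > 0" "w' > 0" "h > 0" "h' > 0"
    by (auto simp: s_def s'_def w_def w'_def h_def h'_def spacing_pos width_pos height_pos)
  have sv: "s = real v * s'" unfolding s_def s'_def v_def by (rule spacing_refinement)
  have ws: "w \<le> s" "w' \<le> s'" "h' \<le> h"
    using width_le[of k] width_le[of "Suc k"] spacing_pos[of k] spacing_pos[of "Suc k"] height_antimono[of k "Suc k"]
    by (auto simp: s_def s'_def w_def w'_def h_def h'_def)
  define X where "X a = grid N k a" for a
  define X' where "X' a = grid N (Suc k) a" for a
  define gL where "gL a b = G (cell i j 3 (X' a) (X' a + w') (X b) (X b + s) 0 h')" for a b
  define gR where "gR a b = G (cell j i 3 (X b) (X b + w) (X a) (X a + s) 0 h')" for a b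
  define gS where "gS a b = G (cell j i 3 (X b) (X b + w) (X a) (X a + s) 0 h)" for a b
  define A where "A a b = \<bar>U (piece j N k b a)\<bar> / (s * w * h)" for a b
  define T where "T a b = A a b + gR a b / (w * h') + gS a b / (s * w)" for a b
  have main: "\<bar>U (piece i N (Suc k) a b)\<bar> / (w' * s' * h') \<le> A (a div v) (b div v) +
     (gL a (b div v) / (w' * h') + gR (a div v) (b div v) / (w * h') + gS (a div v) (b div v) / (s * w))" for a b
  proof -
    have "\<bar>U (cell i j 3 (X' a) (X' a + w') (X' b) (X' b + s') 0 h')\<bar> / (w' * s' * h')
     \<le> \<bar>U (cell j i 3 (X (b div v)) (X (b div v) + w) (X (a div v)) (X (a div v) + s) 0 h)\<bar> / (s * w * h)
       + (G (cell i j 3 (X' a) (X' a + w') (X (b div v)) (X (b div v) + s) 0 h') / (w' * h')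
       + G (cell i j 3 (X (a div v)) (X (a div v) + s) (X (b div v)) (X (b div v) + w) 0 h') / (w * h')
       + G (cell j i 3 (X (b div v)) (X (b div v) + w) (X (a div v)) (X (a div v) + s) 0 h) / (s * w))"
    proof (rule average_chain[OF U])
      show "X (a div v) \<le> X' a" "X (b div v) \<le> X' b" "X' b + s' \<le> X (b div v) + s"
        using grid_parent[of N k] by (auto simp: X_def X'_def v_def s_def s'_def)
      show "X' a + w' \<le> X (a div v) + s"
        using grid_parent(2)[of N k a] ws(2) by (simp add: X_def X'_def v_def s_def s'_def)
      show "cell i j 3 (X' a) (X' a + w') (X (b div v)) (X (b div v) + s) 0 h' \<subseteq> domain"
        unfolding X'_def w'_def h'_def by (rule grid_cell_subset_domain[OF i order_refl])
      show "cell j i 3 (X (b div v)) (X (b div v) + w) (X (a div v)) (X (a div v) + s) 0 h \<subseteq> domain"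
        unfolding X_def w_def h_def by (rule grid_cell_subset_domain[OF j(1) order_refl])
    qed (use pos ws in auto)
    then show ?thesis
      by (simp add: A_def gL_def gR_def gS_def piece_def j j_def[symmetric] X_def X'_def s_def s'_def w_def w'_def h_def h'_def cell_swap[of i j])
  qed
  have "mean_sum i N (Suc k) = (\<Sum>a<n * v. \<Sum>b<n * v. s'\<^sup>2 * (\<bar>U (piece i N (Suc k) a b)\<bar> / (w' * s' * h')))"
    by (simp add: mean_sum_def n' s'_def w'_def h'_def)
  also have "\<dots> \<le> (\<Sum>a<n * v. \<Sum>b<n * v. s'\<^sup>2 * (A (a div v) (b div v) +
     (gL a (b div v) / (w' * h') + gR (a div v) (b div v) / (w * h') + gS (a div v) (b div v) / (s * w))))"
    by (intro sum_mono mult_left_mono main) auto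
  also have "\<dots> = (\<Sum>a<n * v. \<Sum>b<n * v. s'\<^sup>2 * (T (a div v) (b div v) + gL a (b div v) / (w' * h')))"
    by (simp add: T_def algebra_simps)
  also have "\<dots> = s'\<^sup>2 * (\<Sum>a<n * v. \<Sum>b<n * v. T (a div v) (b div v) + gL a (b div v) / (w' * h'))"
    by (simp only: sum_distrib_left)
  \<comment> \<open>The index b enters only through its parent, which yields one factor v. For T the
    same happens with a, whereas \<open>gL\<close> depends on the fine index a.\<close>
  also have "\<dots> = s'\<^sup>2 * (\<Sum>a<n * v. real v * (\<Sum>b<n. T (a div v) b + gL a b / (w' * h')))"
    using sum_div_nat[OF v, of "\<lambda>b. T (a div v) b + gL a b / (w' * h')" n for a] by simp
  also have "\<dots> = s'\<^sup>2 * (real v * ((\<Sum>a<n * v. \<Sum>b<n. T (a div v) b) + (\<Sum>a<n * v. \<Sum>b<n. gL a b) / (w' * h')))"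
    by (simp only: sum.distrib sum_divide_distrib sum_distrib_left[symmetric])
  also have "(\<Sum>a<n * v. \<Sum>b<n. T (a div v) b) = real v * (\<Sum>a<n. \<Sum>b<n. T a b)"
    by (rule sum_div_nat[OF v])
  also have "s'\<^sup>2 * (real v * (real v * (\<Sum>a<n. \<Sum>b<n. T a b) + (\<Sum>a<n * v. \<Sum>b<n. gL a b) / (w' * h')))
     = s\<^sup>2 * (\<Sum>a<n. \<Sum>b<n. A a b) + (s * s' / (w' * h') * (\<Sum>a<n * v. \<Sum>b<n. gL a b) + s\<^sup>2 / (w * h') * (\<Sum>a<n. \<Sum>b<n. gR a b) + s / w * (\<Sum>a<n. \<Sum>b<n. gS a b))"
  proof -
    have "(\<Sum>a<n. \<Sum>b<n. T a b) = (\<Sum>a<n. \<Sum>b<n. A a b) + (\<Sum>a<n. \<Sum>b<n. gR a b) / (w * h') + (\<Sum>a<n. \<Sum>b<n. gS a b) / (s * w)"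
      by (simp add: T_def sum.distrib sum_divide_distrib)
    moreover have "s'\<^sup>2 * (real v * (real v * y + z)) = s\<^sup>2 * y + s * s' * z" for y z
      unfolding sv by (simp add: algebra_simps power2_eq_square)
    moreover have "s\<^sup>2 * (x + r / (w * h') + t / (s * w)) = s\<^sup>2 * x + (s\<^sup>2 / (w * h') * r + s / w * t)" for x r t
      using pos by (simp add: field_simps power2_eq_square)
    moreover have "s * s' * (l / (w' * h')) = s * s' / (w' * h') * l" for l by simp
    ultimately show ?thesis by (simp only: add_ac)
  qed
  \<comment> \<open>The sums are exchanged because \<open>piece\<close> lists the index of its own
    direction first.\<close>
  also have "s\<^sup>2 * (\<Sum>a<n. \<Sum>b<n. A a b) = mean_sum j N k"
    unfolding mean_sum_def sum_distrib_left n_def[symmetric] s_def[symmetric] w_def[symmetric] h_def[symmetric] A_def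
    by (subst sum.swap) (simp add: mult.commute)
  finally have "mean_sum i N (Suc k) \<le> mean_sum j N k + (s * s' / (w' * h') * (\<Sum>a<n * v. \<Sum>b<n. gL a b) + s\<^sup>2 / (w * h') * (\<Sum>a<n. \<Sum>b<n. gR a b) + s / w * (\<Sum>a<n. \<Sum>b<n. gS a b))" .
  moreover have "s * s' / (w' * h') * (\<Sum>a<n * v. \<Sum>b<n. gL a b) + s\<^sup>2 / (w * h') * (\<Sum>a<n. \<Sum>b<n. gR a b) + s / w * (\<Sum>a<n. \<Sum>b<n. gS a b)
     \<le> step_cost N k * Lp_norm (lebesgue_on domain) p g"
  proof -
    let ?g = "Lp_norm (lebesgue_on domain) p g"
    have L: "(\<Sum>a<n * v. \<Sum>b<n. gL a b) \<le> 2 * (4 * (real N)\<^sup>2 * (w' * h' / s')) powr (1 - recip p) * ?g"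
      unfolding n'[symmetric] unfolding gL_def G_def X_def X'_def n_def j_def s_def s'_def
      by (rule sum_grid_cells[OF g i])
         (use pos ws grid_cell_subset_domain[OF i order_refl, where k="Suc k"] in \<open>auto simp: s'_def w'_def h'_def\<close>)
    have "(\<Sum>b<n. \<Sum>a<n. gR a b) \<le> 2 * (4 * (real N)\<^sup>2 * (w * h' / s)) powr (1 - recip p) * ?g"
      unfolding gR_def G_def X_def n_def s_def j(2)[symmetric]
      by (rule sum_grid_cells[OF g j(1)])
         (use pos ws grid_cell_subset_domain[OF j(1), where h=h' and k=k] in \<open>auto simp: s_def w_def h_def\<close>)
    then have R: "(\<Sum>a<n. \<Sum>b<n. gR a b) \<le> 2 * (4 * (real N)\<^sup>2 * (w * h' / s)) powr (1 - recip p) * ?g"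
      by (subst sum.swap)
    have "(\<Sum>b<n. \<Sum>a<n. gS a b) \<le> 2 * (4 * (real N)\<^sup>2 * (w * h / s)) powr (1 - recip p) * ?g"
      unfolding gS_def G_def X_def n_def s_def j(2)[symmetric]
      by (rule sum_grid_cells[OF g j(1)])
         (use pos ws grid_cell_subset_domain[OF j(1), where h=h and k=k] in \<open>auto simp: s_def w_def h_def\<close>)
    then have S: "(\<Sum>a<n. \<Sum>b<n. gS a b) \<le> 2 * (4 * (real N)\<^sup>2 * (w * h / s)) powr (1 - recip p) * ?g"
      by (subst sum.swap)
    have "s * s' / (w' * h') * (\<Sum>a<n * v. \<Sum>b<n. gL a b) + s\<^sup>2 / (w * h') * (\<Sum>a<n. \<Sum>b<n. gR a b) + s / w * (\<Sum>a<n. \<Sum>b<n. gS a b)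
      \<le> s * s' / (w' * h') * (2 * (4 * (real N)\<^sup>2 * (w' * h' / s')) powr (1 - recip p) * ?g)
       + s\<^sup>2 / (w * h') * (2 * (4 * (real N)\<^sup>2 * (w * h' / s)) powr (1 - recip p) * ?g)
       + s / w * (2 * (4 * (real N)\<^sup>2 * (w * h / s)) powr (1 - recip p) * ?g)"
      using pos by (intro add_mono mult_left_mono L R S) auto
    also have "\<dots> = step_cost N k * ?g"
      unfolding step_cost_def s_def s'_def w_def w'_def h_def h'_def distrib_right mult.assoc ..
    finally show ?thesis .
  qed
  ultimately show ?thesis unfolding j_def by linarith
qed

text \<open>The recursion ends at level 0, where all pieces have one fixed size and their averages
  are bounded by the Lp norm of u. The direction stays arbitrary in the induction because it changes
  at every step.\<close>

lemma mean_sum_bound: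
  "i \<noteq> 3 \<Longrightarrow> mean_sum i N k \<le> 2 * (4 * (real N)\<^sup>2 * (width 0 * height 0 / spacing 0)) powr (1 - recip p) / (width 0 * height 0) * Lp_norm (lebesgue_on domain) p u
     + (\<Sum>l<k. step_cost N l) * Lp_norm (lebesgue_on domain) p g"
proof (induction k arbitrary: i)
  case 0
  have s0: "spacing 0 = 1" by (simp add: spacing_def)
  have wh: "width 0 * height 0 > 0" by (simp add: width_pos height_pos)
  have "mean_sum i N 0 \<le> (\<Sum>a<grid_size N 0. \<Sum>b<grid_size N 0. (LINT x:piece i N 0 a b|lebesgue. norm (u x)) / (width 0 * height 0))"
    unfolding mean_sum_def
  proof (intro sum_mono)
    fix a b
    have "\<bar>U (piece i N 0 a b)\<bar> \<le> (LINT x:piece i N 0 a b|lebesgue. norm (u x))"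
      using integral_abs_bound[of lebesgue "\<lambda>y. indicator (piece i N 0 a b) y *\<^sub>R (u y)"]
      by (simp add: U_def set_lebesgue_integral_def abs_mult)
    then show "(spacing 0)\<^sup>2 * (\<bar>U (piece i N 0 a b)\<bar> / (width 0 * spacing 0 * height 0)) \<le> (LINT x:piece i N 0 a b|lebesgue. norm (u x)) / (width 0 * height 0)"
      using wh by (simp add: s0 divide_right_mono)
  qed
  also have "\<dots> = (\<Sum>a<grid_size N 0. \<Sum>b<grid_size N 0. LINT x:piece i N 0 a b|lebesgue. norm (u x)) / (width 0 * height 0)"
    by (simp add: sum_divide_distrib)
  also have "\<dots> \<le> 2 * (4 * (real N)\<^sup>2 * (width 0 * height 0 / spacing 0)) powr (1 - recip p) * Lp_norm (lebesgue_on domain) p u / (width 0 * height 0)"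
    unfolding piece_def
    by (intro divide_right_mono sum_grid_cells[OF u 0])
       (use wh width_pos[of 0] height_pos[of 0] width_le[of 0] spacing_pos[of 0] grid_cell_subset_domain[OF 0 order_refl, where k=0] in auto)
  finally show ?case by simp
next
  case (Suc k)
  have "other i \<noteq> 3" by (rule other_neq)
  from mean_sum_Suc[OF Suc.prems, of N k] Suc.IH[OF this] show ?case by (simp add: algebra_simps)
qed

text \<open>The two moves at the small height cost
  \<open>spacing k * height (Suc k) powr (- \<theta>)\<close>, that is
  \<open>spacing k powr (1 - 2 * \<theta>)\<close>, up to a factor of order 2^k; the exponent is
  positive because p > 2. The upward move costs \<open>height k powr (1 - \<theta>)\<close>, at most
  the square root of the height.\<close>

lemma summable_step_cost:
  assumes "2 < p" "N > 0"
  shows "summable (step_cost N)"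
proof -
  define \<theta> where "\<theta> = recip p"
  have \<theta>: "0 \<le> \<theta>" "\<theta> \<le> 1" "\<theta> < 1 / 2" using recip_bounds[of p] p assms(1) by (auto simp: \<theta>_def)
  define M where "M = 4 * (real N)\<^sup>2"
  have "1 \<le> (real N)\<^sup>2" using assms(2) by (simp add: one_le_power)
  then have M: "M \<ge> 1" by (simp add: M_def)
  define \<rho> where "\<rho> k = (1 / 2 :: real) ^ (k + 6) / 3" for k
  have w: "width k = spacing k * \<rho> k" for k by (simp add: \<rho>_def width_eq)
  have \<rho>: "0 < \<rho> k" "\<rho> k \<le> 1" for k
  proof -
    have "(1 / 2 :: real) ^ (k + 6) \<le> 1" by (intro power_le_one) auto
    then show "0 < \<rho> k" "\<rho> k \<le> 1" by (auto simp: \<rho>_def)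
  qed
  \<comment> \<open>The constant is 3 * 2^6; at level k + 1 the value doubles, whence 768 next to
    384 in the bounds that follow.\<close>
  have inv: "1 / \<rho> k = 192 * 2 ^ k" for k by (simp add: \<rho>_def power_add power_divide)
  have h1: "height k \<le> 1" for k by (simp add: height_def power_le_one)
  have step: "step_cost N k \<le> 1152 * M * (2 ^ k * spacing k powr (1 - 2 * \<theta>)) + 384 * M * (2 ^ k * height k powr (1 / 2))" for k
  proof -
    note sp = spacing_pos[of k] spacing_pos[of "Suc k"] height_pos[of k] height_pos[of "Suc k"]
    have s2: "spacing k * height (Suc k) powr (- \<theta>) = spacing k powr (1 - 2 * \<theta>)"
    proof -
      have "height (Suc k) powr (- \<theta>) = spacing k powr (- (2 * \<theta>))"
        using sp(1) by (simp add: height_Suc powr_powr flip: powr_numeral)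
      then show ?thesis using sp(1) by (simp add: powr_diff powr_minus_divide)
    qed
    have "spacing k * spacing (Suc k) / (width (Suc k) * height (Suc k)) * (2 * (M * (width (Suc k) * height (Suc k) / spacing (Suc k))) powr (1 - \<theta>))
       = spacing k / (\<rho> (Suc k) * height (Suc k)) * (2 * (M * (\<rho> (Suc k) * height (Suc k))) powr (1 - \<theta>))"
      using sp by (simp add: w)
    also have "\<dots> \<le> 2 * M * (spacing k * height (Suc k) powr (- \<theta>)) / \<rho> (Suc k)"
      using sp \<rho> M \<theta> by (intro cost_term_le) auto
    also have "\<dots> = 2 * M * spacing k powr (1 - 2 * \<theta>) * (1 / \<rho> (Suc k))" unfolding s2 by simp
    also have "\<dots> = 768 * M * (2 ^ k * spacing k powr (1 - 2 * \<theta>))" unfolding inv by simp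
    finally have 1: "spacing k * spacing (Suc k) / (width (Suc k) * height (Suc k)) * (2 * (M * (width (Suc k) * height (Suc k) / spacing (Suc k))) powr (1 - \<theta>))
      \<le> 768 * M * (2 ^ k * spacing k powr (1 - 2 * \<theta>))" .
    have "(spacing k)\<^sup>2 / (width k * height (Suc k)) * (2 * (M * (width k * height (Suc k) / spacing k)) powr (1 - \<theta>))
       = spacing k / (\<rho> k * height (Suc k)) * (2 * (M * (\<rho> k * height (Suc k))) powr (1 - \<theta>))"
      using sp by (simp add: w power2_eq_square)
    also have "\<dots> \<le> 2 * M * (spacing k * height (Suc k) powr (- \<theta>)) / \<rho> k"
      using sp \<rho> M \<theta> by (intro cost_term_le) auto
    also have "\<dots> = 2 * M * spacing k powr (1 - 2 * \<theta>) * (1 / \<rho> k)" unfolding s2 by simp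
    also have "\<dots> = 384 * M * (2 ^ k * spacing k powr (1 - 2 * \<theta>))" unfolding inv by simp
    finally have 2: "(spacing k)\<^sup>2 / (width k * height (Suc k)) * (2 * (M * (width k * height (Suc k) / spacing k)) powr (1 - \<theta>))
      \<le> 384 * M * (2 ^ k * spacing k powr (1 - 2 * \<theta>))" .
    have "spacing k / width k * (2 * (M * (width k * height k / spacing k)) powr (1 - \<theta>))
       = height k / (\<rho> k * height k) * (2 * (M * (\<rho> k * height k)) powr (1 - \<theta>))"
      using sp by (simp add: w)
    also have "\<dots> \<le> 2 * M * (height k * height k powr (- \<theta>)) / \<rho> k"
      using sp \<rho> M \<theta> by (intro cost_term_le) auto
    also have "height k * height k powr (- \<theta>) = height k powr (1 - \<theta>)"
      using sp by (simp add: powr_diff powr_minus_divide)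
    also have "2 * M * (height k powr (1 - \<theta>)) / \<rho> k = 2 * M * height k powr (1 - \<theta>) * (1 / \<rho> k)" by simp
    also have "\<dots> = 384 * M * (2 ^ k * height k powr (1 - \<theta>))" unfolding inv by simp
    also have "\<dots> \<le> 384 * M * (2 ^ k * height k powr (1 / 2))"
      using M \<theta> h1[of k] sp by (intro mult_left_mono powr_mono') auto
    finally have 3: "spacing k / width k * (2 * (M * (width k * height k / spacing k)) powr (1 - \<theta>))
      \<le> 384 * M * (2 ^ k * height k powr (1 / 2))" .
    have "step_cost N k \<le> 768 * M * (2 ^ k * spacing k powr (1 - 2 * \<theta>)) + 384 * M * (2 ^ k * spacing k powr (1 - 2 * \<theta>)) + 384 * M * (2 ^ k * height k powr (1 / 2))"
      unfolding step_cost_def M_def[symmetric] \<theta>_def[symmetric] by (intro add_mono 1 2 3)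
    then show ?thesis by simp
  qed
  have sh: "summable (\<lambda>k. 2 ^ k * height k powr (1 / 2))"
  proof -
    have "height (Suc k) powr (1 / 2) = spacing k powr 1" for k
      using spacing_pos[of k] by (simp add: height_Suc powr_half_sqrt)
    then have "(\<lambda>k. 2 ^ Suc k * height (Suc k) powr (1 / 2)) = (\<lambda>k. 2 * (2 ^ k * spacing k powr 1))"
      by (simp add: fun_eq_iff)
    moreover have "summable (\<lambda>k. 2 * (2 ^ k * spacing k powr 1))"
      by (intro summable_mult summable_spacing_powr) simp
    ultimately have "summable (\<lambda>k. 2 ^ Suc k * height (Suc k) powr (1 / 2))" by (simp only:)
    then show ?thesis by (subst (asm) summable_Suc_iff)
  qed
  show ?thesis
  proof (rule summable_comparison_test'[where N=0])
    show "summable (\<lambda>k. 1152 * M * (2 ^ k * spacing k powr (1 - 2 * \<theta>)) + 384 * M * (2 ^ k * height k powr (1 / 2)))"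
      using \<theta> by (intro summable_add summable_mult summable_spacing_powr sh) auto
    fix k
    have "step_cost N k \<ge> 0" unfolding step_cost_def
      using width_pos[of k] width_pos[of "Suc k"] spacing_pos[of k] spacing_pos[of "Suc k"] height_pos[of k] height_pos[of "Suc k"]
      by (intro add_nonneg_nonneg mult_nonneg_nonneg divide_nonneg_nonneg) auto
    then show "norm (step_cost N k) \<le> 1152 * M * (2 ^ k * spacing k powr (1 - 2 * \<theta>)) + 384 * M * (2 ^ k * height k powr (1 / 2))"
      using step[of k] by simp
  qed
qed

lemma step_cost_nonneg: "step_cost N k \<ge> 0"
  unfolding step_cost_def
  using width_pos[of k] width_pos[of "Suc k"] spacing_pos[of k] spacing_pos[of "Suc k"] height_pos[of k] height_pos[of "Suc k"]
  by (intro add_nonneg_nonneg mult_nonneg_nonneg divide_nonneg_nonneg) auto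

text \<open>For large k a grid square and the slit piece above it are so small that u on the square
  is within \<eta> of its average over the piece. Uniform continuity is available on a compact part
  of the closure of the domain, which contains the whole square since the plane belongs to the
  boundary.\<close>

lemma plane_estimate:
  assumes "N > 0" and S: "\<And>k. mean_sum 1 N k \<le> S"
  shows "(\<integral>\<^sup>+q\<in>{q. q $ 3 = 0} \<inter> pillar N. ennreal \<bar>u q\<bar> \<partial>H2) \<le> ennreal (2 * S)"
proof (rule ennreal_le_epsilon)
  fix \<epsilon> :: real assume "\<epsilon> > 0"
  have o: "other 1 = 2" by (simp add: other_def)
  have U: "(UNIV :: 3 set) = {1, 2, 3}" by (rule UNIV_3)
  have U': "(UNIV :: 3 set) = {3, 1, 2}" using U by blast
  \<comment> \<open>The square has area 4 N^2 and Hausdorff bound twice that, so the oscillation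
    contributes 8 N^2 \<eta>.\<close>
  define \<eta> where "\<eta> = \<epsilon> / (8 * (real N)\<^sup>2)"
  have \<eta>: "\<eta> > 0" using \<open>\<epsilon> > 0\<close> assms(1) by (simp add: \<eta>_def)
  define Z where "Z = closure domain \<inter> cbox (vec3 1 2 (- real N) (- real N) 0) (vec3 1 2 (real N) (real N) 1)"
  have "compact Z" unfolding Z_def by (intro closed_Int_compact) auto
  moreover have "continuous_on Z u" using cont by (rule continuous_on_subset) (simp add: Z_def)
  ultimately have "uniformly_continuous_on Z u" by (rule compact_uniformly_continuous[rotated])
  then obtain \<delta> where \<delta>: "\<delta> > 0" "\<And>p q. p \<in> Z \<Longrightarrow> q \<in> Z \<Longrightarrow> dist q p < \<delta> \<Longrightarrow> dist (u q) (u p) < \<eta>"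
    using \<eta> unfolding uniformly_continuous_on_def by metis
  have "eventually (\<lambda>k. spacing k < \<delta> / 4) sequentially" "eventually (\<lambda>k. height k < \<delta> / 4) sequentially"
    using order_tendstoD(2)[OF spacing_tendsto, of "\<delta> / 4"] order_tendstoD(2)[OF height_tendsto, of "\<delta> / 4"] \<delta>(1) by auto
  then have "eventually (\<lambda>k. spacing k < \<delta> / 4 \<and> height k < \<delta> / 4) sequentially" by eventually_elim auto
  then obtain k where k: "spacing k < \<delta> / 4" "height k < \<delta> / 4" by (auto simp: eventually_sequentially)
  note pos = spacing_pos[of k] width_pos[of k] height_pos[of k]
  define n where "n = grid_size N k"
  define I where "I = {..<n} \<times> {..<n}"
  define C where "C = (\<lambda>(a, b). {q::real^3. q $ 3 = 0 \<and> grid N k a \<le> q $ 1 \<and> q $ 1 \<le> grid N k a + spacing k \<and> grid N k b \<le> q $ 2 \<and> q $ 2 \<le> grid N k b + spacing k})"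
  define A where "A = (\<lambda>(a, b). \<bar>U (piece 1 N k a b)\<bar> / (width k * spacing k * height k))"
  have h1: "height k \<le> 1" by (simp add: height_def power_le_one)
  have main: "\<bar>u q\<bar> \<le> A m + \<eta>" if m: "m \<in> I" and q: "q \<in> C m" for m q
  proof -
    obtain a b where ab: "m = (a, b)" "a < n" "b < n" using m by (auto simp: I_def)
    have P: "piece 1 N k a b = cell 1 2 3 (grid N k a) (grid N k a + width k) (grid N k b) (grid N k b + spacing k) 0 (height k)"
      by (simp add: piece_def o)
    have Pd: "piece 1 N k a b \<subseteq> domain" unfolding P by (rule grid_cell_subset_domain) auto
    have Pm: "piece 1 N k a b \<in> lmeasurable" unfolding P by (rule cell_lmeasurable[OF U])
    have g: "- real N \<le> grid N k a" "grid N k a + spacing k \<le> real N" "- real N \<le> grid N k b" "grid N k b + spacing k \<le> real N"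
      using grid_bounds ab unfolding n_def by blast+
    have "\<bar>u q\<bar> \<le> \<bar>(LINT x:piece 1 N k a b|lebesgue. u x) / (width k * spacing k * height k)\<bar> + \<eta>"
    proof (rule abs_le_average[OF Pm])
      show "set_integrable lebesgue (piece 1 N k a b) u"
        by (rule Lp_space_bound_on_finite_measure(1)[OF p open_domain Pm Pd u])
      show "measure lebesgue (piece 1 N k a b) = width k * spacing k * height k"
        unfolding P by (subst measure_cell[OF U]) (use pos in auto)
      show "width k * spacing k * height k > 0" using pos by simp
      fix y assume y: "y \<in> piece 1 N k a b"
      have "q \<in> frontier domain" using q by (intro plane_subset_frontier) (simp add: C_def ab)
      then have qZ: "q \<in> Z" unfolding Z_def using q g by (auto simp: C_def ab frontier_def mem_cbox_vec3[OF U])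
      have yZ: "y \<in> Z" unfolding Z_def
        using y Pd closure_subset[of domain] g h1 width_le[of k] pos unfolding P by (auto simp: mem_cbox_vec3[OF U] cell_def)
      have "\<bar>q $ 1 - y $ 1\<bar> \<le> spacing k" "\<bar>q $ 2 - y $ 2\<bar> \<le> spacing k" "\<bar>q $ 3 - y $ 3\<bar> \<le> height k"
        using q y width_le[of k] pos unfolding P by (auto simp: C_def ab cell_def abs_le_iff)
      then have "(\<Sum>l\<in>UNIV. \<bar>(q - y) $ l\<bar>) \<le> spacing k + spacing k + height k" by (simp add: sum_3'[OF U])
      then have "norm (q - y) \<le> spacing k + spacing k + height k" using norm_le_l1_cart[of "q - y"] by linarith
      then have "dist q y < \<delta>" using k \<delta>(1) by (simp add: dist_norm)
      then show "\<bar>u q - u y\<bar> \<le> \<eta>" using \<delta>(2)[OF yZ qZ] by (simp add: dist_real_def)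
    qed
    then show ?thesis using pos by (simp add: A_def ab U_def abs_divide abs_mult)
  qed
  have "(\<integral>\<^sup>+q\<in>{q. q $ 3 = 0} \<inter> pillar N. ennreal \<bar>u q\<bar> \<partial>H2) \<le> ennreal (\<Sum>m\<in>I. (2 * spacing k * spacing k) * (A m + \<eta>))"
  proof (rule nn_integral_hausdorff_cover[where C=C])
    show "finite I" by (simp add: I_def)
    show "{q. q $ 3 = 0} \<inter> pillar N \<subseteq> (\<Union>m\<in>I. C m)"
    proof
      fix q :: "real^3" assume q: "q \<in> {q. q $ 3 = 0} \<inter> pillar N"
      then have b: "\<bar>q $ 1\<bar> \<le> real N" "\<bar>q $ 2\<bar> \<le> real N" by (auto simp: pillar_def)
      have n0: "n > 0" using assms(1) by (simp add: n_def grid_size_def)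
      have nn: "(2 * real N) / real n = spacing k" using grid_size_spacing[of N k] n0 by (simp add: n_def field_simps)
      have ex: "\<exists>a<n. grid N k a \<le> y \<and> y \<le> grid N k a + spacing k" if "\<bar>y\<bar> \<le> real N" for y
      proof -
        have "- real N \<le> y" "y \<le> - real N + 2 * real N" "2 * real N > 0" using that assms(1) by auto
        then obtain a where "a < n" "- real N + real a * (2 * real N / real n) \<le> y" "y \<le> - real N + real (Suc a) * (2 * real N / real n)"
          using grid_interval[OF _ _ _ n0] by metis
        then have "a < n" "grid N k a \<le> y" "y \<le> grid N k (Suc a)" unfolding nn grid_def by auto
        then show ?thesis unfolding grid_Suc by blast
      qed
      obtain a where "a < n" "grid N k a \<le> q $ 1 \<and> q $ 1 \<le> grid N k a + spacing k" using ex[OF b(1)] by blast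
      moreover obtain c where "c < n" "grid N k c \<le> q $ 2 \<and> q $ 2 \<le> grid N k c + spacing k" using ex[OF b(2)] by blast
      ultimately have "(a, c) \<in> I" "q \<in> C (a, c)" using q by (auto simp: I_def C_def)
      then show "q \<in> (\<Union>m\<in>I. C m)" by blast
    qed
    fix m assume m: "m \<in> I"
    obtain a b where ab: "m = (a, b)" by force
    have "closed {q::real^3. q $ 3 = 0 \<and> grid N k a \<le> q $ 1 \<and> q $ 1 \<le> grid N k a + spacing k \<and> grid N k b \<le> q $ 2 \<and> q $ 2 \<le> grid N k b + spacing k}"
      by (intro closed_Collect_conj closed_Collect_eq closed_Collect_le continuous_intros)
    then show "C m \<in> sets borel" by (simp add: C_def ab)
    show "hausdorff_outer 2 (C m) \<le> ennreal (2 * spacing k * spacing k)"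
      by (rule hausdorff_outer_rectangle[OF U' pos(1,1), where c=0 and b="grid N k a" and b'="grid N k b"]) (auto simp: C_def ab)
    show "0 \<le> 2 * spacing k * spacing k" "0 \<le> A m + \<eta>" using pos \<eta> by (auto simp: A_def ab)
  qed (use main in auto)
  also have "(\<Sum>m\<in>I. (2 * spacing k * spacing k) * (A m + \<eta>)) = 2 * (\<Sum>m\<in>I. (spacing k)\<^sup>2 * A m) + 2 * ((real n * spacing k) * (real n * spacing k)) * \<eta>"
    by (simp add: distrib_left sum.distrib sum_distrib_left I_def power2_eq_square mult_ac)
  also have "(\<Sum>m\<in>I. (spacing k)\<^sup>2 * A m) = mean_sum 1 N k"
    unfolding mean_sum_def I_def n_def[symmetric] A_def by (subst sum.cartesian_product) (simp add: case_prod_beta)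
  also have "2 * ((real n * spacing k) * (real n * spacing k)) * \<eta> = \<epsilon>"
    unfolding n_def grid_size_spacing using assms(1) by (simp add: \<eta>_def power2_eq_square)
  finally have "(\<integral>\<^sup>+q\<in>{q. q $ 3 = 0} \<inter> pillar N. ennreal \<bar>u q\<bar> \<partial>H2) \<le> ennreal (2 * mean_sum 1 N k + \<epsilon>)" .
  also have "\<dots> \<le> ennreal (2 * S + \<epsilon>)" using S[of k] by (intro ennreal_leI) auto
  also have "\<dots> = ennreal (2 * S) + ennreal \<epsilon>"
  proof (rule ennreal_plus)
    have "0 \<le> mean_sum 1 N k" unfolding mean_sum_def using pos by (intro sum_nonneg) auto
    then show "0 \<le> 2 * S" using S[of k] by linarith
  qed (use \<open>\<epsilon> > 0\<close> in simp)
  finally show "(\<integral>\<^sup>+q\<in>{q. q $ 3 = 0} \<inter> pillar N. ennreal \<bar>u q\<bar> \<partial>H2) \<le> ennreal (2 * S) + ennreal \<epsilon>" .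
qed

end

text \<open>Summability of the step costs makes the bound on \<open>mean_sum\<close> uniform in the
  level, and it is linear in the Sobolev norm; this is the a priori bound for squares of the
  plane.\<close>

lemma approx_trace_zero_plane:
  assumes p: "2 < p" and tr: "approx_trace p domain (\<lambda>_. 0) \<phi>" and "N > 0"
  shows "AE q in H2. q \<in> ({q. q $ 3 = 0} \<inter> pillar N) \<inter> frontier domain \<longrightarrow> \<phi> q = 0"
proof -
  have "(1::ennreal) \<le> 2" by simp
  then have p1: "1 \<le> p" using less_imp_le[OF p] by (rule order_trans)
  define c where "c = 2 * (4 * (real N)\<^sup>2 * (width 0 * height 0 / spacing 0)) powr (1 - recip p) / (width 0 * height 0)"
  define c' where "c' = (\<Sum>l. sobolev_pair.step_cost p N l)"
  have c: "c \<ge> 0" using width_pos[of 0] height_pos[of 0] by (simp add: c_def)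
  have closed: "closed ({q::real^3. q $ 3 = 0} \<inter> pillar N)"
    by (intro closed_Int closed_pillar closed_Collect_eq continuous_intros)
  have "{q::real^3. q $ 3 = 0} \<inter> pillar N \<subseteq> cbox (vec3 1 2 (- real N) (- real N) 0) (vec3 1 2 (real N) (real N) 0)"
  proof
    fix q :: "real^3" assume q: "q \<in> {q. q $ 3 = 0} \<inter> pillar N"
    then have "\<bar>q $ 1\<bar> \<le> real N" "\<bar>q $ 2\<bar> \<le> real N" by (auto simp: pillar_def)
    then show "q \<in> cbox (vec3 1 2 (- real N) (- real N) 0) (vec3 1 2 (real N) (real N) 0)"
      using q by (simp add: mem_cbox_vec3[OF UNIV_3] abs_le_iff)
  qed
  with closed have comp: "compact ({q::real^3. q $ 3 = 0} \<inter> pillar N)"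
    by (metis bounded_cbox bounded_subset compact_eq_bounded_closed)
  show ?thesis
  proof (rule approx_trace_zero_on[OF open_domain tr _ comp, where C="2 * (c + c')"])
    show "frontier domain \<subseteq> Gamma_loc domain" by (simp add: Gamma_loc_domain)
    fix u :: "real^3 \<Rightarrow> real" and g :: "real^3 \<Rightarrow> real^3"
    assume "u \<in> Lp_space (lebesgue_on domain) p" "g \<in> Lp_space (lebesgue_on domain) p"
      "weak_gradient domain u g" "continuous_on (closure domain) u"
    then interpret sobolev_pair p u g by unfold_locales (use p1 in auto)
    let ?u = "Lp_norm (lebesgue_on domain) p u" and ?g = "Lp_norm (lebesgue_on domain) p g"
    have sums: "summable (step_cost N)" by (rule summable_step_cost[OF assms(1,3)])
    have c': "(\<Sum>l<k. step_cost N l) \<le> c'" for k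
      unfolding c'_def using step_cost_nonneg by (intro sum_le_suminf sums) auto
    have c'0: "c' \<ge> 0" using c'[of 0] by simp
    have "mean_sum 1 N k \<le> (c + c') * (?u + ?g)" for k
    proof -
      have "mean_sum 1 N k \<le> c * ?u + (\<Sum>l<k. step_cost N l) * ?g"
        unfolding c_def by (rule mean_sum_bound) simp
      also have "\<dots> \<le> c * ?u + c' * ?g" by (intro add_left_mono mult_right_mono c' Lp_norm_nonneg)
      also have "\<dots> \<le> (c + c') * (?u + ?g)"
        using c c'0 by (simp add: distrib_left distrib_right Lp_norm_nonneg)
      finally show ?thesis .
    qed
    from plane_estimate[OF assms(3) this]
    show "(\<integral>\<^sup>+q\<in>{q. q $ 3 = 0} \<inter> pillar N. ennreal \<bar>u q\<bar> \<partial>H2) \<le> ennreal (2 * (c + c') * (?u + ?g))"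
      by (simp only: mult.assoc)
  qed
qed

theorem approx_trace_unique_domain:
  assumes "2 < p"
  shows "approx_trace_unique p domain"
  unfolding approx_trace_unique_def
proof (intro allI impI)
  fix \<phi> assume tr: "approx_trace p domain (\<lambda>_. 0) \<phi>"
  have "(1::ennreal) \<le> 2" by simp
  then have p1: "1 \<le> p" using less_imp_le[OF assms] by (rule order_trans)
  have "AE q in H2. \<forall>N. q \<in> ({q. q $ 3 = 0} \<inter> pillar (Suc N)) \<inter> frontier domain \<longrightarrow> \<phi> q = 0"
    unfolding AE_all_countable by (intro allI approx_trace_zero_plane[OF assms tr]) simp
  with approx_trace_zero_lateral[OF p1 tr]
  show "AE q in H2. q \<in> frontier domain \<longrightarrow> \<phi> q = 0"
  proof eventually_elim
    case (elim q)
    obtain N where "norm q \<le> real N" using real_arch_simple by blast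
    then have "\<bar>q $ l\<bar> \<le> real (Suc N)" for l
      using component_le_norm_cart[of q l] by simp
    then have "q \<in> pillar (Suc N)" by (simp add: pillar_def)
    then show ?case using elim by blast
  qed
qed

section \<open>Non-uniqueness for small exponents\<close>

text \<open>Up to \<pi>/3 the cosine is at least 1/2, so sin x - x/2 increases from 0. Beyond that,
  sin x is at least sqrt 3 / 2 while x/2 is at most \<pi>/4.\<close>

lemma sin_ge_half:
  assumes "0 \<le> x" "x \<le> pi / 2" shows "x / 2 \<le> sin x"
proof (cases "x \<le> pi / 3")
  case True
  have "sin 0 - 0 / 2 \<le> sin x - x / 2"
  proof (rule DERIV_nonneg_imp_nondecreasing[OF assms(1)])
    fix y assume y: "0 \<le> y" "y \<le> x"
    have "cos (pi / 3) \<le> cos y" using y True by (intro cos_monotone_0_pi_le) auto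
    then have "0 \<le> cos y - 1 / 2" by (simp add: cos_60)
    moreover have "((\<lambda>x. sin x - x / 2) has_real_derivative cos y - 1 / 2) (at y)"
      by (auto intro!: derivative_eq_intros)
    ultimately show "\<exists>d. ((\<lambda>x. sin x - x / 2) has_real_derivative d) (at y) \<and> 0 \<le> d" by blast
  qed
  then show ?thesis by simp
next
  case False
  have "pi / 4 \<le> 4 / 5" using pi_less_4 pi_approx by simp
  then have "x / 2 \<le> 4 / 5" using assms(2) by simp
  also have "4 / 5 \<le> sqrt 3 / 2"
  proof -
    have "sqrt ((8 / 5)\<^sup>2) \<le> sqrt 3" by (rule real_sqrt_le_mono) (simp add: power2_eq_square)
    then show ?thesis by simp
  qed
  also have "sqrt 3 / 2 = sin (pi / 3)" by (simp add: sin_60)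
  also have "\<dots> \<le> sin x" using False assms by (intro sin_monotone_2pi_le) auto
  finally show ?thesis .
qed

text \<open>With values in the unit interval the derivative bounds simply add under multiplication,
  which suits products of many cut-offs.\<close>

definition unit_C1 :: "real \<Rightarrow> (real \<Rightarrow> real) \<Rightarrow> bool" where
  "unit_C1 L f \<longleftrightarrow> (\<exists>f'. (\<forall>x. (f has_real_derivative f' x) (at x)) \<and> continuous_on UNIV f' \<and> (\<forall>x. \<bar>f' x\<bar> \<le> L)) \<and> (\<forall>x. 0 \<le> f x \<and> f x \<le> 1)"

lemma unit_C1_mult:
  assumes "unit_C1 L f" "unit_C1 M g" shows "unit_C1 (L + M) (\<lambda>x. f x * g x)"
proof -
  obtain f' g' where f': "\<And>x. (f has_real_derivative f' x) (at x)" "continuous_on UNIV f'" "\<And>x. \<bar>f' x\<bar> \<le> L"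
    and g': "\<And>x. (g has_real_derivative g' x) (at x)" "continuous_on UNIV g'" "\<And>x. \<bar>g' x\<bar> \<le> M"
    using assms unfolding unit_C1_def by blast
  have b: "0 \<le> f x" "f x \<le> 1" "0 \<le> g x" "g x \<le> 1" for x using assms by (auto simp: unit_C1_def)
  have c: "continuous_on UNIV f" "continuous_on UNIV g"
    using f'(1) g'(1) by (auto intro!: continuous_at_imp_continuous_on DERIV_isCont)
  show ?thesis
    unfolding unit_C1_def
  proof (intro conjI exI[of _ "\<lambda>x. f' x * g x + f x * g' x"] allI)
    fix x
    show "((\<lambda>x. f x * g x) has_real_derivative f' x * g x + f x * g' x) (at x)"
      by (auto intro!: derivative_eq_intros f'(1) g'(1))
    have "L \<ge> 0" using f'(3)[of x] by linarith
    have "\<bar>f' x\<bar> * g x \<le> L * 1" by (rule mult_mono) (use f'(3)[of x] b[of x] \<open>L \<ge> 0\<close> in auto)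
    moreover have "f x * \<bar>g' x\<bar> \<le> 1 * M" by (rule mult_mono) (use g'(3)[of x] b[of x] in auto)
    ultimately show "\<bar>f' x * g x + f x * g' x\<bar> \<le> L + M"
      using abs_triangle_ineq[of "f' x * g x" "f x * g' x"] b[of x] by (simp add: abs_mult)
    show "0 \<le> f x * g x" "f x * g x \<le> 1" using b[of x] by (auto intro: mult_le_one)
  qed (intro continuous_intros f' g' c)
qed

lemma smooth_step_derivative:
  obtains S' B where "\<And>t. (smooth_step has_real_derivative S' t) (at t)" "continuous_on UNIV S'" "\<And>t. \<bar>S' t\<bar> \<le> B" "B > 0"
proof -
  obtain S' where S': "\<And>t. (smooth_step has_real_derivative S' t) (at t)" "Ck1 0 S'"
    using Ck1_smooth_step[of "Suc 0"] by auto
  then have c: "continuous_on UNIV S'" by simp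
  have "compact (S' ` {0..1})" by (intro compact_continuous_image continuous_on_subset[OF c]) auto
  then obtain B where B: "\<And>t. t \<in> {0..1} \<Longrightarrow> \<bar>S' t\<bar> \<le> B"
    by (metis bounded_iff compact_imp_bounded imageI real_norm_def)
  have z: "S' t = 0" if "t \<notin> {0..1}" for t
  proof -
    define A where "A = (if t < 0 then {..<0} else {1<..} :: real set)"
    define e where "e = (if t < 0 then 0 else 1 :: real)"
    have "((\<lambda>_. e) has_real_derivative 0) (at t)" by simp
    then have "(smooth_step has_real_derivative 0) (at t)"
      by (rule has_field_derivative_transform_within_open[where S=A])
         (use that smooth_step_0 smooth_step_1 in \<open>auto simp: A_def e_def split: if_splits\<close>)
    then show ?thesis using S'(1) DERIV_unique by blast
  qed
  have "\<bar>S' t\<bar> \<le> \<bar>B\<bar> + 1" for t using B[of t] z[of t] by (cases "t \<in> {0..1}") auto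
  with S'(1) c show ?thesis by (intro that[of S' "\<bar>B\<bar> + 1"]) auto
qed

lemma unit_C1_smooth_step_compose:
  obtains B where "B > 0" "\<And>h h' L. (\<And>x. (h has_real_derivative h' x) (at x)) \<Longrightarrow> continuous_on UNIV h' \<Longrightarrow> (\<And>x. \<bar>h' x\<bar> \<le> L) \<Longrightarrow>
     unit_C1 (B * L) (\<lambda>x. smooth_step (h x))"
proof -
  obtain S' B where S: "\<And>t. (smooth_step has_real_derivative S' t) (at t)" "continuous_on UNIV S'" "\<And>t. \<bar>S' t\<bar> \<le> B" "B > 0"
    by (rule smooth_step_derivative) blast
  show ?thesis
  proof (rule that[OF S(4)])
    fix h h' :: "real \<Rightarrow> real" and L :: real
    assume h: "\<And>x. (h has_real_derivative h' x) (at x)" "continuous_on UNIV h'" "\<And>x. \<bar>h' x\<bar> \<le> L"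
    have hc: "continuous_on UNIV h" using h(1) by (auto intro!: continuous_at_imp_continuous_on DERIV_isCont)
    show "unit_C1 (B * L) (\<lambda>x. smooth_step (h x))"
      unfolding unit_C1_def
    proof (intro conjI exI[of _ "\<lambda>x. S' (h x) * h' x"] allI)
      fix x
      show "((\<lambda>x. smooth_step (h x)) has_real_derivative S' (h x) * h' x) (at x)" by (rule DERIV_chain2[OF S(1) h(1)])
      show "\<bar>S' (h x) * h' x\<bar> \<le> B * L" unfolding abs_mult using S(3,4) h(3) by (intro mult_mono) auto
      show "0 \<le> smooth_step (h x)" "smooth_step (h x) \<le> 1" by (rule smooth_step_bounds)+
    qed (intro continuous_intros continuous_on_compose2[OF S(2) hc] h(2) subset_UNIV)
  qed
qed

definition ratio :: "nat \<Rightarrow> real" where "ratio j = (1 / 2) ^ (j + 6) / 3"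

lemma ratio: "width j = spacing j * ratio j" "ratio j > 0"
  by (auto simp: ratio_def width_eq)

text \<open>Vanishes on the closed slits of level \<open>j\<close> and equals 1 at distance \<open>3 * width j\<close> from \<open>spacing j * \<int>\<close>.\<close>

definition cutoff :: "nat \<Rightarrow> real \<Rightarrow> real" where
  "cutoff j x = smooth_step (((sin (pi * (x / spacing j)))\<^sup>2 - (pi * ratio j)\<^sup>2) / (pi * ratio j)\<^sup>2)"

lemma sin_square_shift: "(sin (pi * (of_int m + t)))\<^sup>2 = (sin (pi * t))\<^sup>2"
proof -
  have "(cos (pi * of_int m))\<^sup>2 = 1" using sin_cos_squared_add[of "pi * of_int m"] by simp
  then show ?thesis by (simp add: distrib_left sin_add power_mult_distrib)
qed

text \<open>The squared sine has the period of the slits, so one formula treats all of them; inside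
  a slit |sin(\<pi> t)| is at most \<pi> t, which keeps the argument of the step
  nonpositive.\<close>

lemma cutoff_eq_0:
  assumes "of_int m * spacing j \<le> x" "x \<le> of_int m * spacing j + width j"
  shows "cutoff j x = 0"
proof -
  define t where "t = x / spacing j - of_int m"
  have t: "0 \<le> t" "t \<le> ratio j"
    using assms spacing_pos[of j] by (auto simp: t_def ratio field_simps)
  have "(sin (pi * (x / spacing j)))\<^sup>2 = (sin (pi * t))\<^sup>2"
    using sin_square_shift[of m t] by (simp add: t_def)
  also have "\<dots> \<le> (pi * ratio j)\<^sup>2"
  proof -
    have "\<bar>sin (pi * t)\<bar> \<le> \<bar>pi * t\<bar>" by (rule abs_sin_x_le_abs_x)
    also have "\<dots> \<le> pi * ratio j" using t by (simp add: abs_mult)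
    finally have "\<bar>sin (pi * t)\<bar>\<^sup>2 \<le> (pi * ratio j)\<^sup>2" by (intro power_mono) auto
    then show ?thesis by simp
  qed
  finally show ?thesis unfolding cutoff_def by (intro smooth_step_0 divide_nonpos_nonneg) auto
qed

text \<open>At three widths from the line the sine is at least 3/2 times \<open>pi * ratio j\<close>
  by \<open>sin_ge_half\<close>; the square of 3/2 is 9/4, more than the 2 at which the step reaches
  1.\<close>

lemma cutoff_eq_1:
  assumes "\<bar>x - of_int m * spacing j\<bar> \<le> spacing j / 2" "3 * width j \<le> \<bar>x - of_int m * spacing j\<bar>"
  shows "cutoff j x = 1"
proof -
  define t where "t = x / spacing j - of_int m"
  have "t = (x - of_int m * spacing j) / spacing j" using spacing_pos[of j] by (simp add: t_def field_simps)
  then have t: "\<bar>t\<bar> = \<bar>x - of_int m * spacing j\<bar> / spacing j" using spacing_pos[of j] by (simp add: abs_divide)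
  have tb: "\<bar>t\<bar> \<le> 1 / 2" "3 * ratio j \<le> \<bar>t\<bar>"
    using assms spacing_pos[of j] unfolding t by (auto simp: ratio field_simps)
  have "(sin (pi * \<bar>t\<bar>))\<^sup>2 = (sin (pi * t))\<^sup>2" by (cases "t \<ge> 0") auto
  then have s: "(sin (pi * (x / spacing j)))\<^sup>2 = (sin (pi * \<bar>t\<bar>))\<^sup>2"
    using sin_square_shift[of m t] by (simp add: t_def)
  have "pi * (3 * ratio j) / 2 \<le> pi * \<bar>t\<bar> / 2" using tb by simp
  also have "\<dots> \<le> sin (pi * \<bar>t\<bar>)" using tb by (intro sin_ge_half) auto
  finally have "(pi * (3 * ratio j) / 2)\<^sup>2 \<le> (sin (pi * \<bar>t\<bar>))\<^sup>2" using ratio(2)[of j] by (intro power_mono) auto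
  moreover have "2 * (pi * ratio j)\<^sup>2 \<le> (pi * (3 * ratio j) / 2)\<^sup>2" by (simp add: power_mult_distrib power_divide)
  ultimately have "2 * (pi * ratio j)\<^sup>2 \<le> (sin (pi * (x / spacing j)))\<^sup>2" unfolding s by linarith
  moreover have "(pi * ratio j)\<^sup>2 > 0" using ratio(2)[of j] by simp
  ultimately show ?thesis unfolding cutoff_def by (intro smooth_step_1) (simp add: field_simps)
qed

lemma unit_C1_cutoff:
  obtains B where "B > 0" "\<And>j. unit_C1 (B * (2 * pi / (spacing j * (pi * ratio j)\<^sup>2))) (cutoff j)"
    "unit_C1 B (\<lambda>x. smooth_step (x + 1))" "unit_C1 B (\<lambda>x. smooth_step (2 - x))"
proof -
  obtain B where B: "B > 0" "\<And>h h' L. (\<And>x. (h has_real_derivative h' x) (at x)) \<Longrightarrow> continuous_on UNIV h' \<Longrightarrow> (\<And>x. \<bar>h' x\<bar> \<le> L) \<Longrightarrow>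
     unit_C1 (B * L) (\<lambda>x. smooth_step (h x))"
    by (rule unit_C1_smooth_step_compose) blast
  show ?thesis
  proof (rule that[OF B(1)])
    fix j
    let ?r = "(pi * ratio j)\<^sup>2" and ?s = "\<lambda>x. sin (pi * (x / spacing j))" and ?c = "\<lambda>x. cos (pi * (x / spacing j))"
    have r: "?r > 0" using ratio(2)[of j] by simp
    show "unit_C1 (B * (2 * pi / (spacing j * (pi * ratio j)\<^sup>2))) (cutoff j)"
      unfolding cutoff_def[abs_def]
    proof (rule B(2))
      fix x
      show "((\<lambda>x. ((?s x)\<^sup>2 - ?r) / ?r) has_real_derivative (2 * ?s x * (?c x * (pi / spacing j))) / ?r) (at x)"
      proof (rule DERIV_cdivide)
        show "((\<lambda>x. (?s x)\<^sup>2 - ?r) has_real_derivative 2 * ?s x * (?c x * (pi / spacing j))) (at x)"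
          using spacing_pos[of j] by (auto intro!: derivative_eq_intros)
      qed
      have "\<bar>?s x\<bar> * \<bar>?c x\<bar> \<le> 1 * 1" by (intro mult_mono) auto
      then have "2 * (\<bar>?s x\<bar> * \<bar>?c x\<bar>) * (pi / spacing j) / ?r \<le> 2 * 1 * (pi / spacing j) / ?r"
        using r spacing_pos[of j] by (intro divide_right_mono mult_right_mono mult_left_mono) auto
      then show "\<bar>(2 * ?s x * (?c x * (pi / spacing j))) / ?r\<bar> \<le> 2 * pi / (spacing j * ?r)"
        using r spacing_pos[of j] by (simp add: abs_mult abs_divide mult_ac)
    qed (intro continuous_intros, use r spacing_pos[of j] in auto)
  next
    have "unit_C1 (B * 1) (\<lambda>x. smooth_step (x + 1))"
      by (rule B(2)[where h'="\<lambda>_. 1"]) (auto intro!: derivative_eq_intros)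
    then show "unit_C1 B (\<lambda>x. smooth_step (x + 1))" by simp
    have "unit_C1 (B * 1) (\<lambda>x. smooth_step (2 - x))"
      by (rule B(2)[where h'="\<lambda>_. -1"]) (auto intro!: derivative_eq_intros)
    then show "unit_C1 B (\<lambda>x. smooth_step (2 - x))" by simp
  qed
qed

text \<open>The first two factors form a plateau, equal to 1 on [0, 1] and 0 off [-1, 2]. The
  product runs over the levels below k, so \<open>profile (Suc k)\<close> cuts off the levels up to
  k.\<close>

definition profile :: "nat \<Rightarrow> real \<Rightarrow> real" where
  "profile k x = (smooth_step (x + 1) * smooth_step (2 - x)) * (\<Prod>j<k. cutoff j x)"

text \<open>The derivative bounds of the factors add. The one of level j is of order 4^j /
  \<open>spacing j\<close>, so the last level dominates; the number k + 1 of terms is absorbed by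
  passing from 4^k to 8^k.\<close>

lemma unit_C1_profile:
  obtains C where "C > 0" "\<And>k. unit_C1 (C * 8 ^ k / spacing k) (profile (Suc k))"
proof -
  obtain B where B: "B > 0" "\<And>j. unit_C1 (B * (2 * pi / (spacing j * (pi * ratio j)\<^sup>2))) (cutoff j)"
    "unit_C1 B (\<lambda>x. smooth_step (x + 1))" "unit_C1 B (\<lambda>x. smooth_step (2 - x))"
    by (rule unit_C1_cutoff) blast
  define L where "L j = B * (2 * pi / (spacing j * (pi * ratio j)\<^sup>2))" for j
  have prof: "unit_C1 (2 * B + (\<Sum>j<k. L j)) (profile k)" for k
  proof (induction k)
    case 0
    have "unit_C1 (B + B) (\<lambda>x. smooth_step (x + 1) * smooth_step (2 - x))" by (rule unit_C1_mult[OF B(3,4)])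
    then show ?case by (simp add: profile_def[abs_def])
  next
    case (Suc k)
    have "unit_C1 ((2 * B + (\<Sum>j<k. L j)) + L k) (\<lambda>x. profile k x * cutoff k x)"
      unfolding L_def by (rule unit_C1_mult[OF Suc[unfolded L_def] B(2)])
    then show ?case by (simp add: profile_def[abs_def] mult.assoc add.assoc)
  qed
  define D where "D = 2 * B + B * (2 / pi) * 192\<^sup>2"
  have D: "D > 0" using B(1) by (simp add: D_def add_pos_pos)
  have "2 * B + (\<Sum>j<Suc k. L j) \<le> D * 8 ^ k / spacing k * 2" for k
  proof -
    have one: "1 \<le> 4 ^ k / spacing k"
    proof -
      have "spacing k \<le> 1" by (simp add: spacing_def power_le_one)
      then have "spacing k \<le> 4 ^ k" using one_le_power[of "4::real" k] by linarith
      then show ?thesis using spacing_pos[of k] by simp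
    qed
    have "L j \<le> B * (2 / pi) * 192\<^sup>2 * (4 ^ k / spacing k)" if "j \<le> k" for j
    proof -
      have "1 / (ratio j)\<^sup>2 = 192\<^sup>2 * 4 ^ j"
        by (simp add: ratio_def power_add power_divide power2_eq_square power_mult_distrib[symmetric])
      moreover have "L j = B * (2 / pi) * ((1 / (ratio j)\<^sup>2) / spacing j)"
        using ratio(2)[of j] spacing_pos[of j] by (simp add: L_def power2_eq_square field_simps)
      ultimately have "L j = B * (2 / pi) * 192\<^sup>2 * (4 ^ j / spacing j)" by simp
      also have "\<dots> \<le> B * (2 / pi) * 192\<^sup>2 * (4 ^ k / spacing k)"
        using that B(1) spacing_antimono[OF that] spacing_pos[of k] by (intro mult_left_mono frac_le power_increasing) auto
      finally show ?thesis .
    qed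
    then have "(\<Sum>j<Suc k. L j) \<le> real (Suc k) * (B * (2 / pi) * 192\<^sup>2 * (4 ^ k / spacing k))"
      using sum_bounded_above[of "{..<Suc k}" L "B * (2 / pi) * 192\<^sup>2 * (4 ^ k / spacing k)"] by auto
    moreover have "2 * B \<le> real (Suc k) * (2 * B * (4 ^ k / spacing k))"
    proof -
      have "1 * 1 \<le> real (Suc k) * (4 ^ k / spacing k)" using one by (intro mult_mono) auto
      then have "2 * B * (1 * 1) \<le> 2 * B * (real (Suc k) * (4 ^ k / spacing k))" using B(1) by (intro mult_left_mono) auto
      then show ?thesis by (simp only: mult_ac mult_1)
    qed
    moreover have "real (Suc k) * (D * (4 ^ k / spacing k)) =
        real (Suc k) * (2 * B * (4 ^ k / spacing k)) + real (Suc k) * (B * (2 / pi) * 192\<^sup>2 * (4 ^ k / spacing k))"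
      by (simp only: D_def distrib_left distrib_right)
    ultimately have "2 * B + (\<Sum>j<Suc k. L j) \<le> real (Suc k) * (D * (4 ^ k / spacing k))"
      by linarith
    also have "\<dots> \<le> (2 * 2 ^ k) * (D * (4 ^ k / spacing k))"
    proof (rule mult_right_mono)
      have "Suc k \<le> 2 ^ Suc k" by (induction k) auto
      then have "real (Suc k) \<le> real (2 ^ Suc k)" by (rule of_nat_mono)
      then show "real (Suc k) \<le> 2 * 2 ^ k" by simp
      show "0 \<le> D * (4 ^ k / spacing k)" using D spacing_pos[of k] by simp
    qed
    also have "\<dots> = D * 8 ^ k / spacing k * 2" by (simp add: power_mult_distrib[symmetric])
    finally show ?thesis .
  qed
  then have "unit_C1 (2 * D * 8 ^ k / spacing k) (profile (Suc k))" for k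
    using prof[of "Suc k"] unfolding unit_C1_def by (auto intro: order_trans simp: mult_ac) (meson order_trans)
  then show ?thesis using D by (intro that[of "2 * D"]) auto
qed

section \<open>Cut-off functions of both directions and the volume of their support\<close>

text \<open>Independent of the height, hence smooth across the plane; the product vanishes as soon
  as one horizontal coordinate lies in a slit of level at most k.\<close>

definition approximant :: "nat \<Rightarrow> real^3 \<Rightarrow> real" where
  "approximant k q = profile (Suc k) (q $ 1) * profile (Suc k) (q $ 2)"

lemma cutoff_bounds: "0 \<le> cutoff j x" "cutoff j x \<le> 1"
  by (auto simp: cutoff_def smooth_step_bounds)

lemma profile_bounds: "0 \<le> profile k x" "profile k x \<le> 1"
  unfolding profile_def by (auto intro!: mult_nonneg_nonneg mult_le_one prod_nonneg prod_le_1 simp: smooth_step_bounds cutoff_bounds)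

lemma approximant_bounds: "0 \<le> approximant k q" "approximant k q \<le> 1"
  unfolding approximant_def by (auto intro!: mult_nonneg_nonneg mult_le_one simp: profile_bounds)

lemma approximant_C1: "C_k 1 (approximant k)"
proof -
  obtain C where "\<And>k. unit_C1 (C * 8 ^ k / spacing k) (profile (Suc k))" using unit_C1_profile by blast
  then obtain f' where "\<And>x. (profile (Suc k) has_real_derivative f' x) (at x)" "continuous_on UNIV f'"
    unfolding unit_C1_def by meson
  then have "Ck1 (Suc 0) (profile (Suc k))" by (intro Ck1_SucI[of _ f']) auto
  then show ?thesis unfolding approximant_def[abs_def] One_nat_def by (intro C_k_mult C_k_coord)
qed

lemma continuous_approximant: "continuous_on UNIV (approximant k)"
  using C_k_lower[of 0 "approximant k"] approximant_C1 by simp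

lemma approximant_gradient_bound:
  obtains C where "C > 0" "\<And>k q. norm (gradient (approximant k) q) \<le> C * 8 ^ k / spacing k"
proof -
  obtain C where C: "C > 0" "\<And>k. unit_C1 (C * 8 ^ k / spacing k) (profile (Suc k))" by (rule unit_C1_profile) blast
  have "norm (gradient (approximant k) q) \<le> 2 * C * 8 ^ k / spacing k" for k q
  proof -
    obtain f' where f': "\<And>x. (profile (Suc k) has_real_derivative f' x) (at x)" "\<And>x. \<bar>f' x\<bar> \<le> C * 8 ^ k / spacing k"
      using C(2)[of k] unfolding unit_C1_def by blast
    let ?f = "profile (Suc k)"
    have d: "(\<lambda>q::real^3. ?f (q $ l)) differentiable at q" for l
      using partial_deriv_coord(1)[OF f'(1)] by (rule differentiableI)
    have pd: "partial_deriv i (approximant k) q = ?f (q $ 1) * (if i = 2 then f' (q $ 2) else 0) + (if i = 1 then f' (q $ 1) else 0) * ?f (q $ 2)" for i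
      unfolding approximant_def[abs_def] partial_deriv_mult[OF d d] by (simp add: partial_deriv_coord(2)[OF f'(1)])
    have "norm (gradient (approximant k) q) \<le> (\<Sum>i\<in>UNIV. \<bar>gradient (approximant k) q $ i\<bar>)" by (rule norm_le_l1_cart)
    also have "\<dots> = \<bar>f' (q $ 1)\<bar> * ?f (q $ 2) + ?f (q $ 1) * \<bar>f' (q $ 2)\<bar>"
      by (simp add: sum_3 gradient_def pd abs_mult profile_bounds)
    also have "\<dots> \<le> (C * 8 ^ k / spacing k) * 1 + 1 * (C * 8 ^ k / spacing k)"
      using f'(2) profile_bounds C(1) spacing_pos[of k] by (intro add_mono mult_mono) auto
    finally show ?thesis by simp
  qed
  then show ?thesis using C(1) by (intro that[of "2 * C"]) auto
qed

lemma profile_eq_0: "j \<le> k \<Longrightarrow> of_int m * spacing j \<le> x \<Longrightarrow> x \<le> of_int m * spacing j + width j \<Longrightarrow> profile (Suc k) x = 0"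
proof -
  assume "j \<le> k" "of_int m * spacing j \<le> x" "x \<le> of_int m * spacing j + width j"
  then have "\<exists>l\<in>{..<Suc k}. cutoff l x = 0" by (intro bexI[of _ j] cutoff_eq_0[of m]) auto
  then have "(\<Prod>l<Suc k. cutoff l x) = 0" by (intro prod_zero) auto
  then show "profile (Suc k) x = 0" unfolding profile_def by (simp only: mult_zero_right)
qed

lemma profile_outside: "\<bar>x\<bar> \<ge> 2 \<Longrightarrow> profile k x = 0"
  unfolding profile_def by (cases "x \<ge> 0") (auto simp: smooth_step_0)

lemma approximant_eq_0:
  assumes "i \<noteq> 3" "j \<le> k" "q \<in> closed_slab i j m" shows "approximant k q = 0"
proof -
  have "i = 1 \<or> i = 2" using assms(1) exhaust_3[of i] by auto
  then show ?thesis using profile_eq_0[OF assms(2), of m "q $ i"] assms(3)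
    by (auto simp: approximant_def closed_slab_def)
qed

lemma gradient_eq_0:
  assumes "open S" "q \<in> S" "\<And>x. x \<in> S \<Longrightarrow> f x = 0"
  shows "gradient f q = 0"
proof -
  have "(f has_derivative (\<lambda>_. 0)) (at q)"
    by (rule has_derivative_transform_within_open[of "\<lambda>_. 0" _ q UNIV S]) (use assms in auto)
  then show ?thesis by (simp add: gradient_def vec_eq_iff partial_deriv_eq)
qed

text \<open>It contains all points of the domain where \<open>approximant k\<close> can be nonzero;
  the column has half side 2 because \<open>profile\<close> vanishes from there on.\<close>

definition fine_part :: "nat \<Rightarrow> (real^3) set" where
  "fine_part k = (\<Union>j. \<Union>(i, m)\<in>{1, 2::3} \<times> UNIV. slab i (Suc (k + j)) m) \<inter> pillar 2"

text \<open>A slab of level at most k is open and the function is 0 on all of it, so the gradient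
  vanishes as well; the same holds off the column.\<close>

lemma approximant_outside_fine_part:
  assumes "q \<in> domain" "q \<notin> fine_part k"
  shows "approximant k q = 0 \<and> gradient (approximant k) q = 0"
proof (cases "q \<in> pillar 2")
  case True
  obtain i j m where i: "i \<in> {1, 2::3}" "q \<in> slab i j m" using assms(1) unfolding domain_eq by blast
  have "j \<le> k"
  proof (rule ccontr)
    assume "\<not> j \<le> k"
    then have "j = Suc (k + (j - Suc k))" by simp
    then have "q \<in> slab i (Suc (k + (j - Suc k))) m" using i(2) by simp
    then have "q \<in> fine_part k" unfolding fine_part_def using i(1) True by blast
    then show False using assms(2) by simp
  qed
  moreover have "slab i j m \<subseteq> closed_slab i j m" by (auto simp: slab_def closed_slab_def)
  moreover have "i \<noteq> 3" using i(1) by auto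
  ultimately have z: "approximant k x = 0" if "x \<in> slab i j m" for x using approximant_eq_0 that by blast
  show ?thesis using z[OF i(2)] gradient_eq_0[OF open_slab i(2) z] by simp
next
  case False
  have "open (- pillar 2)" using closed_pillar by auto
  moreover have z: "approximant k x = 0" if "x \<in> - pillar 2" for x
  proof -
    have "\<exists>i. i \<noteq> 3 \<and> \<not> \<bar>x $ i\<bar> \<le> 2" using that by (simp add: pillar_def)
    then obtain i where "i \<noteq> 3" "\<bar>x $ i\<bar> > 2" by (auto simp: not_le)
    then have "\<bar>x $ 1\<bar> \<ge> 2 \<or> \<bar>x $ 2\<bar> \<ge> 2" using exhaust_3[of i] by auto
    then show ?thesis by (auto simp: approximant_def profile_outside)
  qed
  ultimately show ?thesis using gradient_eq_0[of "- pillar 2" q] False by simp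
qed

lemma fine_part_measurable: "fine_part k \<in> sets borel"
proof -
  have "open (\<Union>j. \<Union>(i, m)\<in>{1, 2::3} \<times> UNIV. slab i (Suc (k + j)) m)"
    by (intro open_UN ballI) (auto intro: open_slab)
  then show ?thesis unfolding fine_part_def by (intro sets.Int borel_open borel_closed closed_pillar)
qed

lemma emeasure_slab_pillar:
  assumes "i \<noteq> 3" "N > 0"
  shows "emeasure lborel (slab i j m \<inter> pillar N) \<le> ennreal (width j * (2 * real N) * height j)"
proof -
  note U = UNIV_other[OF assms(1)]
  let ?B = "cbox (vec3 i (other i) (of_int m * spacing j) (- real N) 0) (vec3 i (other i) (of_int m * spacing j + width j) (real N) (height j))"
  have "slab i j m \<inter> pillar N \<subseteq> ?B"
  proof
    fix q assume q: "q \<in> slab i j m \<inter> pillar N"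
    then have "\<bar>q $ other i\<bar> \<le> real N" using other_neq by (auto simp: pillar_def)
    then show "q \<in> ?B" using q unfolding mem_cbox_vec3[OF U] by (auto simp: slab_def)
  qed
  then have "emeasure lborel (slab i j m \<inter> pillar N) \<le> emeasure lborel ?B" by (intro emeasure_mono) auto
  also have "\<dots> = ennreal (measure lborel ?B)"
    using emeasure_lborel_cbox_finite by (intro emeasure_eq_ennreal_measure) (auto simp: less_top[symmetric])
  also have "measure lborel ?B = width j * (2 * real N) * height j"
    by (subst measure_cbox_vec3[OF U]) (use width_pos[of j] height_pos[of j] in auto)
  finally show ?thesis .
qed

text \<open>About 12 * 2^(l^2) slabs of level l meet the column, each with volume at most
  \<open>4 * width l * height l\<close> there. As \<open>2 ^ (l\<^sup>2) * width l\<close> equals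
  2^(-l)/192, the levels contribute a geometric series, and all heights beyond level k are at most
  \<open>(spacing k)\<^sup>2\<close>.\<close>

lemma emeasure_fine_part: "emeasure lborel (fine_part k) \<le> ennreal ((spacing k)\<^sup>2)"
proof -
  define M where "M l = int (2 + 1) * 2 ^ (l\<^sup>2)" for l :: nat
  define J where "J l = {1, 2::3} \<times> {- M l .. M l}" for l
  have pb: "(case x of (i, m) \<Rightarrow> slab i l m \<inter> pillar 2) \<in> sets lborel" for x l
    using borel_open[OF open_slab] borel_closed[OF closed_pillar] by (cases x) auto
  have fU: "(\<Union>x\<in>J l. case x of (i, m) \<Rightarrow> slab i l m \<inter> pillar 2) \<in> sets lborel" for l
    by (intro sets.finite_UN pb) (simp add: J_def)
  have "fine_part k \<subseteq> (\<Union>j. \<Union>x\<in>J (Suc (k + j)). case x of (i, m) \<Rightarrow> slab i (Suc (k + j)) m \<inter> pillar 2)"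
  proof
    fix q assume "q \<in> fine_part k"
    then obtain i j m where q: "i \<in> {1, 2::3}" "q \<in> slab i (Suc (k + j)) m" "q \<in> pillar 2" unfolding fine_part_def by blast
    have "i \<noteq> 3" using q(1) by auto
    then have "\<bar>q $ i\<bar> \<le> real 2" using q(3) by (auto simp: pillar_def)
    then have "m \<in> {- M (Suc (k + j)) .. M (Suc (k + j))}" unfolding M_def
      by (rule spacing_index_bound) (use q(2) in \<open>auto simp: slab_def\<close>)
    then have "(i, m) \<in> J (Suc (k + j))" using q(1) by (auto simp: J_def)
    then show "q \<in> (\<Union>j. \<Union>x\<in>J (Suc (k + j)). case x of (i, m) \<Rightarrow> slab i (Suc (k + j)) m \<inter> pillar 2)"
      using q(2,3) by blast
  qed
  then have "emeasure lborel (fine_part k) \<le> emeasure lborel (\<Union>j. \<Union>x\<in>J (Suc (k + j)). case x of (i, m) \<Rightarrow> slab i (Suc (k + j)) m \<inter> pillar 2)"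
    using fU by (intro emeasure_mono sets.countable_UN) auto
  also have "\<dots> \<le> (\<Sum>j. emeasure lborel (\<Union>x\<in>J (Suc (k + j)). case x of (i, m) \<Rightarrow> slab i (Suc (k + j)) m \<inter> pillar 2))"
    using fU by (intro emeasure_subadditive_countably) auto
  also have "\<dots> \<le> (\<Sum>j. ennreal ((spacing k)\<^sup>2 * (1 / 2) ^ Suc j))"
  proof (intro suminf_le summableI)
    fix j
    define l where "l = Suc (k + j)"
    have "emeasure lborel (\<Union>x\<in>J l. case x of (i, m) \<Rightarrow> slab i l m \<inter> pillar 2) \<le> (\<Sum>x\<in>J l. emeasure lborel (case x of (i, m) \<Rightarrow> slab i l m \<inter> pillar 2))"
      using pb by (intro emeasure_subadditive_finite) (auto simp: J_def)
    also have "\<dots> \<le> (\<Sum>x\<in>J l. ennreal (width l * (2 * real 2) * height l))"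
    proof (rule sum_mono)
      fix x assume "x \<in> J l"
      then have "fst x \<noteq> 3" by (auto simp: J_def)
      then show "emeasure lborel (case x of (i, m) \<Rightarrow> slab i l m \<inter> pillar 2) \<le> ennreal (width l * (2 * real 2) * height l)"
        using emeasure_slab_pillar[of "fst x" 2 l "snd x"] by (simp add: case_prod_beta)
    qed
    also have "\<dots> = ennreal (real (card (J l)) * (4 * width l * height l))"
      using width_pos[of l] height_pos[of l] by (subst sum_ennreal) (auto simp: mult_ac)
    also have "real (card (J l)) = 2 * (6 * 2 ^ (l\<^sup>2) + 1)"
    proof -
      have "card {- M l .. M l} = nat (2 * M l + 1)" by simp
      moreover have "M l \<ge> 0" by (simp add: M_def)
      moreover have "card {1, 2::3} = 2" by simp
      ultimately have "real (card (J l)) = 2 * real_of_int (2 * M l + 1)"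
        unfolding J_def card_cartesian_product by (simp add: of_nat_nat)
      then show ?thesis by (simp add: M_def)
    qed
    also have "2 * (6 * 2 ^ (l\<^sup>2) + 1) * (4 * width l * height l) \<le> (spacing k)\<^sup>2 * (1 / 2) ^ Suc j"
    proof -
      have pw: "2 ^ (l\<^sup>2) * width l = (1 / 192) * (1 / 2) ^ l"
        by (simp add: width_def power_add power_divide)
      have "2 * (6 * 2 ^ (l\<^sup>2) + 1) * (4 * width l * height l) \<le> 2 * (6 * 2 ^ (l\<^sup>2) + 2 ^ (l\<^sup>2)) * (4 * width l * height l)"
        using width_pos[of l] height_pos[of l] by (intro mult_right_mono mult_left_mono add_left_mono) auto
      also have "\<dots> = 56 * (2 ^ (l\<^sup>2) * width l) * height l" by simp
      also have "\<dots> = 56 / 192 * (1 / 2) ^ l * height l" unfolding pw by simp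
      also have "\<dots> \<le> 1 * (1 / 2) ^ Suc j * (spacing k)\<^sup>2"
      proof (intro mult_mono)
        show "(1 / 2 :: real) ^ l \<le> (1 / 2) ^ Suc j" by (rule power_decreasing) (auto simp: l_def)
        show "height l \<le> (spacing k)\<^sup>2" using height_antimono[of "Suc k" l] by (simp add: l_def height_Suc)
      qed (use height_pos[of l] in auto)
      finally show ?thesis by (simp add: mult.commute)
    qed
    finally show "emeasure lborel (\<Union>x\<in>J (Suc (k + j)). case x of (i, m) \<Rightarrow> slab i (Suc (k + j)) m \<inter> pillar 2) \<le> ennreal ((spacing k)\<^sup>2 * (1 / 2) ^ Suc j)"
      by (simp add: l_def ennreal_leI)
  qed
  also have "\<dots> = ennreal ((spacing k)\<^sup>2)"
    using sums_mult[OF power_half_series, of "(spacing k)\<^sup>2"] by (intro suminf_ennreal_eq) auto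
  finally show ?thesis .
qed

lemma Lp_norm_le_of_support:
  fixes f :: "real^'n::finite \<Rightarrow> 'b::euclidean_space"
  assumes "open \<Omega>" and f: "continuous_on UNIV f" and c: "\<And>x. norm (f x) \<le> c" and V: "V \<in> sets borel" "emeasure lborel V \<le> ennreal v" "v \<ge> 0"
    and out: "\<And>x. x \<in> \<Omega> \<Longrightarrow> x \<notin> V \<Longrightarrow> f x = 0" and q: "q \<ge> 1"
  shows "f \<in> Lp_space (lebesgue_on \<Omega>) (ennreal q)"
    and "Lp_norm (lebesgue_on \<Omega>) (ennreal q) f \<le> c * v powr (1 / q)"
proof -
  have c0: "c \<ge> 0" using c[of undefined] norm_ge_zero order_trans by blast
  have \<Omega>: "\<Omega> \<inter> space lebesgue \<in> sets lebesgue" using assms(1) by auto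
  have fm: "f \<in> borel_measurable lebesgue" using borel_measurable_continuous_onI[OF f] by (simp add: measurable_completion)
  then have fm': "f \<in> borel_measurable (lebesgue_on \<Omega>)" by (rule measurable_restrict_space1)
  have Vl: "V \<in> sets lebesgue" using V(1) by auto
  have eV: "emeasure lebesgue V \<le> ennreal v" using V(1,2) by simp
  then have Vfin: "emeasure lebesgue V < \<infinity>" by (auto intro: le_less_trans)
  have dom: "indicator \<Omega> x *\<^sub>R norm (f x) powr q \<le> indicator V x * c powr q" for x
    using out[of x] c[of x] q by (auto simp: indicator_def powr_mono2)
  have Vi: "integrable lebesgue (\<lambda>x. indicator V x * c powr q :: real)" using Vl Vfin by (simp add: less_top)
  have m: "(\<lambda>x. indicator \<Omega> x *\<^sub>R norm (f x) powr q) \<in> borel_measurable lebesgue"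
  proof (intro borel_measurable_scaleR borel_measurable_indicator)
    show "(\<lambda>x. norm (f x) powr q) \<in> borel_measurable lebesgue" using fm by measurable
  qed (use \<Omega> in simp)
  have int: "integrable lebesgue (\<lambda>x. indicator \<Omega> x *\<^sub>R norm (f x) powr q)"
  proof (rule Bochner_Integration.integrable_bound[OF Vi m])
    show "AE x in lebesgue. norm (indicator \<Omega> x *\<^sub>R norm (f x) powr q) \<le> norm (indicator V x * c powr q)"
      using dom by (intro AE_I2) (simp add: abs_mult)
  qed
  then have i2: "integrable (lebesgue_on \<Omega>) (\<lambda>x. norm (f x) powr q)" using \<Omega> by (simp add: integrable_restrict_space)
  then show "f \<in> Lp_space (lebesgue_on \<Omega>) (ennreal q)" using fm' q by (simp add: Lp_space_def)
  have "(LINT x|lebesgue_on \<Omega>. norm (f x) powr q) = (LINT x|lebesgue. indicator \<Omega> x *\<^sub>R norm (f x) powr q)"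
    using \<Omega> by (simp add: integral_restrict_space)
  also have "\<dots> \<le> (LINT x|lebesgue. indicator V x * c powr q)" by (rule integral_mono[OF int Vi dom])
  also have "\<dots> = measure lebesgue V * c powr q" using Vl by simp
  also have "\<dots> \<le> v * c powr q"
  proof (rule mult_right_mono)
    have "ennreal (measure lebesgue V) \<le> ennreal v" using eV Vfin by (simp add: emeasure_eq_ennreal_measure[symmetric] less_top)
    then show "measure lebesgue V \<le> v" using V(3) by simp
  qed auto
  finally have le: "(LINT x|lebesgue_on \<Omega>. norm (f x) powr q) \<le> v * c powr q" .
  have "Lp_norm (lebesgue_on \<Omega>) (ennreal q) f = (LINT x|lebesgue_on \<Omega>. norm (f x) powr q) powr (1 / q)"
    using q by (simp add: Lp_norm_def)
  also have "\<dots> \<le> (v * c powr q) powr (1 / q)" using le q by (intro powr_mono2 integral_nonneg_AE) auto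
  also have "\<dots> = c * v powr (1 / q)" using q c0 V(3) by (simp add: powr_mult powr_powr mult.commute)
  finally show "Lp_norm (lebesgue_on \<Omega>) (ennreal q) f \<le> c * v powr (1 / q)" .
qed

lemma bounded_borel_in_L1_loc:
  assumes f: "f \<in> borel_measurable borel" and b: "\<And>x. \<bar>f x\<bar> \<le> c"
  shows "f \<in> L1_loc domain"
proof -
  have fm: "f \<in> borel_measurable H2" by (rule borel_measurable_hausdorff[OF _ f]) simp
  have s: "frontier domain \<in> sets H2" by (intro borel_sets_hausdorff) auto
  have "set_integrable H2 K f" if "compact K" "K \<subseteq> Gamma_loc domain" for K
  proof -
    have K: "K \<in> sets borel" using that by (intro borel_compact)
    have "emeasure H2 K < \<infinity>"
      using that K by (intro emeasure_frontier_bounded) (auto simp: Gamma_loc_domain compact_imp_bounded)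
    then show ?thesis unfolding set_integrable_def using K b fm
      by (intro integrableI_bounded_set_indicator[where B=c]) (auto simp: borel_sets_hausdorff)
  qed
  moreover have "set_borel_measurable H2 (frontier domain) f"
    unfolding set_borel_measurable_def using s fm by (intro borel_measurable_scaleR borel_measurable_indicator)
  ultimately show ?thesis by (auto simp: L1_loc_def Gamma_inf_def Gamma_loc_domain)
qed

section \<open>A nonzero approximative trace of the zero function\<close>

definition limit_trace :: "real^3 \<Rightarrow> real" where
  "limit_trace q = lim (\<lambda>k. approximant k q)"

text \<open>Each further level multiplies both profiles by a cut-off with values in [0, 1], so the
  sequence decreases.\<close>

lemma approximant_tendsto: "(\<lambda>k. approximant k q) \<longlonglongrightarrow> limit_trace q"
proof -
  have "profile (Suc (Suc k)) x \<le> profile (Suc k) x" for k x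
    using mult_left_mono[OF cutoff_bounds(2)[of "Suc k" x] profile_bounds(1)[of "Suc k" x]] by (simp add: profile_def mult.assoc)
  then have "decseq (\<lambda>k. approximant k q)"
    unfolding approximant_def by (intro decseq_SucI mult_mono) (auto simp: profile_bounds)
  then have "convergent (\<lambda>k. approximant k q)"
    using approximant_bounds by (intro Bseq_monoseq_convergent) (auto intro!: BseqI'[of _ 1] simp: decseq_imp_monoseq)
  then show ?thesis unfolding limit_trace_def by (simp add: convergent_LIMSEQ_iff)
qed

text \<open>The gradient bound times the measure of the support to the power 1/q is of order 8^k
  times \<open>spacing k powr (2 / q - 1)\<close>, with a positive exponent for q < 2. On compact
  parts of the boundary the measure is finite and the functions are bounded, so pointwise
  convergence gives convergence of the integrals.\<close>

lemma approx_trace_limit_trace: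
  assumes q: "1 \<le> q" "q < 2"
  shows "approx_trace (ennreal q) domain (\<lambda>_. 0) limit_trace"
proof -
  have am: "approximant k \<in> borel_measurable borel" for k
    by (rule borel_measurable_continuous_onI[OF continuous_approximant])
  have lm: "limit_trace \<in> borel_measurable borel"
    unfolding limit_trace_def[abs_def] by (intro borel_measurable_lim_metric am)
  have lb: "\<bar>limit_trace x\<bar> \<le> 1" for x
    using LIMSEQ_le_const[OF approximant_tendsto[of x], of 0] LIMSEQ_le_const2[OF approximant_tendsto[of x], of 1] approximant_bounds
    by auto
  have ab: "\<bar>approximant k x\<bar> \<le> 1" for k x using approximant_bounds[of k x] by simp
  obtain C where C: "C > 0" "\<And>k x. norm (gradient (approximant k) x) \<le> C * 8 ^ k / spacing k"
    by (rule approximant_gradient_bound) blast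
  have gc: "continuous_on UNIV (gradient (approximant k))" for k
    unfolding gradient_def[abs_def] using approximant_C1[of k] by (intro continuous_on_vec_lambda) simp
  note sup = Lp_norm_le_of_support[OF open_domain _ _ fine_part_measurable emeasure_fine_part zero_le_power2 _ q(1)]
  have u: "approximant k \<in> Lp_space (lebesgue_on domain) (ennreal q)"
    "Lp_norm (lebesgue_on domain) (ennreal q) (approximant k) \<le> 1 * (spacing k)\<^sup>2 powr (1 / q)" for k
    using sup[OF continuous_approximant, of k 1 k] ab approximant_outside_fine_part by auto
  have g: "gradient (approximant k) \<in> Lp_space (lebesgue_on domain) (ennreal q)"
    "Lp_norm (lebesgue_on domain) (ennreal q) (gradient (approximant k)) \<le> (C * 8 ^ k / spacing k) * (spacing k)\<^sup>2 powr (1 / q)" for k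
    using sup[OF gc C(2), of k k] approximant_outside_fine_part by auto
  have wg: "weak_gradient domain (approximant k) (gradient (approximant k))" for k
    by (rule weak_gradient_C1[OF approximant_C1 open_domain])
  have W: "approximant k \<in> W1p (ennreal q) domain" for k
    using u(1) g(1) wg by (auto simp: W1p_def)
  define \<epsilon> where "\<epsilon> = 2 / q - 1"
  have \<epsilon>: "\<epsilon> > 0" using q by (simp add: \<epsilon>_def)
  \<comment> \<open>As 8^k is the cube of 2^k, the bound is written as a cube, to which
    \<open>summable_spacing_powr\<close> applies with exponent \<epsilon>/3.\<close>
  have bound: "W1p_norm (ennreal q) domain (approximant k) \<le> (1 + C) * (2 ^ k * spacing k powr (\<epsilon> / 3)) ^ 3" for k
  proof -
    have sp: "0 < spacing k" "spacing k \<le> 1" by (auto simp: spacing_def power_le_one)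
    have "(spacing k)\<^sup>2 powr (1 / q) = spacing k powr (1 + \<epsilon>)"
      using sp by (simp add: \<epsilon>_def powr_powr flip: powr_numeral)
    also have "\<dots> = spacing k * spacing k powr \<epsilon>" using sp by (simp add: powr_add)
    finally have s: "(spacing k)\<^sup>2 powr (1 / q) = spacing k * spacing k powr \<epsilon>" .
    have e3: "(2 ^ k * spacing k powr (\<epsilon> / 3)) ^ 3 = 8 ^ k * spacing k powr \<epsilon>"
    proof -
      have "(spacing k powr (\<epsilon> / 3)) ^ 3 = spacing k powr \<epsilon>" using sp by (simp add: powr_powr flip: powr_numeral)
      moreover have "((2::real) ^ k) ^ 3 = 8 ^ k"
        by (simp only: power_mult[symmetric] mult.commute[of k 3]) (simp add: power_mult)
      ultimately show ?thesis by (simp only: power_mult_distrib)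
    qed
    have "W1p_norm (ennreal q) domain (approximant k) \<le> spacing k * spacing k powr \<epsilon> + (C * 8 ^ k / spacing k) * (spacing k * spacing k powr \<epsilon>)"
      using W1p_norm_eq[OF open_domain wg g(1), of k] u(2)[of k] g(2)[of k] unfolding s by simp
    also have "(C * 8 ^ k / spacing k) * (spacing k * spacing k powr \<epsilon>) = C * (8 ^ k * spacing k powr \<epsilon>)" using sp by simp
    also have "spacing k * spacing k powr \<epsilon> \<le> 8 ^ k * spacing k powr \<epsilon>"
    proof (rule mult_right_mono)
      show "spacing k \<le> 8 ^ k" using sp(2) one_le_power[of "8::real" k] by linarith
    qed simp
    finally show ?thesis unfolding e3 by (simp add: distrib_right)
  qed
  have "(\<lambda>k. 2 ^ k * spacing k powr (\<epsilon> / 3)) \<longlonglongrightarrow> 0"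
    using \<epsilon> by (intro summable_LIMSEQ_zero summable_spacing_powr) simp
  then have "(\<lambda>k. (1 + C) * (2 ^ k * spacing k powr (\<epsilon> / 3)) ^ 3) \<longlonglongrightarrow> (1 + C) * 0 ^ 3"
    by (intro tendsto_intros)
  then have lim0: "(\<lambda>k. (1 + C) * (2 ^ k * spacing k powr (\<epsilon> / 3)) ^ 3) \<longlonglongrightarrow> 0" by simp
  have norm0: "(\<lambda>k. W1p_norm (ennreal q) domain (\<lambda>x. approximant k x - 0)) \<longlonglongrightarrow> 0"
    by (rule tendsto_sandwich[OF _ _ tendsto_const lim0])
       (use bound in \<open>auto simp: W1p_norm_def Lp_norm_nonneg\<close>)
  have conv: "(\<lambda>k. LINT x:K|H2. \<bar>approximant k x - limit_trace x\<bar>) \<longlonglongrightarrow> 0" if K: "compact K \<and> K \<subseteq> Gamma_loc domain" for K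
  proof -
    have Kb: "K \<in> sets borel" using K by (intro borel_compact) simp
    then have KH: "K \<in> sets H2" by (intro borel_sets_hausdorff) auto
    have fin: "emeasure H2 K < \<infinity>"
      using K Kb by (intro emeasure_frontier_bounded) (auto simp: Gamma_loc_domain compact_imp_bounded)
    have "(\<lambda>k. LINT x|H2. indicator K x *\<^sub>R \<bar>approximant k x - limit_trace x\<bar>) \<longlonglongrightarrow> (LINT x|H2. 0)"
    proof (rule integral_dominated_convergence[where w="\<lambda>x. indicator K x * 2"])
      have "(\<lambda>x. indicator K x *\<^sub>R \<bar>approximant k x - limit_trace x\<bar>) \<in> borel_measurable borel" for k
        using Kb am lm by (intro borel_measurable_scaleR borel_measurable_indicator borel_measurable_abs borel_measurable_diff)
      then show "(\<lambda>x. indicator K x *\<^sub>R \<bar>approximant k x - limit_trace x\<bar>) \<in> borel_measurable H2" for k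
        by (intro borel_measurable_hausdorff) auto
      show "integrable H2 (\<lambda>x. indicator K x * 2 :: real)" using KH fin by (simp add: less_top)
      show "AE x in H2. (\<lambda>k. indicator K x *\<^sub>R \<bar>approximant k x - limit_trace x\<bar>) \<longlonglongrightarrow> 0"
      proof (rule AE_I2)
        fix x
        have "(\<lambda>k. indicator K x *\<^sub>R \<bar>approximant k x - limit_trace x\<bar>) \<longlonglongrightarrow> indicator K x *\<^sub>R \<bar>limit_trace x - limit_trace x\<bar>"
          by (intro tendsto_intros approximant_tendsto)
        then show "(\<lambda>k. indicator K x *\<^sub>R \<bar>approximant k x - limit_trace x\<bar>) \<longlonglongrightarrow> 0" by simp
      qed
      show "AE x in H2. norm (indicator K x *\<^sub>R \<bar>approximant k x - limit_trace x\<bar>) \<le> indicator K x * 2" for k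
      proof (rule AE_I2)
        fix x
        have "\<bar>approximant k x - limit_trace x\<bar> \<le> 2" using ab[of k x] lb[of x] by linarith
        then show "norm (indicator K x *\<^sub>R \<bar>approximant k x - limit_trace x\<bar>) \<le> indicator K x * 2" by (auto simp: indicator_def)
      qed
    qed simp
    then show ?thesis by (simp add: set_lebesgue_integral_def)
  qed
  have zero: "(\<lambda>_. 0) \<in> W1p (ennreal q) domain"
  proof -
    have "weak_gradient domain (\<lambda>_. 0) (\<lambda>_. 0)" by (simp add: weak_gradient_def set_integrable_def)
    moreover have "(\<lambda>_. 0 :: real) \<in> Lp_space (lebesgue_on domain) (ennreal q)"
      "(\<lambda>_. 0 :: real^3) \<in> Lp_space (lebesgue_on domain) (ennreal q)"
      using q by (simp_all add: Lp_space_def)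
    ultimately show ?thesis unfolding W1p_def by blast
  qed
  show ?thesis
    unfolding approx_trace_def
  proof (intro conjI exI[of _ approximant] allI impI)
    show "limit_trace \<in> L1_loc domain" by (rule bounded_borel_in_L1_loc[OF lm lb])
    show "approximant n \<in> L1_loc domain" for n by (rule bounded_borel_in_L1_loc[OF am ab])
    show "continuous_on (closure domain) (approximant n)" for n using continuous_approximant by (rule continuous_on_subset) simp
  qed (use zero W norm0 conv in auto)
qed

text \<open>The nearest multiple of \<open>spacing j\<close> must be within three widths by
  \<open>cutoff_eq_1\<close>; on the unit interval its index is at most 2^(j^2), which allows
  counting.\<close>

lemma cutoff_neq_1_near_grid:
  assumes "0 \<le> x" "x \<le> 1" "cutoff j x \<noteq> 1"
  shows "\<exists>m\<in>{..2 ^ (j\<^sup>2)}. \<bar>x - real m * spacing j\<bar> \<le> 3 * width j"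
proof -
  define n where "n = round (x / spacing j)"
  have n: "\<bar>of_int n - x / spacing j\<bar> \<le> 1 / 2" unfolding n_def by (rule of_int_round_abs_le)
  have xs: "0 \<le> x / spacing j" "x / spacing j \<le> 2 ^ (j\<^sup>2)"
    using assms spacing_pos[of j] by (auto simp: spacing_def power_divide)
  have "real_of_int n > -1" using n xs by linarith
  then have n0: "0 \<le> n" by linarith
  have "real_of_int n < 2 ^ (j\<^sup>2) + 1" using n xs by linarith
  then have "real_of_int n < real_of_int (2 ^ (j\<^sup>2) + 1)" by simp
  then have "n < 2 ^ (j\<^sup>2) + 1" by (simp only: of_int_less_iff)
  then have n1: "n \<le> 2 ^ (j\<^sup>2)" by simp
  have "x - of_int n * spacing j = (x / spacing j - of_int n) * spacing j" using spacing_pos[of j] by (simp add: field_simps)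
  then have "\<bar>x - of_int n * spacing j\<bar> = \<bar>x / spacing j - of_int n\<bar> * spacing j" using spacing_pos[of j] by (simp add: abs_mult)
  also have "\<dots> \<le> 1 / 2 * spacing j" using n spacing_pos[of j] by (intro mult_right_mono) (auto simp: abs_minus_commute)
  finally have "\<bar>x - of_int n * spacing j\<bar> \<le> spacing j / 2" by simp
  then have "\<not> 3 * width j \<le> \<bar>x - of_int n * spacing j\<bar>" using cutoff_eq_1 assms(3) by blast
  then show ?thesis using n0 n1 by (intro bexI[of _ "nat n"]) (auto simp: nat_le_iff)
qed

lemma continuous_cutoff: "continuous_on UNIV (cutoff j)"
proof -
  obtain B where "\<And>j. unit_C1 (B * (2 * pi / (spacing j * (pi * ratio j)\<^sup>2))) (cutoff j)" using unit_C1_cutoff by metis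
  then obtain f' where "\<And>x. (cutoff j has_real_derivative f' x) (at x)" unfolding unit_C1_def by blast
  then show ?thesis by (auto intro!: continuous_at_imp_continuous_on DERIV_isCont)
qed

text \<open>On the set S of points of the plane unit square where every cut-off is 1, the limit is
  1. If S were null, \<open>emeasure_le_hausdorff_outer\<close> would make the column T of unit
  height over S null. But the strips around the grid lines take at most 1/8 of the unit cube for
  each direction, so T has positive volume.\<close>

lemma limit_trace_not_null: "\<not> (AE x in H2. x \<in> frontier domain \<longrightarrow> limit_trace x = 0)"
proof
  assume ae: "AE x in H2. x \<in> frontier domain \<longrightarrow> limit_trace x = 0"
  define good where "good = {q::real^3. \<forall>i\<in>{1, 2::3}. 0 \<le> q $ i \<and> q $ i \<le> 1 \<and> (\<forall>j. cutoff j (q $ i) = 1)}"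
  define S where "S = good \<inter> {q. q $ 3 = 0}"
  define T where "T = good \<inter> {q. 0 \<le> q $ 3 \<and> q $ 3 \<le> 1}"
  have "closed {q::real^3. cutoff j (q $ i) = 1}" for i j
    by (intro closed_Collect_eq continuous_on_compose2[OF continuous_cutoff] continuous_intros) auto
  then have "closed {q::real^3. 0 \<le> q $ i \<and> q $ i \<le> 1 \<and> (\<forall>j. cutoff j (q $ i) = 1)}" for i
    by (intro closed_Collect_conj closed_Collect_le closed_Collect_all continuous_intros)
  from closed_Int[OF this[of 1] this[of 2]] have closed: "closed good"
    by (rule back_subst[of closed]) (auto simp: good_def)
  then have Sb: "S \<in> sets borel" unfolding S_def by (intro borel_closed closed_Int closed_Collect_eq continuous_intros)
  have Tb: "T \<in> sets borel" unfolding T_def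
    by (intro borel_closed closed_Int closed closed_Collect_conj closed_Collect_le continuous_intros)
  have one: "limit_trace q = 1" if "q \<in> good" for q
  proof -
    have "profile k (q $ i) = 1" if "i \<in> {1, 2}" for i k
      using \<open>q \<in> good\<close> that by (auto simp: good_def profile_def smooth_step_1)
    then have "approximant k q = 1" for k by (simp add: approximant_def)
    then show ?thesis using approximant_tendsto[of q] by (simp add: LIMSEQ_const_iff)
  qed
  have "AE x in H2. x \<notin> S"
    using ae by eventually_elim (use one plane_subset_frontier in \<open>auto simp: S_def\<close>)
  then have "emeasure H2 S = 0"
    using Sb by (simp add: AE_iff_measurable[of S] borel_sets_hausdorff)
  then have S0: "hausdorff_outer 2 S = 0" using Sb by (simp add: emeasure_hausdorff_borel)
  have "ennreal (1 / 8) * emeasure lborel T \<le> hausdorff_outer 2 S"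
  proof (rule emeasure_le_hausdorff_outer)
    fix p assume "p \<in> T"
    then have "upd p 3 0 \<in> S" by (auto simp: S_def T_def good_def)
    then show "0 \<le> p $ 3 \<and> p $ 3 \<le> 1 \<and> (\<exists>q\<in>S. q $ 1 = p $ 1 \<and> q $ 2 = p $ 2)"
      using \<open>p \<in> T\<close> by (auto simp: T_def intro!: bexI[of _ "upd p 3 0"])
  qed
  then have T0: "emeasure lborel T = 0" using S0 by simp
  define Q where "Q = cbox (vec3 1 2 0 0 0) (vec3 1 2 1 1 1)"
  \<comment> \<open>All places in the cube where the cut-off of level j in direction i can differ
    from 1: strips of thickness six widths about the grid lines.\<close>
  define bad where "bad i j = (\<Union>m\<in>{..2 ^ (j\<^sup>2)}. {q \<in> Q. \<bar>q $ i - real m * spacing j\<bar> \<le> 3 * width j})" for i j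
  have Qi: "q \<in> Q \<longleftrightarrow> (\<forall>i. 0 \<le> q $ i \<and> q $ i \<le> 1)" for q
    unfolding Q_def mem_cbox_vec3[OF UNIV_3] forall_3 by auto
  have strip: "closed {q \<in> Q. \<bar>q $ i - y\<bar> \<le> z}" for i y z
  proof -
    have "closed (Q \<inter> {q. \<bar>q $ i - y\<bar> \<le> z})" unfolding Q_def
      by (intro closed_Int closed_cbox closed_Collect_le continuous_intros)
    then show ?thesis by (simp add: Collect_conj_eq)
  qed
  have badb: "bad i j \<in> sets lborel" for i j
    unfolding bad_def by (intro sets.finite_UN) (auto intro: borel_closed strip)
  have bad_le: "emeasure lborel (bad i j) \<le> ennreal (1 / 16 * (1 / 2) ^ j)" if i: "i \<noteq> 3" for i j
  proof -
    note U = UNIV_other[OF i]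
    have "emeasure lborel {q \<in> Q. \<bar>q $ i - y\<bar> \<le> 3 * width j} \<le> ennreal (6 * width j)" for y
    proof -
      let ?B = "cbox (vec3 i (other i) (y - 3 * width j) 0 0) (vec3 i (other i) (y + 3 * width j) 1 1)"
      have "{q \<in> Q. \<bar>q $ i - y\<bar> \<le> 3 * width j} \<subseteq> ?B"
        unfolding Qi by (auto simp: mem_cbox_vec3[OF U] abs_le_iff)
      then have "emeasure lborel {q \<in> Q. \<bar>q $ i - y\<bar> \<le> 3 * width j} \<le> emeasure lborel ?B" by (intro emeasure_mono) auto
      also have "\<dots> = ennreal (measure lborel ?B)"
        using emeasure_lborel_cbox_finite by (intro emeasure_eq_ennreal_measure) (auto simp: less_top[symmetric])
      also have "measure lborel ?B = 6 * width j"
        by (subst measure_cbox_vec3[OF U]) (use width_pos[of j] in auto)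
      finally show ?thesis .
    qed
    then have "emeasure lborel (bad i j) \<le> (\<Sum>m\<in>{..2 ^ (j\<^sup>2) :: nat}. ennreal (6 * width j))"
      unfolding bad_def
      by (intro order_trans[OF emeasure_subadditive_finite] sum_mono) (auto intro: borel_closed strip)
    also have "\<dots> = ennreal ((real (2 ^ (j\<^sup>2)) + 1) * (6 * width j))"
      using width_pos[of j] by (subst sum_ennreal) (auto simp: add.commute)
    also have "\<dots> \<le> ennreal (1 / 16 * (1 / 2) ^ j)"
    proof (rule ennreal_leI)
      \<comment> \<open>There are 2^(j^2) + 1 strips; bounding the 1 by 2^(j^2) gives the factor
        12/192 = 1/16.\<close>
      have "(real (2 ^ (j\<^sup>2)) + 1) * (6 * width j) \<le> (2 ^ (j\<^sup>2) + 2 ^ (j\<^sup>2)) * (6 * width j)"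
        using width_pos[of j] by (intro mult_right_mono add_mono) auto
      also have "\<dots> = 12 * (2 ^ (j\<^sup>2) * width j)" by simp
      also have "2 ^ (j\<^sup>2) * width j = (1 / 192) * (1 / 2) ^ j" by (simp add: width_def power_add power_divide)
      finally show "(real (2 ^ (j\<^sup>2)) + 1) * (6 * width j) \<le> 1 / 16 * (1 / 2) ^ j" by simp
    qed
    finally show ?thesis .
  qed
  have total: "emeasure lborel (\<Union>j. bad i j) \<le> ennreal (1 / 8)" if i: "i \<noteq> 3" for i
  proof -
    have "emeasure lborel (\<Union>j. bad i j) \<le> (\<Sum>j. emeasure lborel (bad i j))"
      by (rule emeasure_subadditive_countably) (use badb in auto)
    also have "\<dots> \<le> (\<Sum>j. ennreal (1 / 16 * (1 / 2) ^ j))" by (intro suminf_le summableI bad_le[OF i])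
    also have "\<dots> = ennreal (1 / 8)"
    proof (rule suminf_ennreal_eq)
      show "(\<lambda>j. 1 / 16 * (1 / 2) ^ j :: real) sums (1 / 8)"
        using sums_mult[OF geometric_sums[of "1 / 2 :: real"], of "1 / 16"] by simp
    qed simp
    finally show ?thesis .
  qed
  have "Q \<subseteq> T \<union> ((\<Union>j. bad 1 j) \<union> (\<Union>j. bad 2 j))"
  proof
    fix q assume q: "q \<in> Q"
    show "q \<in> T \<union> ((\<Union>j. bad 1 j) \<union> (\<Union>j. bad 2 j))"
    proof (rule ccontr)
      assume n: "q \<notin> T \<union> ((\<Union>j. bad 1 j) \<union> (\<Union>j. bad 2 j))"
      have "cutoff j (q $ i) = 1" if "i \<in> {1, 2}" for i j
      proof (rule ccontr)
        assume "cutoff j (q $ i) \<noteq> 1"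
        then have "q \<in> bad i j" using cutoff_neq_1_near_grid[of "q $ i" j] q unfolding bad_def by (auto simp: Qi)
        then show False using n that by auto
      qed
      then have "q \<in> T" using q by (auto simp: T_def good_def Qi)
      then show False using n by simp
    qed
  qed
  then have "emeasure lborel Q \<le> emeasure lborel (T \<union> ((\<Union>j. bad 1 j) \<union> (\<Union>j. bad 2 j)))"
    by (rule emeasure_mono) (use Tb badb in \<open>auto intro!: sets.countable_UN\<close>)
  also have "\<dots> \<le> emeasure lborel T + (emeasure lborel (\<Union>j. bad 1 j) + emeasure lborel (\<Union>j. bad 2 j))"
    using Tb badb by (intro order_trans[OF emeasure_subadditive] add_left_mono emeasure_subadditive) (auto intro!: sets.countable_UN)
  also have "\<dots> \<le> 0 + (ennreal (1 / 8) + ennreal (1 / 8))"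
    using T0 total[of 1] total[of 2] by (intro add_mono) auto
  also have "\<dots> = ennreal (1 / 4)" by (simp add: ennreal_plus[symmetric] del: ennreal_plus)
  also have "emeasure lborel Q = ennreal (measure lborel Q)"
    unfolding Q_def using emeasure_lborel_cbox_finite by (intro emeasure_eq_ennreal_measure) (auto simp: less_top[symmetric])
  also have "measure lborel Q = 1" unfolding Q_def by (subst measure_cbox_vec3[OF UNIV_3]) auto
  finally show False by (simp add: ennreal_le_iff)
qed

theorem not_approx_trace_unique_domain:
  assumes "1 \<le> p" "p < 2"
  shows "\<not> approx_trace_unique p domain"
proof -
  obtain q where q: "p = ennreal q" "q \<ge> 0" using assms(2) by (cases p) auto
  have "1 \<le> q" using assms(1) q by (metis ennreal_1 ennreal_le_iff)
  moreover have "q < 2" using assms(2) q by (metis ennreal_less_iff ennreal_numeral)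
  ultimately show ?thesis
    using approx_trace_limit_trace[of q] limit_trace_not_null q(1) unfolding approx_trace_unique_def by blast
qed

theorem mainTheorem4:
  shows "\<exists>(\<Omega> :: (real^3) set) (p\<^sub>0 :: real).
    \<Omega> \<noteq> {} \<and> open \<Omega> \<and> connected \<Omega> \<and> quasi_convex \<Omega> \<and> 1 < p\<^sub>0 \<and>
    (\<forall>p :: ennreal. ennreal p\<^sub>0 < p \<longrightarrow> approx_trace_unique p \<Omega>) \<and>
    (\<forall>p :: ennreal. 1 \<le> p \<and> p < ennreal p\<^sub>0 \<longrightarrow> \<not> approx_trace_unique p \<Omega>)"
proof (intro exI[of _ domain] exI[of _ 2] conjI allI impI)
  fix p :: ennreal
  show "approx_trace_unique p domain" if "ennreal 2 < p"
    using that by (intro approx_trace_unique_domain) simp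
  show "\<not> approx_trace_unique p domain" if "1 \<le> p \<and> p < ennreal 2"
    using that by (intro not_approx_trace_unique_domain) auto
qed (simp_all add: domain_nonempty open_domain connected_domain quasi_convex_domain)

end
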